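(* Consider the array observation model and the SPA estimator described in the context. Assume that $\{s(t)\}$ and $\{e_\Omega(t)\}$ are uncorrelated and both are i.i.d. circular complex Gaussian with zero means and covariance matrices $\mathrm{diag}(p)$ and $\mathrm{diag}(\sigma)$ respectively (with $\mathrm{diag}(\sigma)=\sigma I$, $\sigma$ a scalar, in the equal-noise-variance variant), that $\Omega$ is a redundancy array, and that $K=M-1$ with $p\succ0$ and $\sigma\succ0$. Then, as the number of snapshots $N\to\infty$, the SPA estimator $(\widehat\theta,\widehat p,\widehat\sigma)$ is asymptotically normal with asymptotically unbiased mean equal to the true parameter $(\theta^o,p^o,\sigma^o)$ and covariance $F^{-1}$, where $F$ is the Fisher information matrix of the parameter $(\theta,p,\sigma)$; consequently $(\widehat\theta,\widehat p,\widehat\sigma)$ is statistically asymptotically efficient.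
   Context: Let $M\ge2$ and $\Omega=\{\Omega_1<\dots<\Omega_L\}\subseteq\{1,\dots,M\}$ with $\Omega_1=1$, $\Omega_L=M$. $\Omega$ is a redundancy array if $\{m_1-m_2+1: m_1,m_2\in\Omega,\ m_1\ge m_2\}=\{1,\dots,M\}$. For $\theta\in[0,1)$ let $a(\theta)=(1,e^{i2\pi\theta},\dots,e^{i2\pi(M-1)\theta})^T$, and let $\Gamma_\Omega\in\{0,1\}^{L\times M}$ be the selection matrix whose $j$-th row has a single $1$ in position $\Omega_j$; $a_\Omega(\theta)=\Gamma_\Omega a(\theta)$. Observation model: $y_\Omega(t)=\sum_{k=1}^K a_\Omega(\theta_k)s_k(t)+e_\Omega(t)$, $t=1,\dots,N$, with distinct frequencies $\theta\in[0,1)^K$, source powers $p\in\mathbb{R}_+^K$, noise variances $\sigma\in\mathbb{R}_+^L$; the true values are denoted $(\theta^o,p^o,\sigma^o)$. Sample covariance $\widetilde R=\frac1N\sum_t y_\Omega(t)y_\Omega(t)^H$; $T(u)$ is the $M\times M$ Hermitian Toeplitz matrix with first row $u\in\mathbb{C}^M$. SPA estimator: (1) with $R(u,\sigma')=\Gamma_\Omega T(u)\Gamma_\Omega^T+\mathrm{diag}(\sigma')$, $\sigma'\in\mathbb{R}_+^L$ (different-noise-variance variant), or $R(u)=\Gamma_\Omega T(u)\Gamma_\Omega^T$ (equal-noise-variance variant, setting $\sigma'^*=0$), let $(u^*,\sigma'^* )$ minimize $\|R^{-1/2}(\widetilde R-R)\widetilde R^{-1/2}\|_F^2$ subject to $T(u)\succeq0$,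 $\sigma'\succeq0$ when $N\ge L$ (and $\|R^{-1/2}(\widetilde R-R)\|_F^2$ when $N<L$); (2) let $\delta=\lambda_{\min}(T(u^* ))$, $T(\widehat u)=T(u^* )-\delta I$, $\widehat\sigma=\sigma'^*+\delta\mathbf 1$ (scalar $\widehat\sigma=\delta$ in the equal-variance variant); (3) write $T(\widehat u)=\sum_{j=1}^r\widehat p_j a(\widehat\theta_j)a(\widehat\theta_j)^H$ ($r=\mathrm{rank}\,T(\widehat u)$, distinct $\widehat\theta_j\in[0,1)$, $\widehat p_j>0$) and output $(\widehat\theta,\widehat p,\widehat\sigma)$. *)

theory Defs
  imports "HOL-Probability.Probability"
begin

text \<open>Matrices are represented as functions nat => nat => 'a together with explicit
 dimensions (only entries with indices below the dimension are meaningful);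
 vectors are functions nat => 'a.\<close>

definition mmul :: "nat \<Rightarrow> (nat \<Rightarrow> nat \<Rightarrow> 'a::comm_ring_1) \<Rightarrow> (nat \<Rightarrow> nat \<Rightarrow> 'a) \<Rightarrow> nat \<Rightarrow> nat \<Rightarrow> 'a"
  where "mmul n A B = (\<lambda>i j. \<Sum>k<n. A i k * B k j)"

definition idm :: "nat \<Rightarrow> nat \<Rightarrow> 'a::{zero,one}"
  where "idm = (\<lambda>i j. if i = j then 1 else 0)"

definition mdet :: "nat \<Rightarrow> (nat \<Rightarrow> nat \<Rightarrow> 'a::comm_ring_1) \<Rightarrow> 'a"
  where "mdet n A = (\<Sum>p | p permutes {..<n}. of_int (sign p) * (\<Prod>i<n. A i (p i)))"

definition minv :: "nat \<Rightarrow> (nat \<Rightarrow> nat \<Rightarrow> 'a::comm_ring_1) \<Rightarrow> nat \<Rightarrow> nat \<Rightarrow> 'a"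
  where "minv n A = (THE B. (\<forall>i j. (n \<le> i \<or> n \<le> j) \<longrightarrow> B i j = 0) \<and>
            (\<forall>i<n. \<forall>j<n. mmul n A B i j = idm i j \<and> mmul n B A i j = idm i j))"

definition hermitian :: "nat \<Rightarrow> (nat \<Rightarrow> nat \<Rightarrow> complex) \<Rightarrow> bool"
  where "hermitian n A = (\<forall>i<n. \<forall>j<n. A i j = cnj (A j i))"

definition qform :: "nat \<Rightarrow> (nat \<Rightarrow> nat \<Rightarrow> complex) \<Rightarrow> (nat \<Rightarrow> complex) \<Rightarrow> complex"
  where "qform n A v = (\<Sum>i<n. \<Sum>j<n. cnj (v i) * A i j * v j)"

definition psd :: "nat \<Rightarrow> (nat \<Rightarrow> nat \<Rightarrow> complex) \<Rightarrow> bool"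
  where "psd n A = (hermitian n A \<and> (\<forall>v. 0 \<le> Re (qform n A v)))"

definition pd :: "nat \<Rightarrow> (nat \<Rightarrow> nat \<Rightarrow> complex) \<Rightarrow> bool"
  where "pd n A = (hermitian n A \<and> (\<forall>v. (\<exists>i<n. v i \<noteq> 0) \<longrightarrow> 0 < Re (qform n A v)))"

definition msqrt :: "nat \<Rightarrow> (nat \<Rightarrow> nat \<Rightarrow> complex) \<Rightarrow> nat \<Rightarrow> nat \<Rightarrow> complex"
  where "msqrt n A = (THE S. (\<forall>i j. (n \<le> i \<or> n \<le> j) \<longrightarrow> S i j = 0) \<and> psd n S \<and>
            (\<forall>i<n. \<forall>j<n. mmul n S S i j = A i j))"

definition minvsqrt :: "nat \<Rightarrow> (nat \<Rightarrow> nat \<Rightarrow> complex) \<Rightarrow> nat \<Rightarrow> nat \<Rightarrow> complex"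
  where "minvsqrt n A = minv n (msqrt n A)"

definition frob2 :: "nat \<Rightarrow> nat \<Rightarrow> (nat \<Rightarrow> nat \<Rightarrow> complex) \<Rightarrow> real"
  where "frob2 n m A = (\<Sum>i<n. \<Sum>j<m. (cmod (A i j))\<^sup>2)"

definition lmin :: "nat \<Rightarrow> (nat \<Rightarrow> nat \<Rightarrow> complex) \<Rightarrow> real"
  where "lmin n A = Min {x::real. \<exists>v. (\<exists>i<n. v i \<noteq> 0) \<and>
                          (\<forall>i<n. (\<Sum>j<n. A i j * v j) = complex_of_real x * v i)}"

definition crank :: "nat \<Rightarrow> nat \<Rightarrow> (nat \<Rightarrow> nat \<Rightarrow> complex) \<Rightarrow> nat"
  where "crank n m A = Max {card S | S. S \<subseteq> {..<m} \<and>
            (\<forall>c. (\<forall>i<n. (\<Sum>j\<in>S. c j * A i j) = 0) \<longrightarrow> (\<forall>j\<in>S. c j = 0))}"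

definition toep :: "nat \<Rightarrow> (nat \<Rightarrow> complex) \<Rightarrow> nat \<Rightarrow> nat \<Rightarrow> complex"
  where "toep M u = (\<lambda>i j. if i < M \<and> j < M then (if i \<le> j then u (j - i) else cnj (u (i - j))) else 0)"

text \<open>The array Omega is a strictly increasing list Om (1-based positions);
 Omega_j (j = 1..L) is Om ! (j-1).\<close>
definition is_array :: "nat \<Rightarrow> nat list \<Rightarrow> bool"
  where "is_array M Om = (sorted_wrt (<) Om \<and> Om \<noteq> [] \<and> hd Om = 1 \<and> last Om = M \<and>
                          set Om \<subseteq> {1..M})"

definition redundancy_array :: "nat \<Rightarrow> nat list \<Rightarrow> bool"
  where "redundancy_array M Om =
     ({m1 - m2 + 1 | m1 m2. m1 \<in> set Om \<and> m2 \<in> set Om \<and> m1 \<ge> m2} = {1..M})"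

definition compress :: "nat list \<Rightarrow> (nat \<Rightarrow> nat \<Rightarrow> complex) \<Rightarrow> nat \<Rightarrow> nat \<Rightarrow> complex"
  where "compress Om A = (\<lambda>j l. if j < length Om \<and> l < length Om
                                 then A (Om ! j - 1) (Om ! l - 1) else 0)"

definition steer :: "nat \<Rightarrow> real \<Rightarrow> nat \<Rightarrow> complex"
  where "steer M \<theta> = (\<lambda>m. if m < M then cis (2 * pi * real m * \<theta>) else 0)"

definition steerO :: "nat list \<Rightarrow> real \<Rightarrow> nat \<Rightarrow> complex"
  where "steerO Om \<theta> = (\<lambda>j. if j < length Om then cis (2 * pi * real (Om ! j - 1) * \<theta>) else 0)"

definition diagm :: "nat \<Rightarrow> (nat \<Rightarrow> real) \<Rightarrow> nat \<Rightarrow> nat \<Rightarrow> complex"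
  where "diagm n s = (\<lambda>i j. if i = j \<and> i < n then complex_of_real (s i) else 0)"

definition Rmod :: "nat \<Rightarrow> nat list \<Rightarrow> (nat \<Rightarrow> complex) \<Rightarrow> (nat \<Rightarrow> real) \<Rightarrow> nat \<Rightarrow> nat \<Rightarrow> complex"
  where "Rmod M Om u s = (\<lambda>i j. compress Om (toep M u) i j + diagm (length Om) s i j)"

definition spa_obj :: "nat \<Rightarrow> nat \<Rightarrow> (nat \<Rightarrow> nat \<Rightarrow> complex) \<Rightarrow> (nat \<Rightarrow> nat \<Rightarrow> complex) \<Rightarrow> real"
  where "spa_obj L N Rt R =
     (if L \<le> N
      then frob2 L L (mmul L (mmul L (minvsqrt L R) (\<lambda>i j. Rt i j - R i j)) (minvsqrt L Rt))
      else frob2 L L (mmul L (minvsqrt L R) (\<lambda>i j. Rt i j - R i j)))"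

text \<open>Feasible points of step (1).  eqv selects the equal-noise-variance variant
 (in which sigma' is fixed to 0).  The criterion involves R^(-1/2), so it is only
 defined (finite) where R is positive definite.\<close>
definition spa_feasible :: "bool \<Rightarrow> nat \<Rightarrow> nat list \<Rightarrow> (nat \<Rightarrow> complex) \<Rightarrow> (nat \<Rightarrow> real) \<Rightarrow> bool"
  where "spa_feasible eqv M Om u s =
     (psd M (toep M u) \<and> (if eqv then (\<forall>j. s j = 0) else (\<forall>j<length Om. 0 \<le> s j)) \<and>
      pd (length Om) (Rmod M Om u s))"

definition spa_step1 :: "bool \<Rightarrow> nat \<Rightarrow> nat list \<Rightarrow> nat \<Rightarrow> (nat \<Rightarrow> nat \<Rightarrow> complex)
                          \<Rightarrow> (nat \<Rightarrow> complex) \<Rightarrow> (nat \<Rightarrow> real) \<Rightarrow> bool"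
  where "spa_step1 eqv M Om N Rt u s =
     (spa_feasible eqv M Om u s \<and>
      (\<forall>u' s'. spa_feasible eqv M Om u' s' \<longrightarrow>
          spa_obj (length Om) N Rt (Rmod M Om u s) \<le> spa_obj (length Om) N Rt (Rmod M Om u' s')))"

text \<open>(Th, P, sg) is an output of the SPA estimator for sample covariance Rt:
 Th is the set of estimated frequencies, P th the power at th in Th, sg the noise
 variance(s) (sg 0 is the scalar noise variance in the equal-variance variant).\<close>
definition spa_output :: "bool \<Rightarrow> nat \<Rightarrow> nat list \<Rightarrow> nat \<Rightarrow> (nat \<Rightarrow> nat \<Rightarrow> complex)
                           \<Rightarrow> real set \<Rightarrow> (real \<Rightarrow> real) \<Rightarrow> (nat \<Rightarrow> real) \<Rightarrow> bool"
  where "spa_output eqv M Om N Rt Th P sg =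
     (\<exists>u s. spa_step1 eqv M Om N Rt u s \<and>
        (let \<delta> = lmin M (toep M u);
             uh = u(0 := u 0 - complex_of_real \<delta>)
         in (if eqv then sg 0 = \<delta> else (\<forall>j<length Om. sg j = s j + \<delta>)) \<and>
            finite Th \<and> Th \<subseteq> {0..<1} \<and> (\<forall>\<theta>\<in>Th. 0 < P \<theta>) \<and>
            card Th = crank M M (toep M uh) \<and>
            (\<forall>i<M. \<forall>j<M. toep M uh i j =
                 (\<Sum>\<theta>\<in>Th. complex_of_real (P \<theta>) * steer M \<theta> i * cnj (steer M \<theta> j)))))"

definition nsig :: "bool \<Rightarrow> nat list \<Rightarrow> nat"
  where "nsig eqv Om = (if eqv then 1 else length Om)"

text \<open>Representative of theta mod 1 closest to c, and the element of Th closest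
 (circularly) to c; used to label the estimated frequencies by the true ones.\<close>
definition crep :: "real \<Rightarrow> real \<Rightarrow> real"
  where "crep c \<theta> = \<theta> - of_int \<lfloor>\<theta> - c + 1/2\<rfloor>"

definition nearest :: "real \<Rightarrow> real set \<Rightarrow> real"
  where "nearest c Th = (SOME \<theta>. \<theta> \<in> Th \<and> (\<forall>\<theta>'\<in>Th. \<bar>crep c \<theta> - c\<bar> \<le> \<bar>crep c \<theta>' - c\<bar>))"

definition labeled_est :: "bool \<Rightarrow> nat list \<Rightarrow> nat \<Rightarrow> (nat \<Rightarrow> real)
                            \<Rightarrow> real set \<Rightarrow> (real \<Rightarrow> real) \<Rightarrow> (nat \<Rightarrow> real) \<Rightarrow> nat \<Rightarrow> real"
  where "labeled_est eqv Om K th0 Th P sg = restrict (\<lambda>i.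
      if i < K then crep (th0 i) (nearest (th0 i) Th)
      else if i < 2 * K then P (nearest (th0 (i - K)) Th)
      else sg (i - 2 * K)) {..<2 * K + nsig eqv Om}"

definition param_vec :: "bool \<Rightarrow> nat list \<Rightarrow> nat \<Rightarrow> (nat \<Rightarrow> real) \<Rightarrow> (nat \<Rightarrow> real) \<Rightarrow> (nat \<Rightarrow> real)
                          \<Rightarrow> nat \<Rightarrow> real"
  where "param_vec eqv Om K th p sg = restrict (\<lambda>i.
      if i < K then th i else if i < 2 * K then p (i - K) else sg (i - 2 * K))
      {..<2 * K + nsig eqv Om}"

definition Rpar :: "bool \<Rightarrow> nat list \<Rightarrow> nat \<Rightarrow> (nat \<Rightarrow> real) \<Rightarrow> nat \<Rightarrow> nat \<Rightarrow> complex"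
  where "Rpar eqv Om K \<eta> = (\<lambda>j l.
      (\<Sum>k<K. complex_of_real (\<eta> (K + k)) * steerO Om (\<eta> k) j * cnj (steerO Om (\<eta> k) l)) +
      diagm (length Om) (\<lambda>j. \<eta> (2 * K + (if eqv then 0 else j))) j l)"

text \<open>Log-density of one snapshot y ~ CN(0, R(eta)) on C^L (w.r.t. Lebesgue measure).\<close>
definition loglik :: "bool \<Rightarrow> nat list \<Rightarrow> nat \<Rightarrow> (nat \<Rightarrow> real) \<Rightarrow> (nat \<Rightarrow> complex) \<Rightarrow> real"
  where "loglik eqv Om K \<eta> y =
     - real (length Om) * ln pi - ln (Re (mdet (length Om) (Rpar eqv Om K \<eta>)))
     - Re (qform (length Om) (minv (length Om) (Rpar eqv Om K \<eta>)) y)"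

definition score :: "bool \<Rightarrow> nat list \<Rightarrow> nat \<Rightarrow> (nat \<Rightarrow> real) \<Rightarrow> nat \<Rightarrow> (nat \<Rightarrow> complex) \<Rightarrow> real"
  where "score eqv Om K \<eta> a y = deriv (\<lambda>t. loglik eqv Om K (\<eta>(a := t)) y) (\<eta> a)"

text \<open>Fisher information matrix of one snapshot at eta.  The FIM of N i.i.d.
 snapshots is N times this matrix.\<close>
definition fim1 :: "bool \<Rightarrow> nat list \<Rightarrow> nat \<Rightarrow> (nat \<Rightarrow> real) \<Rightarrow> nat \<Rightarrow> nat \<Rightarrow> real"
  where "fim1 eqv Om K \<eta> = (\<lambda>a b.
      \<integral>y. score eqv Om K \<eta> a y * score eqv Om K \<eta> b y * exp (loglik eqv Om K \<eta> y)
        \<partial>(PiM {..<length Om} (\<lambda>_. (lborel :: complex measure))))"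

definition gauss_dens :: "nat \<Rightarrow> (nat \<Rightarrow> nat \<Rightarrow> real) \<Rightarrow> (nat \<Rightarrow> real) \<Rightarrow> real"
  where "gauss_dens d C x =
     exp (- (1/2) * (\<Sum>i<d. \<Sum>j<d. x i * minv d C i j * x j)) / sqrt ((2 * pi) ^ d * mdet d C)"

text \<open>Convergence in distribution of the random vectors X N (taking values in
 R^d, represented as functions extensional on {..<d}) to N(0, C).\<close>
definition conv_distr_normal :: "'w measure \<Rightarrow> (nat \<Rightarrow> 'w \<Rightarrow> nat \<Rightarrow> real) \<Rightarrow> nat
                                  \<Rightarrow> (nat \<Rightarrow> nat \<Rightarrow> real) \<Rightarrow> bool"
  where "conv_distr_normal M X d C =
     (\<forall>g :: (nat \<Rightarrow> real) \<Rightarrow> real. continuous_on UNIV g \<and> bounded (range g) \<longrightarrow>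
        ((\<lambda>N. \<integral>\<omega>. g (X N \<omega>) \<partial>M) \<longlongrightarrow>
           (\<integral>x. g x * gauss_dens d C x \<partial>(PiM {..<d} (\<lambda>_. lborel)))) sequentially)"

end

theory Submission
  imports Defs "Jordan_Normal_Form.Determinant" "HOL-Library.Function_Algebras"
begin

text \<open>The proof linearises the estimator around the true parameter. With \<open>K = M - 1\<close> sources the
  derivatives of the covariance model \<open>R(\<eta>)\<close> in the \<open>d\<close> real parameters are linearly independent, and they
  span all matrices of the form (compressed Hermitian Toeplitz) + (diagonal noise), so near the truth the
  smooth parametrisation by \<open>\<eta>\<close> and the convex parametrisation by \<open>(u, \<sigma>')\<close> describe the same model.
  If the sample covariance \<open>R\<^sub>N\<close> is close to \<open>R\<^sub>0 = R(\<eta>\<^sub>0)\<close>, the criterion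
  \<open>tr (R(\<eta>)\<inverse> R\<^sub>N) + tr (R\<^sub>N\<inverse> R(\<eta>)) - 2 L\<close> has an interior minimiser on a small box around \<open>\<eta>\<^sub>0\<close>;
  it is critical, hence by convexity the global solution of the first step, and uniqueness of the
  Vandermonde decomposition identifies the output of the estimator with it. Expanding the critical equation
  gives the error \<open>F\<inverse> (Re tr (R\<^sub>0\<inverse> R\<^sub>a R\<^sub>0\<inverse> (R\<^sub>N - R\<^sub>0)))\<^sub>a\<close> up to \<open>o(|R\<^sub>N - R\<^sub>0|)\<close>, with
  \<open>F\<^sub>a\<^sub>b = tr (R\<^sub>0\<inverse> R\<^sub>a R\<^sub>0\<inverse> R\<^sub>b)\<close>. Fourth moments of circular Gaussians show that \<open>F\<close> is the Fisher
  information and also the covariance of the linear statistic, so the central limit theorem, applied to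
  linear combinations of the coordinates, yields the limit \<open>N(0, F\<inverse>)\<close>.\<close>

text \<open>Efficiency rests on a count. With \<open>K = M - 1\<close> the \<open>2 K\<close>
  frequencies and powers match the \<open>M - 1\<close> complex lags visible to a redundancy array,
  and the diagonal carries the noise; the convex relaxation therefore has no tangent direction
  outside the parametric model. Lag zero is confounded with the noise, which the subtraction of the
  least eigenvalue repairs. The same count leaves room for the node polynomial, of degree below
  \<open>M\<close> and zero at every frequency: it yields independence of the derivatives,
  uniqueness of the decomposition, the least eigenvalue and the rank. The critical equation can be
  factored exactly, with a weight that tends to twice the weight \<open>R0^-1 R_a R0^-1\<close> of
  the score; so the linear statistic is that of maximum likelihood. Minimiser and output are
  relations that may have no solution or several. The analysis is therefore deterministic on a
  neighbourhood of the true covariance; probability enters only through a second moment bound for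
  leaving it and a central limit theorem for traces.\<close>

text \<open>For matrices that vanish outside the leading block, matrix identities are equalities of functions.\<close>

definition msupp :: "nat \<Rightarrow> (nat \<Rightarrow> nat \<Rightarrow> 'a::zero) \<Rightarrow> bool"
  where "msupp n A \<longleftrightarrow> (\<forall>i j. n \<le> i \<or> n \<le> j \<longrightarrow> A i j = 0)"

text \<open>Unlike \<open>idm\<close>, this identity vanishes outside the block, so \<open>A\<close>
  times its inverse can be equated with it as a function.\<close>

definition eye :: "nat \<Rightarrow> nat \<Rightarrow> nat \<Rightarrow> 'a::{zero,one}"
  where "eye n = (\<lambda>i j. if i = j \<and> i < n then 1 else 0)"

definition mtr :: "nat \<Rightarrow> (nat \<Rightarrow> nat \<Rightarrow> 'a::comm_ring_1) \<Rightarrow> 'a"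
  where "mtr n A = (\<Sum>i<n. A i i)"

definition adjm :: "(nat \<Rightarrow> nat \<Rightarrow> complex) \<Rightarrow> nat \<Rightarrow> nat \<Rightarrow> complex"
  where "adjm A = (\<lambda>i j. cnj (A j i))"

abbreviation mmul_infix ("(_ \<odot>\<^bsub>_\<^esub> _)" [70, 0, 71] 70)
  where "A \<odot>\<^bsub>n\<^esub> B \<equiv> mmul n A B"

lemma mmul_assoc: "A \<odot>\<^bsub>n\<^esub> B \<odot>\<^bsub>m\<^esub> C = A \<odot>\<^bsub>n\<^esub> (B \<odot>\<^bsub>m\<^esub> C)"
  unfolding mmul_def
  by (intro ext) (simp add: sum_distrib_left sum_distrib_right mult.assoc, subst sum.swap, simp)

lemma mmul_add_left: "(A + B) \<odot>\<^bsub>n\<^esub> C = A \<odot>\<^bsub>n\<^esub> C + B \<odot>\<^bsub>n\<^esub> C"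
  and mmul_add_right: "A \<odot>\<^bsub>n\<^esub> (B + C) = A \<odot>\<^bsub>n\<^esub> B + A \<odot>\<^bsub>n\<^esub> C"
  and mmul_diff_left: "(A - B) \<odot>\<^bsub>n\<^esub> C = A \<odot>\<^bsub>n\<^esub> C - B \<odot>\<^bsub>n\<^esub> C"
  and mmul_diff_right: "A \<odot>\<^bsub>n\<^esub> (B - C) = A \<odot>\<^bsub>n\<^esub> B - A \<odot>\<^bsub>n\<^esub> C"
  and mmul_minus_left: "(- A) \<odot>\<^bsub>n\<^esub> C = - (A \<odot>\<^bsub>n\<^esub> C)"
  and mmul_minus_right: "A \<odot>\<^bsub>n\<^esub> (- C) = - (A \<odot>\<^bsub>n\<^esub> C)"
  unfolding mmul_def
  by (auto intro!: ext simp: algebra_simps sum.distrib sum_subtractf sum_negf)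

lemmas mmul_distribs = mmul_add_left mmul_add_right mmul_diff_left mmul_diff_right
  mmul_minus_left mmul_minus_right

lemma mmul_eye_left: "msupp n A \<Longrightarrow> eye n \<odot>\<^bsub>n\<^esub> A = A"
proof (intro ext)
  fix i j assume A: "msupp n A"
  have "(\<Sum>k<n. (if i = k \<and> i < n then 1 else 0) * A k j) = (\<Sum>k<n. if k = i then A k j else 0)"
    by (intro sum.cong) auto
  then show "mmul n (eye n) A i j = A i j" using A unfolding mmul_def eye_def msupp_def by auto
qed

lemma mmul_eye_right: "msupp n A \<Longrightarrow> A \<odot>\<^bsub>n\<^esub> eye n = A"
proof (intro ext)
  fix i j assume A: "msupp n A"
  have "(\<Sum>k<n. A i k * (if k = j \<and> k < n then 1 else 0)) = (\<Sum>k<n. if k = j then A i k else 0)"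
    by (intro sum.cong) auto
  then show "mmul n A (eye n) i j = A i j" using A unfolding mmul_def eye_def msupp_def by auto
qed

lemma msupp_mmul: "msupp n A \<Longrightarrow> msupp n B \<Longrightarrow> msupp n (A \<odot>\<^bsub>m\<^esub> B)"
  unfolding msupp_def mmul_def by auto

lemma msupp_minus: "msupp n A \<Longrightarrow> msupp n B \<Longrightarrow> msupp n (A - B)"
  for A B :: "nat \<Rightarrow> nat \<Rightarrow> 'a::ab_group_add"
  unfolding msupp_def by auto

lemma msupp_eye: "msupp n (eye n)"
  unfolding msupp_def eye_def by auto

lemma msupp_adjm: "msupp n A \<Longrightarrow> msupp n (adjm A)"
  unfolding msupp_def adjm_def by auto

lemma msupp_eqI: "msupp n A \<Longrightarrow> msupp n B \<Longrightarrow> (\<And>i j. i < n \<Longrightarrow> j < n \<Longrightarrow> A i j = B i j) \<Longrightarrow> A = B"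
  unfolding msupp_def by (intro ext) (metis not_less)

lemma mtr_add: "mtr n (A + B) = mtr n A + mtr n B"
  and mtr_diff: "mtr n (A - B) = mtr n A - mtr n B"
  unfolding mtr_def by (auto simp: sum.distrib sum_subtractf)

lemma mtr_mmul_comm: "mtr n (A \<odot>\<^bsub>n\<^esub> B) = mtr n (B \<odot>\<^bsub>n\<^esub> A)"
  unfolding mtr_def mmul_def by (subst sum.swap) (simp add: mult.commute)

lemma mtr_eye: "mtr n (eye n) = of_nat n"
  unfolding mtr_def eye_def by simp

lemma adjm_mmul: "adjm (A \<odot>\<^bsub>n\<^esub> B) = adjm B \<odot>\<^bsub>n\<^esub> adjm A"
  unfolding adjm_def mmul_def by (intro ext) (simp add: mult.commute)

lemma adjm_diff: "adjm (A - B) = adjm A - adjm B"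
  unfolding adjm_def by (auto intro!: ext)

lemma adjm_adjm [simp]: "adjm (adjm A) = A"
  unfolding adjm_def by simp

lemma adjm_eye [simp]: "adjm (eye n) = eye n"
  unfolding adjm_def eye_def by (auto intro!: ext)

lemma hermitian_iff_adjm: "msupp n A \<Longrightarrow> hermitian n A \<longleftrightarrow> adjm A = A"
proof
  assume s: "msupp n A" and h: "hermitian n A"
  show "adjm A = A"
  proof (rule msupp_eqI[of n])
    fix i j assume "i < n" "j < n"
    then have "A i j = cnj (A j i)" using h unfolding hermitian_def by blast
    then show "adjm A i j = A i j" by (simp add: adjm_def)
  qed (use s in \<open>auto intro: msupp_adjm\<close>)
next
  assume "adjm A = A" then show "hermitian n A"
    unfolding hermitian_def adjm_def by metis
qed

subsection \<open>Determinants and inverses\<close>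

text \<open>The bridge by which multiplicativity, Laplace expansion and the kernel criterion are
  taken from \<open>Determinant.det\<close>.\<close>

lemma mdet_eq_det: "mdet n A = Determinant.det (mat n n (\<lambda>(i, j). A i j))"
  unfolding mdet_def Determinant.det_def
  by (auto simp: lessThan_atLeast0 intro!: sum.cong prod.cong dest: permutes_in_image)

lemma mat_mmul: "mat n n (\<lambda>(i, j). mmul n A B i j) = mat n n (\<lambda>(i, j). A i j) * mat n n (\<lambda>(i, j). B i j)"
  by (rule eq_matI) (auto simp: mmul_def scalar_prod_def lessThan_atLeast0)

lemma mdet_mmul: "mdet n (A \<odot>\<^bsub>n\<^esub> B) = mdet n A * mdet n B"
  unfolding mdet_eq_det mat_mmul by (rule det_mult[of _ n]) auto

lemma mdet_cong: "(\<And>i j. i < n \<Longrightarrow> j < n \<Longrightarrow> A i j = B i j) \<Longrightarrow> mdet n A = mdet n B"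
  unfolding mdet_eq_det by (rule arg_cong[of _ _ Determinant.det]) (auto intro!: eq_matI)

lemma mdet_idm: "mdet n idm = 1"
proof -
  have "mat n n (\<lambda>(i, j). idm i j) = (1\<^sub>m n :: 'a mat)" by (auto simp: idm_def)
  then show ?thesis unfolding mdet_eq_det by simp
qed

lemma mdet_eye: "mdet n (eye n) = 1"
proof -
  have "mdet n (eye n) = mdet n idm" by (rule mdet_cong) (auto simp: eye_def idm_def)
  then show ?thesis by (simp add: mdet_idm)
qed

lemma mdet_lower_triangular:
  assumes "\<And>i j. i < j \<Longrightarrow> j < n \<Longrightarrow> A i j = 0"
  shows "mdet n A = (\<Prod>i<n. A i i)"
proof -
  have "mdet n A = prod_list (diag_mat (mat n n (\<lambda>(i, j). A i j)))"
    unfolding mdet_eq_det by (rule det_lower_triangular[of n]) (use assms in auto)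
  also have "\<dots> = (\<Prod>i<n. A i i)"
    unfolding prod_list_diag_prod by (simp add: lessThan_atLeast0)
  finally show ?thesis .
qed

lemma mdet_adjm: "mdet n (adjm A) = cnj (mdet n A)"
proof -
  have "mdet n (adjm A) = Determinant.det (transpose_mat (mat n n (\<lambda>(i, j). cnj (A i j))))"
    unfolding mdet_eq_det by (rule arg_cong[of _ _ Determinant.det]) (auto simp: adjm_def)
  also have "\<dots> = mdet n (\<lambda>i j. cnj (A i j))"
    unfolding mdet_eq_det by (rule det_transpose[of _ n]) auto
  also have "\<dots> = cnj (mdet n A)"
    unfolding mdet_def by simp
  finally show ?thesis .
qed

lemma mdet_0_kernel:
  fixes A :: "nat \<Rightarrow> nat \<Rightarrow> 'a::field"
  shows "mdet n A = 0 \<longleftrightarrow> (\<exists>v. (\<exists>i<n. v i \<noteq> 0) \<and> (\<forall>i\<ge>n. v i = 0) \<and> (\<forall>i<n. (\<Sum>j<n. A i j * v j) = 0))"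
    (is "?l = ?r")
proof
  assume ?l
  then obtain w where w: "w \<in> carrier_vec n" "w \<noteq> 0\<^sub>v n"
    "mat n n (\<lambda>(i, j). A i j) *\<^sub>v w = 0\<^sub>v n"
    using det_0_iff_vec_prod_zero_field[of "mat n n (\<lambda>(i, j). A i j)" n] unfolding mdet_eq_det by auto
  let ?v = "\<lambda>i. if i < n then vec_index w i else 0"
  have "\<exists>i<n. ?v i \<noteq> 0"
  proof (rule ccontr)
    assume "\<not> ?thesis"
    then have "w = 0\<^sub>v n" using w(1) by (auto intro!: eq_vecI)
    with w(2) show False by simp
  qed
  moreover have "(\<Sum>j<n. A i j * ?v j) = 0" if "i < n" for i
  proof -
    have "vec_index (mat n n (\<lambda>(i, j). A i j) *\<^sub>v w) i = 0" using w(3) that by simp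
    then show ?thesis using that w(1) by (simp add: scalar_prod_def lessThan_atLeast0)
  qed
  ultimately show ?r by (intro exI[of _ ?v]) simp
next
  assume ?r
  then obtain v where v: "\<exists>i<n. v i \<noteq> 0" "\<And>i. i < n \<Longrightarrow> (\<Sum>j<n. A i j * v j) = 0" by blast
  have "\<exists>w. w \<in> carrier_vec n \<and> w \<noteq> 0\<^sub>v n \<and> mat n n (\<lambda>(i, j). A i j) *\<^sub>v w = 0\<^sub>v n"
  proof (intro exI[of _ "vec n v"] conjI)
    show "vec n v \<noteq> 0\<^sub>v n"
    proof
      assume "vec n v = 0\<^sub>v n"
      then have "vec_index (vec n v) i = 0" if "i < n" for i using that by simp
      then show False using v(1) by auto
    qed
    show "mat n n (\<lambda>(i, j). A i j) *\<^sub>v vec n v = 0\<^sub>v n"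
      using v(2) by (auto intro!: eq_vecI simp: scalar_prod_def lessThan_atLeast0)
  qed simp
  then show ?l
    using det_0_iff_vec_prod_zero_field[of "mat n n (\<lambda>(i, j). A i j)" n] unfolding mdet_eq_det by auto
qed

lemma mmul_left_right_inverse:
  fixes A :: "nat \<Rightarrow> nat \<Rightarrow> 'a::field"
  assumes "\<forall>i<n. \<forall>j<n. mmul n A B i j = idm i j"
  shows "\<forall>i<n. \<forall>j<n. mmul n B A i j = idm i j"
proof -
  let ?A = "mat n n (\<lambda>(i, j). A i j)" and ?B = "mat n n (\<lambda>(i, j). B i j)"
  have "?A * ?B = 1\<^sub>m n"
    unfolding mat_mmul[symmetric] by (rule eq_matI) (use assms in \<open>simp_all add: idm_def\<close>)
  then have "?B * ?A = 1\<^sub>m n" by (rule mat_mult_left_right_inverse[rotated 2]) auto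
  then have "mat n n (\<lambda>(i, j). mmul n B A i j) = 1\<^sub>m n" unfolding mat_mmul .
  then have e: "mat n n (\<lambda>(i, j). mmul n B A i j) $$ (i, j) = 1\<^sub>m n $$ (i, j)" for i j by simp
  show ?thesis
  proof (intro allI impI)
    fix i j assume "i < n" "j < n"
    then show "mmul n B A i j = idm i j" using e[of i j] by (simp add: idm_def)
  qed
qed

definition row_repl :: "(nat \<Rightarrow> nat \<Rightarrow> 'a) \<Rightarrow> nat \<Rightarrow> (nat \<Rightarrow> 'a) \<Rightarrow> nat \<Rightarrow> nat \<Rightarrow> 'a"
  where "row_repl A k r = (\<lambda>i j. if i = k then r j else A i j)"

text \<open>Laplace expansion along row \<open>k\<close>: the cofactors do not see that row, and
  each equals the determinant with a unit vector in its place. Cofactors thus never leave the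
  language of \<open>mdet\<close>.\<close>

lemma mdet_row_repl:
  assumes "k < n"
  shows "mdet n (row_repl A k r) = (\<Sum>j<n. r j * mdet n (row_repl A k (idm j)))"
proof -
  let ?M = "\<lambda>r. mat n n (\<lambda>(i, j). row_repl A k r i j)"
  have cof: "cofactor (?M r) k j = cofactor (?M r') k j" for r r' j
  proof -
    have "mat_delete (?M r) k j = mat_delete (?M r') k j"
      unfolding mat_delete_def row_repl_def by (auto intro!: eq_matI)
    then show ?thesis unfolding cofactor_def by simp
  qed
  have exp: "mdet n (row_repl A k r) = (\<Sum>j<n. r j * cofactor (?M 0) k j)" for r
    unfolding mdet_eq_det
    by (subst laplace_expansion_row[of _ n k]) (use assms cof[of r _ 0] in \<open>auto intro!: sum.cong simp: row_repl_def\<close>)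
  have "mdet n (row_repl A k (idm j)) = cofactor (?M 0) k j" if "j < n" for j
    unfolding exp using that by (simp add: idm_def if_distrib[of "\<lambda>x. x * _"] cong: if_cong)
  then show ?thesis unfolding exp by simp
qed

text \<open>The adjugate identity: for \<open>i \<noteq> j\<close> the sum expands the determinant
  of a matrix whose rows \<open>i\<close> and \<open>j\<close> coincide.\<close>

lemma mmul_cofactor:
  assumes ij: "i < n" "j < n"
  shows "(\<Sum>k<n. A i k * mdet n (row_repl A j (idm k))) = (if i = j then mdet n A else 0)"
proof -
  have e: "(\<Sum>k<n. A i k * mdet n (row_repl A j (idm k))) = mdet n (row_repl A j (A i))"
    by (rule mdet_row_repl[symmetric]) (use ij in auto)
  show ?thesis
  proof (cases "i = j")
    case True
    then have "row_repl A j (A i) = A" by (auto simp: row_repl_def intro!: ext)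
    then show ?thesis using e True by simp
  next
    case False
    have "Determinant.det (mat n n (\<lambda>(a, b). row_repl A j (A i) a b)) = 0"
      by (rule det_identical_rows[of _ n i j])
         (use ij False in \<open>auto simp: row_repl_def intro!: eq_vecI\<close>)
    then show ?thesis using e False unfolding mdet_eq_det by simp
  qed
qed

text \<open>Cramer's rule supplies the object that the description in \<open>minv\<close> asks for.
  The entry formula is what later gives continuity and differentiability of the inverse.\<close>

lemma minv_props:
  fixes A :: "nat \<Rightarrow> nat \<Rightarrow> 'a::field"
  assumes "mdet n A \<noteq> 0"
  shows msupp_minv_gen: "msupp n (minv n A)"
    and minv_entry: "i < n \<Longrightarrow> j < n \<Longrightarrow> minv n A i j = mdet n (row_repl A j (idm i)) / mdet n A"
    and minv_right: "i < n \<Longrightarrow> j < n \<Longrightarrow> mmul n A (minv n A) i j = idm i j"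
    and minv_left: "i < n \<Longrightarrow> j < n \<Longrightarrow> mmul n (minv n A) A i j = idm i j"
proof -
  define B where "B = (\<lambda>i j. if i < n \<and> j < n then mdet n (row_repl A j (idm i)) / mdet n A else 0)"
  have 1: "\<forall>i<n. \<forall>j<n. mmul n A B i j = idm i j"
  proof (intro allI impI)
    fix i j assume ij: "i < n" "j < n"
    have "mmul n A B i j = (\<Sum>k<n. A i k * mdet n (row_repl A j (idm k))) / mdet n A"
      unfolding mmul_def B_def using ij by (simp add: sum_divide_distrib)
    also have "\<dots> = idm i j" unfolding mmul_cofactor[OF ij] using assms by (simp add: idm_def)
    finally show "mmul n A B i j = idm i j" .
  qed
  note 2 = mmul_left_right_inverse[OF 1]
  have "minv n A = B" unfolding minv_def
  proof (rule the_equality)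
    show "(\<forall>i j. (n \<le> i \<or> n \<le> j) \<longrightarrow> B i j = 0) \<and> (\<forall>i<n. \<forall>j<n. mmul n A B i j = idm i j \<and> mmul n B A i j = idm i j)"
      using 1 2 by (auto simp: B_def)
  next
    fix C assume C: "(\<forall>i j. (n \<le> i \<or> n \<le> j) \<longrightarrow> C i j = 0) \<and> (\<forall>i<n. \<forall>j<n. mmul n A C i j = idm i j \<and> mmul n C A i j = idm i j)"
    have sC: "msupp n C" using C by (auto simp: msupp_def)
    have sB: "msupp n B" by (auto simp: msupp_def B_def)
    show "C = B"
    proof (rule msupp_eqI[OF sC sB])
      fix i j assume ij: "i < n" "j < n"
      have "C i j = mmul n C (eye n) i j" using mmul_eye_right[OF sC] by simp
      also have "\<dots> = mmul n C (mmul n A B) i j"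
        unfolding mmul_def[of n C] by (rule sum.cong) (use 1 ij in \<open>auto simp: idm_def eye_def\<close>)
      also have "\<dots> = mmul n (mmul n C A) B i j" by (simp add: mmul_assoc)
      also have "\<dots> = mmul n (eye n) B i j"
        unfolding mmul_def[of n _ B] by (rule sum.cong) (use C ij in \<open>auto simp: idm_def eye_def\<close>)
      also have "\<dots> = B i j" using mmul_eye_left[OF sB] by simp
      finally show "C i j = B i j" .
    qed
  qed
  then show "msupp n (minv n A)"
    "i < n \<Longrightarrow> j < n \<Longrightarrow> minv n A i j = mdet n (row_repl A j (idm i)) / mdet n A"
    "i < n \<Longrightarrow> j < n \<Longrightarrow> mmul n A (minv n A) i j = idm i j"
    "i < n \<Longrightarrow> j < n \<Longrightarrow> mmul n (minv n A) A i j = idm i j"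
    using 1 2 by (auto simp: B_def msupp_def)
qed

lemma minv_eye:
  fixes A :: "nat \<Rightarrow> nat \<Rightarrow> 'a::field"
  assumes "mdet n A \<noteq> 0" "msupp n A"
  shows "A \<odot>\<^bsub>n\<^esub> minv n A = eye n" "minv n A \<odot>\<^bsub>n\<^esub> A = eye n"
  by (rule msupp_eqI[of n], use assms in
      \<open>simp_all add: msupp_mmul msupp_eye msupp_minv_gen minv_right minv_left\<close>,
      simp add: eye_def idm_def)+

lemma minv_unique:
  fixes A :: "nat \<Rightarrow> nat \<Rightarrow> 'a::field"
  assumes "msupp n A" "msupp n B" "A \<odot>\<^bsub>n\<^esub> B = eye n"
  shows "minv n A = B" "mdet n A \<noteq> 0"
proof -
  have "mdet n A * mdet n B = 1" using mdet_mmul[of n A B] assms(3) by (simp add: mdet_eye)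
  then show d: "mdet n A \<noteq> 0" by auto
  have "minv n A = minv n A \<odot>\<^bsub>n\<^esub> (A \<odot>\<^bsub>n\<^esub> B)" unfolding assms(3)
    by (simp add: mmul_eye_right msupp_minv_gen d)
  also have "\<dots> = B" unfolding mmul_assoc[symmetric] minv_eye(2)[OF d assms(1)]
    by (simp add: mmul_eye_left assms)
  finally show "minv n A = B" .
qed

lemma tendsto_mdet:
  fixes A :: "'b \<Rightarrow> nat \<Rightarrow> nat \<Rightarrow> 'a::real_normed_field"
  assumes "\<And>i j. i < n \<Longrightarrow> j < n \<Longrightarrow> ((\<lambda>x. A x i j) \<longlongrightarrow> B i j) F"
  shows "((\<lambda>x. mdet n (A x)) \<longlongrightarrow> mdet n B) F"
  unfolding mdet_def
  by (intro tendsto_intros assms) (auto dest: permutes_in_image)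

lemma tendsto_minv:
  fixes A :: "'b \<Rightarrow> nat \<Rightarrow> nat \<Rightarrow> 'a::real_normed_field"
  assumes lim: "\<And>i j. i < n \<Longrightarrow> j < n \<Longrightarrow> ((\<lambda>x. A x i j) \<longlongrightarrow> B i j) F"
    and d: "mdet n B \<noteq> 0" and ij: "i < n" "j < n"
  shows "((\<lambda>x. minv n (A x) i j) \<longlongrightarrow> minv n B i j) F"
proof -
  have l: "((\<lambda>x. mdet n (A x)) \<longlongrightarrow> mdet n B) F" by (rule tendsto_mdet[OF lim])
  have "((\<lambda>x. mdet n (row_repl (A x) j (idm i)) / mdet n (A x)) \<longlongrightarrow> minv n B i j) F"
    unfolding minv_entry[OF d ij]
    by (intro tendsto_divide tendsto_mdet l d) (auto simp: row_repl_def lim)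
  moreover have "eventually (\<lambda>x. mdet n (A x) \<noteq> 0) F"
    using tendsto_imp_eventually_ne[OF l d] .
  ultimately show ?thesis
    by (elim Lim_transform_eventually) (auto elim!: eventually_mono simp: minv_entry ij)
qed

text \<open>Jacobi's formula: differentiating one factor in each permutation term collects into
  determinants with one row replaced by its derivative, and expansion of that row produces the
  entries of the inverse.\<close>

lemma has_field_derivative_mdet:
  fixes A :: "'a::real_normed_field \<Rightarrow> nat \<Rightarrow> nat \<Rightarrow> 'a"
  assumes der: "\<And>i j. i < n \<Longrightarrow> j < n \<Longrightarrow> ((\<lambda>t. A t i j) has_field_derivative A' i j) (at t0)"
    and d: "mdet n (A t0) \<noteq> 0"
  shows "((\<lambda>t. mdet n (A t)) has_field_derivative
     mdet n (A t0) * mtr n (minv n (A t0) \<odot>\<^bsub>n\<^esub> A')) (at t0)"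
proof -
  have "((\<lambda>t. mdet n (A t)) has_field_derivative
     (\<Sum>p | p permutes {..<n}. of_int (sign p) * (\<Sum>i<n. A' i (p i) * (\<Prod>k\<in>{..<n}-{i}. A t0 k (p k))))) (at t0)"
    unfolding mdet_def
    by (intro DERIV_sum DERIV_cmult has_field_derivative_prod der) (auto dest: permutes_in_image)
  also have "(\<Sum>p | p permutes {..<n}. of_int (sign p) * (\<Sum>i<n. A' i (p i) * (\<Prod>k\<in>{..<n}-{i}. A t0 k (p k))))
     = (\<Sum>i<n. mdet n (row_repl (A t0) i (A' i)))"
  proof -
    have "(\<Prod>k<n. row_repl (A t0) i (A' i) k (p k)) = A' i (p i) * (\<Prod>k\<in>{..<n}-{i}. A t0 k (p k))"
      if "i < n" for i p
      using that by (subst prod.remove[of _ i]) (auto simp: row_repl_def intro!: prod.cong)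
    then show ?thesis unfolding mdet_def sum_distrib_left by (subst sum.swap) simp
  qed
  also have "\<dots> = (\<Sum>i<n. \<Sum>j<n. A' i j * (mdet n (A t0) * minv n (A t0) j i))"
    by (intro sum.cong refl, subst mdet_row_repl) (use d in \<open>auto simp: minv_entry\<close>)
  also have "\<dots> = mdet n (A t0) * mtr n (minv n (A t0) \<odot>\<^bsub>n\<^esub> A')"
    unfolding mtr_mmul_comm[of n "minv n (A t0)"] unfolding mtr_def mmul_def
    by (simp add: sum_distrib_left algebra_simps)
  finally show ?thesis .
qed

text \<open>Dividing the resolvent identity by \<open>t - t0\<close> leaves only continuity of the
  inverse to be used in the limit.\<close>

lemma has_field_derivative_minv:
  fixes A :: "'a::real_normed_field \<Rightarrow> nat \<Rightarrow> nat \<Rightarrow> 'a"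
  assumes der: "\<And>i j. i < n \<Longrightarrow> j < n \<Longrightarrow> ((\<lambda>t. A t i j) has_field_derivative A' i j) (at t0)"
    and d: "mdet n (A t0) \<noteq> 0" and ij: "i < n" "j < n"
  shows "((\<lambda>t. minv n (A t) i j) has_field_derivative
     - (minv n (A t0) \<odot>\<^bsub>n\<^esub> A' \<odot>\<^bsub>n\<^esub> minv n (A t0)) i j) (at t0)"
proof -
  have cont: "((\<lambda>t. A t i j) \<longlongrightarrow> A t0 i j) (at t0)" if "i < n" "j < n" for i j
    using DERIV_isCont[OF der[OF that]] by (simp add: isCont_def)
  let ?Q = "\<lambda>t. minv n (A t)"
  have ev: "eventually (\<lambda>t. mdet n (A t) \<noteq> 0) (at t0)"
    using tendsto_imp_eventually_ne[OF tendsto_mdet[OF cont] d] .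
  \<comment> \<open>The resolvent identity
    \<open>Q(t) - Q(t0) = - Q(t) (A(t) - A(t0)) Q(t0)\<close>, valid wherever \<open>A t\<close> is
    invertible.\<close>
  have eq: "?Q t i j - ?Q t0 i j = - (\<Sum>k<n. \<Sum>l<n. ?Q t i k * (A t k l - A t0 k l) * ?Q t0 l j)"
    if dt: "mdet n (A t) \<noteq> 0" for t
  proof -
    have a: "(\<Sum>k<n. ?Q t i k * A t k l) = idm i l" if "l < n" for l
      using minv_left[OF dt ij(1) that] by (simp add: mmul_def)
    have b: "(\<Sum>l<n. A t0 k l * ?Q t0 l j) = idm k j" if "k < n" for k
      using minv_right[OF d that ij(2)] by (simp add: mmul_def)
    have "(\<Sum>k<n. \<Sum>l<n. ?Q t i k * (A t k l - A t0 k l) * ?Q t0 l j)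
      = (\<Sum>k<n. \<Sum>l<n. ?Q t i k * A t k l * ?Q t0 l j) - (\<Sum>k<n. \<Sum>l<n. ?Q t i k * A t0 k l * ?Q t0 l j)"
      by (simp add: algebra_simps sum_subtractf)
    also have "(\<Sum>k<n. \<Sum>l<n. ?Q t i k * A t k l * ?Q t0 l j) = (\<Sum>l<n. (\<Sum>k<n. ?Q t i k * A t k l) * ?Q t0 l j)"
      by (subst sum.swap) (simp add: sum_distrib_right)
    also have "\<dots> = ?Q t0 i j"
      using a ij by (simp add: idm_def if_distrib[of "\<lambda>x. x * _"] cong: if_cong)
    also have "(\<Sum>k<n. \<Sum>l<n. ?Q t i k * A t0 k l * ?Q t0 l j) = (\<Sum>k<n. ?Q t i k * (\<Sum>l<n. A t0 k l * ?Q t0 l j))"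
      by (simp add: sum_distrib_left mult.assoc)
    also have "\<dots> = ?Q t i j"
      using b ij by (simp add: idm_def if_distrib[of "\<lambda>x. _ * x"] cong: if_cong)
    finally show ?thesis by simp
  qed
  have "((\<lambda>t. - (\<Sum>k<n. \<Sum>l<n. ?Q t i k * ((A t k l - A t0 k l) / (t - t0)) * ?Q t0 l j)) \<longlongrightarrow>
     - (\<Sum>k<n. \<Sum>l<n. ?Q t0 i k * A' k l * ?Q t0 l j)) (at t0)"
    by (intro tendsto_intros tendsto_minv cont d ij) (use der in \<open>auto simp: has_field_derivative_iff\<close>)
  also have "(\<Sum>k<n. \<Sum>l<n. ?Q t0 i k * A' k l * ?Q t0 l j) = (?Q t0 \<odot>\<^bsub>n\<^esub> A' \<odot>\<^bsub>n\<^esub> ?Q t0) i j"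
    unfolding mmul_def by (subst sum.swap) (simp add: sum_distrib_right)
  finally have "((\<lambda>t. - (\<Sum>k<n. \<Sum>l<n. ?Q t i k * ((A t k l - A t0 k l) / (t - t0)) * ?Q t0 l j)) \<longlongrightarrow>
     - (?Q t0 \<odot>\<^bsub>n\<^esub> A' \<odot>\<^bsub>n\<^esub> ?Q t0) i j) (at t0)" .
  then have "((\<lambda>t. (?Q t i j - ?Q t0 i j) / (t - t0)) \<longlongrightarrow> - (?Q t0 \<odot>\<^bsub>n\<^esub> A' \<odot>\<^bsub>n\<^esub> ?Q t0) i j) (at t0)"
    by (rule Lim_transform_eventually)
       (use ev in \<open>auto elim!: eventually_mono simp: eq sum_divide_distrib\<close>)
  then show ?thesis unfolding has_field_derivative_iff .
qed

subsection \<open>Hermitian forms\<close>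

definition cip :: "nat \<Rightarrow> (nat \<Rightarrow> complex) \<Rightarrow> (nat \<Rightarrow> complex) \<Rightarrow> complex"
  where "cip n u v = (\<Sum>i<n. cnj (u i) * v i)"

definition mvec :: "nat \<Rightarrow> (nat \<Rightarrow> nat \<Rightarrow> complex) \<Rightarrow> (nat \<Rightarrow> complex) \<Rightarrow> nat \<Rightarrow> complex"
  where "mvec n A v = (\<lambda>i. if i < n then \<Sum>j<n. A i j * v j else 0)"

lemma qform_cip: "qform n A v = cip n v (mvec n A v)"
  unfolding qform_def cip_def mvec_def by (simp add: sum_distrib_left mult.assoc)

lemma cip_mvec_hermitian: "hermitian n A \<Longrightarrow> cip n u (mvec n A v) = cip n (mvec n A u) v"
proof -
  assume h: "hermitian n A"
  have "cip n u (mvec n A v) = (\<Sum>i<n. \<Sum>j<n. cnj (u i) * A i j * v j)"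
    unfolding cip_def mvec_def by (simp add: sum_distrib_left mult.assoc)
  also have "\<dots> = (\<Sum>i<n. \<Sum>j<n. cnj (u i) * cnj (A j i) * v j)"
    by (intro sum.cong refl) (metis h hermitian_def lessThan_iff)
  also have "\<dots> = cip n (mvec n A u) v"
    unfolding cip_def mvec_def by (subst sum.swap) (simp add: sum_distrib_right sum_distrib_left mult.commute mult.left_commute)
  finally show ?thesis .
qed

lemma cip_self: "cip n v v = of_real (\<Sum>i<n. (cmod (v i))\<^sup>2)"
  unfolding cip_def by (simp add: complex_norm_square mult.commute del: of_real_power)

lemma cip_commute: "cip n u v = cnj (cip n v u)"
  unfolding cip_def by (simp add: mult.commute)

lemma cip_add_right: "cip n u (\<lambda>i. v i + c * w i) = cip n u v + c * cip n u w"
  and cip_add_left: "cip n (\<lambda>i. v i + c * w i) u = cip n v u + cnj c * cip n w u"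
  unfolding cip_def by (auto simp: algebra_simps sum.distrib sum_distrib_left)

lemma qform_real: "hermitian n A \<Longrightarrow> Im (qform n A v) = 0"
proof -
  assume h: "hermitian n A"
  have "cnj (qform n A v) = qform n A v"
    unfolding qform_cip using cip_mvec_hermitian[OF h, of v v] cip_commute[of n v "mvec n A v"] by simp
  then show ?thesis by (simp add: complex_eq_iff)
qed

text \<open>Tychonoff's theorem. Vectors are functions on all of \<open>nat\<close>; the boxes used
  later have singleton sides beyond the dimension.\<close>

lemma compact_fun_box:
  fixes B :: "'i \<Rightarrow> 'a::topological_space set"
  assumes "\<And>i. compact (B i)"
  shows "compact {v. \<forall>i. v i \<in> B i}"
proof -
  have "compactin (product_topology (\<lambda>_::'i. euclidean :: 'a topology) UNIV) (PiE UNIV B)"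
    unfolding compactin_PiE using assms by simp
  moreover have "PiE UNIV B = {v. \<forall>i. v i \<in> B i}" by (auto simp: PiE_def Pi_def)
  ultimately show ?thesis unfolding euclidean_product_topology by simp
qed

text \<open>Padding the \<open>k\<close> orthogonality conditions with zero rows gives a singular
  square matrix, and a kernel vector is the desired one.\<close>

lemma exists_orthogonal_vector:
  assumes "k < n"
  shows "\<exists>v. (\<exists>i<n. v i \<noteq> 0) \<and> (\<forall>i\<ge>n. v i = 0) \<and> (\<forall>j<k. cip n (V j) v = 0)"
proof -
  let ?A = "\<lambda>i j. if i < k then cnj (V i j) else 0"
  have P: "(\<Prod>i<n. ?A i (p i)) = 0" for p :: "nat \<Rightarrow> nat"
    by (rule prod_zero) (use assms in auto)
  have "mdet n ?A = 0" unfolding mdet_def by (simp only: P) simp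
  then obtain v where v: "\<exists>i<n. v i \<noteq> 0" "\<forall>i\<ge>n. v i = 0" "\<And>i. i < n \<Longrightarrow> (\<Sum>j<n. ?A i j * v j) = 0"
    unfolding mdet_0_kernel by blast
  have "cip n (V j) v = 0" if "j < k" for j
    using v(3)[of j] that assms unfolding cip_def by simp
  with v show ?thesis by blast
qed

lemma continuous_on_cip: "continuous_on S (\<lambda>v. cip n u v)"
  unfolding cip_def by (intro continuous_intros continuous_on_subset[OF continuous_on_product_coordinates]) auto

text \<open>A minimiser of the Rayleigh quotient on the orthogonal complement of eigenvectors
  found so far is a further eigenvector.\<close>

lemma exists_next_eigenvector:
  assumes h: "hermitian n A" and k: "k < n"
    and ev: "\<And>j i. j < k \<Longrightarrow> mvec n A (V j) i = complex_of_real (l j) * V j i"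
  shows "\<exists>v x. (\<forall>i\<ge>n. v i = 0) \<and> cip n v v = 1 \<and> (\<forall>j<k. cip n (V j) v = 0) \<and>
    (\<forall>i. mvec n A v i = complex_of_real x * v i)"
proof -
  define C where "C = {v. (\<forall>i\<ge>n. v i = 0) \<and> (\<forall>j<k. cip n (V j) v = 0)}"
  define S where "S = {v \<in> C. (\<Sum>i<n. (cmod (v i))\<^sup>2) = 1}"
  have coord: "continuous_on X (\<lambda>v::nat \<Rightarrow> complex. v i)" for X i
    by (rule continuous_on_subset[OF continuous_on_product_coordinates]) auto
  have "S \<subseteq> {v. \<forall>i. v i \<in> (if i < n then cball 0 1 else {0})}"
  proof (clarsimp simp: S_def C_def)
    fix v i assume v: "(\<Sum>i<n. (cmod (v i))\<^sup>2) = 1" and i: "i < n"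
    have "(cmod (v i))\<^sup>2 \<le> 1" unfolding v[symmetric]
      by (rule member_le_sum) (use i in auto)
    then show "cmod (v i) \<le> 1" by (simp add: power_le_one_iff abs_square_le_1)
  qed
  moreover have "closed S"
  proof -
    have "S = (\<Inter>i\<in>{n..}. {v. v i = 0}) \<inter> (\<Inter>j\<in>{..<k}. {v. cip n (V j) v = 0}) \<inter>
       {v. (\<Sum>i<n. (cmod (v i))\<^sup>2) = 1}" unfolding S_def C_def by auto
    also have "closed \<dots>"
      by (intro closed_Int closed_INT ballI closed_Collect_eq continuous_on_cip continuous_intros coord)
    finally show ?thesis .
  qed
  moreover have "compact {v::nat \<Rightarrow> complex. \<forall>i. v i \<in> (if i < n then cball 0 1 else {0})}"
    by (rule compact_fun_box) auto
  ultimately have "compact S"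
    using compact_Int_closed by (metis (no_types) inf.absorb_iff2)
  have scal: "\<exists>u\<in>S. \<exists>c>0. \<forall>i. v i = complex_of_real c * u i"
    if v: "v \<in> C" "v \<noteq> (\<lambda>i. 0)" for v
  proof -
    define c where "c = sqrt (\<Sum>i<n. (cmod (v i))\<^sup>2)"
    obtain i where i: "i < n" "v i \<noteq> 0" using v unfolding C_def by (auto simp: fun_eq_iff not_less) (metis not_less)
    then have pos: "(\<Sum>i<n. (cmod (v i))\<^sup>2) > 0" by (intro sum_pos2[of _ i]) auto
    then have c: "c > 0" "c\<^sup>2 = (\<Sum>i<n. (cmod (v i))\<^sup>2)" unfolding c_def by auto
    let ?u = "\<lambda>i. v i / complex_of_real c"
    have "cip n (V j) ?u = cip n (V j) v / complex_of_real c" for j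
      unfolding cip_def by (simp add: sum_divide_distrib)
    then have "?u \<in> C" using v unfolding C_def by auto
    moreover have "(\<Sum>i<n. (cmod (?u i))\<^sup>2) = 1"
      using c pos by (simp add: norm_divide power_divide sum_divide_distrib[symmetric])
    ultimately have "?u \<in> S" unfolding S_def by simp
    then show ?thesis using c(1) by (intro bexI[of _ ?u] exI[of _ c]) auto
  qed
  have "S \<noteq> {}"
  proof -
    obtain v where "\<exists>i<n. v i \<noteq> 0" "v \<in> C"
      using exists_orthogonal_vector[OF k, of V] unfolding C_def by auto
    then show ?thesis using scal[of v] by fastforce
  qed
  have "continuous_on S (\<lambda>v. Re (qform n A v))"
    unfolding qform_def by (intro continuous_intros coord)
  then obtain v where v: "v \<in> S" "\<And>u. u \<in> S \<Longrightarrow> Re (qform n A v) \<le> Re (qform n A u)"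
    using continuous_attains_inf[OF \<open>compact S\<close> \<open>S \<noteq> {}\<close>] by blast
  define x where "x = Re (qform n A v)"
  have min: "x * (\<Sum>i<n. (cmod (w i))\<^sup>2) \<le> Re (qform n A w)" if wC: "w \<in> C" for w
  proof (cases "w = (\<lambda>i. 0)")
    case True then show ?thesis by (simp add: qform_def)
  next
    case False
    then obtain u c where u: "u \<in> S" "c > 0" "\<And>i. w i = complex_of_real c * u i"
      using scal[OF wC False] by blast
    have "qform n A w = complex_of_real (c\<^sup>2) * qform n A u"
      unfolding qform_def u(3) by (simp add: sum_distrib_left power2_eq_square mult_ac)
    moreover have "(\<Sum>i<n. (cmod (w i))\<^sup>2) = c\<^sup>2"
      using u(1) unfolding S_def u(3) by (simp add: norm_mult power_mult_distrib sum_distrib_left[symmetric])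
    ultimately show ?thesis using v(2)[OF u(1)] u(2) unfolding x_def by (simp add: mult.commute)
  qed
  have vC: "v \<in> C" and vn: "cip n v v = 1" using v(1) unfolding S_def by (auto simp: cip_self)
  \<comment> \<open>The residual of the eigenvalue equation at the minimiser. It is orthogonal to
    the earlier eigenvectors, hence an admissible direction of variation.\<close>
  define r where "r = (\<lambda>i. mvec n A v i + complex_of_real (-x) * v i)"
  have r0: "\<forall>i\<ge>n. r i = 0" using vC unfolding r_def C_def mvec_def by simp
  have rC: "r \<in> C"
  proof -
    have "cip n (V j) r = 0" if "j < k" for j
    proof -
      have "cip n (V j) (mvec n A v) = cip n (mvec n A (V j)) v" by (rule cip_mvec_hermitian[OF h])
      also have "mvec n A (V j) = (\<lambda>i. (\<lambda>i. 0) i + complex_of_real (l j) * V j i)" using ev[OF that] by auto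
      also have "cip n \<dots> v = 0" unfolding cip_add_left using vC that by (simp add: C_def cip_def)
      finally show ?thesis unfolding r_def cip_add_right using vC that by (simp add: C_def)
    qed
    then show ?thesis using r0 unfolding C_def by simp
  qed
  define N where "N = (\<Sum>i<n. (cmod (r i))\<^sup>2)"
  have N: "cip n r r = of_real N" unfolding N_def by (rule cip_self)
  \<comment> \<open>The Rayleigh bound at \<open>v + t r\<close>: its first order term is
    \<open>2 t N\<close> with \<open>N\<close> the squared norm of the residual, so small negative
    \<open>t\<close> force \<open>N = 0\<close>.\<close>
  have ineq: "0 \<le> 2 * t * N + t\<^sup>2 * (Re (qform n A r) - x * N)" for t :: real
  proof -
    let ?w = "\<lambda>i. v i + complex_of_real t * r i"
    have wC: "?w \<in> C" using vC rC unfolding C_def by (simp add: cip_add_right)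
    have Aw: "mvec n A ?w = (\<lambda>i. mvec n A v i + complex_of_real t * mvec n A r i)"
      unfolding mvec_def by (intro ext) (simp add: algebra_simps sum.distrib sum_distrib_left)
    have rAv: "cip n r (mvec n A v) = of_real N + of_real x * cip n r v"
    proof -
      have "cip n r r = cip n r (mvec n A v) + complex_of_real (-x) * cip n r v"
        unfolding r_def by (rule cip_add_right)
      then show ?thesis using N by simp
    qed
    have vAr: "cip n v (mvec n A r) = of_real N + of_real x * cip n v r"
      using cip_mvec_hermitian[OF h, of v r] cip_commute[of n "mvec n A v" r] rAv cip_commute[of n v r] by simp
    have q: "qform n A ?w = of_real x + of_real t * (2 * of_real N + of_real x * (cip n r v + cip n v r))
        + of_real (t\<^sup>2) * qform n A r"
    proof -
      have "Im (qform n A v) = 0" by (rule qform_real[OF h])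
      then have qv: "cip n v (mvec n A v) = of_real x"
        unfolding x_def qform_cip by (simp add: complex_eq_iff)
      show ?thesis
        unfolding qform_cip Aw cip_add_right cip_add_left qv rAv vAr
        by (simp add: algebra_simps power2_eq_square)
    qed
    have nw: "complex_of_real (\<Sum>i<n. (cmod (?w i))\<^sup>2) = 1 + of_real t * (cip n r v + cip n v r) + of_real (t\<^sup>2 * N)"
      unfolding cip_self[symmetric] cip_add_right cip_add_left vn N
      by (simp add: algebra_simps power2_eq_square)
    have "(\<Sum>i<n. (cmod (?w i))\<^sup>2) = 1 + t * Re (cip n r v + cip n v r) + t\<^sup>2 * N"
      using arg_cong[OF nw, of Re] by simp
    then show ?thesis using min[OF wC] arg_cong[OF q, of Re] by (simp add: algebra_simps power2_eq_square)
  qed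
  have "N = 0"
  proof (rule ccontr)
    assume "N \<noteq> 0"
    then have Np: "N > 0" unfolding N_def by (simp add: order.not_eq_order_implies_strict sum_nonneg)
    \<comment> \<open>A positive upper bound for the quadratic coefficient; at
      \<open>t = - N / c\<close> the inequality reads \<open>0 \<le> - N^2 / c\<close>.\<close>
    define c where "c = \<bar>Re (qform n A r) - x * N\<bar> + 1"
    have c: "c > 0" "Re (qform n A r) - x * N \<le> c" unfolding c_def by auto
    have "0 \<le> 2 * (- N / c) * N + (- N / c)\<^sup>2 * (Re (qform n A r) - x * N)" by (rule ineq)
    also have "\<dots> \<le> 2 * (- N / c) * N + (- N / c)\<^sup>2 * c"
      using c by (intro add_left_mono mult_left_mono) auto
    also have "\<dots> = - (N\<^sup>2 / c)" using c by (simp add: power2_eq_square field_simps)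
    finally have "N\<^sup>2 / c \<le> 0" by simp
    moreover have "N\<^sup>2 / c > 0" using Np c by simp
    ultimately show False by simp
  qed
  then have "r i = 0" for i
  proof (cases "i < n")
    case True
    have "(\<Sum>i<n. (cmod (r i))\<^sup>2) = 0" using \<open>N = 0\<close> N_def by simp
    then have "(cmod (r i))\<^sup>2 = 0" using True
      by (subst (asm) sum_nonneg_eq_0_iff) auto
    then show ?thesis by simp
  qed (use r0 in simp)
  then have "mvec n A v i = complex_of_real x * v i" for i unfolding r_def by (simp add: eq_neg_iff_add_eq_0[symmetric])
  then show ?thesis using vC vn unfolding C_def by blast
qed

lemma exists_orthonormal_eigenvectors:
  assumes h: "hermitian n A" and "k \<le> n"
  shows "\<exists>V l. (\<forall>j<k. \<forall>i\<ge>n. V j i = 0) \<and>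
    (\<forall>i<k. \<forall>j<k. cip n (V i) (V j) = (if i = j then 1 else 0)) \<and>
    (\<forall>j<k. \<forall>i. mvec n A (V j) i = complex_of_real (l j) * V j i)"
  using \<open>k \<le> n\<close>
proof (induction k)
  case 0 show ?case by simp
next
  case (Suc k)
  then obtain V l where V: "\<forall>j<k. \<forall>i\<ge>n. V j i = 0"
    "\<forall>i<k. \<forall>j<k. cip n (V i) (V j) = (if i = j then 1 else 0)"
    "\<forall>j<k. \<forall>i. mvec n A (V j) i = complex_of_real (l j) * V j i" by auto
  obtain v x where v: "\<forall>i\<ge>n. v i = 0" "cip n v v = 1" "\<forall>j<k. cip n (V j) v = 0"
    "\<forall>i. mvec n A v i = complex_of_real x * v i"
    using exists_next_eigenvector[OF h, of k V l] V(3) Suc.prems by auto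
  have "\<forall>j<k. cip n v (V j) = 0" using v(3) cip_commute[of n v] by simp
  then show ?case
    using V v by (intro exI[of _ "V(k := v)"] exI[of _ "l(k := x)"]) (auto simp: less_Suc_eq)
qed

lemma diagm_mmul: "diagm n d \<odot>\<^bsub>n\<^esub> A = (\<lambda>i j. if i < n then complex_of_real (d i) * A i j else 0)"
proof (intro ext)
  fix i j
  have "mmul n (diagm n d) A i j = (\<Sum>k<n. if k = i then complex_of_real (d i) * A i j else 0)"
    unfolding mmul_def diagm_def by (intro sum.cong) auto
  then show "mmul n (diagm n d) A i j = (if i < n then complex_of_real (d i) * A i j else 0)" by simp
qed

lemma mmul_diagm: "A \<odot>\<^bsub>n\<^esub> diagm n d = (\<lambda>i j. if j < n then A i j * complex_of_real (d j) else 0)"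
proof (intro ext)
  fix i j
  have "mmul n A (diagm n d) i j = (\<Sum>k<n. if k = j then A i j * complex_of_real (d j) else 0)"
    unfolding mmul_def diagm_def by (intro sum.cong) auto
  then show "mmul n A (diagm n d) i j = (if j < n then A i j * complex_of_real (d j) else 0)" by simp
qed

lemma diagm_diagm: "diagm n d \<odot>\<^bsub>n\<^esub> diagm n e = diagm n (\<lambda>i. d i * e i)"
  unfolding diagm_mmul by (auto simp: diagm_def intro!: ext)

lemma adjm_diagm: "adjm (diagm n d) = diagm n d"
  unfolding adjm_def diagm_def by (auto intro!: ext)

lemma msupp_diagm: "msupp n (diagm n d)"
  unfolding msupp_def diagm_def by auto

theorem hermitian_spectral:
  assumes h: "hermitian n A" and s: "msupp n A"
  obtains U l where "msupp n U" "adjm U \<odot>\<^bsub>n\<^esub> U = eye n" "U \<odot>\<^bsub>n\<^esub> adjm U = eye n"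
    "A = U \<odot>\<^bsub>n\<^esub> diagm n l \<odot>\<^bsub>n\<^esub> adjm U"
proof -
  obtain V l where V: "\<forall>j<n. \<forall>i\<ge>n. V j i = 0"
    "\<forall>i<n. \<forall>j<n. cip n (V i) (V j) = (if i = j then 1 else 0)"
    "\<forall>j<n. \<forall>i. mvec n A (V j) i = complex_of_real (l j) * V j i"
    using exists_orthonormal_eigenvectors[OF h, of n] by auto
  define U where "U = (\<lambda>i j. if i < n \<and> j < n then V j i else 0)"
  have sU: "msupp n U" by (auto simp: msupp_def U_def)
  have UU: "mmul n (adjm U) U i j = idm i j" if "i < n" "j < n" for i j
  proof -
    have "mmul n (adjm U) U i j = cip n (V i) (V j)"
      unfolding mmul_def cip_def adjm_def U_def using that by (intro sum.cong) auto
    then show ?thesis using V(2) that by (simp add: idm_def)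
  qed
  have 1: "adjm U \<odot>\<^bsub>n\<^esub> U = eye n"
    by (rule msupp_eqI[of n]) (auto simp: sU msupp_mmul msupp_adjm msupp_eye UU, auto simp: eye_def idm_def)
  have "mmul n U (adjm U) i j = idm i j" if "i < n" "j < n" for i j
    using mmul_left_right_inverse[of n "adjm U" U] UU that by blast
  then have 2: "U \<odot>\<^bsub>n\<^esub> adjm U = eye n"
    by (intro msupp_eqI[of n]) (auto simp: sU msupp_mmul msupp_adjm msupp_eye, auto simp: eye_def idm_def)
  have "A \<odot>\<^bsub>n\<^esub> U = U \<odot>\<^bsub>n\<^esub> diagm n l"
  proof (rule msupp_eqI[of n])
    fix i j assume ij: "i < n" "j < n"
    have "mmul n A U i j = mvec n A (V j) i"
      unfolding mmul_def mvec_def U_def using ij by (auto intro!: sum.cong)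
    then show "mmul n A U i j = mmul n U (diagm n l) i j"
      using V(3) ij by (simp add: mmul_diagm U_def mult.commute)
  qed (auto simp: sU s msupp_mmul msupp_diagm)
  then have "A \<odot>\<^bsub>n\<^esub> U \<odot>\<^bsub>n\<^esub> adjm U = U \<odot>\<^bsub>n\<^esub> diagm n l \<odot>\<^bsub>n\<^esub> adjm U" by simp
  then have "A = U \<odot>\<^bsub>n\<^esub> diagm n l \<odot>\<^bsub>n\<^esub> adjm U"
    by (simp add: mmul_assoc 2 mmul_eye_right s)
  with sU 1 2 show ?thesis by (rule that)
qed

lemma qform_diagm: "qform n (diagm n d) v = of_real (\<Sum>i<n. d i * (cmod (v i))\<^sup>2)"
proof -
  have "qform n (diagm n d) v = (\<Sum>i<n. \<Sum>j<n. if j = i then cnj (v i) * of_real (d i) * v i else 0)"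
    unfolding qform_def diagm_def by (intro sum.cong refl) auto
  then show ?thesis by (simp add: complex_norm_square mult_ac del: of_real_power)
qed

lemma qform_congruence:
  "qform n (B \<odot>\<^bsub>m\<^esub> C \<odot>\<^bsub>m\<^esub> adjm B) v = qform m C (\<lambda>j. \<Sum>i<n. cnj (B i j) * v i)"
proof -
  define w where "w = (\<lambda>l. \<Sum>j<n. cnj (B j l) * v j)"
  define x where "x = (\<lambda>k. \<Sum>l<m. C k l * w l)"
  have x: "x k = (\<Sum>j<n. (\<Sum>l<m. C k l * cnj (B j l)) * v j)" for k
    unfolding x_def w_def sum_distrib_left sum_distrib_right by (subst sum.swap) (simp add: mult.assoc)
  have "qform m C w = (\<Sum>k<m. cnj (w k) * x k)"
    unfolding qform_def x_def by (simp add: sum_distrib_left mult.assoc)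
  also have "\<dots> = (\<Sum>k<m. \<Sum>i<n. cnj (v i) * (B i k * x k))"
    unfolding w_def by (simp add: sum_distrib_right sum_distrib_left mult_ac)
  also have "\<dots> = (\<Sum>i<n. cnj (v i) * (\<Sum>k<m. B i k * x k))"
    by (subst sum.swap) (simp add: sum_distrib_left)
  also have "\<dots> = (\<Sum>i<n. cnj (v i) * (\<Sum>j<n. (B \<odot>\<^bsub>m\<^esub> (C \<odot>\<^bsub>m\<^esub> adjm B)) i j * v j))"
  proof (rule sum.cong[OF refl], rule arg_cong2[where f=times, OF refl])
    fix i
    have "(\<Sum>k<m. B i k * x k) = (\<Sum>k<m. \<Sum>j<n. B i k * (\<Sum>l<m. C k l * cnj (B j l)) * v j)"
      unfolding x by (simp only: sum_distrib_left[of "B i _" "\<lambda>j. _ j * v j"] mult.assoc)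
    also have "\<dots> = (\<Sum>j<n. (\<Sum>k<m. B i k * (\<Sum>l<m. C k l * cnj (B j l))) * v j)"
      by (subst sum.swap) (simp add: sum_distrib_right)
    finally show "(\<Sum>k<m. B i k * x k) = (\<Sum>j<n. (B \<odot>\<^bsub>m\<^esub> (C \<odot>\<^bsub>m\<^esub> adjm B)) i j * v j)"
      unfolding mmul_def adjm_def by (simp add: sum_distrib_left)
  qed
  also have "\<dots> = qform n (B \<odot>\<^bsub>m\<^esub> C \<odot>\<^bsub>m\<^esub> adjm B) v"
    unfolding qform_def mmul_assoc by (simp add: sum_distrib_left mult.assoc)
  finally show ?thesis unfolding w_def by simp
qed

lemma qform_cong: "(\<And>i j. i < n \<Longrightarrow> j < n \<Longrightarrow> A i j = B i j) \<Longrightarrow> (\<And>i. i < n \<Longrightarrow> v i = w i) \<Longrightarrow> qform n A v = qform n B w"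
  unfolding qform_def by (intro sum.cong refl) auto

section \<open>Positive definite matrices: kernels, square roots, inverses\<close>

lemma pd_imp_psd: "pd n A \<Longrightarrow> psd n A"
  unfolding pd_def psd_def
proof safe
  fix v assume *: "\<forall>v. (\<exists>i<n. v i \<noteq> 0) \<longrightarrow> 0 < Re (qform n A v)"
  show "0 \<le> Re (qform n A v)"
  proof (cases "\<exists>i<n. v i \<noteq> 0")
    case False
    then have "qform n A v = 0" unfolding qform_def by simp
    then show ?thesis by simp
  qed (use * in \<open>simp add: less_imp_le\<close>)
qed

lemma pd_mdet: "pd n A \<Longrightarrow> mdet n A \<noteq> 0"
proof
  assume p: "pd n A" and "mdet n A = 0"
  then obtain v where v: "\<exists>i<n. v i \<noteq> 0" "\<forall>i<n. (\<Sum>j<n. A i j * v j) = 0" unfolding mdet_0_kernel by blast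
  have "qform n A v = (\<Sum>i<n. cnj (v i) * (\<Sum>j<n. A i j * v j))"
    unfolding qform_def by (simp add: sum_distrib_left mult.assoc)
  then have "qform n A v = 0" using v(2) by simp
  then show False using p v(1) unfolding pd_def by auto
qed

text \<open>A zero of a nonnegative form is a minimiser, so the first variation vanishes; varying
  along \<open>r = A v\<close> itself gives \<open>r = 0\<close>.\<close>

lemma psd_kernel:
  assumes p: "psd n A" and z: "Re (qform n A v) = 0" and i: "i < n"
  shows "mvec n A v i = 0"
proof -
  have h: "hermitian n A" using p by (simp add: psd_def)
  define r where "r = mvec n A v"
  define N where "N = (\<Sum>i<n. (cmod (r i))\<^sup>2)"
  have N: "cip n r r = of_real N" unfolding N_def by (rule cip_self)
  have ineq: "0 \<le> 2 * t * N + t\<^sup>2 * Re (qform n A r)" for t :: real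
  proof -
    let ?w = "\<lambda>i. v i + complex_of_real t * r i"
    have Aw: "mvec n A ?w = (\<lambda>i. mvec n A v i + complex_of_real t * mvec n A r i)"
      unfolding mvec_def by (intro ext) (simp add: algebra_simps sum.distrib sum_distrib_left)
    have vAr: "cip n v (mvec n A r) = of_real N"
      using cip_mvec_hermitian[OF h, of v r] N r_def by simp
    have "qform n A ?w = qform n A v + of_real t * (2 * of_real N) + of_real (t\<^sup>2) * qform n A r"
      unfolding qform_cip Aw cip_add_right cip_add_left vAr r_def[symmetric] N
      by (simp add: algebra_simps power2_eq_square)
    then have "Re (qform n A ?w) = 2 * t * N + t\<^sup>2 * Re (qform n A r)" using z by simp
    then show ?thesis using p unfolding psd_def by metis
  qed
  have "N = 0"
  proof (rule ccontr)
    assume "N \<noteq> 0"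
    then have Np: "N > 0" unfolding N_def by (simp add: order.not_eq_order_implies_strict sum_nonneg)
    define c where "c = \<bar>Re (qform n A r)\<bar> + 1"
    have c: "c > 0" "Re (qform n A r) \<le> c" unfolding c_def by auto
    have "0 \<le> 2 * (- N / c) * N + (- N / c)\<^sup>2 * Re (qform n A r)" by (rule ineq)
    also have "\<dots> \<le> 2 * (- N / c) * N + (- N / c)\<^sup>2 * c"
      using c by (intro add_left_mono mult_left_mono) auto
    also have "\<dots> = - (N\<^sup>2 / c)" using c by (simp add: power2_eq_square field_simps)
    finally have "N\<^sup>2 / c \<le> 0" by simp
    moreover have "N\<^sup>2 / c > 0" using Np c by simp
    ultimately show False by simp
  qed
  then have "(cmod (r i))\<^sup>2 = 0" unfolding N_def using i by (subst (asm) sum_nonneg_eq_0_iff) auto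
  then show ?thesis unfolding r_def by simp
qed

lemma adjm_minv:
  assumes "mdet n A \<noteq> 0" "msupp n A" "adjm A = A"
  shows "adjm (minv n A) = minv n A"
proof -
  have "A \<odot>\<^bsub>n\<^esub> adjm (minv n A) = eye n"
    using arg_cong[OF minv_eye(2)[OF assms(1,2)], of adjm] by (simp add: adjm_mmul assms(3))
  then show ?thesis using minv_unique(1)[of n A "adjm (minv n A)"] assms
    by (simp add: msupp_adjm msupp_minv_gen)
qed

lemma hermitian_congruence: "adjm C = C \<Longrightarrow> adjm (B \<odot>\<^bsub>m\<^esub> C \<odot>\<^bsub>m\<^esub> adjm B) = B \<odot>\<^bsub>m\<^esub> C \<odot>\<^bsub>m\<^esub> adjm B"
  by (simp add: adjm_mmul mmul_assoc)

lemma hermitianI: "adjm A = A \<Longrightarrow> hermitian n A"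
  unfolding hermitian_def adjm_def by metis

lemma psd_congruence_diagm:
  assumes "\<And>j. j < m \<Longrightarrow> 0 \<le> d j"
  shows "psd n (B \<odot>\<^bsub>m\<^esub> diagm m d \<odot>\<^bsub>m\<^esub> adjm B)"
  unfolding psd_def qform_congruence qform_diagm
  using assms by (auto intro!: hermitianI hermitian_congruence sum_nonneg simp: adjm_diagm)

lemma mvec_mmul: "mvec n (A \<odot>\<^bsub>n\<^esub> B) v i = mvec n A (mvec n B v) i"
proof (cases "i < n")
  case True
  have "(\<Sum>j<n. mmul n A B i j * v j) = (\<Sum>j<n. \<Sum>k<n. A i k * B k j * v j)"
    unfolding mmul_def by (simp add: sum_distrib_right)
  also have "\<dots> = (\<Sum>k<n. A i k * (\<Sum>j<n. B k j * v j))"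
    by (subst sum.swap) (simp add: sum_distrib_left mult.assoc)
  finally show ?thesis using True unfolding mvec_def by simp
qed (simp add: mvec_def)

text \<open>With \<open>D = S - T\<close> one has \<open>S D + D T = 0\<close>. Multiplying by
  \<open>D\<close> and taking traces makes two nonnegative quantities sum to zero, so the columns of
  \<open>D\<close> lie in both kernels; then \<open>D D = 0\<close>, and \<open>D\<close> is
  Hermitian.\<close>

lemma psd_sqrt_unique:
  assumes S: "msupp n S" "psd n S" and T: "msupp n T" "psd n T"
    and eq: "S \<odot>\<^bsub>n\<^esub> S = T \<odot>\<^bsub>n\<^esub> T"
  shows "S = T"
proof -
  define D where "D = S - T"
  have hS: "adjm S = S" and hT: "adjm T = T"
    using S T hermitian_iff_adjm[of n] by (auto simp: psd_def)
  have hD: "adjm D = D" unfolding D_def adjm_diff hS hT ..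
  have "S \<odot>\<^bsub>n\<^esub> D + D \<odot>\<^bsub>n\<^esub> T = 0" unfolding D_def mmul_distribs eq by simp
  then have z: "D \<odot>\<^bsub>n\<^esub> S \<odot>\<^bsub>n\<^esub> D + D \<odot>\<^bsub>n\<^esub> D \<odot>\<^bsub>n\<^esub> T = 0"
    by (metis add.right_neutral mmul_add_right mmul_assoc add_left_cancel)
  have tz: "mtr n (D \<odot>\<^bsub>n\<^esub> S \<odot>\<^bsub>n\<^esub> D) + mtr n (D \<odot>\<^bsub>n\<^esub> T \<odot>\<^bsub>n\<^esub> D) = 0"
    using arg_cong[OF z, of "mtr n"] mtr_mmul_comm[of n "D" "D \<odot>\<^bsub>n\<^esub> T"]
    by (simp add: mtr_add mmul_assoc) (simp add: mtr_def)
  have tr: "mtr n (D \<odot>\<^bsub>n\<^esub> X \<odot>\<^bsub>n\<^esub> D) = (\<Sum>j<n. qform n X (\<lambda>i. D i j))" for X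
  proof -
    have "mmul n (mmul n D X) D j j = qform n X (\<lambda>i. D i j)" for j
      unfolding mmul_assoc unfolding mmul_def qform_def sum_distrib_left
      using hD by (intro sum.cong refl) (auto simp: adjm_def fun_eq_iff mult.assoc)
    then show ?thesis unfolding mtr_def by simp
  qed
  have "(\<Sum>j<n. Re (qform n S (\<lambda>i. D i j)) + Re (qform n T (\<lambda>i. D i j))) = 0"
    using arg_cong[OF tz, of Re] unfolding tr by (simp add: sum.distrib)
  then have "\<forall>j<n. Re (qform n S (\<lambda>i. D i j)) + Re (qform n T (\<lambda>i. D i j)) = 0"
    using S(2) T(2) unfolding psd_def by (subst (asm) sum_nonneg_eq_0_iff) auto
  then have 0: "Re (qform n S (\<lambda>i. D i j)) = 0" "Re (qform n T (\<lambda>i. D i j)) = 0" if "j < n" for j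
    using that S(2) T(2) unfolding psd_def by (auto simp: add_nonneg_eq_0_iff)
  have DD: "mmul n D D j j = 0" if j: "j < n" for j
  proof -
    have "mmul n D D i j = mvec n S (\<lambda>i. D i j) i - mvec n T (\<lambda>i. D i j) i" if "i < n" for i
    proof -
      have "D i k = S i k - T i k" for k by (simp add: D_def)
      then show ?thesis unfolding mmul_def mvec_def using that by (simp add: left_diff_distrib sum_subtractf)
    qed
    then show ?thesis
      using psd_kernel[OF S(2) 0(1)[OF j] j] psd_kernel[OF T(2) 0(2)[OF j] j] j by simp
  qed
  have "D i j = 0" if "i < n" "j < n" for i j
  proof -
    have "D j k = cnj (D k j)" for k using hD by (metis adjm_def)
    then have "mmul n D D j j = of_real (\<Sum>k<n. (cmod (D k j))\<^sup>2)"
      unfolding mmul_def by (simp add: complex_norm_square mult.commute del: of_real_power)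
    then have "(\<Sum>k<n. (cmod (D k j))\<^sup>2) = 0" using DD[OF that(2)] of_real_eq_0_iff by metis
    then have "(cmod (D i j))\<^sup>2 = 0" using that by (subst (asm) sum_nonneg_eq_0_iff) auto
    then show ?thesis by simp
  qed
  then show ?thesis using msupp_eqI[OF S(1) T(1)] unfolding D_def by simp
qed

text \<open>Resolves both definite descriptions behind \<open>minvsqrt\<close> once: the root is
  built from the eigenvalues, and every property of it and of its inverse that is used later is
  exported.\<close>

lemma pd_sqrt:
  assumes p: "pd n A" and s: "msupp n A"
  obtains S W where "msupp n S" "adjm S = S" "S \<odot>\<^bsub>n\<^esub> S = A" "minvsqrt n A = W"
    "msupp n W" "adjm W = W" "W \<odot>\<^bsub>n\<^esub> S = eye n" "S \<odot>\<^bsub>n\<^esub> W = eye n" "W \<odot>\<^bsub>n\<^esub> W = minv n A"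
proof -
  have h: "hermitian n A" using p by (simp add: pd_def)
  obtain U l where U: "msupp n U" "adjm U \<odot>\<^bsub>n\<^esub> U = eye n" "U \<odot>\<^bsub>n\<^esub> adjm U = eye n"
    "A = U \<odot>\<^bsub>n\<^esub> diagm n l \<odot>\<^bsub>n\<^esub> adjm U"
    by (rule hermitian_spectral[OF h s])
  have l: "l j \<ge> 0" if j: "j < n" for j
  proof -
    have "qform n A (\<lambda>i. U i j) = qform n (diagm n l) (\<lambda>k. \<Sum>i<n. cnj (U i k) * U i j)"
      unfolding U(4) by (rule qform_congruence)
    also have "\<dots> = qform n (diagm n l) (\<lambda>k. eye n k j)"
      unfolding U(2)[symmetric] by (simp add: mmul_def adjm_def)
    also have "\<dots> = of_real (\<Sum>i<n. if i = j then l j else 0)"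
      unfolding qform_diagm by (intro arg_cong[of _ _ of_real] sum.cong) (auto simp: eye_def)
    also have "\<dots> = of_real (l j)" using j by simp
    finally show ?thesis using pd_imp_psd[OF p] unfolding psd_def by (metis Re_complex_of_real)
  qed
  define S where "S = U \<odot>\<^bsub>n\<^esub> diagm n (\<lambda>i. sqrt (l i)) \<odot>\<^bsub>n\<^esub> adjm U"
  have sS: "msupp n S" unfolding S_def by (intro msupp_mmul U msupp_diagm msupp_adjm)
  have pS: "psd n S" unfolding S_def by (rule psd_congruence_diagm) (use l in auto)
  have "S \<odot>\<^bsub>n\<^esub> S = U \<odot>\<^bsub>n\<^esub> (diagm n (\<lambda>i. sqrt (l i)) \<odot>\<^bsub>n\<^esub> ((adjm U \<odot>\<^bsub>n\<^esub> U) \<odot>\<^bsub>n\<^esub> diagm n (\<lambda>i. sqrt (l i)))) \<odot>\<^bsub>n\<^esub> adjm U"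
    unfolding S_def by (simp add: mmul_assoc)
  also have "\<dots> = U \<odot>\<^bsub>n\<^esub> diagm n (\<lambda>i. sqrt (l i) * sqrt (l i)) \<odot>\<^bsub>n\<^esub> adjm U"
    unfolding U(2) by (simp add: mmul_eye_left msupp_diagm diagm_diagm)
  also have "diagm n (\<lambda>i. sqrt (l i) * sqrt (l i)) = diagm n l"
    unfolding diagm_def using l by (auto intro!: ext)
  finally have SS: "S \<odot>\<^bsub>n\<^esub> S = A" using U(4) by simp
  have hS: "adjm S = S" using pS sS hermitian_iff_adjm by (auto simp: psd_def)
  have ms: "msqrt n A = S" unfolding msqrt_def
  proof (rule the_equality)
    show "(\<forall>i j. (n \<le> i \<or> n \<le> j) \<longrightarrow> S i j = 0) \<and> psd n S \<and> (\<forall>i<n. \<forall>j<n. mmul n S S i j = A i j)"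
      using sS pS SS by (auto simp: msupp_def)
    fix T assume T: "(\<forall>i j. (n \<le> i \<or> n \<le> j) \<longrightarrow> T i j = 0) \<and> psd n T \<and> (\<forall>i<n. \<forall>j<n. mmul n T T i j = A i j)"
    have sT: "msupp n T" using T by (auto simp: msupp_def)
    show "T = S"
    proof (rule psd_sqrt_unique[OF sT _ sS pS])
      show "T \<odot>\<^bsub>n\<^esub> T = S \<odot>\<^bsub>n\<^esub> S" unfolding SS
        by (rule msupp_eqI[of n]) (use T sT s in \<open>auto simp: msupp_mmul\<close>)
    qed (use T in simp)
  qed
  have "mdet n S * mdet n S \<noteq> 0" using pd_mdet[OF p] unfolding SS[symmetric] mdet_mmul .
  then have dS: "mdet n S \<noteq> 0" by simp
  define W where "W = minv n S"
  have W: "msupp n W" "adjm W = W" "W \<odot>\<^bsub>n\<^esub> S = eye n" "S \<odot>\<^bsub>n\<^esub> W = eye n"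
    unfolding W_def by (auto intro!: msupp_minv_gen adjm_minv minv_eye dS sS hS)
  have "minvsqrt n A = W" unfolding minvsqrt_def ms W_def ..
  moreover have "W \<odot>\<^bsub>n\<^esub> W = minv n A"
  proof (rule minv_unique(1)[symmetric])
    have "A \<odot>\<^bsub>n\<^esub> (W \<odot>\<^bsub>n\<^esub> W) = S \<odot>\<^bsub>n\<^esub> ((S \<odot>\<^bsub>n\<^esub> W) \<odot>\<^bsub>n\<^esub> W)"
      unfolding SS[symmetric] by (simp add: mmul_assoc)
    then show "A \<odot>\<^bsub>n\<^esub> (W \<odot>\<^bsub>n\<^esub> W) = eye n" by (simp add: W mmul_eye_left)
  qed (auto intro: s W msupp_mmul)
  ultimately show ?thesis using that[OF sS hS SS] W by blast
qed

text \<open>The determinant is the square of that of the Hermitian root, which is real and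
  nonzero.\<close>

lemma mdet_pd_real:
  assumes p: "pd n A" and s: "msupp n A"
  shows "mdet n A = of_real (Re (mdet n A))" "Re (mdet n A) > 0"
proof -
  obtain S W where S: "msupp n S" "adjm S = S" "S \<odot>\<^bsub>n\<^esub> S = A" by (rule pd_sqrt[OF p s])
  have "mdet n S = cnj (mdet n S)" using mdet_adjm[of n S] S(2) by simp
  then have r: "Im (mdet n S) = 0" by (simp add: complex_eq_iff)
  have e: "mdet n A = mdet n S * mdet n S" unfolding S(3)[symmetric] by (rule mdet_mmul)
  show "mdet n A = of_real (Re (mdet n A))" unfolding e using r by (simp add: complex_eq_iff)
  have "mdet n S \<noteq> 0" using pd_mdet[OF p] e by auto
  then have "Re (mdet n S) \<noteq> 0" using r by (auto simp: complex_eq_iff)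
  then show "Re (mdet n A) > 0" unfolding e using r by (simp add: power2_eq_square[symmetric])
qed

text \<open>The inverse is congruent to the matrix, \<open>Q = Q A Q\<close>, and a vector killed by
  \<open>Q\<close> would be zero.\<close>

lemma pd_minv:
  assumes p: "pd n A" and s: "msupp n A"
  shows "pd n (minv n A)"
proof -
  have hA: "adjm A = A" using p s hermitian_iff_adjm by (auto simp: pd_def)
  have d: "mdet n A \<noteq> 0" by (rule pd_mdet[OF p])
  let ?Q = "minv n A"
  have sQ: "msupp n ?Q" by (rule msupp_minv_gen[OF d])
  have hQ: "adjm ?Q = ?Q" by (rule adjm_minv[OF d s hA])
  have e: "?Q = ?Q \<odot>\<^bsub>n\<^esub> A \<odot>\<^bsub>n\<^esub> adjm ?Q"
    unfolding hQ by (simp add: minv_eye[OF d s] mmul_eye_left sQ)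
  have "0 < Re (qform n ?Q v)" if v: "\<exists>i<n. v i \<noteq> 0" for v
  proof -
    define w where "w = (\<lambda>j. \<Sum>i<n. cnj (?Q i j) * v i)"
    have w: "w j = (\<Sum>i<n. ?Q j i * v i)" for j
      unfolding w_def using hQ by (auto simp: adjm_def fun_eq_iff)
    have "\<exists>j<n. w j \<noteq> 0"
    proof (rule ccontr)
      assume "\<not> ?thesis"
      then have "(\<Sum>j<n. A i j * w j) = 0" for i by simp
      moreover have "(\<Sum>j<n. A i j * w j) = v i" if "i < n" for i
      proof -
        have "(\<Sum>j<n. A i j * w j) = mvec n A (mvec n ?Q v) i"
          unfolding w mvec_def using that by simp
        also have "\<dots> = mvec n (eye n) v i" unfolding mvec_mmul[symmetric] minv_eye[OF d s] ..
        also have "\<dots> = v i"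
          unfolding mvec_def eye_def using that by (simp add: if_distrib[of "\<lambda>x. x * _"] cong: if_cong)
        finally show ?thesis .
      qed
      ultimately show False using v by auto
    qed
    moreover have "qform n ?Q v = qform n A w"
      unfolding w_def by (subst e) (rule qform_congruence)
    ultimately show ?thesis using p unfolding pd_def by simp
  qed
  then show ?thesis unfolding pd_def using hermitianI[OF hQ] by blast
qed

lemma mtr_adjm_mmul: "mtr n (adjm X \<odot>\<^bsub>n\<^esub> P \<odot>\<^bsub>n\<^esub> X) = (\<Sum>j<n. qform n P (\<lambda>i. X i j))"
proof -
  have "mmul n (mmul n (adjm X) P) X j j = qform n P (\<lambda>i. X i j)" for j
    unfolding mmul_assoc unfolding mmul_def qform_def sum_distrib_left
    by (intro sum.cong refl) (auto simp: adjm_def mult.assoc)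
  then show ?thesis unfolding mtr_def by simp
qed

lemma mtr_pd_nonneg: "pd n P \<Longrightarrow> 0 \<le> Re (mtr n (adjm X \<odot>\<^bsub>n\<^esub> P \<odot>\<^bsub>n\<^esub> X))"
  unfolding mtr_adjm_mmul using pd_imp_psd[of n P] by (auto simp: psd_def intro!: sum_nonneg)

text \<open>The trace is the sum of the form over the columns of \<open>X\<close>, so each column is
  a zero of a positive definite form.\<close>

lemma mtr_pd_zero:
  assumes p: "pd n P" and z: "Re (mtr n (adjm X \<odot>\<^bsub>n\<^esub> P \<odot>\<^bsub>n\<^esub> X)) \<le> 0" and s: "msupp n X"
  shows "X = 0"
proof -
  have nn: "0 \<le> Re (qform n P v)" for v using pd_imp_psd[OF p] by (simp add: psd_def)
  have "(\<Sum>j<n. Re (qform n P (\<lambda>i. X i j))) \<le> 0" using z unfolding mtr_adjm_mmul by simp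
  then have "(\<Sum>j<n. Re (qform n P (\<lambda>i. X i j))) = 0" using nn by (intro antisym sum_nonneg) auto
  then have "\<forall>j<n. Re (qform n P (\<lambda>i. X i j)) = 0" using nn by (subst (asm) sum_nonneg_eq_0_iff) auto
  then have "X i j = 0" if "i < n" "j < n" for i j using p that unfolding pd_def
    by (metis less_irrefl)
  then show ?thesis using s by (intro ext) (metis msupp_def not_less zero_fun_apply)
qed

lemma pd_eye: "pd n (eye n)"
proof -
  have "eye n = diagm n (\<lambda>_. 1)" by (auto simp: eye_def diagm_def intro!: ext)
  then show ?thesis unfolding pd_def using adjm_eye[of n]
    by (auto simp: qform_diagm intro!: hermitianI sum_pos2)
qed

section \<open>The covariance fitting criterion in trace form and its convexity\<close>

lemma frob2_mtr: "frob2 n n X = Re (mtr n (adjm X \<odot>\<^bsub>n\<^esub> X))"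
proof -
  have "mtr n (adjm X \<odot>\<^bsub>n\<^esub> X) = of_real (\<Sum>j<n. \<Sum>i<n. (cmod (X i j))\<^sup>2)"
    unfolding mtr_def mmul_def adjm_def
    by (simp add: complex_norm_square mult.commute del: of_real_power)
  then show ?thesis unfolding frob2_def by (subst sum.swap) simp
qed

text \<open>Let \<open>Q\<close>, \<open>Q'\<close> be the inverses of \<open>R\<close>,
  \<open>Rt\<close> and \<open>D = Rt - R\<close>. By cyclicity the squared norm is the trace of
  \<open>D Q D Q'\<close>, and \<open>D Q = Rt Q - I\<close>, \<open>D Q' = I - R Q'\<close>
  multiply out to the stated form. The roots disappear, which makes the criterion differentiable in
  \<open>R\<close> by elementary means.\<close>

lemma spa_obj_eq_frob2:
  assumes "n \<le> N" and p: "pd n R" "pd n Rt" and s: "msupp n R" "msupp n Rt"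
  shows spa_obj_trace: "spa_obj n N Rt R =
      Re (mtr n (minv n R \<odot>\<^bsub>n\<^esub> Rt)) + Re (mtr n (minv n Rt \<odot>\<^bsub>n\<^esub> R)) - 2 * real n"
    and spa_obj_nonneg: "0 \<le> spa_obj n N Rt R"
    and spa_obj_zero: "spa_obj n N Rt R = 0 \<Longrightarrow> R = Rt"
proof -
  obtain S W where S: "msupp n S" "adjm S = S" "S \<odot>\<^bsub>n\<^esub> S = R" "minvsqrt n R = W"
    "msupp n W" "adjm W = W" "W \<odot>\<^bsub>n\<^esub> S = eye n" "S \<odot>\<^bsub>n\<^esub> W = eye n" "W \<odot>\<^bsub>n\<^esub> W = minv n R"
    by (rule pd_sqrt[OF p(1) s(1)])
  obtain S' W' where S': "msupp n S'" "adjm S' = S'" "S' \<odot>\<^bsub>n\<^esub> S' = Rt" "minvsqrt n Rt = W'"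
    "msupp n W'" "adjm W' = W'" "W' \<odot>\<^bsub>n\<^esub> S' = eye n" "S' \<odot>\<^bsub>n\<^esub> W' = eye n" "W' \<odot>\<^bsub>n\<^esub> W' = minv n Rt"
    by (rule pd_sqrt[OF p(2) s(2)])
  define D where "D = Rt - R"
  define X where "X = W \<odot>\<^bsub>n\<^esub> D \<odot>\<^bsub>n\<^esub> W'"
  have hR: "adjm R = R" "adjm Rt = Rt" using p s hermitian_iff_adjm by (auto simp: pd_def)
  have hD: "adjm D = D" unfolding D_def adjm_diff hR ..
  have sD: "msupp n D" unfolding D_def using s by (simp add: msupp_minus)
  have sX: "msupp n X" unfolding X_def by (intro msupp_mmul S S' sD)
  have obj: "spa_obj n N Rt R = frob2 n n X"
    unfolding spa_obj_def X_def D_def S(4) S'(4) using assms(1) by (simp add: fun_diff_def)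
  have nn: "0 \<le> frob2 n n X" unfolding frob2_def by (intro sum_nonneg) auto
  show "0 \<le> spa_obj n N Rt R" unfolding obj by (rule nn)
  let ?Q = "minv n R" and ?Q' = "minv n Rt"
  have "mtr n (adjm X \<odot>\<^bsub>n\<^esub> X) = mtr n (W' \<odot>\<^bsub>n\<^esub> (D \<odot>\<^bsub>n\<^esub> (W \<odot>\<^bsub>n\<^esub> W) \<odot>\<^bsub>n\<^esub> D \<odot>\<^bsub>n\<^esub> W'))"
    unfolding X_def by (simp add: adjm_mmul mmul_assoc S(6) S'(6) hD)
  also have "\<dots> = mtr n (D \<odot>\<^bsub>n\<^esub> ?Q \<odot>\<^bsub>n\<^esub> D \<odot>\<^bsub>n\<^esub> ?Q')"
    by (subst mtr_mmul_comm) (simp add: mmul_assoc S(9)[symmetric] S'(9)[symmetric])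
  also have "D \<odot>\<^bsub>n\<^esub> ?Q \<odot>\<^bsub>n\<^esub> D \<odot>\<^bsub>n\<^esub> ?Q' = Rt \<odot>\<^bsub>n\<^esub> ?Q - eye n - (eye n - R \<odot>\<^bsub>n\<^esub> ?Q')"
  proof -
    note i1 = minv_eye[OF pd_mdet[OF p(1)] s(1)] and i2 = minv_eye[OF pd_mdet[OF p(2)] s(2)]
    have sQ: "msupp n ?Q" "msupp n ?Q'" by (intro msupp_minv_gen pd_mdet p)+
    have 1: "D \<odot>\<^bsub>n\<^esub> ?Q = Rt \<odot>\<^bsub>n\<^esub> ?Q - eye n" "D \<odot>\<^bsub>n\<^esub> ?Q' = eye n - R \<odot>\<^bsub>n\<^esub> ?Q'"
      unfolding D_def mmul_distribs i1 i2 by simp_all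
    have "D \<odot>\<^bsub>n\<^esub> ?Q \<odot>\<^bsub>n\<^esub> D \<odot>\<^bsub>n\<^esub> ?Q' = (Rt \<odot>\<^bsub>n\<^esub> ?Q - eye n) \<odot>\<^bsub>n\<^esub> (eye n - R \<odot>\<^bsub>n\<^esub> ?Q')"
      using 1 by (metis mmul_assoc)
    also have "\<dots> = Rt \<odot>\<^bsub>n\<^esub> ?Q - eye n - (Rt \<odot>\<^bsub>n\<^esub> ((?Q \<odot>\<^bsub>n\<^esub> R) \<odot>\<^bsub>n\<^esub> ?Q') - R \<odot>\<^bsub>n\<^esub> ?Q')"
      by (simp add: mmul_distribs mmul_eye_left mmul_eye_right sQ s msupp_mmul msupp_eye mmul_assoc)
    also have "\<dots> = Rt \<odot>\<^bsub>n\<^esub> ?Q - eye n - (eye n - R \<odot>\<^bsub>n\<^esub> ?Q')"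
      unfolding i1 by (simp add: mmul_eye_left sQ i2)
    finally show ?thesis .
  qed
  finally show "spa_obj n N Rt R =
      Re (mtr n (minv n R \<odot>\<^bsub>n\<^esub> Rt)) + Re (mtr n (minv n Rt \<odot>\<^bsub>n\<^esub> R)) - 2 * real n"
    unfolding obj frob2_mtr mtr_diff mtr_eye mtr_mmul_comm[of n Rt] mtr_mmul_comm[of n R] by simp
  assume "spa_obj n N Rt R = 0"
  then have "Re (mtr n (adjm X \<odot>\<^bsub>n\<^esub> eye n \<odot>\<^bsub>n\<^esub> X)) \<le> 0"
    unfolding obj frob2_mtr by (simp add: mmul_eye_right msupp_adjm sX)
  then have "X = 0" by (rule mtr_pd_zero[OF pd_eye _ sX])
  then have "S \<odot>\<^bsub>n\<^esub> X \<odot>\<^bsub>n\<^esub> S' = 0" by (simp add: mmul_def fun_eq_iff)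
  moreover have "S \<odot>\<^bsub>n\<^esub> X \<odot>\<^bsub>n\<^esub> S' = (S \<odot>\<^bsub>n\<^esub> W) \<odot>\<^bsub>n\<^esub> D \<odot>\<^bsub>n\<^esub> (W' \<odot>\<^bsub>n\<^esub> S')"
    unfolding X_def by (simp add: mmul_assoc)
  ultimately have "D = 0" unfolding S S' by (simp add: mmul_eye_left mmul_eye_right sD)
  then show "R = Rt" unfolding D_def by simp
qed

text \<open>Hypothesis \<open>crit\<close> says that the derivative of the criterion at
  \<open>R\<close> in direction \<open>R' - R\<close> is zero. An exact second order expansion then
  leaves only the trace of \<open>X^* Q' X\<close> with \<open>X = (R' - R) Q S\<close>, where
  \<open>S\<close> is the root of \<open>Rt\<close>; it is nonnegative and zero only for
  \<open>R' = R\<close>.\<close>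

lemma trace_convexity:
  assumes p: "pd n R" "pd n R'" "pd n Rt" and s: "msupp n R" "msupp n R'" "msupp n Rt"
    and crit: "Re (mtr n (minv n Rt \<odot>\<^bsub>n\<^esub> (R' - R))) = Re (mtr n (minv n R \<odot>\<^bsub>n\<^esub> (R' - R) \<odot>\<^bsub>n\<^esub> minv n R \<odot>\<^bsub>n\<^esub> Rt))"
  shows spa_obj_critical_le: "n \<le> N \<Longrightarrow> spa_obj n N Rt R \<le> spa_obj n N Rt R'"
    and spa_obj_critical_unique: "n \<le> N \<Longrightarrow> spa_obj n N Rt R' \<le> spa_obj n N Rt R \<Longrightarrow> R' = R"
proof -
  obtain S W where S: "msupp n S" "adjm S = S" "S \<odot>\<^bsub>n\<^esub> S = Rt" "S \<odot>\<^bsub>n\<^esub> W = eye n" "msupp n W"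
    by (rule pd_sqrt[OF p(3) s(3)])
  let ?Q = "minv n R" and ?Q' = "minv n R'"
  define D where "D = R' - R"
  note i1 = minv_eye[OF pd_mdet[OF p(1)] s(1)] and i2 = minv_eye[OF pd_mdet[OF p(2)] s(2)]
  have sQ: "msupp n ?Q" "msupp n ?Q'" by (intro msupp_minv_gen pd_mdet p)+
  have hR: "adjm R = R" "adjm R' = R'" using p s hermitian_iff_adjm by (auto simp: pd_def)
  have hD: "adjm D = D" unfolding D_def adjm_diff hR ..
  have hQ: "adjm ?Q = ?Q" by (intro adjm_minv pd_mdet p s hR)
  have sD: "msupp n D" unfolding D_def using s by (simp add: msupp_minus)
  \<comment> \<open>The resolvent identity in both orders; inserting one into the other yields a
    Taylor expansion of the inverse with exact remainder.\<close>
  have a: "?Q' \<odot>\<^bsub>n\<^esub> D \<odot>\<^bsub>n\<^esub> ?Q = ?Q - ?Q'"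
    unfolding D_def mmul_distribs i2 by (simp add: mmul_assoc i1 mmul_eye_left mmul_eye_right sQ)
  have b: "?Q \<odot>\<^bsub>n\<^esub> D \<odot>\<^bsub>n\<^esub> ?Q' = ?Q - ?Q'"
    unfolding D_def mmul_distribs i1 by (simp add: mmul_assoc i2 mmul_eye_left mmul_eye_right sQ)
  have "?Q \<odot>\<^bsub>n\<^esub> D \<odot>\<^bsub>n\<^esub> ?Q' \<odot>\<^bsub>n\<^esub> D \<odot>\<^bsub>n\<^esub> ?Q = ?Q \<odot>\<^bsub>n\<^esub> D \<odot>\<^bsub>n\<^esub> ?Q - (?Q - ?Q')"
    unfolding b using a by (simp add: mmul_distribs)
  then have c: "?Q' - ?Q = ?Q \<odot>\<^bsub>n\<^esub> D \<odot>\<^bsub>n\<^esub> ?Q' \<odot>\<^bsub>n\<^esub> D \<odot>\<^bsub>n\<^esub> ?Q - ?Q \<odot>\<^bsub>n\<^esub> D \<odot>\<^bsub>n\<^esub> ?Q" by simp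
  define X where "X = D \<odot>\<^bsub>n\<^esub> ?Q \<odot>\<^bsub>n\<^esub> S"
  have sX: "msupp n X" unfolding X_def by (intro msupp_mmul sD sQ S)
  have "mtr n (?Q \<odot>\<^bsub>n\<^esub> D \<odot>\<^bsub>n\<^esub> ?Q' \<odot>\<^bsub>n\<^esub> D \<odot>\<^bsub>n\<^esub> ?Q \<odot>\<^bsub>n\<^esub> Rt)
    = mtr n ((?Q \<odot>\<^bsub>n\<^esub> D \<odot>\<^bsub>n\<^esub> ?Q' \<odot>\<^bsub>n\<^esub> D \<odot>\<^bsub>n\<^esub> ?Q \<odot>\<^bsub>n\<^esub> S) \<odot>\<^bsub>n\<^esub> S)"
    unfolding S(3)[symmetric] by (simp add: mmul_assoc)
  also have "\<dots> = mtr n (adjm X \<odot>\<^bsub>n\<^esub> ?Q' \<odot>\<^bsub>n\<^esub> X)"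
    by (subst mtr_mmul_comm) (simp add: X_def adjm_mmul hD hQ S(2) mmul_assoc)
  finally have d: "mtr n (?Q \<odot>\<^bsub>n\<^esub> D \<odot>\<^bsub>n\<^esub> ?Q' \<odot>\<^bsub>n\<^esub> D \<odot>\<^bsub>n\<^esub> ?Q \<odot>\<^bsub>n\<^esub> Rt) = mtr n (adjm X \<odot>\<^bsub>n\<^esub> ?Q' \<odot>\<^bsub>n\<^esub> X)" .
  have e: "spa_obj n N Rt R' - spa_obj n N Rt R = Re (mtr n (adjm X \<odot>\<^bsub>n\<^esub> ?Q' \<odot>\<^bsub>n\<^esub> X))" if "n \<le> N"
  proof -
    have "spa_obj n N Rt R' - spa_obj n N Rt R =
      Re (mtr n ((?Q' - ?Q) \<odot>\<^bsub>n\<^esub> Rt)) + Re (mtr n (minv n Rt \<odot>\<^bsub>n\<^esub> D))"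
      unfolding spa_obj_trace[OF that p(1,3) s(1,3)] spa_obj_trace[OF that p(2,3) s(2,3)]
      unfolding D_def mmul_diff_left mmul_diff_right mtr_diff by simp
    also have "Re (mtr n ((?Q' - ?Q) \<odot>\<^bsub>n\<^esub> Rt)) = Re (mtr n (adjm X \<odot>\<^bsub>n\<^esub> ?Q' \<odot>\<^bsub>n\<^esub> X)) - Re (mtr n (?Q \<odot>\<^bsub>n\<^esub> D \<odot>\<^bsub>n\<^esub> ?Q \<odot>\<^bsub>n\<^esub> Rt))"
      unfolding c mmul_diff_left mtr_diff d by simp
    finally show ?thesis using crit[folded D_def] by linarith
  qed
  have pQ': "pd n ?Q'" by (rule pd_minv[OF p(2) s(2)])
  show "n \<le> N \<Longrightarrow> spa_obj n N Rt R \<le> spa_obj n N Rt R'"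
    using e mtr_pd_nonneg[OF pQ', of X] by simp
  assume "n \<le> N" "spa_obj n N Rt R' \<le> spa_obj n N Rt R"
  then have "X = 0" using e by (intro mtr_pd_zero[OF pQ' _ sX]) simp
  then have "X \<odot>\<^bsub>n\<^esub> W \<odot>\<^bsub>n\<^esub> R = 0" by (simp add: mmul_def fun_eq_iff)
  moreover have "X \<odot>\<^bsub>n\<^esub> W \<odot>\<^bsub>n\<^esub> R = D"
    unfolding X_def by (simp add: mmul_assoc) (simp add: mmul_assoc[symmetric] S mmul_assoc i1 mmul_eye_left mmul_eye_right sD sQ s)
  ultimately show "R' = R" unfolding D_def by simp
qed

section \<open>Triangular factorisation of positive definite matrices\<close>

lemma mdet_Reals:
  fixes A :: "nat \<Rightarrow> nat \<Rightarrow> complex"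
  assumes "\<And>i j. i < n \<Longrightarrow> j < n \<Longrightarrow> A i j \<in> \<real>"
  shows "mdet n A \<in> \<real>"
  unfolding mdet_def
  by (intro sum_in_Reals Reals_mult prod_in_Reals assms) (auto dest: permutes_in_image)

text \<open>Feeds the reality clause of the factorisation below, by which one complex construction
  also serves the real Gaussian limit law.\<close>

lemma minv_Reals:
  fixes A :: "nat \<Rightarrow> nat \<Rightarrow> complex"
  assumes "\<And>i j. i < n \<Longrightarrow> j < n \<Longrightarrow> A i j \<in> \<real>" "mdet n A \<noteq> 0"
  shows "minv n A i j \<in> \<real>"
proof (cases "i < n \<and> j < n")
  case True
  then show ?thesis
    by (auto simp: minv_entry assms(2) row_repl_def idm_def intro!: Reals_divide mdet_Reals assms(1))
next
  case False
  then have "minv n A i j = 0" using msupp_minv_gen[OF assms(2)] by (auto simp: msupp_def not_less)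
  then show ?thesis by simp
qed

lemma pd_Suc: "pd (Suc n) A \<Longrightarrow> pd n A"
  unfolding pd_def
proof safe
  assume h: "hermitian (Suc n) A" and q: "\<forall>v. (\<exists>i<Suc n. v i \<noteq> 0) \<longrightarrow> 0 < Re (qform (Suc n) A v)"
  show "hermitian n A" using h unfolding hermitian_def by (metis less_SucI)
  fix v :: "nat \<Rightarrow> complex" and i assume i: "i < n" "v i \<noteq> 0"
  let ?v = "v(n := 0)"
  have "\<exists>i<Suc n. ?v i \<noteq> 0" using i by (intro exI[of _ i]) auto
  then have "0 < Re (qform (Suc n) A ?v)" using q by blast
  moreover have "qform (Suc n) A ?v = qform n A v"
    unfolding qform_def by simp
  ultimately show "0 < Re (qform n A v)" by simp
qed

text \<open>The factor has unit diagonal, so the substitution it defines preserves Lebesgue measure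
  while it turns a Gaussian density into a product of one-dimensional ones. The induction borders
  the matrix by one row; the new pivot is a Schur complement.\<close>

theorem pd_LDL:
  assumes "pd n R"
  shows "\<exists>A V. (\<forall>i<n. A i i = 1) \<and> (\<forall>i j. i < j \<longrightarrow> A i j = 0) \<and> msupp n A \<and> (\<forall>i<n. 0 < V i) \<and>
    (\<forall>i<n. \<forall>j<n. R i j = (\<Sum>k<n. A i k * complex_of_real (V k) * cnj (A j k))) \<and>
    ((\<forall>i<n. \<forall>j<n. R i j \<in> \<real>) \<longrightarrow> (\<forall>i j. A i j \<in> \<real>))"
  using assms
proof (induction n)
  case 0
  show ?case by (rule exI[of _ "0"]) (auto simp: msupp_def)
next
  case (Suc n)
  have pn: "pd n R" by (rule pd_Suc[OF Suc.prems])
  obtain A V where A: "\<forall>i<n. A i i = 1" "\<forall>i j. i < j \<longrightarrow> A i j = 0" "msupp n A" "\<forall>i<n. 0 < V i"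
    and R': "\<forall>i<n. \<forall>j<n. R i j = (\<Sum>k<n. A i k * complex_of_real (V k) * cnj (A j k))"
    and re: "(\<forall>i<n. \<forall>j<n. R i j \<in> \<real>) \<longrightarrow> (\<forall>i j. A i j \<in> \<real>)"
    using Suc.IH[OF pn] by (elim exE conjE) (rule that)
  have R: "R i j = (\<Sum>k<n. A i k * complex_of_real (V k) * cnj (A j k))" if "i < n" "j < n" for i j
    using R' that by blast
  have herm: "R i j = cnj (R j i)" if "i \<le> n" "j \<le> n" for i j
    using Suc.prems that unfolding pd_def hermitian_def by (metis le_imp_less_Suc)
  \<comment> \<open>Solves \<open>R x =\<close> last column, restricted to the leading
    block.\<close>
  define x where "x = (\<lambda>i. \<Sum>j<n. minv n R i j * R j n)"
  have x: "(\<Sum>j<n. R i j * x j) = R i n" if i: "i < n" for i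
  proof -
    have "(\<Sum>j<n. R i j * x j) = (\<Sum>k<n. mmul n R (minv n R) i k * R k n)"
      unfolding x_def mmul_def sum_distrib_left sum_distrib_right
      by (subst sum.swap) (simp add: mult.assoc)
    also have "\<dots> = (\<Sum>k<n. idm i k * R k n)"
      by (intro sum.cong refl) (simp add: minv_right pd_mdet[OF pn] i)
    also have "\<dots> = R i n" using i by (simp add: idm_def if_distrib[of "\<lambda>x. x * _"] cong: if_cong)
    finally show ?thesis .
  qed
  \<comment> \<open>With \<open>b = A^* x\<close> the last column is \<open>A V b\<close>, so the
    conjugate of \<open>b\<close> is the new row of the factor.\<close>
  define b where "b = (\<lambda>k. \<Sum>j<n. cnj (A j k) * x j)"
  define a where "a = (\<lambda>k. cnj (b k))"
  have rb: "R i n = (\<Sum>k<n. A i k * complex_of_real (V k) * cnj (a k))" if i: "i < n" for i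
  proof -
    have "R i n = (\<Sum>j<n. \<Sum>k<n. A i k * complex_of_real (V k) * cnj (A j k) * x j)"
      unfolding x[OF i, symmetric] using i by (simp add: R sum_distrib_right)
    also have "\<dots> = (\<Sum>k<n. A i k * complex_of_real (V k) * b k)"
      by (subst sum.swap) (simp add: b_def sum_distrib_left mult.assoc)
    finally show ?thesis by (simp add: a_def)
  qed
  define s where "s = (\<Sum>k<n. V k * (cmod (a k))\<^sup>2)"
  define v where "v = Re (R n n) - s"
  have Rnn: "R n n = of_real (Re (R n n))" using herm[of n n] by (simp add: complex_eq_iff)
  have s1: "(\<Sum>i<n. cnj (x i) * R i n) = of_real s"
  proof -
    have "(\<Sum>i<n. cnj (x i) * R i n) = (\<Sum>k<n. \<Sum>i<n. cnj (x i) * (A i k * complex_of_real (V k) * b k))"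
      by (subst sum.swap) (simp add: rb a_def sum_distrib_left)
    also have "\<dots> = (\<Sum>k<n. cnj (b k) * complex_of_real (V k) * b k)"
    proof (rule sum.cong[OF refl])
      fix k
      have "cnj (b k) = (\<Sum>i<n. cnj (x i) * A i k)" unfolding b_def by (simp add: mult.commute)
      then show "(\<Sum>i<n. cnj (x i) * (A i k * complex_of_real (V k) * b k)) = cnj (b k) * complex_of_real (V k) * b k"
        by (simp add: sum_distrib_right mult.assoc)
    qed
    also have "\<dots> = of_real s"
      unfolding s_def a_def by (simp add: complex_norm_square mult_ac del: of_real_power)
    finally show ?thesis .
  qed
  have "v > 0"
  proof -
    \<comment> \<open>At this vector the form takes the value of the Schur complement
      \<open>v\<close>, which is how positive definiteness gives \<open>v > 0\<close>.\<close>
    let ?w = "x(n := -1)"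
    have "0 < Re (qform (Suc n) R ?w)"
      using Suc.prems unfolding pd_def by (metis fun_upd_same lessI neg_equal_0_iff_equal zero_neq_one)
    moreover have "qform (Suc n) R ?w = (\<Sum>i<n. cnj (x i) * (\<Sum>j<n. R i j * x j)) - (\<Sum>i<n. cnj (x i) * R i n)
       - (\<Sum>i<n. R n i * x i) + R n n"
      unfolding qform_def by (simp add: sum_distrib_left sum.distrib sum_subtractf mult.assoc sum_negf)
    moreover have "(\<Sum>i<n. R n i * x i) = cnj (\<Sum>i<n. cnj (x i) * R i n)"
      unfolding cnj_sum by (intro sum.cong refl) (simp add: herm[of n] mult.commute)
    ultimately show ?thesis using x s1 Rnn unfolding v_def by simp
  qed
  let ?A = "\<lambda>i j. if i = n then (if j = n then 1 else if j < n then a j else 0) else A i j"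
  let ?V = "V(n := v)"
  have An: "A i n = 0" for i using A(3) by (simp add: msupp_def)
  have eq: "R i j = (\<Sum>k<Suc n. ?A i k * complex_of_real (?V k) * cnj (?A j k))" if ij: "i < Suc n" "j < Suc n" for i j
  proof -
    consider "i < n" "j < n" | "i < n" "j = n" | "i = n" "j < n" | "i = n" "j = n" using ij by linarith
    then show ?thesis
    proof cases
      case 1 then show ?thesis using R An by (simp add: An)
    next
      case 2
      then show ?thesis using rb[of i] by (simp add: An)
    next
      case 3
      have "R n j = cnj (R j n)" using herm[of n j] 3 by simp
      then show ?thesis using 3 rb[of j] by (simp add: An mult_ac)
    next
      case 4
      have "R n n = of_real (s + v)" using Rnn unfolding v_def by simp
      then show ?thesis using 4 unfolding s_def by (simp add: complex_norm_square mult_ac del: of_real_power)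
    qed
  qed
  have real: "?A i j \<in> \<real>" if RR: "\<forall>i<Suc n. \<forall>j<Suc n. R i j \<in> \<real>" for i j
  proof -
    have AR: "A i j \<in> \<real>" for i j using re RR by (meson less_SucI)
    have "x i \<in> \<real>" for i unfolding x_def
      by (intro sum_in_Reals Reals_mult minv_Reals pd_mdet[OF pn]) (use RR in auto)
    then have "a k \<in> \<real>" for k unfolding a_def b_def using AR
      by (auto intro!: sum_in_Reals Reals_mult simp: Reals_cnj_iff)
    then show ?thesis using AR by auto
  qed
  show ?case
    by (rule exI[of _ ?A], rule exI[of _ ?V])
       (use A \<open>v > 0\<close> eq real in \<open>auto simp: msupp_def less_Suc_eq\<close>)
qed

subsection \<open>Trigonometric polynomials determine convergence in distribution\<close>

text \<open>The free phase \<open>b\<close> lets cosines stand for sines as well, and closes the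
  span under products by the product-to-sum formula.\<close>

inductive_set trigpoly :: "nat \<Rightarrow> ((nat \<Rightarrow> real) \<Rightarrow> real) set" for d where
  cosine: "(\<lambda>x. r * cos ((\<Sum>i<d. c i * x i) + b)) \<in> trigpoly d"
| add: "f \<in> trigpoly d \<Longrightarrow> g \<in> trigpoly d \<Longrightarrow> (\<lambda>x. f x + g x) \<in> trigpoly d"

lemma trigpoly_mult:
  assumes "f \<in> trigpoly d" "g \<in> trigpoly d"
  shows "(\<lambda>x. f x * g x) \<in> trigpoly d"
  using assms(1)
proof induction
  case (cosine r c b)
  show ?case using assms(2)
  proof induction
    case (cosine r' c' b')
    have "(\<lambda>x. (r * r' / 2) * cos ((\<Sum>i<d. (c i - c' i) * x i) + (b - b')) +
        (r * r' / 2) * cos ((\<Sum>i<d. (c i + c' i) * x i) + (b + b'))) \<in> trigpoly d"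
      by (intro trigpoly.add trigpoly.cosine)
    also have "(\<lambda>x. (r * r' / 2) * cos ((\<Sum>i<d. (c i - c' i) * x i) + (b - b')) +
        (r * r' / 2) * cos ((\<Sum>i<d. (c i + c' i) * x i) + (b + b')))
      = (\<lambda>x. r * cos ((\<Sum>i<d. c i * x i) + b) * (r' * cos ((\<Sum>i<d. c' i * x i) + b')))"
    proof
      fix x :: "nat \<Rightarrow> real"
      let ?A = "(\<Sum>i<d. c i * x i) + b" and ?B = "(\<Sum>i<d. c' i * x i) + b'"
      have 1: "(\<Sum>i<d. (c i - c' i) * x i) + (b - b') = ?A - ?B"
        "(\<Sum>i<d. (c i + c' i) * x i) + (b + b') = ?A + ?B"
        by (simp_all add: algebra_simps sum_subtractf sum.distrib)
      have "r * cos ?A * (r' * cos ?B) = r * r' * (cos ?A * cos ?B)" by (simp add: mult_ac)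
      also have "\<dots> = r * r' / 2 * cos (?A - ?B) + r * r' / 2 * cos (?A + ?B)"
        unfolding cos_times_cos by (simp add: field_simps)
      finally show "(r * r' / 2) * cos ((\<Sum>i<d. (c i - c' i) * x i) + (b - b')) +
        (r * r' / 2) * cos ((\<Sum>i<d. (c i + c' i) * x i) + (b + b')) = r * cos ?A * (r' * cos ?B)"
        unfolding 1 by simp
    qed
    finally show ?case .
  next
    case (add f g)
    then show ?case using trigpoly.add[OF add.IH] by (simp add: algebra_simps)
  qed
next
  case (add f g')
  then show ?case using trigpoly.add[OF add.IH] by (simp add: algebra_simps)
qed

lemma trigpoly_bounded: "f \<in> trigpoly d \<Longrightarrow> \<exists>B. \<forall>x. \<bar>f x\<bar> \<le> B"
proof (induction rule: trigpoly.induct)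
  case (cosine r c b)
  have "\<bar>r * cos ((\<Sum>i<d. c i * x i) + b)\<bar> \<le> \<bar>r\<bar>" for x
    unfolding abs_mult by (intro mult_left_le) auto
  then show ?case by blast
next
  case (add f g)
  then obtain B B' where "\<forall>x. \<bar>f x\<bar> \<le> B" "\<forall>x. \<bar>g x\<bar> \<le> B'" by blast
  then have "\<bar>f x + g x\<bar> \<le> B + B'" for x by (meson abs_triangle_ineq add_mono order_trans)
  then show ?case by blast
qed

lemma continuous_on_coord: "continuous_on S (\<lambda>x::nat \<Rightarrow> real. x i)"
  by (rule continuous_on_subset[OF continuous_on_product_coordinates]) auto

lemma trigpoly_continuous: "f \<in> trigpoly d \<Longrightarrow> continuous_on UNIV f"
  by (induction rule: trigpoly.induct) (intro continuous_intros continuous_on_coord; simp)+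

lemma trigpoly_measurable: "f \<in> trigpoly d \<Longrightarrow> X \<in> borel_measurable M \<Longrightarrow> (\<lambda>w. f (X w)) \<in> borel_measurable M"
  using borel_measurable_continuous_onI[OF trigpoly_continuous] measurable_compose by blast

lemma (in prob_space) integrable_bounded:
  fixes f :: "'a \<Rightarrow> real"
  shows "f \<in> borel_measurable M \<Longrightarrow> (\<And>x. \<bar>f x\<bar> \<le> B) \<Longrightarrow> integrable M f"
  by (rule integrable_const_bound[of _ B]) auto

lemma trigpoly_convergence:
  fixes X :: "nat \<Rightarrow> 'w \<Rightarrow> nat \<Rightarrow> real" and Y :: "'v \<Rightarrow> nat \<Rightarrow> real"
  assumes M: "prob_space M" and G: "prob_space G"
    and X: "\<And>N. X N \<in> borel_measurable M" and Y: "Y \<in> borel_measurable G"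
    and trig: "\<And>c b. (\<lambda>N. \<integral>w. cos ((\<Sum>i<d. c i * X N w i) + b) \<partial>M) \<longlonglongrightarrow> (\<integral>w. cos ((\<Sum>i<d. c i * Y w i) + b) \<partial>G)"
    and f: "f \<in> trigpoly d"
  shows "(\<lambda>N. \<integral>w. f (X N w) \<partial>M) \<longlonglongrightarrow> (\<integral>w. f (Y w) \<partial>G)"
  using f
proof induction
  case (cosine r c b)
  show ?case using tendsto_mult_left[OF trig[of c b], of r] by simp
next
  case (add f g)
  have int: "integrable M (\<lambda>w. h (X N w))" "integrable G (\<lambda>w. h (Y w))" if "h \<in> trigpoly d" for h N
    using trigpoly_bounded[OF that] prob_space.integrable_bounded[OF M] prob_space.integrable_bounded[OF G]
      trigpoly_measurable[OF that X] trigpoly_measurable[OF that Y] by blast+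
  show ?case using add by (simp add: Bochner_Integration.integral_add int tendsto_add)
qed

text \<open>Substituting it turns polynomial expressions in the coordinates into trigonometric ones.
  Coordinates from \<open>d\<close> on are frozen at \<open>0\<close>, so the image lies in a
  compact cube.\<close>

definition sin_map :: "nat \<Rightarrow> real \<Rightarrow> (nat \<Rightarrow> real) \<Rightarrow> nat \<Rightarrow> real"
  where "sin_map d w x = (\<lambda>i. if i < d then sin (w * x i) else 0)"

text \<open>Stone--Weierstrass is applied on the cube to \<open>g\<close> composed with rescaled arcsines;
  substituting sines back yields a trigonometric polynomial that is close to \<open>g\<close> on a large box
  and bounded by the same constant everywhere.\<close>

lemma trigpoly_approx:
  fixes g :: "(nat \<Rightarrow> real) \<Rightarrow> real"
  assumes g: "continuous_on UNIV g" and gC: "\<And>x. \<bar>g x\<bar> \<le> C" and e: "e > 0" and B: "B > 0"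
  obtains f where "f \<in> trigpoly d" "\<And>x. \<bar>f x\<bar> \<le> C + e"
    "\<And>x. (\<forall>i<d. \<bar>x i\<bar> \<le> B) \<Longrightarrow> (\<forall>i\<ge>d. x i = undefined) \<Longrightarrow> \<bar>g x - f x\<bar> \<le> e"
proof -
  \<comment> \<open>Scales the box \<open>[-B, B]\<close> onto \<open>[-pi/2, pi/2]\<close>, where
    \<open>arcsin\<close> inverts the sine.\<close>
  define w where "w = pi / (2 * B)"
  have w: "w > 0" "w * B = pi / 2" using B by (auto simp: w_def)
  define S where "S = {v::nat \<Rightarrow> real. \<forall>i. v i \<in> (if i < d then {-1..1} else {0})}"
  \<comment> \<open>The algebra for Stone-Weierstrass: those continuous functions that become
    trigonometric polynomials after the substitution. Coordinates belong to it because a cosine with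
    phase \<open>- pi / 2\<close> is a sine.\<close>
  define R where "R = {f. continuous_on UNIV f \<and> (\<lambda>x. f (sin_map d w x)) \<in> trigpoly d}"
  have "function_ring_on R S"
  proof
    show "compact S" unfolding S_def by (rule compact_fun_box) auto
    fix f g assume "f \<in> R" "g \<in> R"
    then show "continuous_on S f" "(\<lambda>x. f x + g x) \<in> R" "(\<lambda>x. f x * g x) \<in> R"
      unfolding R_def by (auto intro: continuous_on_subset continuous_intros trigpoly.add trigpoly_mult)
  next
    fix c :: real
    show "(\<lambda>_. c) \<in> R" unfolding R_def using trigpoly.cosine[where r=c and c="\<lambda>_. 0" and b=0 and d=d] by simp
  next
    fix x y :: "nat \<Rightarrow> real" assume xy: "x \<in> S" "y \<in> S" "x \<noteq> y"
    then obtain i where i: "x i \<noteq> y i" by auto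
    have id: "i < d" using xy i unfolding S_def by (auto split: if_splits) (metis singletonD)
    have "(\<lambda>x. 1 * cos ((\<Sum>j<d. (if j = i then w else 0) * x j) + - (pi / 2))) \<in> trigpoly d"
      by (rule trigpoly.cosine)
    also have "(\<lambda>x. 1 * cos ((\<Sum>j<d. (if j = i then w else 0) * x j) + - (pi / 2))) = (\<lambda>x. sin_map d w x i)"
    proof
      fix x :: "nat \<Rightarrow> real"
      have "(\<Sum>j<d. (if j = i then w else 0) * x j) = (\<Sum>j<d. if j = i then w * x i else 0)"
        by (intro sum.cong) auto
      also have "\<dots> = w * x i" using id by simp
      finally have e: "(\<Sum>j<d. (if j = i then w else 0) * x j) = w * x i" .
      have "cos (w * x i + - (pi / 2)) = sin (w * x i)"
        unfolding cos_add by simp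
      then show "1 * cos ((\<Sum>j<d. (if j = i then w else 0) * x j) + - (pi / 2)) = sin_map d w x i"
        unfolding e using id by (simp add: sin_map_def)
    qed
    finally have "(\<lambda>x. sin_map d w x i) \<in> trigpoly d" .
    then have "(\<lambda>x. x i) \<in> R" unfolding R_def by (intro CollectI conjI continuous_on_coord)
    then show "\<exists>f\<in>R. f x \<noteq> f y" using i by (intro bexI[of _ "\<lambda>x. x i"])
  qed
  then interpret function_ring_on R S .
  \<comment> \<open>The value \<open>undefined\<close> from \<open>d\<close> on matches extensional
    vectors, so that \<open>h\<close> after \<open>sin_map\<close> returns \<open>g\<close> on the
    box.\<close>
  define h where "h = (\<lambda>v. g (\<lambda>i. if i < d then arcsin (v i) / w else undefined))"
  have "continuous_on S h" unfolding h_def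
  proof (rule continuous_on_compose2[OF g])
    show "continuous_on S (\<lambda>v i. if i < d then arcsin (v i) / w else undefined)"
    proof (rule continuous_on_coordinatewise_then_product)
      fix i
      show "continuous_on S (\<lambda>v. if i < d then arcsin (v i) / w else undefined)"
      proof (cases "i < d")
        case True
        then have "\<forall>v\<in>S. v i \<in> {-1..1}" unfolding S_def by auto
        then have "continuous_on S (\<lambda>v. arcsin (v i))"
          by (intro continuous_on_arcsin continuous_on_coord) auto
        then show ?thesis using True w by (auto intro!: continuous_intros)
      qed simp
    qed
  qed auto
  then obtain q where q: "q \<in> R" "\<And>v. v \<in> S \<Longrightarrow> \<bar>h v - q v\<bar> < e"
    using Stone_Weierstrass_basic[OF _ e] by blast
  have inS: "sin_map d w x \<in> S" for x unfolding S_def sin_map_def by auto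
  show ?thesis
  proof (rule that)
    show "(\<lambda>x. q (sin_map d w x)) \<in> trigpoly d" using q(1) by (simp add: R_def)
    show "\<bar>q (sin_map d w x)\<bar> \<le> C + e" for x
    proof -
      have "\<bar>h (sin_map d w x)\<bar> \<le> C" unfolding h_def by (rule gC)
      then show ?thesis using q(2)[OF inS[of x]] by linarith
    qed
    fix x :: "nat \<Rightarrow> real" assume x: "\<forall>i<d. \<bar>x i\<bar> \<le> B" "\<forall>i\<ge>d. x i = undefined"
    have "(\<lambda>i. if i < d then arcsin (sin_map d w x i) / w else undefined) = x"
    proof
      fix i
      have "arcsin (sin (w * x i)) = w * x i" if "i < d"
      proof (rule arcsin_sin)
        have "\<bar>w * x i\<bar> \<le> pi / 2" unfolding w(2)[symmetric] abs_mult
          using w(1) x(1) that by (intro mult_mono) auto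
        then show "- (pi / 2) \<le> w * x i" "w * x i \<le> pi / 2" by linarith+
      qed
      then show "(if i < d then arcsin (sin_map d w x i) / w else undefined) = x i"
        using x(2) w(1) by (auto simp: sin_map_def)
    qed
    then have "h (sin_map d w x) = g x" unfolding h_def by simp
    then show "\<bar>g x - q (sin_map d w x)\<bar> \<le> e" using q(2)[OF inS[of x]] by linarith
  qed
qed

lemma (in prob_space) expectation_diff_le:
  fixes f g :: "'a \<Rightarrow> real"
  assumes meas: "f \<in> borel_measurable M" "g \<in> borel_measurable M" "A \<in> events"
    and bd: "\<And>x. \<bar>f x\<bar> \<le> C" "\<And>x. \<bar>g x\<bar> \<le> C'"
    and close: "\<And>x. x \<in> space M \<Longrightarrow> x \<notin> A \<Longrightarrow> \<bar>f x - g x\<bar> \<le> e" and e: "e \<ge> 0"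
  shows "\<bar>expectation f - expectation g\<bar> \<le> e + (C + C') * prob A"
proof -
  have int: "integrable M f" "integrable M g" using integrable_bounded meas bd by blast+
  have "\<bar>expectation f - expectation g\<bar> = \<bar>expectation (\<lambda>x. f x - g x)\<bar>" using int by simp
  also have "\<dots> \<le> expectation (\<lambda>x. \<bar>f x - g x\<bar>)" by simp
  also have "\<dots> \<le> expectation (\<lambda>x. e + (C + C') * indicator A x)"
  proof (rule integral_mono)
    fix x assume x: "x \<in> space M"
    have "\<bar>f x - g x\<bar> \<le> C + C'" using bd[of x] by linarith
    then show "\<bar>f x - g x\<bar> \<le> e + (C + C') * indicator A x"
      using close[OF x] e by (cases "x \<in> A") auto
  qed (use int meas in \<open>auto intro!: Bochner_Integration.integrable_add integrable_mult_right integrable_real_indicator simp: emeasure_finite less_top[symmetric]\<close>)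
  also have "\<dots> = expectation (\<lambda>x. e) + expectation (\<lambda>x. (C + C') * indicator A x)"
    by (rule Bochner_Integration.integral_add)
       (use meas in \<open>auto intro!: integrable_mult_right integrable_real_indicator simp: emeasure_finite less_top[symmetric]\<close>)
  also have "\<dots> = e + (C + C') * prob A" using meas(3) by (simp add: prob_space Int_absorb2 sets.sets_into_space)
  finally show ?thesis .
qed

text \<open>Tightness confines all but a small mass to a box, and there \<open>g\<close> is
  uniformly close to a trigonometric polynomial, whose integrals converge by linearity. Outside the
  box the common bound \<open>C + e\<close> suffices, however large the box is. All vectors are
  extensional, so the box constrains them completely.\<close>

theorem weak_convergence_of_trig:
  fixes X :: "nat \<Rightarrow> 'w \<Rightarrow> nat \<Rightarrow> real" and Y :: "'v \<Rightarrow> nat \<Rightarrow> real" and g :: "(nat \<Rightarrow> real) \<Rightarrow> real"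
  assumes M: "prob_space M" and G: "prob_space G"
    and X: "\<And>N. X N \<in> borel_measurable M" and Y: "Y \<in> borel_measurable G"
    and ext: "\<And>N w i. w \<in> space M \<Longrightarrow> d \<le> i \<Longrightarrow> X N w i = undefined" "\<And>w i. w \<in> space G \<Longrightarrow> d \<le> i \<Longrightarrow> Y w i = undefined"
    and trig: "\<And>c b. (\<lambda>N. \<integral>w. cos ((\<Sum>i<d. c i * X N w i) + b) \<partial>M) \<longlonglongrightarrow> (\<integral>w. cos ((\<Sum>i<d. c i * Y w i) + b) \<partial>G)"
    and tight: "\<And>e. e > 0 \<Longrightarrow> \<exists>B. eventually (\<lambda>N. measure M {w \<in> space M. \<exists>i<d. B < \<bar>X N w i\<bar>} < e) sequentially"
    and g: "continuous_on UNIV g" and gC: "\<And>x. \<bar>g x\<bar> \<le> C"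
  shows "(\<lambda>N. \<integral>w. g (X N w) \<partial>M) \<longlonglongrightarrow> (\<integral>w. g (Y w) \<partial>G)"
proof (rule LIMSEQ_I)
  interpret M: prob_space M by fact
  interpret G: prob_space G by fact
  fix r :: real assume r: "r > 0"
  have C0: "C \<ge> 0" using gC[of undefined] by linarith
  \<comment> \<open>Each of the two approximation errors will be at most \<open>(2 C + 2) e\<close>;
    this choice keeps their sum below \<open>r / 2\<close>, and the other half of \<open>r\<close>
    goes to the trigonometric integrals.\<close>
  define e where "e = min 1 (r / (4 * (2 * C + 2) + 1))"
  have e: "e > 0" "e \<le> 1" using r C0 unfolding e_def by auto
  have ebound: "4 * ((2 * C + 2) * e) < r"
  proof -
    have "4 * (2 * C + 2) * e \<le> 4 * (2 * C + 2) * (r / (4 * (2 * C + 2) + 1))"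
      using C0 unfolding e_def by (intro mult_left_mono) auto
    also have "\<dots> < r" using C0 r by (simp add: field_simps)
    finally show ?thesis by (simp add: algebra_simps)
  qed
  have mX: "(\<lambda>w. X N w i) \<in> borel_measurable M" and mY: "(\<lambda>w. Y w i) \<in> borel_measurable G" for N i
    using X Y by (auto intro: measurable_product_then_coordinatewise)
  define Xout where "Xout N B = {w \<in> space M. \<exists>i<d. B < \<bar>X N w i\<bar>}" for N and B :: real
  define Yout where "Yout B = {w \<in> space G. \<exists>i<d. B < \<bar>Y w i\<bar>}" for B :: real
  have EXm: "Xout N B \<in> M.events" for N B
  proof -
    have "Xout N B = (\<Union>i\<in>{..<d}. {w \<in> space M. B < \<bar>X N w i\<bar>})" unfolding Xout_def by auto
    also have "\<dots> \<in> M.events" by (intro sets.finite_UN) (use mX in \<open>auto\<close>)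
    finally show ?thesis .
  qed
  have EYm: "Yout B \<in> G.events" for B
  proof -
    have "Yout B = (\<Union>i\<in>{..<d}. {w \<in> space G. B < \<bar>Y w i\<bar>})" unfolding Yout_def by auto
    also have "\<dots> \<in> G.events" by (intro sets.finite_UN) (use mY in \<open>auto\<close>)
    finally show ?thesis .
  qed
  have Xmono: "Xout N b \<subseteq> Xout N a" and Ymono: "Yout b \<subseteq> Yout a" if "a \<le> b" for N a b
    unfolding Xout_def Yout_def using that by (blast intro: le_less_trans)+
  obtain B1 where B1: "eventually (\<lambda>N. measure M (Xout N B1) < e) sequentially"
    using tight[OF e(1)] unfolding Xout_def by blast
  \<comment> \<open>Tightness of the single law of \<open>Y\<close> is continuity from above: the
    sets of large vectors decrease to the empty set.\<close>
  have "(\<lambda>n. G.prob (Yout (real n))) \<longlonglongrightarrow> G.prob (\<Inter>n. Yout (real n))"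
    by (rule G.finite_Lim_measure_decseq) (use EYm Ymono in \<open>auto simp: decseq_def\<close>)
  also have "(\<Inter>n. Yout (real n)) = {}"
  proof (rule ccontr)
    assume "(\<Inter>n. Yout (real n)) \<noteq> {}"
    then obtain w where w: "\<And>n. \<exists>i<d. real n < \<bar>Y w i\<bar>" unfolding Yout_def by blast
    obtain n where n: "(\<Sum>i<d. \<bar>Y w i\<bar>) < real n" using reals_Archimedean2 by blast
    obtain i where i: "i < d" "real n < \<bar>Y w i\<bar>" using w by blast
    have "\<bar>Y w i\<bar> \<le> (\<Sum>i<d. \<bar>Y w i\<bar>)" by (rule member_le_sum) (use i in auto)
    then show False using n i by linarith
  qed
  finally have "(\<lambda>n. G.prob (Yout (real n))) \<longlonglongrightarrow> 0" by simp
  then obtain n where n: "G.prob (Yout (real n)) < e"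
    using order_tendstoD(2)[OF _ e(1)] unfolding eventually_sequentially by fastforce
  define B where "B = max 1 (max B1 (real n))"
  have B: "B > 0" "B1 \<le> B" "real n \<le> B" unfolding B_def by auto
  have EXB: "measure M (Xout N B) \<le> measure M (Xout N B1)" for N
    by (rule M.finite_measure_mono[OF Xmono[OF B(2)] EXm])
  have EYB: "G.prob (Yout B) \<le> G.prob (Yout (real n))"
    by (rule G.finite_measure_mono[OF Ymono[OF B(3)] EYm])
  obtain f where f: "f \<in> trigpoly d" "\<And>x. \<bar>f x\<bar> \<le> C + e"
    "\<And>x. (\<forall>i<d. \<bar>x i\<bar> \<le> B) \<Longrightarrow> (\<forall>i\<ge>d. x i = undefined) \<Longrightarrow> \<bar>g x - f x\<bar> \<le> e"
    using trigpoly_approx[OF g gC e(1) B(1), of d] by blast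
  have gm: "(\<lambda>w. g (X N w)) \<in> borel_measurable M" "(\<lambda>w. g (Y w)) \<in> borel_measurable G" for N
    using measurable_compose[OF X borel_measurable_continuous_onI[OF g]]
      measurable_compose[OF Y borel_measurable_continuous_onI[OF g]] by auto
  have dX: "\<bar>(\<integral>w. g (X N w) \<partial>M) - (\<integral>w. f (X N w) \<partial>M)\<bar> \<le> e + (C + (C + e)) * measure M (Xout N B)" for N
  proof (rule M.expectation_diff_le)
    show "(\<lambda>w. g (X N w)) \<in> borel_measurable M" by (rule gm)
    show "(\<lambda>w. f (X N w)) \<in> borel_measurable M" by (rule trigpoly_measurable[OF f(1) X])
    show "Xout N B \<in> sets M" by (rule EXm)
    fix w show "\<bar>g (X N w)\<bar> \<le> C" "\<bar>f (X N w)\<bar> \<le> C + e" by (rule gC, rule f(2))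
    assume w: "w \<in> space M" "w \<notin> Xout N B"
    then have "\<forall>i<d. \<bar>X N w i\<bar> \<le> B" unfolding Xout_def mem_Collect_eq by (meson not_less)
    then show "\<bar>g (X N w) - f (X N w)\<bar> \<le> e" using ext w(1) by (intro f(3)) auto
  qed (use e in simp)
  have dY: "\<bar>(\<integral>w. g (Y w) \<partial>G) - (\<integral>w. f (Y w) \<partial>G)\<bar> \<le> e + (C + (C + e)) * G.prob (Yout B)"
  proof (rule G.expectation_diff_le)
    show "(\<lambda>w. g (Y w)) \<in> borel_measurable G" by (rule gm)
    show "(\<lambda>w. f (Y w)) \<in> borel_measurable G" by (rule trigpoly_measurable[OF f(1) Y])
    show "Yout B \<in> sets G" by (rule EYm)
    fix w show "\<bar>g (Y w)\<bar> \<le> C" "\<bar>f (Y w)\<bar> \<le> C + e" by (rule gC, rule f(2))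
    assume w: "w \<in> space G" "w \<notin> Yout B"
    then have "\<forall>i<d. \<bar>Y w i\<bar> \<le> B" unfolding Yout_def mem_Collect_eq by (meson not_less)
    then show "\<bar>g (Y w) - f (Y w)\<bar> \<le> e" using ext w(1) by (intro f(3)) auto
  qed (use e in simp)
  have small: "e + (C + (C + e)) * p \<le> (2 * C + 2) * e" if "p \<le> e" for p
  proof -
    have "(C + (C + e)) * p \<le> (2 * C + 1) * e"
    proof -
      have "(C + (C + e)) * p \<le> (C + (C + e)) * e" using that e C0 by (intro mult_left_mono) auto
      also have "\<dots> \<le> (2 * C + 1) * e" using e by (intro mult_right_mono) auto
      finally show ?thesis .
    qed
    then show ?thesis by (simp add: algebra_simps)
  qed
  have "eventually (\<lambda>N. \<bar>(\<integral>w. f (X N w) \<partial>M) - (\<integral>w. f (Y w) \<partial>G)\<bar> < r / 2) sequentially"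
    using tendstoD[OF trigpoly_convergence[OF M G X Y trig f(1)], of "r / 2"] r by (simp add: dist_real_def)
  then have "eventually (\<lambda>N. norm ((\<integral>w. g (X N w) \<partial>M) - (\<integral>w. g (Y w) \<partial>G)) < r) sequentially"
    using B1
  proof eventually_elim
    case (elim N)
    have 1: "\<bar>(\<integral>w. g (X N w) \<partial>M) - (\<integral>w. f (X N w) \<partial>M)\<bar> \<le> (2 * C + 2) * e"
      using dX[of N] small[of "measure M (Xout N B)"] EXB[of N] elim by linarith
    have 2: "\<bar>(\<integral>w. g (Y w) \<partial>G) - (\<integral>w. f (Y w) \<partial>G)\<bar> \<le> (2 * C + 2) * e"
      using dY small[of "G.prob (Yout B)"] EYB n by linarith
    show ?case using 1 2 elim ebound by (simp add: abs_if split: if_splits)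
  qed
  then show "\<exists>no. \<forall>n\<ge>no. norm ((\<integral>w. g (X n w) \<partial>M) - (\<integral>w. g (Y w) \<partial>G)) < r"
    unfolding eventually_sequentially .
qed

subsection \<open>Unitriangular substitutions\<close>

definition shear :: "nat \<Rightarrow> (nat \<Rightarrow> nat \<Rightarrow> 'a) \<Rightarrow> (nat \<Rightarrow> 'a) \<Rightarrow> nat \<Rightarrow> 'a::comm_ring_1"
  where "shear n A y = restrict (\<lambda>i. \<Sum>j<n. A i j * y j) {..<n}"

lemma shear_measurable [measurable]:
  fixes A :: "nat \<Rightarrow> nat \<Rightarrow> 'a::{euclidean_space, real_normed_field}"
  shows "shear n A \<in> measurable (PiM {..<n} (\<lambda>_. lborel)) (PiM {..<n} (\<lambda>_. lborel))"
proof -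
  have "(\<lambda>y. restrict (\<lambda>i. \<Sum>j<n. A i j * y j) {..<n}) \<in> measurable (PiM {..<n} (\<lambda>_. lborel)) (PiM {..<n} (\<lambda>_. lborel))"
  proof (rule measurable_restrict)
    fix i assume "i \<in> {..<n}"
    have "(\<lambda>y. \<Sum>j<n. A i j * y j) \<in> borel_measurable (PiM {..<n} (\<lambda>_. lborel))"
    proof (rule borel_measurable_sum)
      fix j assume "j \<in> {..<n}"
      then have "(\<lambda>y. y j) \<in> measurable (PiM {..<n} (\<lambda>_. lborel)) (lborel :: 'a measure)"
        by (rule measurable_component_singleton)
      then have "(\<lambda>y. y j) \<in> borel_measurable (PiM {..<n} (\<lambda>_. lborel :: 'a measure))" by simp
      then show "(\<lambda>y. A i j * y j) \<in> borel_measurable (PiM {..<n} (\<lambda>_. lborel))"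
        by (intro borel_measurable_times) auto
    qed
    then show "(\<lambda>y. \<Sum>j<n. A i j * y j) \<in> measurable (PiM {..<n} (\<lambda>_. lborel)) lborel" by simp
  qed
  then show ?thesis unfolding shear_def .
qed

lemma nn_integral_lborel_translate:
  fixes f :: "'a::euclidean_space \<Rightarrow> ennreal"
  assumes "f \<in> borel_measurable borel"
  shows "(\<integral>\<^sup>+y. f (c + y) \<partial>lborel) = (\<integral>\<^sup>+y. f y \<partial>lborel)"
proof -
  have "(\<integral>\<^sup>+y. f y \<partial>lborel) = (\<integral>\<^sup>+y. f y \<partial>distr lborel borel ((+) c))"
    unfolding lborel_distr_plus ..
  also have "\<dots> = (\<integral>\<^sup>+y. f (c + y) \<partial>lborel)"
    using assms by (subst nn_integral_distr) auto
  finally show ?thesis by simp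
qed

text \<open>For fixed earlier coordinates the last one is merely translated, so Fubini and
  translation invariance settle the induction step. The type class covers real and complex
  coordinates at once.\<close>

lemma nn_integral_shear:
  fixes A :: "nat \<Rightarrow> nat \<Rightarrow> 'a::{euclidean_space, real_normed_field}"
  assumes diag: "\<And>i. i < n \<Longrightarrow> A i i = 1" and upper: "\<And>i j. i < j \<Longrightarrow> A i j = 0"
    and f: "f \<in> borel_measurable (PiM {..<n} (\<lambda>_. lborel))"
  shows "(\<integral>\<^sup>+y. f (shear n A y) \<partial>PiM {..<n} (\<lambda>_. lborel)) = (\<integral>\<^sup>+y. f y \<partial>PiM {..<n} (\<lambda>_. lborel))"
  using diag f
proof (induction n arbitrary: f)
  case 0
  have "f (shear 0 A y) = f y" if "y \<in> space (PiM {..<0} (\<lambda>_. lborel::'a measure))" for y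
    using that by (simp add: space_PiM shear_def restrict_def)
  then show ?case by (intro nn_integral_cong) auto
next
  case (Suc n)
  interpret product_sigma_finite "\<lambda>_::nat. lborel :: 'a measure" ..
  have ins: "{..<Suc n} = insert n {..<n}" by auto
  have f': "f \<in> borel_measurable (PiM (insert n {..<n}) (\<lambda>_. lborel))" using Suc.prems(2) unfolding ins .
  have sm: "shear (Suc n) A \<in> measurable (PiM (insert n {..<n}) (\<lambda>_. lborel)) (PiM (insert n {..<n}) (\<lambda>_. lborel))"
    using shear_measurable[of "Suc n" A] unfolding ins .
  define F where "F x = (\<integral>\<^sup>+y. f (x(n := y)) \<partial>lborel)" for x
  have upd: "(\<lambda>p. f ((fst p)(n := snd p))) \<in> borel_measurable (PiM {..<n} (\<lambda>_. lborel) \<Otimes>\<^sub>M lborel)"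
    using measurable_compose[OF measurable_add_dim[of n "{..<n}" "\<lambda>_. lborel"] f'] by (simp add: case_prod_beta)
  have Fm: "F \<in> borel_measurable (PiM {..<n} (\<lambda>_. lborel))"
    unfolding F_def using sigma_finite_lborel upd
    by (intro sigma_finite_measure.borel_measurable_nn_integral) (auto simp: case_prod_beta)
  have inner: "(\<integral>\<^sup>+y. f (shear (Suc n) A (x(n := y))) \<partial>lborel) = F (shear n A x)"
    if x: "x \<in> space (PiM {..<n} (\<lambda>_. lborel))" for x
  proof -
    define c where "c = (\<Sum>j<n. A n j * x j)"
    have "shear (Suc n) A (x(n := y)) = (shear n A x)(n := c + y)" for y
    proof
      fix i
      consider "i < n" | "i = n" | "i > n" by linarith
      then show "shear (Suc n) A (x(n := y)) i = ((shear n A x)(n := c + y)) i"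
        by cases (auto simp: shear_def c_def upper Suc.prems)
    qed
    then have "(\<integral>\<^sup>+y. f (shear (Suc n) A (x(n := y))) \<partial>lborel) = (\<integral>\<^sup>+y. f ((shear n A x)(n := c + y)) \<partial>lborel)" by simp
    also have "\<dots> = F (shear n A x)" unfolding F_def
    proof (rule nn_integral_lborel_translate[of "\<lambda>y. f ((shear n A x)(n := y))"])
      have "shear n A x \<in> space (PiM {..<n} (\<lambda>_. lborel))"
        using measurable_space[OF shear_measurable x] .
      from measurable_compose[OF measurable_Pair1'[OF this, of lborel] upd]
      show "(\<lambda>y. f ((shear n A x)(n := y))) \<in> borel_measurable borel" by simp
    qed
    finally show ?thesis .
  qed
  have "(\<integral>\<^sup>+y. f (shear (Suc n) A y) \<partial>PiM {..<Suc n} (\<lambda>_. lborel)) =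
      (\<integral>\<^sup>+x. (\<integral>\<^sup>+y. f (shear (Suc n) A (x(n := y))) \<partial>lborel) \<partial>PiM {..<n} (\<lambda>_. lborel))"
    unfolding ins using measurable_compose[OF sm f'] by (intro product_nn_integral_insert) auto
  also have "\<dots> = (\<integral>\<^sup>+x. F (shear n A x) \<partial>PiM {..<n} (\<lambda>_. lborel))"
    by (intro nn_integral_cong inner)
  also have "\<dots> = (\<integral>\<^sup>+x. F x \<partial>PiM {..<n} (\<lambda>_. lborel))"
    by (rule Suc.IH[OF _ Fm]) (simp add: Suc.prems)
  also have "\<dots> = (\<integral>\<^sup>+y. f y \<partial>PiM {..<Suc n} (\<lambda>_. lborel))"
    unfolding ins F_def using f' by (intro product_nn_integral_insert[symmetric]) auto
  finally show ?case .
qed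

lemma distr_shear:
  fixes A :: "nat \<Rightarrow> nat \<Rightarrow> 'a::{euclidean_space, real_normed_field}"
  assumes diag: "\<And>i. i < n \<Longrightarrow> A i i = 1" and upper: "\<And>i j. i < j \<Longrightarrow> A i j = 0"
  shows "distr (PiM {..<n} (\<lambda>_. lborel)) (PiM {..<n} (\<lambda>_. lborel)) (shear n A) = PiM {..<n} (\<lambda>_. lborel)"
proof (rule measure_eqI)
  let ?M = "PiM {..<n} (\<lambda>_. lborel :: 'a measure)"
  fix X assume "X \<in> sets (distr ?M ?M (shear n A))"
  then have X: "X \<in> sets ?M" by simp
  have "emeasure (distr ?M ?M (shear n A)) X = (\<integral>\<^sup>+y. indicator X y \<partial>distr ?M ?M (shear n A))"
    using X by simp
  also have "\<dots> = (\<integral>\<^sup>+y. indicator X (shear n A y) \<partial>?M)"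
    using X by (subst nn_integral_distr) auto
  also have "\<dots> = (\<integral>\<^sup>+y. indicator X y \<partial>?M)"
    by (rule nn_integral_shear) (use assms X in auto)
  also have "\<dots> = emeasure ?M X" using X by simp
  finally show "emeasure (distr ?M ?M (shear n A)) X = emeasure ?M X" .
qed simp

text \<open>Stated in the direction of use: integrability and value are computed in the decoupled
  variables and carried back.\<close>

lemma has_bochner_integral_shear:
  fixes A :: "nat \<Rightarrow> nat \<Rightarrow> 'a::{euclidean_space, real_normed_field}"
    and f :: "(nat \<Rightarrow> 'a) \<Rightarrow> 'b::{banach, second_countable_topology}"
  assumes "\<And>i. i < n \<Longrightarrow> A i i = 1" "\<And>i j. i < j \<Longrightarrow> A i j = 0"
    and f: "f \<in> borel_measurable (PiM {..<n} (\<lambda>_. lborel))"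
    and i: "has_bochner_integral (PiM {..<n} (\<lambda>_. lborel)) (\<lambda>y. f (shear n A y)) x"
  shows "has_bochner_integral (PiM {..<n} (\<lambda>_. lborel)) f x"
  using has_bochner_integral_distr[OF f shear_measurable, of A x] i distr_shear[of n A] assms(1,2) by simp

lemma minv_cong:
  fixes A B :: "nat \<Rightarrow> nat \<Rightarrow> 'a::field"
  assumes eq: "\<And>i j. i < n \<Longrightarrow> j < n \<Longrightarrow> A i j = B i j" and d: "mdet n A \<noteq> 0"
  shows "minv n A = minv n B"
proof -
  have d': "mdet n B \<noteq> 0" using mdet_cong[of n A B] eq d by simp
  show ?thesis
  proof (rule msupp_eqI[OF msupp_minv_gen[OF d] msupp_minv_gen[OF d']])
    fix i j assume ij: "i < n" "j < n"
    have "mdet n (row_repl A j (idm i)) = mdet n (row_repl B j (idm i))"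
      by (rule mdet_cong) (simp add: row_repl_def eq)
    then show "minv n A i j = minv n B i j"
      using ij mdet_cong[of n A B] eq by (simp add: minv_entry d d')
  qed
qed

text \<open>The two ingredients of a Gaussian density in the variables \<open>z\<close> with
  \<open>y = A z\<close>: the determinant is the product of the pivots and the exponent a weighted
  sum of squares.\<close>

lemma LDL_inverse_form:
  assumes diag: "\<forall>i<n. A i i = 1" and upper: "\<forall>i j. i < j \<longrightarrow> A i j = 0" and s: "msupp n A"
    and V: "\<forall>i<n. 0 < V i"
    and R: "\<forall>i<n. \<forall>j<n. R i j = (\<Sum>k<n. A i k * complex_of_real (V k) * cnj (A j k))"
  shows LDL_mdet: "mdet n R = of_real (\<Prod>k<n. V k)"
    and LDL_qform: "(\<And>i. i < n \<Longrightarrow> y i = (\<Sum>j<n. A i j * z j)) \<Longrightarrow>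
      qform n (minv n R) y = of_real (\<Sum>k<n. (cmod (z k))\<^sup>2 / V k)"
proof -
  define R' where "R' = A \<odot>\<^bsub>n\<^esub> diagm n V \<odot>\<^bsub>n\<^esub> adjm A"
  have eq: "R i j = R' i j" if "i < n" "j < n" for i j
    unfolding R'_def mmul_diagm using R that by (simp add: mmul_def adjm_def)
  have dA: "mdet n A = 1" using mdet_lower_triangular[of n A] diag upper by simp
  have sR': "msupp n R'" unfolding R'_def by (intro msupp_mmul s msupp_diagm msupp_adjm)
  have "mdet n R' = mdet n (diagm n V)"
    unfolding R'_def mdet_mmul mdet_adjm dA by simp
  also have "\<dots> = of_real (\<Prod>k<n. V k)"
    by (subst mdet_lower_triangular) (auto simp: diagm_def)
  finally have dR': "mdet n R' = of_real (\<Prod>k<n. V k)" .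
  have dRR: "mdet n R = mdet n R'" by (rule mdet_cong) (rule eq)
  then show dR: "mdet n R = of_real (\<Prod>k<n. V k)" using dR' by simp
  have nz: "mdet n R \<noteq> 0" unfolding dR of_real_eq_0_iff using V by (simp add: prod_zero_iff) force
  define A' where "A' = minv n A"
  have A': "A \<odot>\<^bsub>n\<^esub> A' = eye n" "A' \<odot>\<^bsub>n\<^esub> A = eye n" "msupp n A'"
    unfolding A'_def by (intro minv_eye msupp_minv_gen; simp add: dA s)+
  have A'H: "adjm A \<odot>\<^bsub>n\<^esub> adjm A' = eye n"
    using arg_cong[OF A'(2), of adjm] by (simp add: adjm_mmul)
  \<comment> \<open>The inverse assembled from the factors. The doubled adjoint keeps the shape to
    which \<open>qform_congruence\<close> applies.\<close>
  define Q where "Q = adjm A' \<odot>\<^bsub>n\<^esub> diagm n (\<lambda>k. 1 / V k) \<odot>\<^bsub>n\<^esub> adjm (adjm A')"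
  have "R' \<odot>\<^bsub>n\<^esub> Q = A \<odot>\<^bsub>n\<^esub> (diagm n V \<odot>\<^bsub>n\<^esub> ((adjm A \<odot>\<^bsub>n\<^esub> adjm A') \<odot>\<^bsub>n\<^esub> (diagm n (\<lambda>k. 1 / V k) \<odot>\<^bsub>n\<^esub> A')))"
    unfolding R'_def Q_def by (simp add: mmul_assoc)
  also have "\<dots> = A \<odot>\<^bsub>n\<^esub> ((diagm n V \<odot>\<^bsub>n\<^esub> diagm n (\<lambda>k. 1 / V k)) \<odot>\<^bsub>n\<^esub> A')"
    unfolding A'H by (simp add: mmul_eye_left msupp_mmul msupp_diagm A' mmul_assoc)
  also have "diagm n V \<odot>\<^bsub>n\<^esub> diagm n (\<lambda>k. 1 / V k) = eye n"
    unfolding diagm_diagm using V by (auto simp: diagm_def eye_def intro!: ext)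
  finally have "R' \<odot>\<^bsub>n\<^esub> Q = eye n" by (simp add: mmul_eye_left A')
  then have "minv n R' = Q"
    by (intro minv_unique(1) sR') (auto simp: Q_def intro!: msupp_mmul msupp_adjm A' msupp_diagm)
  then have Q: "minv n R = Q" using minv_cong[of n R R'] eq nz by simp
  assume y: "\<And>i. i < n \<Longrightarrow> y i = (\<Sum>j<n. A i j * z j)"
  have z: "(\<Sum>i<n. cnj (adjm A' i k) * y i) = z k" if k: "k < n" for k
  proof -
    have "(\<Sum>i<n. cnj (adjm A' i k) * y i) = (\<Sum>i<n. \<Sum>j<n. A' k i * A i j * z j)"
      by (intro sum.cong refl) (simp add: adjm_def y sum_distrib_left mult.assoc)
    also have "\<dots> = (\<Sum>j<n. mmul n A' A k j * z j)"
      by (subst sum.swap) (simp add: mmul_def sum_distrib_right)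
    also have "\<dots> = z k" unfolding A' using k
      by (simp add: eye_def if_distrib[of "\<lambda>x. x * _"] cong: if_cong)
    finally show ?thesis .
  qed
  have "qform n (minv n R) y = qform n (diagm n (\<lambda>k. 1 / V k)) (\<lambda>k. \<Sum>i<n. cnj (adjm A' i k) * y i)"
    unfolding Q Q_def by (rule qform_congruence)
  also have "\<dots> = qform n (diagm n (\<lambda>k. 1 / V k)) z"
    by (rule qform_cong) (auto simp: z)
  also have "\<dots> = of_real (\<Sum>k<n. (cmod (z k))\<^sup>2 / V k)" unfolding qform_diagm by simp
  finally show "qform n (minv n R) y = of_real (\<Sum>k<n. (cmod (z k))\<^sup>2 / V k)" .
qed

subsection \<open>Real Gaussian vectors\<close>

lemma mdet_of_real: "mdet n (\<lambda>i j. complex_of_real (C i j)) = of_real (mdet n C)"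
  unfolding mdet_def by simp

lemma minv_of_real:
  assumes "mdet n C \<noteq> 0"
  shows "minv n (\<lambda>i j. complex_of_real (C i j)) i j = of_real (minv n C i j)"
proof (cases "i < n \<and> j < n")
  case True
  have "row_repl (\<lambda>i j. complex_of_real (C i j)) j (idm i) = (\<lambda>a b. complex_of_real (row_repl C j (idm i) a b))"
    by (auto simp: row_repl_def idm_def intro!: ext)
  then show ?thesis using True assms by (simp add: minv_entry mdet_of_real)
next
  case False
  then have "minv n C i j = 0" "minv n (\<lambda>i j. complex_of_real (C i j)) i j = 0"
    using msupp_minv_gen[of n C] msupp_minv_gen[of n "\<lambda>i j. complex_of_real (C i j)"] assms
    by (auto simp: msupp_def not_less mdet_of_real)
  then show ?thesis by simp
qed

lemma gauss_dens_measurable [measurable]: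
  "gauss_dens d C \<in> borel_measurable (PiM {..<d} (\<lambda>_. lborel))"
proof -
  have [measurable]: "(\<lambda>x. x i) \<in> borel_measurable (PiM {..<d} (\<lambda>_. lborel :: real measure))" if "i \<in> {..<d}" for i
    using measurable_component_singleton[OF that, of "\<lambda>_. lborel :: real measure"] by simp
  have "(\<lambda>x. \<Sum>i<d. \<Sum>j<d. x i * minv d C i j * x j) \<in> borel_measurable (PiM {..<d} (\<lambda>_. lborel))"
    by (intro borel_measurable_sum borel_measurable_times) auto
  then show ?thesis unfolding gauss_dens_def[abs_def] by measurable
qed

text \<open>Rescaling to unit variance reduces this to the characteristic function of the standard
  normal law.\<close>

lemma has_bochner_integral_cis_normal:
  assumes "s > 0"
  shows "has_bochner_integral lborel (\<lambda>x. cis (a * x) * of_real (normal_density 0 s x))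
    (of_real (exp (- (a\<^sup>2 * s\<^sup>2) / 2)))"
proof -
  have int: "integrable lborel (\<lambda>x. cis (a * x) * complex_of_real (normal_density 0 s x))"
  proof (rule Bochner_Integration.integrable_bound)
    show "integrable lborel (normal_density 0 s)" using assms by (simp add: integrable_normal_density)
    have "(\<lambda>x. cis (a * x)) \<in> borel_measurable borel"
      by (intro borel_measurable_continuous_onI continuous_intros)
    then show "(\<lambda>x. cis (a * x) * complex_of_real (normal_density 0 s x)) \<in> borel_measurable lborel" by simp
  qed (simp add: norm_mult)
  have "(\<integral>x. cis (a * x) * complex_of_real (normal_density 0 s x) \<partial>lborel)
    = s *\<^sub>R (\<integral>x. cis (a * (0 + s * x)) * complex_of_real (normal_density 0 s (0 + s * x)) \<partial>lborel)"
    using assms by (subst lborel_integral_real_affine[of s _ 0]) auto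
  also have "\<dots> = (\<integral>x. std_normal_density x *\<^sub>R cis ((a * s) * x) \<partial>lborel)"
  proof -
    have "normal_density 0 s (s * x) = std_normal_density x / s" for x
      using assms by (simp add: normal_density_def power_mult_distrib real_sqrt_mult field_simps)
    then show ?thesis using assms
      by (subst integral_scaleR_right[symmetric]) (auto intro!: Bochner_Integration.integral_cong simp: scaleR_conv_of_real mult_ac)
  qed
  also have "\<dots> = char std_normal_distribution (a * s)"
    unfolding char_def by (subst integral_density) (auto simp: cis_conv_exp)
  also have "\<dots> = of_real (exp (- (a\<^sup>2 * s\<^sup>2) / 2))"
    unfolding char_std_normal_distribution by (simp add: power_mult_distrib)
  finally show ?thesis using int by (simp add: has_bochner_integral_iff)
qed

lemma (in product_sigma_finite) has_bochner_integral_prod: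
  fixes f :: "'i \<Rightarrow> 'a \<Rightarrow> _::{real_normed_field,banach,second_countable_topology}"
  assumes "finite I" "\<And>i. i \<in> I \<Longrightarrow> has_bochner_integral (M i) (f i) (x i)"
  shows "has_bochner_integral (PiM I M) (\<lambda>z. \<Prod>i\<in>I. f i (z i)) (\<Prod>i\<in>I. x i)"
proof -
  have i: "integrable (M i) (f i)" "integral\<^sup>L (M i) (f i) = x i" if "i \<in> I" for i
    using assms(2)[OF that] by (auto simp: has_bochner_integral_iff)
  show ?thesis unfolding has_bochner_integral_iff
    using product_integrable_prod[OF assms(1) i(1)] product_integral_prod[OF assms(1) i(1)] i(2) by simp
qed

lemma sqrt_prod: "sqrt (\<Prod>i\<in>I. f i) = (\<Prod>i\<in>I. sqrt (f i))"
  by (induction I rule: infinite_finite_induct) (auto simp: real_sqrt_mult)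

lemma cis_sum: "cis (\<Sum>i\<in>I. f i) = (\<Prod>i\<in>I. cis (f i))"
  by (induction I rule: infinite_finite_induct) (auto simp: cis_mult[symmetric])

text \<open>After the triangular substitution the characteristic function factors over the
  coordinates; the cosine with phase \<open>b\<close> is the real part of \<open>cis b\<close> times
  it. Zero frequency and phase give total mass one.\<close>

theorem gauss_dens_trig:
  assumes p: "pd d (\<lambda>i j. complex_of_real (C i j))"
  shows gauss_dens_nonneg: "\<And>x. 0 \<le> gauss_dens d C x"
    and gauss_dens_cos: "has_bochner_integral (PiM {..<d} (\<lambda>_. lborel))
      (\<lambda>x. cos ((\<Sum>i<d. c i * x i) + b) * gauss_dens d C x)
      (cos b * exp (- (\<Sum>i<d. \<Sum>j<d. c i * C i j * c j) / 2))"
proof -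
  let ?C = "\<lambda>i j. complex_of_real (C i j)"
  let ?P = "PiM {..<d} (\<lambda>_. lborel :: real measure)"
  interpret product_sigma_finite "\<lambda>_::nat. lborel :: real measure" ..
  obtain A V where A: "\<forall>i<d. A i i = 1" "\<forall>i j. i < j \<longrightarrow> A i j = 0" "msupp d A" "\<forall>i<d. 0 < V i"
    "\<forall>i<d. \<forall>j<d. ?C i j = (\<Sum>k<d. A i k * complex_of_real (V k) * cnj (A j k))"
    "(\<forall>i<d. \<forall>j<d. ?C i j \<in> \<real>) \<longrightarrow> (\<forall>i j. A i j \<in> \<real>)"
    using pd_LDL[OF p] by (elim exE conjE) (rule that)
  define B where "B = (\<lambda>i j. Re (A i j))"
  have AB: "A i j = of_real (B i j)" for i j using A(6) by (simp add: B_def)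
  have C: "C i j = (\<Sum>k<d. B i k * V k * B j k)" if "i < d" "j < d" for i j
  proof -
    have "?C i j = of_real (\<Sum>k<d. B i k * V k * B j k)" using A(5) that unfolding AB by simp
    then show ?thesis unfolding of_real_eq_iff .
  qed
  have det: "mdet d C = (\<Prod>k<d. V k)"
    using LDL_mdet[OF A(1-5)] unfolding mdet_of_real of_real_eq_iff .
  have detp: "mdet d C > 0" unfolding det using A(4) by (intro prod_pos) auto
  show nn: "0 \<le> gauss_dens d C x" for x unfolding gauss_dens_def using detp by simp
  have dens: "gauss_dens d C (shear d B z) = (\<Prod>k<d. normal_density 0 (sqrt (V k)) (z k))" for z
  proof -
    let ?x = "shear d B z"
    have "complex_of_real (\<Sum>i<d. \<Sum>j<d. ?x i * minv d C i j * ?x j) = qform d (minv d ?C) (\<lambda>i. of_real (?x i))"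
      using detp by (simp add: qform_def minv_of_real)
    also have "\<dots> = of_real (\<Sum>k<d. (cmod (complex_of_real (z k)))\<^sup>2 / V k)"
      by (rule LDL_qform[OF A(1-5)]) (simp add: shear_def AB)
    finally have q: "(\<Sum>i<d. \<Sum>j<d. ?x i * minv d C i j * ?x j) = (\<Sum>k<d. (z k)\<^sup>2 / V k)"
      unfolding of_real_eq_iff by simp
    have "(\<Prod>k<d. normal_density 0 (sqrt (V k)) (z k)) = (\<Prod>k<d. exp (- (1/2) * ((z k)\<^sup>2 / V k)) / sqrt (2 * pi * V k))"
      using A(4) by (intro prod.cong refl) (simp add: normal_density_def less_imp_le)
    also have "\<dots> = exp (\<Sum>k<d. - (1/2) * ((z k)\<^sup>2 / V k)) / sqrt ((2 * pi) ^ d * (\<Prod>k<d. V k))"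
      by (simp add: prod_dividef exp_sum sqrt_prod[symmetric] prod.distrib)
    finally show ?thesis unfolding gauss_dens_def q det by (simp add: sum_distrib_left)
  qed
  \<comment> \<open>The frequency vector seen by the decoupled coordinates, that is the transpose of
    \<open>B\<close> applied to \<open>c\<close>.\<close>
  define a where "a = (\<lambda>k. \<Sum>i<d. c i * B i k)"
  have ax: "(\<Sum>i<d. c i * shear d B z i) = (\<Sum>k<d. a k * z k)" for z
    unfolding a_def shear_def by (simp add: sum_distrib_left sum_distrib_right mult.assoc) (subst sum.swap, simp)
  have quad: "(\<Sum>k<d. (a k)\<^sup>2 * V k) = (\<Sum>i<d. \<Sum>j<d. c i * C i j * c j)"
  proof -
    have "(\<Sum>i<d. \<Sum>j<d. c i * C i j * c j) = (\<Sum>i<d. \<Sum>j<d. \<Sum>k<d. (c i * B i k) * (c j * B j k) * V k)"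
      by (intro sum.cong refl) (simp add: C sum_distrib_left sum_distrib_right mult_ac)
    also have "\<dots> = (\<Sum>i<d. \<Sum>k<d. \<Sum>j<d. (c i * B i k) * (c j * B j k) * V k)"
      by (rule sum.cong[OF refl]) (rule sum.swap)
    also have "\<dots> = (\<Sum>k<d. \<Sum>i<d. \<Sum>j<d. (c i * B i k) * (c j * B j k) * V k)" by (rule sum.swap)
    also have "\<dots> = (\<Sum>k<d. (a k)\<^sup>2 * V k)"
      unfolding a_def power2_eq_square sum_product by (simp add: sum_distrib_right)
    finally show ?thesis by simp
  qed
  have one: "has_bochner_integral lborel (\<lambda>x. cis (a k * x) * of_real (normal_density 0 (sqrt (V k)) x))
    (of_real (exp (- ((a k)\<^sup>2 * V k) / 2)))" if "k < d" for k
    using has_bochner_integral_cis_normal[of "sqrt (V k)" "a k"] A(4) that by (simp add: less_imp_le)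
  have prod: "has_bochner_integral ?P (\<lambda>z. \<Prod>k<d. cis (a k * z k) * of_real (normal_density 0 (sqrt (V k)) (z k)))
    (\<Prod>k<d. of_real (exp (- ((a k)\<^sup>2 * V k) / 2)))"
    using one by (intro has_bochner_integral_prod) auto
  have e1: "(\<Prod>k<d. cis (a k * z k) * of_real (normal_density 0 (sqrt (V k)) (z k)))
     = cis (\<Sum>k<d. a k * z k) * complex_of_real (\<Prod>k<d. normal_density 0 (sqrt (V k)) (z k))" for z
    by (simp add: prod.distrib cis_sum)
  have e2: "(\<Prod>k<d. complex_of_real (exp (- ((a k)\<^sup>2 * V k) / 2))) = of_real (exp (- (\<Sum>i<d. \<Sum>j<d. c i * C i j * c j) / 2))"
    unfolding quad[symmetric] of_real_prod[symmetric] exp_sum[symmetric, OF finite_lessThan]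
    by (simp add: sum_divide_distrib sum_negf)
  have "has_bochner_integral ?P (\<lambda>z. cis b * (cis (\<Sum>k<d. a k * z k) * complex_of_real (\<Prod>k<d. normal_density 0 (sqrt (V k)) (z k))))
    (cis b * of_real (exp (- (\<Sum>i<d. \<Sum>j<d. c i * C i j * c j) / 2)))"
    using prod unfolding e1 e2 by (rule has_bochner_integral_mult_right)
  note Re_int = has_bochner_integral_bounded_linear[OF bounded_linear_Re this]
  have e3: "Re (cis b * (cis u * complex_of_real r)) = cos (u + b) * r" for u r
    by (simp add: cos_add algebra_simps)
  have e4: "Re (cis b * complex_of_real r) = cos b * r" for r by simp
  from Re_int have "has_bochner_integral ?P (\<lambda>z. cos ((\<Sum>i<d. c i * shear d B z i) + b) * gauss_dens d C (shear d B z))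
      (cos b * exp (- (\<Sum>i<d. \<Sum>j<d. c i * C i j * c j) / 2))"
    unfolding dens ax e3 e4 .
  then show "has_bochner_integral (PiM {..<d} (\<lambda>_. lborel))
      (\<lambda>x. cos ((\<Sum>i<d. c i * x i) + b) * gauss_dens d C x)
      (cos b * exp (- (\<Sum>i<d. \<Sum>j<d. c i * C i j * c j) / 2))"
  proof (rule has_bochner_integral_shear[rotated 3])
    have [measurable]: "(\<lambda>x. x i) \<in> borel_measurable ?P" if "i \<in> {..<d}" for i
      using measurable_component_singleton[OF that, of "\<lambda>_. lborel :: real measure"] by simp
    have "(\<lambda>x. (\<Sum>i<d. c i * x i) + b) \<in> borel_measurable ?P"
      by (intro borel_measurable_add borel_measurable_sum borel_measurable_times) auto
    then have "(\<lambda>x. cos ((\<Sum>i<d. c i * x i) + b)) \<in> borel_measurable ?P"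
      by (rule measurable_compose) (auto intro: borel_measurable_continuous_onI continuous_intros)
    then show "(\<lambda>x. cos ((\<Sum>i<d. c i * x i) + b) * gauss_dens d C x) \<in> borel_measurable ?P" by simp
  qed (use A(1,2) in \<open>auto simp: AB\<close>)
qed

subsection \<open>Complex Gaussian moments\<close>

lemma measurable_Complex: "(\<lambda>p. Complex (fst p) (snd p)) \<in> borel_measurable (borel \<Otimes>\<^sub>M borel)"
  unfolding complex_eq_iff Complex_eq by measurable

text \<open>Boxes determine Lebesgue measure, and a box in the complex plane is a product of
  intervals. It reduces circular moments to those of two independent real normals.\<close>

lemma lborel_complex:
  "(lborel :: complex measure) = distr (lborel \<Otimes>\<^sub>M lborel) borel (\<lambda>p. Complex (fst p) (snd p))"
proof (rule lborel_eqI)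
  let ?f = "\<lambda>p. Complex (fst p) (snd p)"
  fix l u :: complex assume le: "\<And>b. b \<in> Basis \<Longrightarrow> l \<bullet> b \<le> u \<bullet> b"
  have le: "Re l \<le> Re u" "Im l \<le> Im u"
    using le[of 1] le[of \<i>] by (auto simp: Basis_complex_def)
  have m: "?f \<in> measurable (lborel \<Otimes>\<^sub>M lborel) borel"
    using measurable_Complex by (simp add: measurable_def sets_pair_measure space_pair_measure)
  have "emeasure (distr (lborel \<Otimes>\<^sub>M lborel) borel ?f) (box l u)
      = emeasure (lborel \<Otimes>\<^sub>M lborel) (?f -` box l u \<inter> space (lborel \<Otimes>\<^sub>M lborel))"
    by (rule emeasure_distr[OF m]) simp
  also have "?f -` box l u \<inter> space (lborel \<Otimes>\<^sub>M lborel) = {Re l<..<Re u} \<times> {Im l<..<Im u}"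
    by (auto simp: box_def Basis_complex_def space_pair_measure)
  also have "emeasure (lborel \<Otimes>\<^sub>M lborel) \<dots> = ennreal (Re u - Re l) * ennreal (Im u - Im l)"
    using le by (subst lborel.emeasure_pair_measure_Times) auto
  also have "\<dots> = (\<Prod>b\<in>Basis. (u - l) \<bullet> b)"
    using le by (simp add: Basis_complex_def ennreal_mult)
  finally show "emeasure (distr (lborel \<Otimes>\<^sub>M lborel) borel ?f) (box l u) = (\<Prod>b\<in>Basis. (u - l) \<bullet> b)" .
qed simp

lemma has_bochner_integral_lborel_complex:
  fixes f :: "complex \<Rightarrow> 'b::{banach, second_countable_topology}"
  assumes f: "f \<in> borel_measurable borel"
    and i: "has_bochner_integral (lborel \<Otimes>\<^sub>M lborel) (\<lambda>p. f (Complex (fst p) (snd p))) x"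
  shows "has_bochner_integral lborel f x"
proof -
  have m: "(\<lambda>p. Complex (fst p) (snd p)) \<in> measurable (lborel \<Otimes>\<^sub>M lborel) borel"
    using measurable_Complex by (simp add: measurable_def sets_pair_measure space_pair_measure)
  show ?thesis unfolding lborel_complex using has_bochner_integral_distr[OF f m] i by simp
qed

lemma (in pair_sigma_finite) has_bochner_integral_mult_pair:
  fixes f g :: "_ \<Rightarrow> real"
  assumes f: "has_bochner_integral M1 f x" and g: "has_bochner_integral M2 g y"
  shows "has_bochner_integral (M1 \<Otimes>\<^sub>M M2) (\<lambda>p. f (fst p) * g (snd p)) (x * y)"
proof -
  have if_: "integrable M1 f" and ig: "integrable M2 g" using f g by (auto simp: has_bochner_integral_iff)
  have m: "(\<lambda>p. f (fst p) * g (snd p)) \<in> borel_measurable (M1 \<Otimes>\<^sub>M M2)"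
    using borel_measurable_integrable[OF if_] borel_measurable_integrable[OF ig] by measurable
  have int: "integrable (M1 \<Otimes>\<^sub>M M2) (\<lambda>p. f (fst p) * g (snd p))"
    by (rule Fubini_integrable[OF m]) (use if_ ig in \<open>auto simp: abs_mult\<close>)
  have "(\<integral>p. f (fst p) * g (snd p) \<partial>(M1 \<Otimes>\<^sub>M M2)) = (\<integral>a. \<integral>b. f a * g b \<partial>M2 \<partial>M1)"
    using integral_fst'[OF int] by simp
  also have "\<dots> = x * y" using f g by (simp add: has_bochner_integral_iff)
  finally show ?thesis using int by (simp add: has_bochner_integral_iff)
qed

text \<open>Moments up to order four of a centred normal variable of variance \<open>v / 2\<close>,
  the law of real and imaginary part of a circular Gaussian of variance \<open>v\<close>.\<close>

definition nmom :: "real \<Rightarrow> nat \<Rightarrow> real"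
  where "nmom v m = (if m = 0 then 1 else if m = 2 then v / 2 else if m = 4 then 3 * (v / 2)\<^sup>2 else 0)"

lemma normal_moments:
  assumes v: "v > 0" and m: "m \<le> 4"
  shows "has_bochner_integral lborel (\<lambda>x. x ^ m * normal_density 0 (sqrt (v / 2)) x) (nmom v m)"
proof -
  have s: "sqrt (v / 2) > 0" using v by simp
  note ev = normal_moment_even[OF s, of 0] and od = normal_moment_odd[OF s, of 0]
  have sq: "(sqrt (v / 2))\<^sup>2 = v / 2" using v by simp
  consider "m = 0" | "m = 1" | "m = 2" | "m = 3" | "m = 4" using m by linarith
  then show ?thesis
  proof cases
    case 1 then show ?thesis using ev[of 0] by (simp add: nmom_def mult.commute)
  next
    case 2 then show ?thesis using od[of 0] by (simp add: nmom_def mult.commute)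
  next
    case 3 then show ?thesis using ev[of 1] v by (simp add: nmom_def mult.commute sq)
  next
    case 4 then show ?thesis using od[of 1] by (simp add: nmom_def mult.commute)
  next
    case 5 then show ?thesis using ev[of 2] v by (simp add: nmom_def mult.commute sq fact_numeral power2_eq_square field_simps)
  qed
qed

text \<open>The weight \<open>h\<close> allows one statement for probability spaces (\<open>h = 1\<close>) and for densities.\<close>

lemma circular_moments:
  fixes X Y h :: "'v \<Rightarrow> real"
  assumes H: "\<And>m l. m \<le> 4 \<Longrightarrow> l \<le> 4 \<Longrightarrow> has_bochner_integral N (\<lambda>w. X w ^ m * Y w ^ l * h w) (nmom v m * nmom v l)"
    and ab: "a \<le> 2" "b \<le> 2"
  shows "has_bochner_integral N (\<lambda>w. cnj (Complex (X w) (Y w)) ^ a * Complex (X w) (Y w) ^ b * of_real (h w))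
    (if a = b then of_real (fact a * v ^ a) else 0)"
proof -
  have R: "has_bochner_integral N (\<lambda>w. c * complex_of_real (X w ^ m * Y w ^ l * h w)) (c * of_real (nmom v m * nmom v l))"
    if "m \<le> 4" "l \<le> 4" for m l and c :: complex
    by (intro has_bochner_integral_mult_right has_bochner_integral_bounded_linear[OF bounded_linear_of_real] H that)
  let ?I = "\<lambda>a b. has_bochner_integral N (\<lambda>w. cnj (Complex (X w) (Y w)) ^ a * Complex (X w) (Y w) ^ b * of_real (h w))
    (if a = b then of_real (fact a * v ^ a) else 0)"
  note add = has_bochner_integral_add
  have 00: "?I 0 0" using R[of 0 0 1] by (simp add: nmom_def)
  have 01: "?I 0 1"
    by (rule has_bochner_integral_cong[THEN iffD1, OF refl _ _ add[OF R[of 1 0 1] R[of 0 1 \<i>]]])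
       (auto simp: nmom_def complex_eq_iff)
  have 02: "?I 0 2"
    by (rule has_bochner_integral_cong[THEN iffD1, OF refl _ _ add[OF add[OF R[of 2 0 1] R[of 0 2 "-1"]] R[of 1 1 "2 * \<i>"]]])
       (auto simp: nmom_def complex_eq_iff power2_eq_square algebra_simps)
  have 11: "?I 1 1"
    by (rule has_bochner_integral_cong[THEN iffD1, OF refl _ _ add[OF R[of 2 0 1] R[of 0 2 1]]])
       (auto simp: nmom_def complex_eq_iff power2_eq_square algebra_simps)
  have 12: "?I 1 2"
    by (rule has_bochner_integral_cong[THEN iffD1, OF refl _ _
          add[OF add[OF R[of 3 0 1] R[of 1 2 1]] add[OF R[of 2 1 \<i>] R[of 0 3 \<i>]]]])
       (auto simp: nmom_def complex_eq_iff power2_eq_square power3_eq_cube algebra_simps)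
  have 22: "?I 2 2"
    by (rule has_bochner_integral_cong[THEN iffD1, OF refl _ _
          add[OF add[OF R[of 4 0 1] R[of 2 2 2]] R[of 0 4 1]]])
       (auto simp: nmom_def complex_eq_iff power2_eq_square power4_eq_xxxx algebra_simps)
  \<comment> \<open>Conjugation exchanges \<open>a\<close> and \<open>b\<close> and fixes the value,
    so six of the nine cases suffice.\<close>
  have flip: "?I a b" if "?I b a" for a b
    using has_bochner_integral_bounded_linear[OF bounded_linear_cnj that]
    by (cases "a = b") (simp_all add: mult_ac)
  have "a = 0 \<or> a = 1 \<or> a = 2" "b = 0 \<or> b = 1 \<or> b = 2" using ab by auto
  then show ?thesis using 00 01 02 11 12 22 flip[OF 01] flip[OF 02] flip[OF 12] by (elim disjE; simp only:)
qed

text \<open>Density on the complex plane of the circular Gaussian law with variance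
  \<open>v\<close>.\<close>

definition cgd :: "real \<Rightarrow> complex \<Rightarrow> real"
  where "cgd v z = exp (- (cmod z)\<^sup>2 / v) / (pi * v)"

lemma cgd_Complex: "v > 0 \<Longrightarrow> cgd v (Complex x y) = normal_density 0 (sqrt (v / 2)) x * normal_density 0 (sqrt (v / 2)) y"
  by (simp add: cgd_def normal_density_def cmod_power2 exp_add[symmetric] real_sqrt_mult[symmetric] add_divide_distrib diff_divide_distrib)

lemma cgd_measurable [measurable]: "cgd v \<in> borel_measurable borel"
  unfolding cgd_def[abs_def] by (intro borel_measurable_divide borel_measurable_exp) measurable

lemma cgd_moments:
  assumes v: "v > 0" and ab: "a \<le> 2" "b \<le> 2"
  shows "has_bochner_integral lborel (\<lambda>z. cnj z ^ a * z ^ b * of_real (cgd v z))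
    (if a = b then of_real (fact a * v ^ a) else 0)"
proof (rule has_bochner_integral_lborel_complex)
  have "(\<lambda>z. cnj z) \<in> borel_measurable borel"
    by (intro borel_measurable_continuous_onI continuous_intros)
  then show "(\<lambda>z. cnj z ^ a * z ^ b * complex_of_real (cgd v z)) \<in> borel_measurable borel" by measurable
  show "has_bochner_integral (lborel \<Otimes>\<^sub>M lborel)
     (\<lambda>p. cnj (Complex (fst p) (snd p)) ^ a * Complex (fst p) (snd p) ^ b * complex_of_real (cgd v (Complex (fst p) (snd p))))
     (if a = b then complex_of_real (fact a * v ^ a) else 0)"
  proof (rule circular_moments[OF _ ab])
    fix m l :: nat assume "m \<le> 4" "l \<le> 4"
    from lborel_pair.has_bochner_integral_mult_pair[OF normal_moments[OF v this(1)] normal_moments[OF v this(2)]]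
    show "has_bochner_integral (lborel \<Otimes>\<^sub>M lborel)
      (\<lambda>p. fst p ^ m * snd p ^ l * cgd v (Complex (fst p) (snd p))) (nmom v m * nmom v l)"
      by (simp add: cgd_Complex[OF v] mult_ac)
  qed
qed

lemma cgd_product_moments:
  fixes v :: "nat \<Rightarrow> real"
  assumes v: "\<And>k. k < m \<Longrightarrow> 0 < v k" and ab: "\<And>k. k < m \<Longrightarrow> a k \<le> 2" "\<And>k. k < m \<Longrightarrow> b k \<le> 2"
  shows "has_bochner_integral (PiM {..<m} (\<lambda>_. lborel))
    (\<lambda>z. (\<Prod>k<m. cnj (z k) ^ a k * z k ^ b k) * of_real (\<Prod>k<m. cgd (v k) (z k)))
    (\<Prod>k<m. if a k = b k then of_real (fact (a k) * v k ^ a k) else 0)"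
proof -
  interpret product_sigma_finite "\<lambda>_::nat. lborel :: complex measure" ..
  have "has_bochner_integral (PiM {..<m} (\<lambda>_. lborel))
    (\<lambda>z. \<Prod>k<m. cnj (z k) ^ a k * z k ^ b k * of_real (cgd (v k) (z k)))
    (\<Prod>k<m. if a k = b k then of_real (fact (a k) * v k ^ a k) else 0)"
    by (rule has_bochner_integral_prod[where f="\<lambda>k z. cnj z ^ a k * z ^ b k * of_real (cgd (v k) z)"])
       (use cgd_moments[OF v ab] in auto)
  then show ?thesis by (simp add: prod.distrib)
qed

text \<open>Wick's formula for independent circular variables, read off from the moments with
  exponents: at most two conjugated and two plain factors meet at any index, and a mixed moment is
  nonzero only if the exponents balance there.\<close>

lemma fourth_moment_product:
  fixes w :: "nat \<Rightarrow> 'v \<Rightarrow> complex" and h :: "'v \<Rightarrow> complex"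
  assumes H: "\<And>a b. (\<And>k. k < m \<Longrightarrow> a k \<le> 2) \<Longrightarrow> (\<And>k. k < m \<Longrightarrow> b k \<le> 2) \<Longrightarrow>
      has_bochner_integral N (\<lambda>x. (\<Prod>k<m. cnj (w k x) ^ a k * w k x ^ b k) * h x)
        (\<Prod>k<m. if a k = b k then of_real (fact (a k) * v k ^ a k) else 0)"
  shows "i < m \<Longrightarrow> j < m \<Longrightarrow> k < m \<Longrightarrow> l < m \<Longrightarrow>
     has_bochner_integral N (\<lambda>x. cnj (w i x) * w j x * (cnj (w k x) * w l x) * h x)
       (of_real (v i * v k) * (of_bool (i = j) * of_bool (k = l) + of_bool (i = l) * of_bool (k = j)))" (is "_ \<Longrightarrow> _ \<Longrightarrow> _ \<Longrightarrow> _ \<Longrightarrow> ?four")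
    and "i < m \<Longrightarrow> j < m \<Longrightarrow> has_bochner_integral N (\<lambda>x. cnj (w i x) * w j x * h x) (of_real (v i) * of_bool (i = j))" (is "_ \<Longrightarrow> _ \<Longrightarrow> ?two")
    and "has_bochner_integral N h 1"
proof -
  have pb: "(\<Prod>q<m. f q ^ of_bool (q = i)) = f i" if "i < m" for f :: "nat \<Rightarrow> complex" and i
  proof -
    have "(\<Prod>q<m. f q ^ of_bool (q = i)) = (\<Prod>q<m. if q = i then f i else 1)" by (intro prod.cong) auto
    then show ?thesis using that by simp
  qed
  show "has_bochner_integral N h 1" using H[of "\<lambda>_. 0" "\<lambda>_. 0"] by simp
  show ?two if "i < m" "j < m"
  proof -
    \<comment> \<open>Indicator exponents, so that the product over all variables reduces to the two
      selected factors.\<close>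
    let ?a = "\<lambda>q. of_bool (q = i) :: nat" and ?b = "\<lambda>q. of_bool (q = j) :: nat"
    have "(\<Prod>q<m. if ?a q = ?b q then complex_of_real (fact (?a q) * v q ^ ?a q) else 0) = of_real (v i) * of_bool (i = j)"
    proof (cases "i = j")
      case True
      then have "(\<Prod>q<m. if ?a q = ?b q then complex_of_real (fact (?a q) * v q ^ ?a q) else 0) = (\<Prod>q<m. of_real (v q) ^ of_bool (q = i))"
        by (intro prod.cong) auto
      then show ?thesis using that True pb[of i "\<lambda>q. of_real (v q)"] by simp
    next
      case False
      then show ?thesis using that by (auto intro!: prod_zero bexI[of _ i])
    qed
    then show ?thesis using H[of ?a ?b] that by (simp add: prod.distrib pb)
  qed
  show ?four if "i < m" "j < m" "k < m" "l < m"
  proof -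
    let ?a = "\<lambda>q. of_bool (q = i) + of_bool (q = k) :: nat" and ?b = "\<lambda>q. of_bool (q = j) + of_bool (q = l) :: nat"
    let ?v = "\<lambda>q. if ?a q = ?b q then complex_of_real (fact (?a q) * v q ^ ?a q) else 0"
    have ik: "i < m" "k < m" by (fact that)+
    have val: "(\<Prod>q<m. ?v q) = of_real (v i * v k) * (of_bool (i = j) * of_bool (k = l) + of_bool (i = l) * of_bool (k = j))"
    proof (cases "(i = j \<and> k = l) \<or> (i = l \<and> k = j)")
      case eq: True
      then have ab: "?a q = ?b q" for q by auto
      show ?thesis
      proof (cases "i = k")
        \<comment> \<open>All four indices coincide. Both pairings count, and this is the factor
          \<open>2\<close> coming from \<open>fact 2\<close>.\<close>
        case True
        then have "(\<Prod>q<m. ?v q) = (\<Prod>q<m. (of_real (2 * v q ^ 2)) ^ of_bool (q = i))"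
          unfolding ab[symmetric] by (intro prod.cong refl) (auto simp: ab fact_numeral power2_eq_square)
        also have "\<dots> = of_real (2 * v i ^ 2)" using that by (intro pb)
        finally show ?thesis using True eq by (auto simp: power2_eq_square)
      next
        case False
        then have "(\<Prod>q<m. ?v q) = (\<Prod>q<m. of_real (v q) ^ of_bool (q = i) * of_real (v q) ^ of_bool (q = k))"
          unfolding ab[symmetric] by (intro prod.cong refl) auto
        also have "\<dots> = of_real (v i) * of_real (v k)" unfolding prod.distrib using that by (simp add: pb)
        finally show ?thesis using False eq by auto
      qed
    next
      case False
      then have "?a i \<noteq> ?b i \<or> ?a k \<noteq> ?b k" by (auto simp: of_bool_def split: if_splits)
      then obtain q where "q < m" "?a q \<noteq> ?b q" using ik by blast
      then have "(\<Prod>q<m. ?v q) = 0" by (intro prod_zero bexI[of _ q]) simp_all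
      moreover have "of_bool (i = j) * of_bool (k = l) + of_bool (i = l) * of_bool (k = j) = (0::complex)"
        using False by (cases "i = j"; cases "i = l") simp_all
      ultimately show ?thesis by simp
    qed
    have "(\<Prod>q<m. cnj (w q x) ^ ?a q * w q x ^ ?b q) = cnj (w i x) * w j x * (cnj (w k x) * w l x)" for x
      unfolding power_add prod.distrib using that by (simp add: pb)
    then show ?thesis using H[of ?a ?b] unfolding val by simp
  qed
qed

lemma mtr_mmul_rect: "mtr n (A \<odot>\<^bsub>m\<^esub> B) = mtr m (B \<odot>\<^bsub>n\<^esub> A)"
  unfolding mtr_def mmul_def by (subst sum.swap) (simp add: mult.commute)

text \<open>In the independent coordinates the two pairings of the fourth moment give the product of
  the means and the trace of \<open>B R B' R\<close>. The factor \<open>A\<close> may be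
  rectangular: it is the mixing matrix of sources and noise for snapshots, and a square triangular
  factor for densities.\<close>

lemma qform_moments:
  fixes w :: "nat \<Rightarrow> 'v \<Rightarrow> complex" and h :: "'v \<Rightarrow> complex"
  assumes H: "\<And>a b. (\<And>k. k < m \<Longrightarrow> a k \<le> 2) \<Longrightarrow> (\<And>k. k < m \<Longrightarrow> b k \<le> 2) \<Longrightarrow>
      has_bochner_integral N (\<lambda>x. (\<Prod>k<m. cnj (w k x) ^ a k * w k x ^ b k) * h x)
        (\<Prod>k<m. if a k = b k then of_real (fact (a k) * v k ^ a k) else 0)"
    and y: "\<And>x p. p < n \<Longrightarrow> y x p = (\<Sum>k<m. A p k * w k x)"
  defines "R \<equiv> A \<odot>\<^bsub>m\<^esub> diagm m v \<odot>\<^bsub>m\<^esub> adjm A"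
  shows qform_moment1: "has_bochner_integral N (\<lambda>x. qform n B (y x) * h x) (mtr n (B \<odot>\<^bsub>n\<^esub> R))"
    and qform_moment2: "has_bochner_integral N (\<lambda>x. qform n B (y x) * qform n B' (y x) * h x)
       (mtr n (B \<odot>\<^bsub>n\<^esub> R) * mtr n (B' \<odot>\<^bsub>n\<^esub> R) + mtr n (B \<odot>\<^bsub>n\<^esub> R \<odot>\<^bsub>n\<^esub> B' \<odot>\<^bsub>n\<^esub> R))"
proof -
  \<comment> \<open>The matrix of the form in the independent coordinates,
    \<open>A^* B A\<close>.\<close>
  define G where "G B = adjm A \<odot>\<^bsub>n\<^esub> B \<odot>\<^bsub>n\<^esub> adjm (adjm A)" for B
  let ?D = "diagm m v"
  have q: "qform n B (y x) = (\<Sum>i<m. \<Sum>j<m. G B i j * (cnj (w i x) * w j x))" for B x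
  proof -
    have "qform n B (y x) = qform n B (\<lambda>p. \<Sum>k<m. cnj (adjm A k p) * w k x)"
      by (rule qform_cong) (auto simp: y adjm_def)
    also have "\<dots> = qform m (G B) (\<lambda>k. w k x)" unfolding G_def by (rule qform_congruence[symmetric])
    also have "\<dots> = (\<Sum>i<m. \<Sum>j<m. G B i j * (cnj (w i x) * w j x))"
      unfolding qform_def by (simp add: mult_ac)
    finally show ?thesis .
  qed
  note fm = fourth_moment_product[of m N w h v, OF H]
  have tr1: "mtr m (G B \<odot>\<^bsub>m\<^esub> ?D) = mtr n (B \<odot>\<^bsub>n\<^esub> R)" for B
  proof -
    have "mtr m (G B \<odot>\<^bsub>m\<^esub> ?D) = mtr m (adjm A \<odot>\<^bsub>n\<^esub> (B \<odot>\<^bsub>n\<^esub> A \<odot>\<^bsub>m\<^esub> ?D))"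
      unfolding G_def by (simp add: mmul_assoc)
    also have "\<dots> = mtr n ((B \<odot>\<^bsub>n\<^esub> A \<odot>\<^bsub>m\<^esub> ?D) \<odot>\<^bsub>m\<^esub> adjm A)" by (rule mtr_mmul_rect)
    finally show ?thesis unfolding R_def by (simp add: mmul_assoc)
  qed
  have tr2: "mtr m (G B \<odot>\<^bsub>m\<^esub> ?D \<odot>\<^bsub>m\<^esub> G B' \<odot>\<^bsub>m\<^esub> ?D) = mtr n (B \<odot>\<^bsub>n\<^esub> R \<odot>\<^bsub>n\<^esub> B' \<odot>\<^bsub>n\<^esub> R)"
  proof -
    have "mtr m (G B \<odot>\<^bsub>m\<^esub> ?D \<odot>\<^bsub>m\<^esub> G B' \<odot>\<^bsub>m\<^esub> ?D)
      = mtr m (adjm A \<odot>\<^bsub>n\<^esub> (B \<odot>\<^bsub>n\<^esub> A \<odot>\<^bsub>m\<^esub> ?D \<odot>\<^bsub>m\<^esub> adjm A \<odot>\<^bsub>n\<^esub> B' \<odot>\<^bsub>n\<^esub> A \<odot>\<^bsub>m\<^esub> ?D))"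
      unfolding G_def by (simp add: mmul_assoc)
    also have "\<dots> = mtr n ((B \<odot>\<^bsub>n\<^esub> A \<odot>\<^bsub>m\<^esub> ?D \<odot>\<^bsub>m\<^esub> adjm A \<odot>\<^bsub>n\<^esub> B' \<odot>\<^bsub>n\<^esub> A \<odot>\<^bsub>m\<^esub> ?D) \<odot>\<^bsub>m\<^esub> adjm A)" by (rule mtr_mmul_rect)
    finally show ?thesis unfolding R_def by (simp add: mmul_assoc)
  qed
  have trD: "mtr m (X \<odot>\<^bsub>m\<^esub> ?D) = (\<Sum>i<m. X i i * of_real (v i))" for X
    unfolding mtr_def mmul_diagm by simp
  have "has_bochner_integral N (\<lambda>x. \<Sum>i<m. \<Sum>j<m. G B i j * (cnj (w i x) * w j x * h x))
    (\<Sum>i<m. \<Sum>j<m. G B i j * (of_real (v i) * of_bool (i = j)))"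
    by (intro has_bochner_integral_sum has_bochner_integral_mult_right fm(2)) auto
  also have "(\<Sum>i<m. \<Sum>j<m. G B i j * (of_real (v i) * of_bool (i = j))) = mtr m (G B \<odot>\<^bsub>m\<^esub> ?D)"
    unfolding trD of_bool_def by (simp add: if_distrib[of "\<lambda>x. _ * x"] cong: if_cong)
  finally show "has_bochner_integral N (\<lambda>x. qform n B (y x) * h x) (mtr n (B \<odot>\<^bsub>n\<^esub> R))"
    unfolding q tr1 by (simp add: sum_distrib_right mult.assoc)
  have "has_bochner_integral N (\<lambda>x. \<Sum>i<m. \<Sum>j<m. \<Sum>k<m. \<Sum>l<m. (G B i j * G B' k l) * (cnj (w i x) * w j x * (cnj (w k x) * w l x) * h x))
    (\<Sum>i<m. \<Sum>j<m. \<Sum>k<m. \<Sum>l<m. (G B i j * G B' k l) * (of_real (v i * v k) * (of_bool (i = j) * of_bool (k = l) + of_bool (i = l) * of_bool (k = j))))"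
    by (intro has_bochner_integral_sum has_bochner_integral_mult_right fm(1)) auto
  also have "(\<lambda>x. \<Sum>i<m. \<Sum>j<m. \<Sum>k<m. \<Sum>l<m. (G B i j * G B' k l) * (cnj (w i x) * w j x * (cnj (w k x) * w l x) * h x))
    = (\<lambda>x. qform n B (y x) * qform n B' (y x) * h x)"
  proof
    fix x
    have 1: "qform n B (y x) * c = (\<Sum>i<m. \<Sum>j<m. G B i j * (cnj (w i x) * w j x) * c)" for c
      unfolding q sum_distrib_right ..
    have 2: "G B i j * (cnj (w i x) * w j x) * (qform n B' (y x) * h x) =
      (\<Sum>k<m. \<Sum>l<m. (G B i j * G B' k l) * (cnj (w i x) * w j x * (cnj (w k x) * w l x) * h x))" for i j
      unfolding q sum_distrib_right sum_distrib_left by (simp add: mult_ac)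
    show "(\<Sum>i<m. \<Sum>j<m. \<Sum>k<m. \<Sum>l<m. (G B i j * G B' k l) * (cnj (w i x) * w j x * (cnj (w k x) * w l x) * h x))
       = qform n B (y x) * qform n B' (y x) * h x"
      unfolding mult.assoc[of "qform n B (y x)"] unfolding 1 unfolding 2 ..
  qed
  also have "(\<Sum>i<m. \<Sum>j<m. \<Sum>k<m. \<Sum>l<m. (G B i j * G B' k l) * (of_real (v i * v k) * (of_bool (i = j) * of_bool (k = l) + of_bool (i = l) * of_bool (k = j))))
    = (\<Sum>i<m. \<Sum>k<m. G B i i * of_real (v i) * (G B' k k * of_real (v k)) + G B i k * of_real (v k) * (G B' k i * of_real (v i)))"
  proof (rule sum.cong[OF refl])
    fix i assume i: "i \<in> {..<m}"
    have inner: "(\<Sum>j<m. \<Sum>l<m. (G B i j * G B' k l) * (of_real (v i * v k) * (of_bool (i = j) * of_bool (k = l) + of_bool (i = l) * of_bool (k = j))))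
      = G B i i * of_real (v i) * (G B' k k * of_real (v k)) + G B i k * of_real (v k) * (G B' k i * of_real (v i))" if k: "k \<in> {..<m}" for k
    proof -
      have "(\<Sum>j<m. \<Sum>l<m. (G B i j * G B' k l) * (of_real (v i * v k) * (of_bool (i = j) * of_bool (k = l) + of_bool (i = l) * of_bool (k = j))))
       = (\<Sum>j<m. \<Sum>l<m. (if l = k then (if j = i then G B i j * G B' k l * of_real (v i * v k) else 0) else 0))
       + (\<Sum>j<m. \<Sum>l<m. (if l = i then (if j = k then G B i j * G B' k l * of_real (v i * v k) else 0) else 0))"
        unfolding sum.distrib[symmetric] by (intro sum.cong refl) auto
      also have "\<dots> = G B i i * G B' k k * of_real (v i * v k) + G B i k * G B' k i * of_real (v i * v k)"
        using i k by simp
      finally show ?thesis by (simp add: mult_ac)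
    qed
    show "(\<Sum>j<m. \<Sum>k<m. \<Sum>l<m. (G B i j * G B' k l) * (of_real (v i * v k) * (of_bool (i = j) * of_bool (k = l) + of_bool (i = l) * of_bool (k = j))))
      = (\<Sum>k<m. G B i i * of_real (v i) * (G B' k k * of_real (v k)) + G B i k * of_real (v k) * (G B' k i * of_real (v i)))"
      by (subst sum.swap) (intro sum.cong refl inner)
  qed
  also have "\<dots> = mtr m (G B \<odot>\<^bsub>m\<^esub> ?D) * mtr m (G B' \<odot>\<^bsub>m\<^esub> ?D) + mtr m (G B \<odot>\<^bsub>m\<^esub> ?D \<odot>\<^bsub>m\<^esub> G B' \<odot>\<^bsub>m\<^esub> ?D)"
  proof -
    have "mmul m (G B \<odot>\<^bsub>m\<^esub> ?D) (G B' \<odot>\<^bsub>m\<^esub> ?D) i i = (\<Sum>k<m. G B i k * of_real (v k) * (G B' k i * of_real (v i)))" if "i < m" for i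
      unfolding mmul_diagm mmul_def[of m "\<lambda>i j. if j < m then G B i j * of_real (v j) else 0"] using that by simp
    then have "mtr m (G B \<odot>\<^bsub>m\<^esub> ?D \<odot>\<^bsub>m\<^esub> G B' \<odot>\<^bsub>m\<^esub> ?D) = (\<Sum>i<m. \<Sum>k<m. G B i k * of_real (v k) * (G B' k i * of_real (v i)))"
      unfolding mtr_def by (simp add: mmul_assoc)
    then show ?thesis unfolding trD by (simp add: sum.distrib sum_product)
  qed
  finally show "has_bochner_integral N (\<lambda>x. qform n B (y x) * qform n B' (y x) * h x)
       (mtr n (B \<odot>\<^bsub>n\<^esub> R) * mtr n (B' \<odot>\<^bsub>n\<^esub> R) + mtr n (B \<odot>\<^bsub>n\<^esub> R \<odot>\<^bsub>n\<^esub> B' \<odot>\<^bsub>n\<^esub> R))"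
    unfolding tr1 tr2 .
qed

subsection \<open>Exponential sums and node polynomials\<close>

lemma poly_sum_coeff: "degree (f :: complex poly) < M \<Longrightarrow> poly f z = (\<Sum>i<M. coeff f i * z ^ i)"
proof -
  assume d: "degree f < M"
  have "(\<Sum>i<M. coeff f i * z ^ i) = (\<Sum>i\<le>degree f. coeff f i * z ^ i)"
    by (rule sum.mono_neutral_right) (use d in \<open>auto simp: coeff_eq_0 not_le\<close>)
  then show ?thesis by (simp add: poly_altdef)
qed

text \<open>Its coefficients serve as test vectors: pairing a sum of exponentials with them
  evaluates the polynomial at the nodes.\<close>

definition node_poly :: "(nat \<Rightarrow> complex) \<Rightarrow> nat set \<Rightarrow> complex poly"
  where "node_poly z S = (\<Prod>k\<in>S. [:- z k, 1:])"

lemma poly_node_poly: "finite S \<Longrightarrow> poly (node_poly z S) x = (\<Prod>k\<in>S. x - z k)"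
  unfolding node_poly_def poly_prod by simp

lemma degree_node_poly: "finite S \<Longrightarrow> degree (node_poly z S) = card S"
  unfolding node_poly_def by (subst degree_prod_eq_sum_degree) auto

lemma node_poly_nonzero: "finite S \<Longrightarrow> node_poly z S \<noteq> 0"
  unfolding node_poly_def by simp

lemma poly_node_poly_zero: "finite S \<Longrightarrow> k \<in> S \<Longrightarrow> poly (node_poly z S) (z k) = 0"
  by (auto simp: poly_node_poly)

lemma poly_node_poly_nonzero:
  "finite S \<Longrightarrow> inj_on z (insert k S) \<Longrightarrow> k \<notin> S \<Longrightarrow> poly (node_poly z S) (z k) \<noteq> 0"
  by (auto simp: poly_node_poly inj_on_def)

lemma node_poly_coeff_pos: "finite S \<Longrightarrow> card S < M \<Longrightarrow> (\<Sum>i<M. (cmod (coeff (node_poly z S) i))\<^sup>2) > 0"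
proof -
  assume S: "finite S" "card S < M"
  have "coeff (node_poly z S) (degree (node_poly z S)) \<noteq> 0" using node_poly_nonzero[OF S(1)] by simp
  then show ?thesis
    by (intro sum_pos2[of _ "degree (node_poly z S)"]) (use S in \<open>auto simp: degree_node_poly\<close>)
qed

text \<open>Contracting with coefficient vectors evaluates at the nodes; a factor \<open>i\<close>
  acts as the operator \<open>z d/dz\<close> on \<open>f\<close> and a factor \<open>j\<close> as
  the conjugate one on \<open>g\<close>, so frequency directions show up as derivatives.\<close>

lemma exp_sum_pairing:
  fixes z :: "'k \<Rightarrow> complex"
  assumes "finite I" "degree f < M" "degree g < M"
  shows "(\<Sum>i<M. \<Sum>j<M. coeff f i * cnj (coeff g j) * (\<Sum>k\<in>I. (a k + b k * (of_nat i - of_nat j)) * (z k ^ i * cnj (z k) ^ j)))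
    = (\<Sum>k\<in>I. a k * (poly f (z k) * cnj (poly g (z k))) +
         b k * (z k * poly (pderiv f) (z k) * cnj (poly g (z k)) - poly f (z k) * cnj (z k * poly (pderiv g) (z k))))"
proof -
  have der: "x * poly (pderiv h) x = (\<Sum>i<M. of_nat i * coeff h i * x ^ i)" if "degree h < M" for h :: "complex poly" and x
  proof -
    have "degree (pCons 0 (pderiv h)) < M" using that
      by (cases "pderiv h = 0") (auto simp: degree_pderiv pderiv_eq_0_iff)
    then have "poly (pCons 0 (pderiv h)) x = (\<Sum>i<M. coeff (pCons 0 (pderiv h)) i * x ^ i)" by (rule poly_sum_coeff)
    also have "\<dots> = (\<Sum>i<M. of_nat i * coeff h i * x ^ i)"
      by (intro sum.cong refl) (auto simp: coeff_pCons coeff_pderiv split: nat.splits)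
    finally show ?thesis by simp
  qed
  have tm: "(\<Sum>i<M. \<Sum>j<M. coeff f i * cnj (coeff g j) * ((a k + b k * (of_nat i - of_nat j)) * (z k ^ i * cnj (z k) ^ j)))
    = a k * (poly f (z k) * cnj (poly g (z k))) +
         b k * (z k * poly (pderiv f) (z k) * cnj (poly g (z k)) - poly f (z k) * cnj (z k * poly (pderiv g) (z k)))" for k
  proof -
    let ?F = "\<lambda>i. coeff f i * z k ^ i" and ?G = "\<lambda>j. cnj (coeff g j * z k ^ j)"
    have 1: "poly f (z k) * cnj (poly g (z k)) = (\<Sum>i<M. \<Sum>j<M. ?F i * ?G j)"
      unfolding poly_sum_coeff[OF assms(2)] poly_sum_coeff[OF assms(3)] cnj_sum by (rule sum_product)
    have 2: "z k * poly (pderiv f) (z k) * cnj (poly g (z k)) = (\<Sum>i<M. \<Sum>j<M. of_nat i * ?F i * ?G j)"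
      unfolding der[OF assms(2)] poly_sum_coeff[OF assms(3)] cnj_sum sum_product by (simp add: mult.assoc)
    have 3: "poly f (z k) * cnj (z k * poly (pderiv g) (z k)) = (\<Sum>i<M. \<Sum>j<M. of_nat j * ?F i * ?G j)"
      unfolding der[OF assms(3)] poly_sum_coeff[OF assms(2)] cnj_sum sum_product by (simp add: mult_ac)
    show ?thesis unfolding 1 2 3 sum_subtractf[symmetric] sum_distrib_left sum.distrib[symmetric]
      by (intro sum.cong refl) (simp add: algebra_simps)
  qed
  have "(\<Sum>i<M. \<Sum>j<M. coeff f i * cnj (coeff g j) * (\<Sum>k\<in>I. (a k + b k * (of_nat i - of_nat j)) * (z k ^ i * cnj (z k) ^ j)))
    = (\<Sum>i<M. \<Sum>j<M. \<Sum>k\<in>I. coeff f i * cnj (coeff g j) * ((a k + b k * (of_nat i - of_nat j)) * (z k ^ i * cnj (z k) ^ j)))"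
    by (simp add: sum_distrib_left)
  also have "\<dots> = (\<Sum>i<M. \<Sum>k\<in>I. \<Sum>j<M. coeff f i * cnj (coeff g j) * ((a k + b k * (of_nat i - of_nat j)) * (z k ^ i * cnj (z k) ^ j)))"
    by (rule sum.cong[OF refl], rule sum.swap)
  also have "\<dots> = (\<Sum>k\<in>I. \<Sum>i<M. \<Sum>j<M. coeff f i * cnj (coeff g j) * ((a k + b k * (of_nat i - of_nat j)) * (z k ^ i * cnj (z k) ^ j)))"
    by (rule sum.swap)
  also have "\<dots> = (\<Sum>k\<in>I. a k * (poly f (z k) * cnj (poly g (z k))) +
         b k * (z k * poly (pderiv f) (z k) * cnj (poly g (z k)) - poly f (z k) * cnj (z k * poly (pderiv g) (z k))))"
    by (rule sum.cong[OF refl], rule tm)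
  finally show ?thesis .
qed

text \<open>Hermite-type independence: pairing with the node polynomial, which has a double zero in
  modulus at every node, first kills the mean value.\<close>

lemma exp_sum_independent:
  fixes z :: "nat \<Rightarrow> complex" and a b :: "nat \<Rightarrow> complex"
  assumes inj: "inj_on z {..<K}" and KM: "Suc K = M" and z0: "\<And>k. k < K \<Longrightarrow> z k \<noteq> 0"
    and zero: "\<And>i j. i < M \<Longrightarrow> j < M \<Longrightarrow> i \<noteq> j \<Longrightarrow>
      (\<Sum>k<K. (a k + b k * (of_nat i - of_nat j)) * (z k ^ i * cnj (z k) ^ j)) = 0"
    and unit: "\<And>k. k < K \<Longrightarrow> cmod (z k) = 1"
  shows "\<And>k. k < K \<Longrightarrow> a k = 0" "\<And>k. k < K \<Longrightarrow> b k = 0"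
proof -
  let ?P = "node_poly z {..<K}" and ?Q = "\<lambda>k. node_poly z ({..<K} - {k})"
  have dP: "degree ?P < M" using KM by (simp add: degree_node_poly)
  have dQ: "degree (?Q k) < M" if "k < K" for k using KM that by (simp add: degree_node_poly)
  \<comment> \<open>The hypothesis concerns only \<open>i \<noteq> j\<close>. Unit modulus makes all
    diagonal entries equal to the sum of the \<open>a k\<close>, the one remaining unknown.\<close>
  have T: "(\<Sum>k<K. (a k + b k * (of_nat i - of_nat j)) * (z k ^ i * cnj (z k) ^ j)) = (if i = j then sum a {..<K} else 0)"
    if "i < M" "j < M" for i j
  proof (cases "i = j")
    case True
    have "z k ^ i * cnj (z k) ^ i = 1" if "k < K" for k
      using unit[OF that] by (simp add: power_mult_distrib[symmetric] complex_norm_square[symmetric])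
    then show ?thesis using True by (simp add: mult.assoc)
  qed (use zero that in simp)
  have pair: "sum a {..<K} * (\<Sum>i<M. coeff f i * cnj (coeff g i)) = (\<Sum>k<K. a k * (poly f (z k) * cnj (poly g (z k))) +
         b k * (z k * poly (pderiv f) (z k) * cnj (poly g (z k)) - poly f (z k) * cnj (z k * poly (pderiv g) (z k))))"
    if "degree f < M" "degree g < M" for f g
  proof -
    have "(\<Sum>i<M. \<Sum>j<M. coeff f i * cnj (coeff g j) * (\<Sum>k<K. (a k + b k * (of_nat i - of_nat j)) * (z k ^ i * cnj (z k) ^ j)))
      = (\<Sum>i<M. \<Sum>j<M. if j = i then coeff f i * cnj (coeff g i) * sum a {..<K} else 0)"
      by (intro sum.cong refl) (auto simp: T)
    also have "\<dots> = sum a {..<K} * (\<Sum>i<M. coeff f i * cnj (coeff g i))"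
      by (simp add: sum_distrib_left mult_ac)
    finally show ?thesis using exp_sum_pairing[OF _ that, of "{..<K}" a b z] by simp
  qed
  \<comment> \<open>Pairing the node polynomial with itself: every term at the nodes contains a
    zero, whereas the diagonal contributes the positive squared norm of the coefficients.\<close>
  have "sum a {..<K} * (\<Sum>i<M. coeff ?P i * cnj (coeff ?P i)) = 0"
    unfolding pair[OF dP dP] by (simp add: poly_node_poly_zero)
  moreover have "(\<Sum>i<M. coeff ?P i * cnj (coeff ?P i)) = of_real (\<Sum>i<M. (cmod (coeff ?P i))\<^sup>2)"
    by (simp add: complex_norm_square del: of_real_power)
  ultimately have "sum a {..<K} = 0 \<or> (\<Sum>i<M. (cmod (coeff ?P i))\<^sup>2) = 0"
    by (simp only: mult_eq_0_iff of_real_eq_0_iff)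
  then have A0: "sum a {..<K} = 0" using node_poly_coeff_pos[of "{..<K}" M z] KM by auto
  have nz: "poly (?Q k) (z k) \<noteq> 0" if "k < K" for k
    by (rule poly_node_poly_nonzero) (use inj that in \<open>auto simp: insert_absorb\<close>)
  have zz: "poly (?Q k) (z l) = 0" if "k < K" "l < K" "l \<noteq> k" for k l
    by (rule poly_node_poly_zero) (use that in auto)
  show b: "b k = 0" if k: "k < K" for k
  proof -
    \<comment> \<open>Pairing the node polynomial with the one lacking node \<open>k\<close> leaves
      only \<open>b k\<close>, since the derivative of the former at \<open>z k\<close> is the value
      of the latter.\<close>
    have PQ: "?P = [:- z k, 1:] * ?Q k" unfolding node_poly_def
      by (subst prod.remove[of _ k]) (use k in auto)
    have d: "poly (pderiv ?P) (z k) = poly (?Q k) (z k)" unfolding PQ pderiv_mult by simp (simp add: pderiv_pCons)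
    have "0 = (\<Sum>l<K. b l * (z l * poly (pderiv ?P) (z l) * cnj (poly (?Q k) (z l))))"
      using pair[OF dP dQ[OF k]] A0 by (simp add: poly_node_poly_zero)
    also have "\<dots> = (\<Sum>l<K. if l = k then b k * (z k * poly (pderiv ?P) (z k) * cnj (poly (?Q k) (z k))) else 0)"
      using zz[OF k] by (intro sum.cong refl) auto
    also have "\<dots> = b k * (z k * poly (?Q k) (z k) * cnj (poly (?Q k) (z k)))" using k d by simp
    finally show ?thesis using nz[OF k] z0[OF k] by simp
  qed
  show "a k = 0" if k: "k < K" for k
  proof -
    \<comment> \<open>With the \<open>b\<close> terms gone, the polynomial lacking node
      \<open>k\<close> is paired with itself and isolates \<open>a k\<close>.\<close>
    have "0 = (\<Sum>l<K. a l * (poly (?Q k) (z l) * cnj (poly (?Q k) (z l))))"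
      using pair[OF dQ[OF k] dQ[OF k]] A0 b by simp
    also have "\<dots> = (\<Sum>l<K. if l = k then a k * (poly (?Q k) (z k) * cnj (poly (?Q k) (z k))) else 0)"
      using zz[OF k] by (intro sum.cong refl) auto
    also have "\<dots> = a k * (poly (?Q k) (z k) * cnj (poly (?Q k) (z k)))" using k by simp
    finally show ?thesis using nz[OF k] by simp
  qed
qed

lemma exp_sum_quadratic:
  fixes z :: "'k \<Rightarrow> complex"
  assumes "finite I" "degree f < M"
  shows "(\<Sum>i<M. \<Sum>j<M. coeff f i * cnj (coeff f j) * (\<Sum>k\<in>I. complex_of_real (p k) * (z k ^ i * cnj (z k) ^ j)))
    = of_real (\<Sum>k\<in>I. p k * (cmod (poly f (z k)))\<^sup>2)"
  using exp_sum_pairing[OF assms(1,2,2), of "\<lambda>k. of_real (p k)" "\<lambda>_. 0" z]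
  by (simp add: complex_norm_square del: of_real_power)

text \<open>As \<open>K < M\<close>, the node polynomial is an admissible test vector and the form
  vanishes at it; positivity of the other weights forces their nodes among its roots. Omitting one
  root isolates a single node and compares the weights, which also shows that no node is
  lost.\<close>

lemma vandermonde_unique:
  fixes z :: "nat \<Rightarrow> complex" and zt :: "'k \<Rightarrow> complex"
  assumes inj: "inj_on z {..<K}" and KM: "Suc K = M" and fin: "finite I" and injt: "inj_on zt I"
    and p: "\<And>k. k < K \<Longrightarrow> 0 < p k" and pt: "\<And>k. k \<in> I \<Longrightarrow> 0 < pt k"
    and eq: "\<And>i j. i < M \<Longrightarrow> j < M \<Longrightarrow> (\<Sum>k\<in>I. complex_of_real (pt k) * (zt k ^ i * cnj (zt k) ^ j)) =
       (\<Sum>k<K. complex_of_real (p k) * (z k ^ i * cnj (z k) ^ j))"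
  shows "zt ` I = z ` {..<K}" "\<And>k l. k \<in> I \<Longrightarrow> l < K \<Longrightarrow> zt k = z l \<Longrightarrow> pt k = p l"
proof -
  let ?P = "node_poly z {..<K}" and ?Q = "\<lambda>k. node_poly z ({..<K} - {k})"
  have dP: "degree ?P < M" using KM by (simp add: degree_node_poly)
  have dQ: "degree (?Q k) < M" if "k < K" for k using KM that by (simp add: degree_node_poly)
  have q: "(\<Sum>k\<in>I. pt k * (cmod (poly f (zt k)))\<^sup>2) = (\<Sum>k<K. p k * (cmod (poly f (z k)))\<^sup>2)" if "degree f < M" for f
  proof -
    have "complex_of_real (\<Sum>k\<in>I. pt k * (cmod (poly f (zt k)))\<^sup>2) = of_real (\<Sum>k<K. p k * (cmod (poly f (z k)))\<^sup>2)"
      unfolding exp_sum_quadratic[OF fin that, symmetric] exp_sum_quadratic[OF finite_lessThan that, symmetric]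
      by (intro sum.cong refl arg_cong2[where f=times] eq) auto
    then show ?thesis unfolding of_real_eq_iff .
  qed
  have "(\<Sum>k\<in>I. pt k * (cmod (poly ?P (zt k)))\<^sup>2) = 0"
    unfolding q[OF dP] by (simp add: poly_node_poly_zero)
  then have "\<forall>k\<in>I. pt k * (cmod (poly ?P (zt k)))\<^sup>2 = 0"
    using fin pt by (subst (asm) sum_nonneg_eq_0_iff) (auto intro!: mult_nonneg_nonneg simp: less_imp_le)
  then have roots: "zt k \<in> z ` {..<K}" if "k \<in> I" for k
    using pt[OF that] that by (fastforce simp: poly_node_poly)
  have nz: "poly (?Q k) (z k) \<noteq> 0" if "k < K" for k
    by (rule poly_node_poly_nonzero) (use inj that in \<open>auto simp: insert_absorb\<close>)
  have zz: "poly (?Q k) (z l) = 0" if "k < K" "l < K" "l \<noteq> k" for k l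
    by (rule poly_node_poly_zero) (use that in auto)
  have val: "(\<Sum>l\<in>I. pt l * (cmod (poly (?Q k) (zt l)))\<^sup>2) = p k * (cmod (poly (?Q k) (z k)))\<^sup>2" if k: "k < K" for k
  proof -
    have "(\<Sum>l<K. p l * (cmod (poly (?Q k) (z l)))\<^sup>2) = (\<Sum>l<K. if l = k then p k * (cmod (poly (?Q k) (z k)))\<^sup>2 else 0)"
      using zz[OF k] by (intro sum.cong refl) auto
    then show ?thesis unfolding q[OF dQ[OF k]] using k by simp
  qed
  have ex: "\<exists>l\<in>I. zt l = z k" if k: "k < K" for k
  proof (rule ccontr)
    assume "\<not> ?thesis"
    then have "poly (?Q k) (zt l) = 0" if "l \<in> I" for l using roots[OF that] zz[OF k] that by force
    then have "p k * (cmod (poly (?Q k) (z k)))\<^sup>2 = 0" using val[OF k] by simp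
    then show False using p[OF k] nz[OF k] by simp
  qed
  show "zt ` I = z ` {..<K}" using roots ex by force
  fix k l assume kl: "k \<in> I" "l < K" "zt k = z l"
  have "(\<Sum>m\<in>I. pt m * (cmod (poly (?Q l) (zt m)))\<^sup>2) = (\<Sum>m\<in>I. if m = k then pt k * (cmod (poly (?Q l) (z l)))\<^sup>2 else 0)"
  proof (intro sum.cong refl)
    fix m assume m: "m \<in> I"
    show "pt m * (cmod (poly (?Q l) (zt m)))\<^sup>2 = (if m = k then pt k * (cmod (poly (?Q l) (z l)))\<^sup>2 else 0)"
    proof (cases "m = k")
      case False
      then have "zt m \<noteq> z l" using injt m kl by (auto simp: inj_on_def)
      then have "poly (?Q l) (zt m) = 0" using roots[OF m] zz[OF kl(2)] by force
      then show ?thesis using False by simp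
    qed (use kl in simp)
  qed
  then show "pt k = p l" using val[OF kl(2)] kl fin nz[OF kl(2)] by simp
qed

text \<open>A positive sum of \<open>K = M - 1\<close> exponentials is semidefinite and singular, so
  the shift is the least eigenvalue.\<close>

lemma lmin_shifted_exp_sum:
  fixes z :: "nat \<Rightarrow> complex"
  assumes KM: "Suc K = M" and p: "\<And>k. k < K \<Longrightarrow> 0 \<le> p k"
    and T: "\<And>i j. i < M \<Longrightarrow> j < M \<Longrightarrow> T i j = (\<Sum>k<K. complex_of_real (p k) * (z k ^ i * cnj (z k) ^ j)) + (if i = j then of_real c else 0)"
    and s: "msupp M T"
  shows "lmin M T = c"
proof -
  have Tv: "(\<Sum>j<M. T i j * v j) = (\<Sum>k<K. complex_of_real (p k) * z k ^ i * (\<Sum>j<M. cnj (z k) ^ j * v j)) + of_real c * v i"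
    if i: "i < M" for i v
  proof -
    have "(\<Sum>j<M. T i j * v j) = (\<Sum>j<M. (\<Sum>k<K. complex_of_real (p k) * z k ^ i * (cnj (z k) ^ j * v j)) + (if j = i then of_real c * v i else 0))"
      using i by (intro sum.cong refl) (auto simp: T sum_distrib_right sum_distrib_left algebra_simps)
    also have "\<dots> = (\<Sum>k<K. complex_of_real (p k) * z k ^ i * (\<Sum>j<M. cnj (z k) ^ j * v j)) + of_real c * v i"
      using i by (simp add: sum.distrib sum_distrib_left) (rule sum.swap)
    finally show ?thesis .
  qed
  have herm: "hermitian M T"
    unfolding hermitian_def by (auto simp: T mult_ac)
  \<comment> \<open>The eigenvalue set is a \<open>Min\<close> argument in \<open>lmin\<close>, so
    its finiteness has to be proved; the spectral theorem places it among the diagonal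
    entries.\<close>
  have fin: "finite {x. \<exists>v. (\<exists>i<M. v i \<noteq> 0) \<and> (\<forall>i<M. (\<Sum>j<M. T i j * v j) = complex_of_real x * v i)}" (is "finite ?E")
  proof -
    obtain U l where U: "msupp M U" "adjm U \<odot>\<^bsub>M\<^esub> U = eye M" "U \<odot>\<^bsub>M\<^esub> adjm U = eye M"
      "T = U \<odot>\<^bsub>M\<^esub> diagm M l \<odot>\<^bsub>M\<^esub> adjm U" by (rule hermitian_spectral[OF herm s])
    have "?E \<subseteq> l ` {..<M}"
    proof safe
      fix x v i assume v: "i < M" "v i \<noteq> 0" "\<forall>i<M. (\<Sum>j<M. T i j * v j) = complex_of_real x * v i"
      define w where "w = mvec M (adjm U) v"
      have Uw: "mvec M U w i = v i" if "i < M" for i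
      proof -
        have "mvec M U w i = mvec M (eye M) v i" unfolding w_def mvec_mmul[symmetric] U ..
        then show ?thesis using that by (simp add: mvec_def eye_def if_distrib[of "\<lambda>x. x * _"] cong: if_cong)
      qed
      have "\<exists>k<M. w k \<noteq> 0"
      proof (rule ccontr)
        assume "\<not> ?thesis"
        then have "mvec M U w i = 0" using v(1) by (simp add: mvec_def)
        then show False using Uw[OF v(1)] v(2) by simp
      qed
      then obtain k where k: "k < M" "w k \<noteq> 0" by blast
      have Tm: "mvec M T v j = complex_of_real x * v j" if "j < M" for j using v(3) that by (simp add: mvec_def)
      have "adjm U \<odot>\<^bsub>M\<^esub> T = (adjm U \<odot>\<^bsub>M\<^esub> U) \<odot>\<^bsub>M\<^esub> (diagm M l \<odot>\<^bsub>M\<^esub> adjm U)"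
        by (subst U(4)) (simp add: mmul_assoc)
      then have UT: "adjm U \<odot>\<^bsub>M\<^esub> T = diagm M l \<odot>\<^bsub>M\<^esub> adjm U"
        unfolding U(2) by (simp add: mmul_eye_left msupp_mmul msupp_diagm msupp_adjm U(1))
      have "mvec M (adjm U) (mvec M T v) k = of_real (l k) * w k"
        unfolding mvec_mmul[symmetric] UT diagm_mmul w_def using k(1) by (simp add: mvec_def sum_distrib_left mult.assoc)
      moreover have "mvec M (adjm U) (mvec M T v) k = complex_of_real x * w k"
        using k(1) Tm unfolding w_def by (simp add: mvec_def[of M "adjm U"] sum_distrib_left mult_ac)
      ultimately show "x \<in> l ` {..<M}" using k by auto
    qed
    then show ?thesis by (rule finite_subset) simp
  qed
  let ?P = "node_poly z {..<K}"
  have dP: "degree ?P < M" using KM by (simp add: degree_node_poly)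
  \<comment> \<open>Conjugated coefficients of the node polynomial span the kernel of the unshifted
    sum.\<close>
  let ?v = "\<lambda>j. cnj (coeff ?P j)"
  have "(\<Sum>j<M. cnj (z k) ^ j * ?v j) = 0" if "k < K" for k
  proof -
    have "(\<Sum>j<M. cnj (z k) ^ j * ?v j) = cnj (poly ?P (z k))"
      unfolding poly_sum_coeff[OF dP] by (simp add: mult.commute)
    then show ?thesis using that by (simp add: poly_node_poly_zero)
  qed
  then have v1: "\<forall>i<M. (\<Sum>j<M. T i j * ?v j) = of_real c * ?v i" by (simp add: Tv)
  have v2: "\<exists>i<M. ?v i \<noteq> 0"
    using dP node_poly_nonzero[of "{..<K}" z] by (intro exI[of _ "degree ?P"]) simp
  have cE: "c \<in> ?E" by (rule CollectI, rule exI[of _ ?v], rule conjI, rule v2, rule v1)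
  have "c \<le> x" if "x \<in> ?E" for x
  proof -
    from that obtain v where v: "\<exists>i<M. v i \<noteq> 0" "\<forall>i<M. (\<Sum>j<M. T i j * v j) = complex_of_real x * v i" by blast
    define n where "n = (\<Sum>i<M. (cmod (v i))\<^sup>2)"
    have n: "n > 0" unfolding n_def using v(1) by (auto intro: sum_pos2)
    have nn: "(\<Sum>i<M. cnj (v i) * v i) = of_real n"
      unfolding n_def by (simp add: complex_norm_square mult.commute del: of_real_power)
    define w where "w k = (\<Sum>j<M. cnj (z k) ^ j * v j)" for k
    have wc: "cnj (w k) = (\<Sum>i<M. cnj (v i) * z k ^ i)" for k unfolding w_def by (simp add: mult.commute)
    have "of_real x * of_real n = (\<Sum>i<M. cnj (v i) * (\<Sum>j<M. T i j * v j))"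
      unfolding nn[symmetric] sum_distrib_left[of "of_real x"] using v(2)
      by (intro sum.cong refl) (simp add: mult_ac)
    also have "\<dots> = (\<Sum>i<M. \<Sum>k<K. of_real (p k) * (cnj (v i) * z k ^ i) * w k) + of_real c * of_real n"
      unfolding nn[symmetric] sum_distrib_left[of "of_real c"] sum.distrib[symmetric]
      by (intro sum.cong refl, simp only: lessThan_iff Tv w_def[symmetric])
         (simp add: distrib_left sum_distrib_left mult_ac)
    also have "(\<Sum>i<M. \<Sum>k<K. of_real (p k) * (cnj (v i) * z k ^ i) * w k) = (\<Sum>k<K. of_real (p k) * cnj (w k) * w k)"
      unfolding wc by (subst sum.swap) (simp add: sum_distrib_left sum_distrib_right mult.assoc)
    also have "\<dots> = of_real (\<Sum>k<K. p k * (cmod (w k))\<^sup>2)"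
      by (simp add: complex_norm_square mult_ac del: of_real_power)
    finally have "complex_of_real (x * n) = of_real ((\<Sum>k<K. p k * (cmod (w k))\<^sup>2) + c * n)" by simp
    then have "x * n = (\<Sum>k<K. p k * (cmod (w k))\<^sup>2) + c * n" unfolding of_real_eq_iff .
    moreover have "0 \<le> (\<Sum>k<K. p k * (cmod (w k))\<^sup>2)" using p by (intro sum_nonneg) auto
    ultimately have "c * n \<le> x * n" by linarith
    then show ?thesis using n by simp
  qed
  then show ?thesis unfolding lmin_def using fin cE by (intro Min_eqI) auto
qed

text \<open>\<open>crank\<close> maximises over independent sets of columns. All \<open>M\<close>
  columns are dependent through the node polynomial; independence of the first \<open>K\<close> is a
  root count for a polynomial of degree below \<open>K\<close> with \<open>K\<close> roots.\<close>

lemma crank_exp_sum: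
  fixes z :: "nat \<Rightarrow> complex"
  assumes KM: "Suc K = M" and inj: "inj_on z {..<K}" and p: "\<And>k. k < K \<Longrightarrow> 0 < p k"
    and T: "\<And>i j. i < M \<Longrightarrow> j < M \<Longrightarrow> T i j = (\<Sum>k<K. complex_of_real (p k) * (z k ^ i * cnj (z k) ^ j))"
  shows "crank M M T = K"
proof -
  let ?ind = "\<lambda>S. \<forall>c. (\<forall>i<M. (\<Sum>j\<in>S. c j * T i j) = 0) \<longrightarrow> (\<forall>j\<in>S. c j = 0)"
  let ?C = "{card S | S. S \<subseteq> {..<M} \<and> ?ind S}"
  let ?P = "node_poly z {..<K}" and ?Q = "\<lambda>k. node_poly z ({..<K} - {k})"
  have dP: "degree ?P < M" using KM by (simp add: degree_node_poly)
  have dQ: "degree (?Q k) < M" if "k < K" for k using KM that by (simp add: degree_node_poly)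
  have Tc: "(\<Sum>j\<in>S. c j * T i j) = (\<Sum>k<K. of_real (p k) * z k ^ i * (\<Sum>j\<in>S. c j * cnj (z k) ^ j))"
    if "i < M" "S \<subseteq> {..<M}" for i S and c :: "nat \<Rightarrow> complex"
  proof -
    have "(\<Sum>j\<in>S. c j * T i j) = (\<Sum>j\<in>S. \<Sum>k<K. of_real (p k) * z k ^ i * (c j * cnj (z k) ^ j))"
      using that by (intro sum.cong refl) (auto simp: T sum_distrib_left mult_ac subset_iff)
    also have "\<dots> = (\<Sum>k<K. of_real (p k) * z k ^ i * (\<Sum>j\<in>S. c j * cnj (z k) ^ j))"
      by (subst sum.swap) (simp add: sum_distrib_left)
    finally show ?thesis .
  qed
  have "?ind {..<K}"
  proof (intro allI impI ballI)
    fix c j assume c: "\<forall>i<M. (\<Sum>j<K. c j * T i j) = 0" and j: "j \<in> {..<K}"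
    define g where "g k = (\<Sum>j<K. c j * cnj (z k) ^ j)" for k
    have g: "g k = 0" if k: "k < K" for k
    proof -
      have "0 = (\<Sum>i<M. coeff (?Q k) i * (\<Sum>l<K. of_real (p l) * z l ^ i * g l))"
        using c Tc[of _ "{..<K}" c] KM unfolding g_def by (intro sum.neutral[symmetric]) auto
      also have "\<dots> = (\<Sum>l<K. of_real (p l) * g l * (\<Sum>i<M. coeff (?Q k) i * z l ^ i))"
        unfolding sum_distrib_left by (subst sum.swap) (simp add: mult_ac)
      also have "\<dots> = (\<Sum>l<K. of_real (p l) * g l * poly (?Q k) (z l))"
        unfolding poly_sum_coeff[OF dQ[OF k]] ..
      also have "\<dots> = (\<Sum>l<K. if l = k then of_real (p k) * g k * poly (?Q k) (z k) else 0)"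
        using k by (intro sum.cong refl) (auto simp: poly_node_poly_zero)
      also have "\<dots> = of_real (p k) * g k * poly (?Q k) (z k)" using k by simp
      finally show ?thesis using p[OF k] poly_node_poly_nonzero[of "{..<K} - {k}" z k] inj k
        by (auto simp: insert_absorb)
    qed
    \<comment> \<open>The conjugated combination as a polynomial: vanishing of all
      \<open>g k\<close> says that it vanishes at every node.\<close>
    define C where "C = (\<Sum>j<K. monom (cnj (c j)) j)"
    have coefC: "coeff C j = cnj (c j)" if "j < K" for j
      unfolding C_def coeff_sum using that by (simp add: if_distrib cong: if_cong)
    have "C = 0"
    proof (rule ccontr)
      assume C0: "C \<noteq> 0"
      have "degree C \<le> K - 1" unfolding C_def
        by (intro degree_sum_le) (auto intro: order_trans[OF degree_monom_le])
      moreover have "K > 0" using j by auto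
      ultimately have "degree C < K" by linarith
      moreover have "poly C (z k) = cnj (g k)" for k
        unfolding C_def g_def poly_sum by (simp add: poly_monom mult.commute)
      then have "z ` {..<K} \<subseteq> {x. poly C x = 0}" using g by auto
      then have "card (z ` {..<K}) \<le> card {x. poly C x = 0}" using C0 by (intro card_mono poly_roots_finite)
      then have "K \<le> degree C" using card_poly_roots_bound[OF C0] inj by (simp add: card_image)
      ultimately show False by simp
    qed
    then show "c j = 0" using coefC[of j] j by simp
  qed
  then have KC: "K \<in> ?C" using KM by (intro CollectI exI[of _ "{..<K}"]) auto
  have "\<not> ?ind {..<M}"
  proof
    assume ind: "?ind {..<M}"
    let ?v = "\<lambda>j. cnj (coeff ?P j)"
    have "(\<Sum>j<M. ?v j * cnj (z k) ^ j) = 0" if "k < K" for k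
    proof -
      have "(\<Sum>j<M. ?v j * cnj (z k) ^ j) = cnj (poly ?P (z k))"
        unfolding poly_sum_coeff[OF dP] by simp
      then show ?thesis using that by (simp add: poly_node_poly_zero)
    qed
    then have "\<forall>i<M. (\<Sum>j<M. ?v j * T i j) = 0" by (simp add: Tc)
    then have "\<forall>j<M. ?v j = 0" using ind by (metis lessThan_iff)
    then have "coeff ?P (degree ?P) = 0" using dP by simp
    then show False using node_poly_nonzero[of "{..<K}" z] by simp
  qed
  then have "n \<le> K" if "n \<in> ?C" for n
  proof -
    from that obtain S where S: "n = card S" "S \<subseteq> {..<M}" "?ind S" by blast
    then have "S \<noteq> {..<M}" using \<open>\<not> ?ind {..<M}\<close> by metis
    then have "card S < card {..<M}" using S(2) by (intro psubset_card_mono) auto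
    then show ?thesis using S(1) KM by simp
  qed
  moreover have "finite ?C"
    by (rule finite_subset[of _ "{..M}"]) (auto intro: order_trans[OF card_mono[OF finite_lessThan]])
  ultimately show ?thesis unfolding crank_def using KC by (intro Max_eqI) auto
qed

subsection \<open>The parametrised covariance\<close>

lemma cis_power_mult: "cis (2 * pi * real n * t) = cis (2 * pi * t) ^ n"
proof -
  have "real n * (2 * pi * t) = 2 * pi * real n * t" by simp
  then show ?thesis using Complex.DeMoivre[of "2 * pi * t" n] by (simp only:)
qed

lemma unit_power_cancel: "cmod z = 1 \<Longrightarrow> z ^ i * cnj z ^ (i + m) = cnj z ^ m" "cmod z = 1 \<Longrightarrow> z ^ (i + m) * cnj z ^ i = z ^ m"
proof -
  assume "cmod z = 1"
  then have "z * cnj z = 1" by (simp add: complex_norm_square[symmetric])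
  then have "z ^ i * cnj z ^ i = 1" by (simp add: power_mult_distrib[symmetric])
  then show "z ^ i * cnj z ^ (i + m) = cnj z ^ m" "z ^ (i + m) * cnj z ^ i = z ^ m"
    by (simp_all add: power_add mult_ac)
qed

lemma cis_2pi_eq_iff: "cis (2 * pi * a) = cis (2 * pi * b) \<longleftrightarrow> (\<exists>n::int. a = b + of_int n)"
proof -
  have "cis (2 * pi * a) = cis (2 * pi * b) \<longleftrightarrow> cis (2 * pi * a) / cis (2 * pi * b) = 1" by simp
  also have "\<dots> \<longleftrightarrow> cis (2 * pi * (a - b)) = 1" by (simp add: cis_divide right_diff_distrib)
  also have "\<dots> \<longleftrightarrow> (\<exists>n::int. 2 * pi * (a - b) = of_int n * (2 * pi))"
    by (auto simp: cis_conv_exp exp_eq_1)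
  also have "\<dots> \<longleftrightarrow> (\<exists>n::int. a = b + of_int n)"
  proof (intro ex_cong1)
    fix n :: int
    show "2 * pi * (a - b) = of_int n * (2 * pi) \<longleftrightarrow> a = b + of_int n"
      unfolding mult.commute[of "real_of_int n" "2 * pi"] mult_cancel_left by auto
  qed
  finally show ?thesis .
qed

lemma sum_lessThan_add: "(\<Sum>k<a + b. f k) = (\<Sum>k<a. f k) + (\<Sum>k<b. f (a + k))"
  for f :: "nat \<Rightarrow> 'a::comm_monoid_add"
  by (induction b) (auto simp: add.assoc)

locale spa_model =
  fixes eqv :: bool and M K :: nat and Om :: "nat list"
  assumes M2: "M \<ge> 2" and arr: "is_array M Om" and red: "redundancy_array M Om" and KM: "K = M - 1"
begin

abbreviation "L \<equiv> length Om"
abbreviation "d \<equiv> 2 * K + nsig eqv Om"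

definition pos :: "nat \<Rightarrow> nat" where "pos j = Om ! j - 1"
text \<open>Position in the parameter vector of the noise variance acting on sensor
  \<open>j\<close>; in the equal-variance variant all sensors share one.\<close>

definition sidx :: "nat \<Rightarrow> nat" where "sidx j = 2 * K + (if eqv then 0 else j)"

lemma SK: "Suc K = M" using KM M2 by simp

lemma Om_nth: "j < L \<Longrightarrow> 1 \<le> Om ! j \<and> Om ! j \<le> M"
  using arr unfolding is_array_def by (auto simp: subset_iff)

lemma pos_less: "j < L \<Longrightarrow> pos j < M"
  using Om_nth[of j] by (simp add: pos_def) linarith

lemma pos_inj: "j < L \<Longrightarrow> l < L \<Longrightarrow> pos j = pos l \<Longrightarrow> j = l"
proof -
  assume jl: "j < L" "l < L" "pos j = pos l"
  then have "Om ! j = Om ! l" using Om_nth[of j] Om_nth[of l] unfolding pos_def by linarith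
  moreover have "distinct Om" using arr unfolding is_array_def
    by (simp add: strict_sorted_iff)
  ultimately show "j = l" using jl by (simp add: nth_eq_iff_index_eq)
qed

lemma exists_lag: "m < M \<Longrightarrow> \<exists>j<L. \<exists>l<L. pos j = pos l + m"
proof -
  assume m: "m < M"
  then have "m + 1 \<in> {m1 - m2 + 1 | m1 m2. m1 \<in> set Om \<and> m2 \<in> set Om \<and> m1 \<ge> m2}"
    using red unfolding redundancy_array_def by auto
  then obtain m1 m2 where a: "m1 \<in> set Om" "m2 \<in> set Om" "m1 \<ge> m2" "m = m1 - m2" by auto
  then obtain j l where "j < L" "l < L" "Om ! j = m1" "Om ! l = m2" by (metis in_set_conv_nth)
  then show ?thesis using a Om_nth[of l] unfolding pos_def by (intro exI[of _ j] conjI exI[of _ l]) auto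
qed

lemma L_pos: "0 < L" using exists_lag[of 0] M2 by auto

lemma sidx_0: "sidx 0 = 2 * K" by (simp add: sidx_def)

lemma sidx_less: "j < L \<Longrightarrow> sidx j < d"
  by (auto simp: sidx_def nsig_def)

definition zz :: "(nat \<Rightarrow> real) \<Rightarrow> nat \<Rightarrow> complex" where "zz \<eta> k = cis (2 * pi * \<eta> k)"

lemma norm_zz [simp]: "cmod (zz \<eta> k) = 1" by (simp add: zz_def)

definition freq :: "nat \<Rightarrow> nat \<Rightarrow> real" where "freq j l = 2 * pi * (real (pos j) - real (pos l))"

lemma cis_freq: "cis (freq j l * \<eta> k) = zz \<eta> k ^ pos j * cnj (zz \<eta> k) ^ pos l"
proof -
  have "freq j l * \<eta> k = 2 * pi * real (pos j) * \<eta> k - 2 * pi * real (pos l) * \<eta> k"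
    by (simp add: freq_def algebra_simps)
  then have "cis (freq j l * \<eta> k) = cis (2 * pi * real (pos j) * \<eta> k) * cnj (cis (2 * pi * real (pos l) * \<eta> k))"
    by (simp add: cis_divide[symmetric] cis_cnj divide_inverse)
  then show ?thesis unfolding cis_power_mult zz_def by simp
qed

text \<open>The regular parameters. Distinctness is required of the points on the unit circle,
  because nearby parameters may leave the interval \<open>[0, 1)\<close>.\<close>

definition good :: "(nat \<Rightarrow> real) \<Rightarrow> bool"
  where "good \<eta> \<longleftrightarrow> (\<forall>k<K. 0 < \<eta> (K + k)) \<and> (\<forall>j<nsig eqv Om. 0 < \<eta> (2 * K + j)) \<and> inj_on (zz \<eta>) {..<K}"

lemma good_sidx: "good \<eta> \<Longrightarrow> j < L \<Longrightarrow> 0 < \<eta> (sidx j)"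
  by (auto simp: good_def sidx_def nsig_def split: if_splits)

abbreviation "Rp \<equiv> Rpar eqv Om K"

lemma steerO_eq: "j < L \<Longrightarrow> steerO Om t j = cis (2 * pi * t) ^ pos j"
  unfolding steerO_def pos_def cis_power_mult by simp

lemma steer_eq: "j < M \<Longrightarrow> steer M t j = cis (2 * pi * t) ^ j"
  unfolding steer_def cis_power_mult by simp

lemma Rpar_entry:
  assumes "j < L" "l < L"
  shows "Rp \<eta> j l = (\<Sum>k<K. of_real (\<eta> (K + k)) * cis (freq j l * \<eta> k)) + (if j = l then of_real (\<eta> (sidx j)) else 0)"
  using assms unfolding Rpar_def cis_freq
  by (simp add: steerO_eq zz_def diagm_def sidx_def mult.assoc)

lemma msupp_Rpar: "msupp L (Rp \<eta>)"
  by (auto simp: msupp_def Rpar_def steerO_def diagm_def)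

text \<open>Columns below \<open>K\<close> belong to the sources, the remaining ones to the noise components.\<close>

definition mixm :: "(nat \<Rightarrow> real) \<Rightarrow> nat \<Rightarrow> nat \<Rightarrow> complex"
  where "mixm \<eta> j k = (if k < K then steerO Om (\<eta> k) j else if k = K + j \<and> j < L then 1 else 0)"

definition mixv :: "(nat \<Rightarrow> real) \<Rightarrow> nat \<Rightarrow> real"
  where "mixv \<eta> k = (if k < K then \<eta> (K + k) else \<eta> (sidx (k - K)))"

text \<open>Exhibits the covariance as that of \<open>mixm \<eta>\<close> applied to independent
  variables with variances \<open>mixv \<eta>\<close>, which is literally how a snapshot
  arises.\<close>

lemma Rpar_factor: "Rp \<eta> = mixm \<eta> \<odot>\<^bsub>K + L\<^esub> diagm (K + L) (mixv \<eta>) \<odot>\<^bsub>K + L\<^esub> adjm (mixm \<eta>)"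
proof (intro ext)
  fix j l
  note split = sum_lessThan_add[of _ K L]
  have "(mixm \<eta> \<odot>\<^bsub>K + L\<^esub> diagm (K + L) (mixv \<eta>) \<odot>\<^bsub>K + L\<^esub> adjm (mixm \<eta>)) j l
    = (\<Sum>k<K + L. mixm \<eta> j k * of_real (mixv \<eta> k) * cnj (mixm \<eta> l k))"
    unfolding mmul_diagm by (simp add: mmul_def adjm_def)
  also have "\<dots> = (\<Sum>k<K. complex_of_real (\<eta> (K + k)) * steerO Om (\<eta> k) j * cnj (steerO Om (\<eta> k) l))
     + (\<Sum>k<L. if k = j then (if j = l then of_real (\<eta> (sidx j)) else 0) else 0)"
    unfolding split by (intro arg_cong2[where f="(+)"] sum.cong refl) (auto simp: mixm_def mixv_def mult_ac)
  also have "\<dots> = Rp \<eta> j l"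
    unfolding Rpar_def by (auto simp: diagm_def sidx_def)
  finally show "Rp \<eta> j l = (mixm \<eta> \<odot>\<^bsub>K + L\<^esub> diagm (K + L) (mixv \<eta>) \<odot>\<^bsub>K + L\<^esub> adjm (mixm \<eta>)) j l" by simp
qed

lemma mixv_pos: "good \<eta> \<Longrightarrow> k < K + L \<Longrightarrow> 0 < mixv \<eta> k"
  using good_sidx[of \<eta> "k - K"] by (auto simp: mixv_def good_def)

lemma adjm_Rpar: "adjm (Rp \<eta>) = Rp \<eta>"
  unfolding Rpar_factor by (rule hermitian_congruence[OF adjm_diagm])

lemma pd_Rpar: "good \<eta> \<Longrightarrow> pd L (Rp \<eta>)"
  unfolding pd_def
proof (intro conjI allI impI)
  show "hermitian L (Rp \<eta>)" by (rule hermitianI[OF adjm_Rpar])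
  assume g: "good \<eta>"
  fix v :: "nat \<Rightarrow> complex" assume "\<exists>i<L. v i \<noteq> 0"
  then obtain i where i: "i < L" "v i \<noteq> 0" by blast
  let ?w = "\<lambda>k. \<Sum>j<L. cnj (mixm \<eta> j k) * v j"
  \<comment> \<open>The noise column of sensor \<open>i\<close> reads off the coordinate
    \<open>v i\<close>, so already the noise term makes the form positive.\<close>
  have wi: "?w (K + i) = v i"
  proof -
    have "?w (K + i) = (\<Sum>j<L. if j = i then v j else 0)" by (intro sum.cong) (auto simp: mixm_def)
    then show ?thesis using i by simp
  qed
  have "0 < (\<Sum>k<K + L. mixv \<eta> k * (cmod (?w k))\<^sup>2)"
    by (rule sum_pos2[of _ "K + i"]) (use mixv_pos[OF g] i wi in \<open>auto intro!: mult_nonneg_nonneg simp: less_imp_le\<close>)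
  then show "0 < Re (qform L (Rp \<eta>) v)"
    unfolding Rpar_factor qform_congruence qform_diagm by simp
qed

subsection \<open>Identifiability of the output of the estimator\<close>

lemma compress_entry: "j < L \<Longrightarrow> l < L \<Longrightarrow> compress Om A j l = A (pos j) (pos l)"
  by (simp add: compress_def pos_def)

text \<open>Redundancy places every positive lag at some off-diagonal position of the compressed
  matrix, where noise is absent; hence all \<open>u m\<close> with \<open>0 < m\<close> are
  determined. Only \<open>u 0\<close> mixes with the noise and remains as a multiple of the
  identity.\<close>

lemma toep_of_Rmod:
  assumes eq: "\<And>j l. j < L \<Longrightarrow> l < L \<Longrightarrow> Rmod M Om u s j l = Rp \<eta> j l" and u0: "Im (u 0) = 0"
    and ij: "i < M" "j < M"
  shows "toep M u i j = (\<Sum>k<K. of_real (\<eta> (K + k)) * (zz \<eta> k ^ i * cnj (zz \<eta> k) ^ j)) +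
    (if i = j then of_real (Re (u 0) - (\<Sum>k<K. \<eta> (K + k))) else 0)"
proof -
  have lag: "u m = (\<Sum>k<K. of_real (\<eta> (K + k)) * cnj (zz \<eta> k) ^ m)" if m: "0 < m" "m < M" for m
  proof -
    obtain a b where ab: "a < L" "b < L" "pos a = pos b + m" using exists_lag[OF m(2)] by blast
    then have ne: "b \<noteq> a" using m by auto
    have "Rmod M Om u s b a = u m"
      using ab ne m pos_less[OF ab(1)] pos_less[OF ab(2)] by (simp add: Rmod_def compress_entry diagm_def toep_def)
    moreover have "Rp \<eta> b a = (\<Sum>k<K. of_real (\<eta> (K + k)) * cnj (zz \<eta> k) ^ m)"
      unfolding Rpar_entry[OF ab(2,1)] cis_freq ab(3) using ne by (simp add: unit_power_cancel)
    ultimately show ?thesis using eq[OF ab(2,1)] by simp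
  qed
  consider "i = j" | "i < j" | "j < i" by linarith
  then show ?thesis
  proof cases
    case 1
    have "zz \<eta> k ^ i * cnj (zz \<eta> k) ^ i = 1" for k using unit_power_cancel(1)[of "zz \<eta> k" i 0] by simp
    then show ?thesis using 1 ij u0 by (simp add: toep_def complex_eq_iff)
  next
    case 2
    have "zz \<eta> k ^ i * cnj (zz \<eta> k) ^ j = cnj (zz \<eta> k) ^ (j - i)" for k
      using unit_power_cancel(1)[of "zz \<eta> k" i "j - i"] 2 by simp
    then show ?thesis using 2 ij lag[of "j - i"] by (simp add: toep_def)
  next
    case 3
    have "zz \<eta> k ^ i * cnj (zz \<eta> k) ^ j = zz \<eta> k ^ (i - j)" for k
      using unit_power_cancel(2)[of "zz \<eta> k" j "i - j"] 3 by simp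
    then show ?thesis using 3 ij lag[of "i - j"] by (simp add: toep_def)
  qed
qed

text \<open>Steps (2) and (3) of the estimator, detached from the minimisation that yields
  \<open>u\<close> and \<open>s\<close>.\<close>

definition spa_rest :: "(nat \<Rightarrow> complex) \<Rightarrow> (nat \<Rightarrow> real) \<Rightarrow> real set \<Rightarrow> (real \<Rightarrow> real) \<Rightarrow> (nat \<Rightarrow> real) \<Rightarrow> bool"
  where "spa_rest u s Th P sg \<longleftrightarrow> (let \<delta> = lmin M (toep M u);
             uh = u(0 := u 0 - complex_of_real \<delta>)
         in (if eqv then sg 0 = \<delta> else (\<forall>j<length Om. sg j = s j + \<delta>)) \<and>
            finite Th \<and> Th \<subseteq> {0..<1} \<and> (\<forall>\<theta>\<in>Th. 0 < P \<theta>) \<and>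
            card Th = crank M M (toep M uh) \<and>
            (\<forall>i<M. \<forall>j<M. toep M uh i j =
                 (\<Sum>\<theta>\<in>Th. complex_of_real (P \<theta>) * steer M \<theta> i * cnj (steer M \<theta> j))))"

lemma spa_output_iff: "spa_output eqv M Om N Rt Th P sg \<longleftrightarrow>
    (\<exists>u s. spa_step1 eqv M Om N Rt u s \<and> spa_rest u s Th P sg)"
  unfolding spa_output_def spa_rest_def ..

lemma steer_sum:
  assumes "i < M" "j < M"
  shows "complex_of_real p * steer M t i * cnj (steer M t j) = of_real p * (cis (2 * pi * t) ^ i * cnj (cis (2 * pi * t)) ^ j)"
  using assms by (simp add: steer_eq mult.assoc)

lemma zz_frac: "cis (2 * pi * frac (\<eta> k)) = zz \<eta> k"
  unfolding zz_def cis_2pi_eq_iff by (rule exI[of _ "- \<lfloor>\<eta> k\<rfloor>"]) (simp add: frac_def)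

lemma msupp_toep: "msupp M (toep M u)" by (auto simp: msupp_def toep_def)

text \<open>However the diagonal is split between \<open>u 0\<close> and \<open>s\<close>,
  subtracting the least eigenvalue removes exactly the excess over the powers and returns it to the
  noise.\<close>

lemma shifted_toep:
  assumes g: "good \<eta>"
    and eq: "\<And>j l. j < L \<Longrightarrow> l < L \<Longrightarrow> Rmod M Om u s j l = Rp \<eta> j l" and u0: "Im (u 0) = 0"
  shows lmin_toep: "lmin M (toep M u) = Re (u 0) - (\<Sum>k<K. \<eta> (K + k))"
    and toep_hat: "\<And>i j. i < M \<Longrightarrow> j < M \<Longrightarrow> toep M (u(0 := u 0 - complex_of_real (lmin M (toep M u)))) i j =
      (\<Sum>k<K. of_real (\<eta> (K + k)) * (zz \<eta> k ^ i * cnj (zz \<eta> k) ^ j))"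
    and noise_hat: "\<And>j. j < L \<Longrightarrow> s j + lmin M (toep M u) = \<eta> (sidx j)"
proof -
  let ?c = "Re (u 0) - (\<Sum>k<K. \<eta> (K + k))"
  show l: "lmin M (toep M u) = ?c"
    by (rule lmin_shifted_exp_sum[OF SK _ toep_of_Rmod[OF eq u0] msupp_toep])
       (use g in \<open>auto simp: good_def less_imp_le\<close>)
  show "toep M (u(0 := u 0 - complex_of_real (lmin M (toep M u)))) i j =
      (\<Sum>k<K. of_real (\<eta> (K + k)) * (zz \<eta> k ^ i * cnj (zz \<eta> k) ^ j))" if ij: "i < M" "j < M" for i j
  proof -
    have "toep M (u(0 := u 0 - complex_of_real (lmin M (toep M u)))) i j = toep M u i j - (if i = j then of_real ?c else 0)"
      unfolding l using ij by (auto simp: toep_def)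
    then show ?thesis using toep_of_Rmod[OF eq u0 ij] by (cases "i = j") (simp_all del: of_real_diff)
  qed
  show "s j + lmin M (toep M u) = \<eta> (sidx j)" if j: "j < L" for j
  proof -
    have "Rmod M Om u s j j = u 0 + of_real (s j)"
      using j pos_less by (simp add: Rmod_def compress_entry diagm_def toep_def)
    moreover have "Rp \<eta> j j = of_real (\<Sum>k<K. \<eta> (K + k)) + of_real (\<eta> (sidx j))"
      unfolding Rpar_entry[OF j j] by (simp add: freq_def)
    ultimately have "u 0 + of_real (s j) = of_real (\<Sum>k<K. \<eta> (K + k)) + of_real (\<eta> (sidx j))"
      using eq[OF j j] by simp
    from arg_cong[OF this, of Re] show ?thesis unfolding l by simp
  qed
qed

lemma feasible_u0: "spa_feasible eqv M Om u s \<Longrightarrow> Im (u 0) = 0"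
proof -
  assume "spa_feasible eqv M Om u s"
  then have "hermitian M (toep M u)" unfolding spa_feasible_def psd_def by simp
  then have "toep M u 0 0 = cnj (toep M u 0 0)" unfolding hermitian_def using M2 by (metis gr0I not_numeral_le_zero)
  then show ?thesis using M2 by (simp add: toep_def complex_eq_iff)
qed

text \<open>The shifted Toeplitz matrix is the exponential sum of \<open>\<eta>\<close>, so
  uniqueness of the Vandermonde decomposition applies. Output frequencies lie in
  \<open>[0, 1)\<close>, whence \<open>frac\<close>.\<close>

theorem spa_rest_unique:
  assumes g: "good \<eta>" and f: "spa_feasible eqv M Om u s"
    and eq: "\<And>j l. j < L \<Longrightarrow> l < L \<Longrightarrow> Rmod M Om u s j l = Rp \<eta> j l"
    and r: "spa_rest u s Th P sg"
  shows "Th = (\<lambda>k. frac (\<eta> k)) ` {..<K}" "\<And>k. k < K \<Longrightarrow> P (frac (\<eta> k)) = \<eta> (K + k)"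
    "\<And>j. j < nsig eqv Om \<Longrightarrow> sg j = \<eta> (2 * K + j)"
proof -
  note u0 = feasible_u0[OF f]
  let ?uh = "u(0 := u 0 - complex_of_real (lmin M (toep M u)))"
  have r': "if eqv then sg 0 = lmin M (toep M u) else (\<forall>j<L. sg j = s j + lmin M (toep M u))"
    "finite Th" "Th \<subseteq> {0..<1}" "\<And>t. t \<in> Th \<Longrightarrow> 0 < P t"
    "\<And>i j. i < M \<Longrightarrow> j < M \<Longrightarrow> toep M ?uh i j = (\<Sum>\<theta>\<in>Th. complex_of_real (P \<theta>) * steer M \<theta> i * cnj (steer M \<theta> j))"
    using r unfolding spa_rest_def Let_def by blast+
  have injt: "inj_on (\<lambda>t. cis (2 * pi * t)) Th"
  proof (rule inj_onI)
    fix a b assume ab: "a \<in> Th" "b \<in> Th" "cis (2 * pi * a) = cis (2 * pi * b)"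
    then obtain n :: int where n: "a = b + of_int n" unfolding cis_2pi_eq_iff by blast
    have "0 \<le> a" "a < 1" "0 \<le> b" "b < 1" using ab r'(3) by auto
    then have "n = 0" using n by linarith
    then show "a = b" using n by simp
  qed
  have inj: "inj_on (zz \<eta>) {..<K}" using g by (simp add: good_def)
  have V: "(\<lambda>t. cis (2 * pi * t)) ` Th = zz \<eta> ` {..<K}"
    "\<And>t l. t \<in> Th \<Longrightarrow> l < K \<Longrightarrow> cis (2 * pi * t) = zz \<eta> l \<Longrightarrow> P t = \<eta> (K + l)"
  proof -
    have e: "(\<Sum>t\<in>Th. complex_of_real (P t) * (cis (2 * pi * t) ^ i * cnj (cis (2 * pi * t)) ^ j)) =
       (\<Sum>k<K. complex_of_real (\<eta> (K + k)) * (zz \<eta> k ^ i * cnj (zz \<eta> k) ^ j))" if ij: "i < M" "j < M" for i j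
    proof -
      have "(\<Sum>t\<in>Th. complex_of_real (P t) * (cis (2 * pi * t) ^ i * cnj (cis (2 * pi * t)) ^ j)) = toep M ?uh i j"
        unfolding r'(5)[OF ij] steer_sum[OF ij] ..
      also have "\<dots> = (\<Sum>k<K. complex_of_real (\<eta> (K + k)) * (zz \<eta> k ^ i * cnj (zz \<eta> k) ^ j))"
        by (rule toep_hat[OF g eq u0 ij])
      finally show ?thesis .
    qed
    have gp: "\<And>k. k < K \<Longrightarrow> 0 < \<eta> (K + k)" using g by (simp add: good_def)
    note vu = vandermonde_unique[of "zz \<eta>" K M Th "\<lambda>t. cis (2 * pi * t)" "\<lambda>k. \<eta> (K + k)" P, OF inj SK r'(2) injt gp r'(4) e]
    show "(\<lambda>t. cis (2 * pi * t)) ` Th = zz \<eta> ` {..<K}" by (rule vu(1))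
    show "\<And>t l. t \<in> Th \<Longrightarrow> l < K \<Longrightarrow> cis (2 * pi * t) = zz \<eta> l \<Longrightarrow> P t = \<eta> (K + l)" by (rule vu(2))
  qed
  have fr: "frac (\<eta> k) \<in> Th" if k: "k < K" for k
  proof -
    obtain t where t: "t \<in> Th" "cis (2 * pi * t) = zz \<eta> k" using V(1) k by force
    have "frac (\<eta> k) = t"
    proof -
      obtain n :: int where n: "t = frac (\<eta> k) + of_int n"
        using t(2) unfolding zz_frac[symmetric, of \<eta> k] cis_2pi_eq_iff by blast
      have "0 \<le> t" "t < 1" using t(1) r'(3) by auto
      then have "n = 0" using n frac_ge_0[of "\<eta> k"] frac_lt_1[of "\<eta> k"] by linarith
      then show ?thesis using n by simp
    qed
    then show ?thesis using t(1) by simp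
  qed
  show "P (frac (\<eta> k)) = \<eta> (K + k)" if "k < K" for k
    by (rule V(2)[OF fr[OF that] that zz_frac])
  show "Th = (\<lambda>k. frac (\<eta> k)) ` {..<K}"
  proof
    show "Th \<subseteq> (\<lambda>k. frac (\<eta> k)) ` {..<K}"
    proof
      fix t assume t: "t \<in> Th"
      then obtain k where k: "k < K" "cis (2 * pi * t) = zz \<eta> k" using V(1) by blast
      then have "t = frac (\<eta> k)"
        using inj_onD[OF injt _ t fr[OF k(1)]] zz_frac by simp
      then show "t \<in> (\<lambda>k. frac (\<eta> k)) ` {..<K}" using k(1) by blast
    qed
  qed (use fr in auto)
  show "sg j = \<eta> (2 * K + j)" if j: "j < nsig eqv Om" for j
  proof (cases eqv)
    case True
    have "s 0 = 0" using f True unfolding spa_feasible_def by simp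
    then show ?thesis using noise_hat[OF g eq u0 L_pos, unfolded sidx_0] r'(1) True j by (simp add: nsig_def)
  next
    case False
    then have "sidx j = 2 * K + j" unfolding sidx_def by simp
    then show ?thesis using noise_hat[OF g eq u0, of j] r'(1) j False by (simp add: nsig_def)
  qed
qed

text \<open>Every regular parameter is reached by a feasible point of the convex problem together
  with a completed output, which links the smooth parametrisation to the estimator.\<close>

theorem spa_rest_exists:
  assumes g: "good \<eta>"
  shows "\<exists>u s. spa_feasible eqv M Om u s \<and> (\<forall>j<L. \<forall>l<L. Rmod M Om u s j l = Rp \<eta> j l) \<and>
    (\<exists>Th P sg. spa_rest u s Th P sg)"
proof -
  define sg where "sg j = \<eta> (2 * K + j)" for j
  \<comment> \<open>The equal-variance variant has no free \<open>s\<close>, so the noise is stored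
    in the diagonal of the Toeplitz matrix; otherwise \<open>s\<close> holds all of it.\<close>
  define c where "c = (if eqv then \<eta> (2 * K) else 0)"
  define u where "u m = (\<Sum>k<K. of_real (\<eta> (K + k)) * cnj (zz \<eta> k) ^ m) + (if m = 0 then of_real c else 0)" for m
  define s where "s j = (if eqv then 0 else \<eta> (2 * K + j))" for j
  have Tu: "toep M u i j = (\<Sum>k<K. of_real (\<eta> (K + k)) * (zz \<eta> k ^ i * cnj (zz \<eta> k) ^ j)) + (if i = j then of_real c else 0)"
    if ij: "i < M" "j < M" for i j
  proof (cases "i \<le> j")
    case True
    have "zz \<eta> k ^ i * cnj (zz \<eta> k) ^ j = cnj (zz \<eta> k) ^ (j - i)" for k
      using unit_power_cancel(1)[of "zz \<eta> k" i "j - i"] True by simp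
    then show ?thesis using True ij by (simp add: toep_def u_def)
  next
    case False
    have "zz \<eta> k ^ i * cnj (zz \<eta> k) ^ j = zz \<eta> k ^ (i - j)" for k
      using unit_power_cancel(2)[of "zz \<eta> k" j "i - j"] False by simp
    then show ?thesis using False ij by (simp add: toep_def u_def)
  qed
  have c0: "c \<ge> 0" using good_sidx[OF g L_pos] by (auto simp: c_def sidx_def)
  have R: "Rmod M Om u s j l = Rp \<eta> j l" if jl: "j < L" "l < L" for j l
    unfolding Rpar_entry[OF jl] cis_freq using jl
    by (auto simp: Rmod_def compress_entry Tu pos_less diagm_def c_def s_def sidx_def dest: pos_inj)
  have psdT: "psd M (toep M u)"
  proof -
    \<comment> \<open>Semidefiniteness by factorisation: \<open>K\<close> exponential columns
      followed by \<open>M\<close> unit columns that carry the shift \<open>c\<close>.\<close>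
    define B where "B i k = (if i < M then (if k < K then zz \<eta> k ^ i else if k = K + i then 1 else 0) else 0)" for i k
    define D where "D k = (if k < K then \<eta> (K + k) else c)" for k
    note split = sum_lessThan_add[of _ K M]
    have "toep M u = B \<odot>\<^bsub>K + M\<^esub> diagm (K + M) D \<odot>\<^bsub>K + M\<^esub> adjm B"
    proof (rule msupp_eqI[OF msupp_toep])
      show "msupp M (B \<odot>\<^bsub>K + M\<^esub> diagm (K + M) D \<odot>\<^bsub>K + M\<^esub> adjm B)"
        by (auto simp: msupp_def mmul_def adjm_def B_def)
      fix i j assume ij: "i < M" "j < M"
      have "(B \<odot>\<^bsub>K + M\<^esub> diagm (K + M) D \<odot>\<^bsub>K + M\<^esub> adjm B) i j = (\<Sum>k<K + M. B i k * of_real (D k) * cnj (B j k))"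
        unfolding mmul_diagm by (simp add: mmul_def adjm_def)
      also have "\<dots> = (\<Sum>k<K. of_real (\<eta> (K + k)) * (zz \<eta> k ^ i * cnj (zz \<eta> k) ^ j)) + (\<Sum>k<M. if k = i then (if i = j then of_real c else 0) else 0)"
        unfolding split using ij by (intro arg_cong2[where f="(+)"] sum.cong refl) (auto simp: B_def D_def)
      also have "\<dots> = toep M u i j" using ij by (simp add: Tu)
      finally show "toep M u i j = (B \<odot>\<^bsub>K + M\<^esub> diagm (K + M) D \<odot>\<^bsub>K + M\<^esub> adjm B) i j" by simp
    qed
    moreover have "psd M (B \<odot>\<^bsub>K + M\<^esub> diagm (K + M) D \<odot>\<^bsub>K + M\<^esub> adjm B)"
      by (rule psd_congruence_diagm) (use g c0 in \<open>auto simp: D_def good_def less_imp_le\<close>)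
    ultimately show ?thesis by simp
  qed
  have feas: "spa_feasible eqv M Om u s"
  proof -
    have "Rmod M Om u s = Rp \<eta>"
      by (rule msupp_eqI[OF _ msupp_Rpar R]) (auto simp: msupp_def Rmod_def compress_def diagm_def)
    moreover have "\<forall>j<L. 0 \<le> s j" using good_sidx[OF g] by (auto simp: s_def sidx_def less_imp_le)
    ultimately show ?thesis unfolding spa_feasible_def using psdT pd_Rpar[OF g] by (cases eqv) (simp_all add: s_def)
  qed
  note u0 = feasible_u0[OF feas]
  define Th where "Th = (\<lambda>k. frac (\<eta> k)) ` {..<K}"
  have inj: "inj_on (zz \<eta>) {..<K}" using g by (simp add: good_def)
  have injf: "inj_on (\<lambda>k. frac (\<eta> k)) {..<K}"
  proof (rule inj_onI)
    fix a b assume ab: "a \<in> {..<K}" "b \<in> {..<K}" "frac (\<eta> a) = frac (\<eta> b)"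
    then have "zz \<eta> a = zz \<eta> b" using zz_frac[of \<eta> a] zz_frac[of \<eta> b] by simp
    then show "a = b" using inj ab by (auto dest: inj_onD)
  qed
  \<comment> \<open>Output powers are a function of the frequency, so the labelling is inverted;
    injectivity of the fractional parts makes this sound.\<close>
  define P where "P t = \<eta> (K + the_inv_into {..<K} (\<lambda>k. frac (\<eta> k)) t)" for t
  have Pf: "P (frac (\<eta> k)) = \<eta> (K + k)" if "k < K" for k
    unfolding P_def using the_inv_into_f_f[OF injf, of k] that by simp
  have "spa_rest u s Th P sg"
    unfolding spa_rest_def Let_def
  proof (intro conjI allI impI ballI)
    show "if eqv then sg 0 = lmin M (toep M u) else (\<forall>j<L. sg j = s j + lmin M (toep M u))"
      using noise_hat[OF g R u0 L_pos] noise_hat[OF g R u0] by (auto simp: sg_def sidx_def s_def)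
    show "finite Th" "Th \<subseteq> {0..<1}" by (auto simp: Th_def frac_lt_1)
    show "0 < P t" if "t \<in> Th" for t using that g by (auto simp: Th_def Pf good_def)
    have "card Th = K" unfolding Th_def using injf by (simp add: card_image)
    also have "K = crank M M (toep M (u(0 := u 0 - complex_of_real (lmin M (toep M u)))))"
      by (rule crank_exp_sum[OF SK inj _ toep_hat[OF g R u0], symmetric]) (use g in \<open>auto simp: good_def\<close>)
    finally show "card Th = crank M M (toep M (u(0 := u 0 - complex_of_real (lmin M (toep M u)))))" .
    fix i j assume ij: "i < M" "j < M"
    show "toep M (u(0 := u 0 - complex_of_real (lmin M (toep M u)))) i j =
        (\<Sum>\<theta>\<in>Th. complex_of_real (P \<theta>) * steer M \<theta> i * cnj (steer M \<theta> j))"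
    proof (rule trans[OF toep_hat[OF g R u0 ij]])
      have "(\<Sum>\<theta>\<in>Th. complex_of_real (P \<theta>) * steer M \<theta> i * cnj (steer M \<theta> j))
        = (\<Sum>k<K. complex_of_real (P (frac (\<eta> k))) * steer M (frac (\<eta> k)) i * cnj (steer M (frac (\<eta> k)) j))"
        unfolding Th_def by (subst sum.reindex[OF injf]) simp
      also have "\<dots> = (\<Sum>k<K. complex_of_real (\<eta> (K + k)) * (zz \<eta> k ^ i * cnj (zz \<eta> k) ^ j))"
        by (intro sum.cong refl) (simp only: steer_sum[OF ij] zz_frac Pf lessThan_iff)
      finally show "(\<Sum>k<K. complex_of_real (\<eta> (K + k)) * (zz \<eta> k ^ i * cnj (zz \<eta> k) ^ j)) =
        (\<Sum>\<theta>\<in>Th. complex_of_real (P \<theta>) * steer M \<theta> i * cnj (steer M \<theta> j))" by simp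
    qed
  qed
  then show ?thesis using feas R by blast
qed

end

context spa_model
begin

subsection \<open>The tangent space\<close>

text \<open>Closed form of the partial derivative of \<open>Rp \<eta>\<close> in coordinate
  \<open>a\<close>; the three ranges are frequencies, powers and noise variances.\<close>

definition Rder :: "(nat \<Rightarrow> real) \<Rightarrow> nat \<Rightarrow> nat \<Rightarrow> nat \<Rightarrow> complex"
  where "Rder \<eta> a j l = (if j < L \<and> l < L then
      (if a < K then of_real (\<eta> (K + a) * freq j l) * \<i> * cis (freq j l * \<eta> a)
       else if a < 2 * K then cis (freq j l * \<eta> (a - K))
       else if j = l \<and> a = sidx j then 1 else 0) else 0)"

lemma msupp_Rder: "msupp L (Rder \<eta> a)"
  by (auto simp: msupp_def Rder_def)

lemma sum_d_split: "(\<Sum>a<d. f a) = (\<Sum>k<K. f k) + (\<Sum>k<K. f (K + k)) + (\<Sum>j<nsig eqv Om. f (2 * K + j))"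
  for f :: "nat \<Rightarrow> 'a::comm_monoid_add"
  using sum_lessThan_add[of f "2 * K" "nsig eqv Om"] sum_lessThan_add[of f K K] by (simp add: mult_2)

lemma Rder_sum:
  assumes jl: "j < L" "l < L"
  shows "(\<Sum>a<d. of_real (x a) * Rder \<eta> a j l) =
    (\<Sum>k<K. (of_real (x (K + k)) + \<i> * of_real (x k * \<eta> (K + k) * freq j l)) * cis (freq j l * \<eta> k))
     + (if j = l then of_real (x (sidx j)) else 0)"
proof -
  have 1: "(\<Sum>k<K. of_real (x k) * Rder \<eta> k j l) = (\<Sum>k<K. \<i> * of_real (x k * \<eta> (K + k) * freq j l) * cis (freq j l * \<eta> k))"
    using jl by (intro sum.cong refl) (simp add: Rder_def mult_ac)
  have 2: "(\<Sum>k<K. of_real (x (K + k)) * Rder \<eta> (K + k) j l) = (\<Sum>k<K. of_real (x (K + k)) * cis (freq j l * \<eta> k))"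
    using jl by (intro sum.cong refl) (simp add: Rder_def)
  have 3: "(\<Sum>q<nsig eqv Om. of_real (x (2 * K + q)) * Rder \<eta> (2 * K + q) j l) = (if j = l then of_real (x (sidx j)) else 0)"
  proof -
    let ?q = "if eqv then 0 else j"
    have q: "sidx j = 2 * K + ?q" "?q < nsig eqv Om" using jl by (auto simp: sidx_def nsig_def)
    have "(\<Sum>q<nsig eqv Om. of_real (x (2 * K + q)) * Rder \<eta> (2 * K + q) j l)
      = (\<Sum>q<nsig eqv Om. if q = ?q then (if j = l then of_real (x (sidx j)) else 0) else (0::complex))"
      using jl unfolding Rder_def sidx_def by (intro sum.cong refl) auto
    then show ?thesis using q(2) by simp
  qed
  show ?thesis unfolding sum_d_split 1 2 3 by (simp add: distrib_right sum.distrib)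
qed

text \<open>Off the diagonal a vanishing combination is an exponential sum with amplitudes
  \<open>A\<close> from the powers and linear parts \<open>B\<close> from the frequencies, available
  at all lags by redundancy. Once these vanish, the diagonal isolates the noise coordinates.\<close>

lemma Rder_independent:
  assumes g: "good \<eta>" and z: "\<And>j l. j < L \<Longrightarrow> l < L \<Longrightarrow> (\<Sum>a<d. of_real (x a) * Rder \<eta> a j l) = 0"
  shows "\<And>a. a < d \<Longrightarrow> x a = 0"
proof -
  define A where "A k = complex_of_real (x (K + k))" for k
  define B where "B k = \<i> * of_real (x k * \<eta> (K + k) * (2 * pi))" for k
  have inj: "inj_on (zz \<eta>) {..<K}" using g by (simp add: good_def)
  have T: "(\<Sum>k<K. (A k + B k * (of_nat i - of_nat j)) * (zz \<eta> k ^ i * cnj (zz \<eta> k) ^ j)) = 0"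
    if ij: "i < M" "j < M" "i \<noteq> j" for i j
  proof -
    \<comment> \<open>Positive lags are read from the array. Negative lags follow by conjugation,
      since \<open>A k\<close> is real and \<open>B k\<close> imaginary.\<close>
    have pos: "(\<Sum>k<K. (A k + B k * of_nat m) * zz \<eta> k ^ m) = 0" if m: "0 < m" "m < M" for m
    proof -
      obtain a b where ab: "a < L" "b < L" "pos a = pos b + m" using exists_lag[OF m(2)] by blast
      have ne: "a \<noteq> b" using ab m by auto
      have "freq a b = 2 * pi * real m" using ab by (simp add: freq_def)
      then have "(of_real (x (K + k)) + \<i> * of_real (x k * \<eta> (K + k) * freq a b)) * cis (freq a b * \<eta> k)
        = (A k + B k * of_nat m) * zz \<eta> k ^ m" for k
        unfolding cis_freq ab(3) unit_power_cancel(2)[OF norm_zz] A_def B_def by simp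
      then show ?thesis using z[OF ab(1,2)] ne unfolding Rder_sum[OF ab(1,2)] by simp
    qed
    show ?thesis
    proof (cases "j < i")
      case True
      have e: "zz \<eta> k ^ i * cnj (zz \<eta> k) ^ j = zz \<eta> k ^ (i - j)" for k
        using unit_power_cancel(2)[of "zz \<eta> k" j "i - j"] True by simp
      have n: "of_nat i - of_nat j = (of_nat (i - j) :: complex)" using True by (simp add: of_nat_diff)
      show ?thesis unfolding e n using pos[of "i - j"] True ij by simp
    next
      case False
      then have ij': "i < j" using ij by simp
      have e: "zz \<eta> k ^ i * cnj (zz \<eta> k) ^ j = cnj (zz \<eta> k ^ (j - i))" for k
        using unit_power_cancel(1)[of "zz \<eta> k" i "j - i"] ij' by simp
      have n: "of_nat i - of_nat j = - (of_nat (j - i) :: complex)" using ij' by (simp add: of_nat_diff)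
      have cAB: "cnj (A k) = A k" "cnj (B k) = - B k" for k by (simp_all add: A_def B_def)
      have "(\<Sum>k<K. (A k + B k * - of_nat (j - i)) * cnj (zz \<eta> k ^ (j - i))) = cnj (\<Sum>k<K. (A k + B k * of_nat (j - i)) * zz \<eta> k ^ (j - i))"
        by (simp add: cAB)
      moreover have "(\<Sum>k<K. (A k + B k * of_nat (j - i)) * zz \<eta> k ^ (j - i)) = 0"
        by (rule pos) (use ij' ij in auto)
      ultimately show ?thesis unfolding e n by (simp only: complex_cnj_zero)
    qed
  qed
  have z0: "zz \<eta> k \<noteq> 0" for k by (simp add: zz_def)
  have ind1: "A k = 0" if "k < K" for k
    by (rule exp_sum_independent(1)[of "zz \<eta>" K M A B, OF inj SK z0 _ norm_zz that]) (rule T; assumption)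
  have ind2: "B k = 0" if "k < K" for k
    by (rule exp_sum_independent(2)[of "zz \<eta>" K M A B, OF inj SK z0 _ norm_zz that]) (rule T; assumption)
  have x1: "x (K + k) = 0" if "k < K" for k using ind1[OF that] by (simp add: A_def)
  have x0: "x k = 0" if k: "k < K" for k
  proof -
    have "\<eta> (K + k) \<noteq> 0" using g k by (auto simp: good_def)
    then show ?thesis using ind2[OF k] by (simp add: B_def)
  qed
  have x2: "x (sidx j) = 0" if "j < L" for j
    using z[OF that that] unfolding Rder_sum[OF that that] by (simp add: x0 x1)
  fix a assume a: "a < d"
  consider "a < K" | "K \<le> a" "a < 2 * K" | "2 * K \<le> a" by linarith
  then show "x a = 0"
  proof cases
    case 2 then show ?thesis using x1[of "a - K"] by simp
  next
    case 3
    have "a = sidx (a - 2 * K)" "a - 2 * K < L" using 3 a L_pos by (auto simp: sidx_def nsig_def split: if_splits)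
    then show ?thesis using x2[of "a - 2 * K"] by simp
  qed (use x0 in auto)
qed

text \<open>Linear conditions instead of a parametrised form, so that differences of feasible and
  parametric covariances qualify at once. Equality of lags is written with sums to avoid truncated
  subtraction.\<close>

definition tangent :: "(nat \<Rightarrow> nat \<Rightarrow> complex) \<Rightarrow> bool"
  where "tangent D \<longleftrightarrow> hermitian L D \<and>
    (\<forall>j<L. \<forall>l<L. \<forall>j'<L. \<forall>l'<L. j \<noteq> l \<longrightarrow> pos j + pos l' = pos j' + pos l \<longrightarrow> D j l = D j' l') \<and>
    (eqv \<longrightarrow> (\<forall>j<L. D j j = D 0 0))"

lemma tangentI:
  assumes "\<And>j l. j < L \<Longrightarrow> l < L \<Longrightarrow> D j l = t (int (pos j) - int (pos l)) + (if j = l then complex_of_real (w j) else 0)"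
    and "\<And>n. t (- n) = cnj (t n)" and "eqv \<Longrightarrow> (\<And>j. j < L \<Longrightarrow> w j = w 0)"
  shows "tangent D"
  unfolding tangent_def
proof (intro conjI impI allI)
  show "hermitian L D" unfolding hermitian_def
  proof (intro allI impI)
    fix i j assume ij: "i < L" "j < L"
    show "D i j = cnj (D j i)"
      unfolding assms(1)[OF ij] assms(1)[OF ij(2,1)] using assms(2)[of "int (pos j) - int (pos i)"] by auto
  qed
  show "D j l = D j' l'" if "j < L" "l < L" "j' < L" "l' < L" "j \<noteq> l" "pos j + pos l' = pos j' + pos l" for j l j' l'
  proof -
    have "int (pos j) - int (pos l) = int (pos j') - int (pos l')" using that(6) by linarith
    moreover have "j' \<noteq> l'" using that pos_inj[of j l] by auto
    then have "D j' l' = t (int (pos j') - int (pos l'))" using assms(1)[OF that(3,4)] by simp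
    moreover have "D j l = t (int (pos j) - int (pos l))" using assms(1)[OF that(1,2)] that(5) by simp
    ultimately show ?thesis by (simp only:)
  qed
  show "D j j = D 0 0" if "eqv" "j < L" for j
    using assms(1)[of j j] assms(1)[of 0 0] assms(3)[OF that] that(2) L_pos by simp
qed

lemma tangentD:
  assumes "tangent D"
  shows tangent_herm: "i < L \<Longrightarrow> j < L \<Longrightarrow> D i j = cnj (D j i)"
    and tangent_shift: "j < L \<Longrightarrow> l < L \<Longrightarrow> j' < L \<Longrightarrow> l' < L \<Longrightarrow> j \<noteq> l \<Longrightarrow>
      pos j + pos l' = pos j' + pos l \<Longrightarrow> D j l = D j' l'"
    and tangent_diag: "eqv \<Longrightarrow> j < L \<Longrightarrow> D j j = D 0 0"
proof -
  note a = conjunct1[OF assms[unfolded tangent_def]]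
    conjunct1[OF conjunct2[OF assms[unfolded tangent_def]]]
    conjunct2[OF conjunct2[OF assms[unfolded tangent_def]]]
  show "i < L \<Longrightarrow> j < L \<Longrightarrow> D i j = cnj (D j i)" by (rule a(1)[unfolded hermitian_def, rule_format])
  show "j < L \<Longrightarrow> l < L \<Longrightarrow> j' < L \<Longrightarrow> l' < L \<Longrightarrow> j \<noteq> l \<Longrightarrow>
      pos j + pos l' = pos j' + pos l \<Longrightarrow> D j l = D j' l'" by (rule a(2)[rule_format])
  show "eqv \<Longrightarrow> j < L \<Longrightarrow> D j j = D 0 0" by (rule a(3)[rule_format])
qed

lemma tangent_diff:
  assumes D: "tangent D" and D': "tangent D'"
  shows "tangent (D - D')"
proof -
  note h = tangent_herm[OF D] tangent_herm[OF D']
    and t = tangent_shift[OF D] tangent_shift[OF D'] and q = tangent_diag[OF D] tangent_diag[OF D']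
  show ?thesis unfolding tangent_def hermitian_def
  proof (intro conjI allI impI)
    show "(D - D') i j = cnj ((D - D') j i)" if "i < L" "j < L" for i j
      using h(1)[OF that] h(2)[OF that] by (simp only: minus_apply complex_cnj_diff)
    show "(D - D') j l = (D - D') j' l'"
      if "j < L" "l < L" "j' < L" "l' < L" "j \<noteq> l" "pos j + pos l' = pos j' + pos l" for j l j' l'
      using t(1)[OF that] t(2)[OF that] by (simp only: minus_apply)
    show "(D - D') j j = (D - D') 0 0" if "eqv" "j < L" for j
      using q(1)[OF that] q(2)[OF that] by (simp only: minus_apply)
  qed
qed

lemma cis_freq_int: "cis (freq j l * t) = cis (2 * pi * of_int (int (pos j) - int (pos l)) * t)"
  by (simp add: freq_def)

lemma tangent_Rpar: "tangent (Rp \<eta>)"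
proof (rule tangentI[where t = "\<lambda>n. \<Sum>k<K. of_real (\<eta> (K + k)) * cis (2 * pi * of_int n * \<eta> k)" and w = "\<lambda>j. \<eta> (sidx j)"])
  show "(\<Sum>k<K. of_real (\<eta> (K + k)) * cis (2 * pi * of_int (- n) * \<eta> k)) =
      cnj (\<Sum>k<K. of_real (\<eta> (K + k)) * cis (2 * pi * of_int n * \<eta> k))" for n
    by (simp add: cis_cnj)
  show "\<eta> (sidx j) = \<eta> (sidx 0)" if "eqv" "j < L" for j using that(1) unfolding sidx_def by simp
qed (auto simp: Rpar_entry cis_freq_int)

lemma tangent_Rmod:
  assumes f: "spa_feasible eqv M Om u s"
  shows "tangent (Rmod M Om u s)"
proof (rule tangentI[where t = "\<lambda>n. if n \<le> 0 then u (nat (- n)) else cnj (u (nat n))" and w = s])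
  show "Rmod M Om u s j l = (if int (pos j) - int (pos l) \<le> 0 then u (nat (- (int (pos j) - int (pos l))))
      else cnj (u (nat (int (pos j) - int (pos l))))) + (if j = l then complex_of_real (s j) else 0)" if jl: "j < L" "l < L" for j l
  proof -
    have "nat (int (pos l) - int (pos j)) = pos l - pos j" "nat (int (pos j) - int (pos l)) = pos j - pos l" by linarith+
    then show ?thesis using jl pos_less by (auto simp: Rmod_def compress_entry toep_def diagm_def)
  qed
  show "(if - n \<le> 0 then u (nat (- (- n))) else cnj (u (nat (- n)))) =
     cnj (if n \<le> 0 then u (nat (- n)) else cnj (u (nat n)))" for n :: int
    using feasible_u0[OF f] by (auto simp: complex_eq_iff)
  show "s j = s 0" if "eqv" "j < L" for j :: nat using f that(1) unfolding spa_feasible_def by simp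
qed

lemma tangent_Rder_sum: "tangent (\<lambda>j l. \<Sum>a<d. of_real (x a) * Rder \<eta> a j l)"
proof (rule tangentI[where t = "\<lambda>n. \<Sum>k<K. (of_real (x (K + k)) + \<i> * of_real (x k * \<eta> (K + k) * (2 * pi * of_int n))) * cis (2 * pi * of_int n * \<eta> k)"
      and w = "\<lambda>j. x (sidx j)"])
  show "(\<Sum>a<d. of_real (x a) * Rder \<eta> a j l) =
     (\<Sum>k<K. (of_real (x (K + k)) + \<i> * of_real (x k * \<eta> (K + k) * (2 * pi * of_int (int (pos j) - int (pos l))))) *
        cis (2 * pi * of_int (int (pos j) - int (pos l)) * \<eta> k)) + (if j = l then complex_of_real (x (sidx j)) else 0)"
    if "j < L" "l < L" for j l
    unfolding Rder_sum[OF that] cis_freq_int by (simp add: freq_def)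
  show "(\<Sum>k<K. (of_real (x (K + k)) + \<i> * of_real (x k * \<eta> (K + k) * (2 * pi * of_int (- n)))) * cis (2 * pi * of_int (- n) * \<eta> k))
    = cnj (\<Sum>k<K. (of_real (x (K + k)) + \<i> * of_real (x k * \<eta> (K + k) * (2 * pi * of_int n))) * cis (2 * pi * of_int n * \<eta> k))" for n
    by (simp add: cis_cnj)
  show "x (sidx j) = x (sidx 0)" if "eqv" "j < L" for j using that(1) unfolding sidx_def by simp
qed

lemma hermitian_Rder: "a < d \<Longrightarrow> adjm (Rder \<eta> a) = Rder \<eta> a"
proof -
  assume a: "a < d"
  have "(\<Sum>b<d. of_real (if b = a then 1 else 0) * Rder \<eta> b j l) = Rder \<eta> a j l" for j l
  proof -
    have "(\<Sum>b<d. of_real (if b = a then 1 else 0) * Rder \<eta> b j l) = (\<Sum>b<d. if b = a then Rder \<eta> a j l else 0)"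
      by (intro sum.cong) auto
    then show ?thesis using a by simp
  qed
  then have "hermitian L (Rder \<eta> a)"
    using tangent_Rder_sum[of "\<lambda>b. if b = a then 1 else 0" \<eta>] unfolding tangent_def by simp
  then show ?thesis using hermitian_iff_adjm[OF msupp_Rder] by simp
qed

text \<open>The tangent space has dimension \<open>d\<close>: \<open>d\<close> real coordinates determine its elements, so
  independence of the \<open>d\<close> partial derivatives makes them a spanning set.\<close>

lemma tangent_span:
  assumes g: "good \<eta>" and D: "tangent D"
  shows "\<exists>x. \<forall>j<L. \<forall>l<L. D j l = (\<Sum>a<d. of_real (x a) * Rder \<eta> a j l)"
proof -
  have "\<exists>f. \<forall>m<M. fst (f m) < L \<and> snd (f m) < L \<and> pos (fst (f m)) = pos (snd (f m)) + m"
    using exists_lag by (intro choice) (metis fst_conv snd_conv)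
  then obtain f where f: "\<And>m. m < M \<Longrightarrow> fst (f m) < L \<and> snd (f m) < L \<and> pos (fst (f m)) = pos (snd (f m)) + m" by blast
  define en where "en D m = (D :: nat \<Rightarrow> nat \<Rightarrow> complex) (fst (f m)) (snd (f m))" for D m
  \<comment> \<open>The \<open>d\<close> real coordinates: real and imaginary parts at the lags
    \<open>1\<close> to \<open>M - 1\<close>, hence the offset \<open>+ 1\<close>, followed by the
    diagonal entries carrying independent noise.\<close>
  define c where "c D b = (if b < K then Re (en D (b + 1)) else if b < 2 * K then Im (en D (b - K + 1)) else Re (D (b - 2 * K) (b - 2 * K)))" for D b
  have nsL: "q < L" if "q < nsig eqv Om" for q using that L_pos by (auto simp: nsig_def split: if_splits)
  have zero: "E j l = 0" if E: "tangent E" and cz: "\<And>b. b < d \<Longrightarrow> c E b = 0" and jl: "j < L" "l < L" for E j l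
  proof -
    have herm: "E j l = cnj (E l j)" if "j < L" "l < L" for j l
      by (rule tangent_herm[OF E that])
    have enz: "en E m = 0" if m: "0 < m" "m < M" for m
    proof -
      obtain n where n: "m = Suc n" using m(1) by (cases m) auto
      have nK: "n < K" "n < d" "K + n < d" using n m SK by auto
      have "Re (en E m) = 0" using cz[OF nK(2)] nK(1) n by (simp add: c_def)
      moreover have "Im (en E m) = 0" using cz[OF nK(3)] nK(1) n by (simp add: c_def)
      ultimately show ?thesis by (simp add: complex_eq_iff)
    qed
    have gt: "E j l = 0" if "j < L" "l < L" "pos l < pos j" for j l
    proof -
      let ?m = "pos j - pos l"
      have m: "0 < ?m" "?m < M" using that pos_less[OF that(1)] by auto
      have "E j l = E (fst (f ?m)) (snd (f ?m))"
        by (rule tangent_shift[OF E]) (use f[OF m(2)] that in auto)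
      then show ?thesis using enz[OF m] by (simp add: en_def)
    qed
    consider "pos l < pos j" | "pos j < pos l" | "pos j = pos l" by linarith
    then show ?thesis
    proof cases
      case 1 then show ?thesis using gt jl by blast
    next
      case 2 then show ?thesis using gt[of l j] jl herm[of j l] by simp
    next
      case 3
      then have "j = l" using pos_inj jl by blast
      let ?q = "if eqv then 0 else j"
      have q: "?q < nsig eqv Om" using jl by (auto simp: nsig_def)
      have "Re (E ?q ?q) = 0" using cz[of "2 * K + ?q"] q by (simp add: c_def)
      moreover have "Im (E ?q ?q) = 0" using herm[of ?q ?q] jl L_pos by (simp add: complex_eq_iff split: if_splits)
      moreover have "E j j = E ?q ?q" using tangent_diag[OF E] jl by (cases eqv) auto
      ultimately show ?thesis using \<open>j = l\<close> by (simp add: complex_eq_iff)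
    qed
  qed
  have c_lin: "c (\<lambda>j l. \<Sum>a<d. of_real (x a) * Rder \<eta> a j l) b = (\<Sum>a<d. c (Rder \<eta> a) b * x a)" for x b
    unfolding c_def en_def by (simp add: mult.commute)
  define G where "G b a = c (Rder \<eta> a) b" for a b
  \<comment> \<open>A kernel vector would combine the derivatives into a tangent element with zero
    coordinates, hence to zero, against their independence.\<close>
  have det: "mdet d G \<noteq> 0"
  proof
    assume "mdet d G = 0"
    then obtain x where x: "\<exists>i<d. x i \<noteq> 0" "\<And>i. i < d \<Longrightarrow> (\<Sum>j<d. G i j * x j) = 0"
      unfolding mdet_0_kernel by blast
    have "(\<Sum>a<d. of_real (x a) * Rder \<eta> a j l) = 0" if "j < L" "l < L" for j l
      by (rule zero[OF tangent_Rder_sum _ that]) (unfold c_lin, use x(2) in \<open>simp add: G_def\<close>)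
    then show False using Rder_independent[OF g, of x] x(1) by blast
  qed
  define x where "x a = (\<Sum>b<d. minv d G a b * c D b)" for a
  have Gx: "(\<Sum>a<d. G b a * x a) = c D b" if b: "b < d" for b
  proof -
    have "(\<Sum>a<d. G b a * x a) = (\<Sum>e<d. mmul d G (minv d G) b e * c D e)"
      unfolding x_def mmul_def sum_distrib_left sum_distrib_right by (subst sum.swap) (simp add: mult.assoc)
    also have "\<dots> = (\<Sum>e<d. if e = b then c D b else 0)"
      by (intro sum.cong refl) (simp add: minv_right[OF det b] idm_def)
    finally show ?thesis using b by simp
  qed
  let ?E = "D - (\<lambda>j l. \<Sum>a<d. of_real (x a) * Rder \<eta> a j l)"
  have cE: "c ?E b = 0" if "b < d" for b
  proof -
    have "c ?E b = c D b - c (\<lambda>j l. \<Sum>a<d. of_real (x a) * Rder \<eta> a j l) b"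
      unfolding c_def en_def by simp
    then show ?thesis unfolding c_lin using Gx[OF that] by (simp add: G_def)
  qed
  have "D j l = (\<Sum>a<d. of_real (x a) * Rder \<eta> a j l)" if "j < L" "l < L" for j l
    using zero[OF tangent_diff[OF D tangent_Rder_sum[of x \<eta>]] cE that] by simp
  then show ?thesis by blast
qed

subsection \<open>Derivatives along coordinates\<close>

text \<open>An extension to complex values of the coordinate \<open>a\<close>: the derivatives of determinant and inverse are complex ones.\<close>

definition Rcx :: "(nat \<Rightarrow> real) \<Rightarrow> nat \<Rightarrow> complex \<Rightarrow> nat \<Rightarrow> nat \<Rightarrow> complex"
  where "Rcx \<eta> a t j l = (if j < L \<and> l < L then Rp \<eta> j l +
     (if a < K then of_real (\<eta> (K + a)) * (exp (\<i> * of_real (freq j l) * t) - cis (freq j l * \<eta> a))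
      else (t - of_real (\<eta> a)) * Rder \<eta> a j l) else 0)"

lemma Rcx_deriv:
  assumes "j < L" "l < L"
  shows "((\<lambda>t. Rcx \<eta> a t j l) has_field_derivative Rder \<eta> a j l) (at (of_real (\<eta> a)))"
proof (cases "a < K")
  case True
  have "((\<lambda>t. Rp \<eta> j l + of_real (\<eta> (K + a)) * (exp (\<i> * of_real (freq j l) * t) - cis (freq j l * \<eta> a)))
     has_field_derivative of_real (\<eta> (K + a)) * (exp (\<i> * of_real (freq j l) * of_real (\<eta> a)) * (\<i> * of_real (freq j l)))) (at (of_real (\<eta> a)))"
    by (auto intro!: derivative_eq_intros)
  moreover have "exp (\<i> * of_real (freq j l) * of_real (\<eta> a)) = cis (freq j l * \<eta> a)"
    by (simp add: cis_conv_exp mult.assoc)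
  ultimately show ?thesis using True assms by (simp add: Rcx_def Rder_def mult_ac)
next
  case False
  have "((\<lambda>t. Rp \<eta> j l + (t - of_real (\<eta> a)) * Rder \<eta> a j l) has_field_derivative Rder \<eta> a j l) (at (of_real (\<eta> a)))"
    by (auto intro!: derivative_eq_intros)
  then show ?thesis using False assms by (simp add: Rcx_def)
qed

lemma Rcx_real:
  assumes a: "a < d"
  shows "Rcx \<eta> a (of_real t) = Rp (\<eta>(a := t))"
proof (rule msupp_eqI[OF _ msupp_Rpar])
  show "msupp L (Rcx \<eta> a (of_real t))" by (auto simp: msupp_def Rcx_def)
  fix j l assume jl: "j < L" "l < L"
  have e: "exp (\<i> * of_real (freq j l) * of_real t) = cis (freq j l * t)"
    by (simp add: cis_conv_exp mult.assoc)
  let ?f = "\<lambda>\<eta> k. complex_of_real (\<eta> (K + k)) * cis (freq j l * \<eta> k)"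
  consider "a < K" | "K \<le> a" "a < 2 * K" | "2 * K \<le> a" by linarith
  then show "Rcx \<eta> a (of_real t) j l = Rp (\<eta>(a := t)) j l"
  proof cases
    case 1
    have s: "sidx q \<noteq> a" for q using 1 unfolding sidx_def by simp
    have "(\<Sum>k<K. ?f (\<eta>(a := t)) k) = (\<Sum>k<K. ?f \<eta> k + (if k = a then of_real (\<eta> (K + a)) * (cis (freq j l * t) - cis (freq j l * \<eta> a)) else 0))"
      using 1 by (intro sum.cong refl) (auto simp: algebra_simps)
    also have "\<dots> = (\<Sum>k<K. ?f \<eta> k) + of_real (\<eta> (K + a)) * (cis (freq j l * t) - cis (freq j l * \<eta> a))"
      using 1 by (simp add: sum.distrib)
    finally show ?thesis using 1 jl s by (simp add: Rcx_def e Rpar_entry)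
  next
    case 2
    have s: "sidx q \<noteq> a" for q using 2 unfolding sidx_def by simp
    have aK: "a - K < K" using 2 by linarith
    have "(\<Sum>k<K. ?f (\<eta>(a := t)) k) = (\<Sum>k<K. ?f \<eta> k + (if k = a - K then (of_real t - of_real (\<eta> a)) * cis (freq j l * \<eta> (a - K)) else 0))"
      using 2 by (intro sum.cong refl) (auto simp: algebra_simps)
    also have "\<dots> = (\<Sum>k<K. ?f \<eta> k) + (of_real t - of_real (\<eta> a)) * cis (freq j l * \<eta> (a - K))"
      using aK by (simp add: sum.distrib)
    finally show ?thesis using 2 jl s by (simp add: Rcx_def Rder_def Rpar_entry)
  next
    case 3
    have "(\<Sum>k<K. ?f (\<eta>(a := t)) k) = (\<Sum>k<K. ?f \<eta> k)"
      using 3 by (intro sum.cong refl) auto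
    then show ?thesis using 3 jl by (auto simp: Rcx_def Rder_def Rpar_entry)
  qed
qed

lemma has_real_derivative_Re:
  assumes "(f has_field_derivative D) (at (of_real t0))"
  shows "((\<lambda>t. Re (f (of_real t))) has_real_derivative Re D) (at t0)"
proof -
  have "((\<lambda>t. f (of_real t)) has_vector_derivative D) (at t0)"
    using has_vector_derivative_real_field[OF assms] by simp
  then have "((\<lambda>t. Re (f (of_real t))) has_vector_derivative Re D) (at t0)"
    by (rule bounded_linear.has_vector_derivative[OF bounded_linear_Re])
  then show ?thesis by (simp add: has_real_derivative_iff_has_vector_derivative)
qed

lemma mtr_mmul: "mtr n (A \<odot>\<^bsub>n\<^esub> B) = (\<Sum>i<n. \<Sum>j<n. A i j * B j i)"
  unfolding mtr_def mmul_def ..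

text \<open>Gradient of the criterion in trace form. The matrix \<open>S\<close> is arbitrary and
  constant; its role is that of the inverse of \<open>Rt\<close>.\<close>

lemma obj_deriv:
  assumes g: "good \<eta>" and a: "a < d"
  defines "Q \<equiv> minv L (Rp \<eta>)"
  shows "((\<lambda>t. Re (mtr L (minv L (Rp (\<eta>(a := t))) \<odot>\<^bsub>L\<^esub> Rt)) + Re (mtr L (S \<odot>\<^bsub>L\<^esub> Rp (\<eta>(a := t)))))
     has_real_derivative (Re (mtr L (S \<odot>\<^bsub>L\<^esub> Rder \<eta> a)) - Re (mtr L (Q \<odot>\<^bsub>L\<^esub> Rder \<eta> a \<odot>\<^bsub>L\<^esub> Q \<odot>\<^bsub>L\<^esub> Rt)))) (at (\<eta> a))"
proof -
  have R0: "Rcx \<eta> a (of_real (\<eta> a)) = Rp \<eta>" unfolding Rcx_real[OF a] by simp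
  have d: "mdet L (Rcx \<eta> a (of_real (\<eta> a))) \<noteq> 0" unfolding R0 by (rule pd_mdet[OF pd_Rpar[OF g]])
  have "((\<lambda>t. mtr L (minv L (Rcx \<eta> a t) \<odot>\<^bsub>L\<^esub> Rt) + mtr L (S \<odot>\<^bsub>L\<^esub> Rcx \<eta> a t)) has_field_derivative
     (\<Sum>i<L. \<Sum>j<L. - (Q \<odot>\<^bsub>L\<^esub> Rder \<eta> a \<odot>\<^bsub>L\<^esub> Q) i j * Rt j i) + (\<Sum>i<L. \<Sum>j<L. S i j * Rder \<eta> a j i)) (at (of_real (\<eta> a)))"
    unfolding mtr_mmul Q_def R0[symmetric]
    by (intro DERIV_add DERIV_sum DERIV_cmult DERIV_cmult_right has_field_derivative_minv Rcx_deriv d) auto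
  from has_real_derivative_Re[OF this]
  show ?thesis unfolding Rcx_real[OF a] by (simp add: mtr_mmul sum_negf)
qed

text \<open>Jacobi's formula for the log-determinant and the derivative of the inverse for the
  exponent show the score to be a quadratic form minus its mean, so Fisher information becomes a
  covariance of quadratic forms.\<close>

lemma score_eq:
  assumes g: "good \<eta>" and a: "a < d"
  defines "Q \<equiv> minv L (Rp \<eta>)"
  shows "score eqv Om K \<eta> a y = Re (qform L (Q \<odot>\<^bsub>L\<^esub> Rder \<eta> a \<odot>\<^bsub>L\<^esub> Q) y) - Re (mtr L (Q \<odot>\<^bsub>L\<^esub> Rder \<eta> a))"
proof -
  have R0: "Rcx \<eta> a (of_real (\<eta> a)) = Rp \<eta>" unfolding Rcx_real[OF a] by simp
  have d: "mdet L (Rcx \<eta> a (of_real (\<eta> a))) \<noteq> 0" unfolding R0 by (rule pd_mdet[OF pd_Rpar[OF g]])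
  note dp = mdet_pd_real[OF pd_Rpar[OF g] msupp_Rpar]
  have "((\<lambda>t. mdet L (Rcx \<eta> a t)) has_field_derivative mdet L (Rp \<eta>) * mtr L (Q \<odot>\<^bsub>L\<^esub> Rder \<eta> a)) (at (of_real (\<eta> a)))"
    unfolding Q_def R0[symmetric] by (rule has_field_derivative_mdet[OF Rcx_deriv d])
  from has_real_derivative_Re[OF this]
  have 1: "((\<lambda>t. Re (mdet L (Rp (\<eta>(a := t))))) has_real_derivative Re (mdet L (Rp \<eta>)) * Re (mtr L (Q \<odot>\<^bsub>L\<^esub> Rder \<eta> a))) (at (\<eta> a))"
    unfolding Rcx_real[OF a] by (subst (asm) dp(1)) (simp only: Re_complex_of_real times_complex.sel, simp)
  have "((\<lambda>t. qform L (minv L (Rcx \<eta> a t)) y) has_field_derivative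
     (\<Sum>i<L. \<Sum>j<L. cnj (y i) * - (Q \<odot>\<^bsub>L\<^esub> Rder \<eta> a \<odot>\<^bsub>L\<^esub> Q) i j * y j)) (at (of_real (\<eta> a)))"
    unfolding qform_def Q_def R0[symmetric]
    by (intro DERIV_sum DERIV_cmult DERIV_cmult_right has_field_derivative_minv Rcx_deriv d) auto
  from has_real_derivative_Re[OF this]
  have 2: "((\<lambda>t. Re (qform L (minv L (Rp (\<eta>(a := t)))) y)) has_real_derivative - Re (qform L (Q \<odot>\<^bsub>L\<^esub> Rder \<eta> a \<odot>\<^bsub>L\<^esub> Q) y)) (at (\<eta> a))"
    unfolding Rcx_real[OF a] qform_def by (simp add: sum_negf)
  have p0: "0 < Re (mdet L (Rp (\<eta>(a := \<eta> a))))" using dp(2) by simp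
  have "((\<lambda>t. loglik eqv Om K (\<eta>(a := t)) y) has_real_derivative
     (0 - Re (mdet L (Rp \<eta>)) * Re (mtr L (Q \<odot>\<^bsub>L\<^esub> Rder \<eta> a)) * (1 / Re (mdet L (Rp (\<eta>(a := \<eta> a)))))
      - - Re (qform L (Q \<odot>\<^bsub>L\<^esub> Rder \<eta> a \<odot>\<^bsub>L\<^esub> Q) y))) (at (\<eta> a))"
    unfolding loglik_def
    by (intro DERIV_diff 2 DERIV_const DERIV_cong[OF DERIV_chain2[OF DERIV_ln_divide[OF p0] 1]]) simp
  then show ?thesis unfolding score_def using dp(2) by (simp add: DERIV_imp_deriv)
qed

end

lemma mtr_mmul_sum:
  "mtr n (Z \<odot>\<^bsub>n\<^esub> (\<lambda>i j. \<Sum>a<d. complex_of_real (x a) * Y a i j)) = (\<Sum>a<d. complex_of_real (x a) * mtr n (Z \<odot>\<^bsub>n\<^esub> Y a))"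
proof -
  have "mtr n (Z \<odot>\<^bsub>n\<^esub> (\<lambda>i j. \<Sum>a<d. complex_of_real (x a) * Y a i j)) = (\<Sum>i<n. \<Sum>j<n. \<Sum>a<d. complex_of_real (x a) * (Z i j * Y a j i))"
    unfolding mtr_def mmul_def by (simp add: sum_distrib_left mult_ac)
  also have "\<dots> = (\<Sum>i<n. \<Sum>a<d. \<Sum>j<n. complex_of_real (x a) * (Z i j * Y a j i))"
    by (rule sum.cong[OF refl], rule sum.swap)
  also have "\<dots> = (\<Sum>a<d. \<Sum>i<n. \<Sum>j<n. complex_of_real (x a) * (Z i j * Y a j i))" by (rule sum.swap)
  finally show ?thesis unfolding mtr_def mmul_def by (simp add: sum_distrib_left)
qed

subsection \<open>Perturbation of positive definite matrices\<close>

lemma pdD: "pd n A \<Longrightarrow> \<exists>i<n. v i \<noteq> 0 \<Longrightarrow> 0 < Re (qform n A v)"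
  unfolding pd_def by (elim conjE allE impE)

lemma pd_lower_bound:
  assumes p: "pd n A" and s: "msupp n A"
  obtains m where "m > 0" "\<And>v. m * (\<Sum>i<n. (cmod (v i))\<^sup>2) \<le> Re (qform n A v)"
proof -
  have h: "hermitian n A" using p by (simp add: pd_def)
  obtain U l where U: "msupp n U" "adjm U \<odot>\<^bsub>n\<^esub> U = eye n" "U \<odot>\<^bsub>n\<^esub> adjm U = eye n"
    "A = U \<odot>\<^bsub>n\<^esub> diagm n l \<odot>\<^bsub>n\<^esub> adjm U" by (rule hermitian_spectral[OF h s])
  have l: "l j > 0" if j: "j < n" for j
  proof -
    have "qform n A (\<lambda>i. U i j) = qform n (diagm n l) (\<lambda>k. \<Sum>i<n. cnj (U i k) * U i j)"
      unfolding U(4) by (rule qform_congruence)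
    also have "\<dots> = qform n (diagm n l) (\<lambda>k. eye n k j)"
      unfolding U(2)[symmetric] by (simp add: mmul_def adjm_def)
    also have "\<dots> = of_real (\<Sum>i<n. if i = j then l j else 0)"
      unfolding qform_diagm by (intro arg_cong[of _ _ of_real] sum.cong) (auto simp: eye_def)
    also have "\<dots> = of_real (l j)" using j by simp
    finally have q: "qform n A (\<lambda>i. U i j) = of_real (l j)" .
    have "\<exists>i<n. U i j \<noteq> 0"
    proof (rule ccontr)
      assume "\<not> ?thesis"
      then have "mmul n (adjm U) U j j = 0" by (simp add: mmul_def)
      then show False unfolding U(2) using j by (simp add: eye_def)
    qed
    then have "0 < Re (qform n A (\<lambda>i. U i j))" by (rule pdD[OF p])
    then show ?thesis unfolding q by simp
  qed
  \<comment> \<open>The inserted \<open>1\<close> keeps the minimum meaningful for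
    \<open>n = 0\<close>.\<close>
  define m where "m = Min (insert 1 (l ` {..<n}))"
  have m: "m > 0" "\<And>j. j < n \<Longrightarrow> m \<le> l j" unfolding m_def using l by auto
  have eye: "eye n = diagm n (\<lambda>_. 1)" by (auto simp: eye_def diagm_def intro!: ext)
  have "m * (\<Sum>i<n. (cmod (v i))\<^sup>2) \<le> Re (qform n A v)" for v
  proof -
    let ?w = "\<lambda>k. \<Sum>i<n. cnj (U i k) * v i"
    have "eye n = U \<odot>\<^bsub>n\<^esub> diagm n (\<lambda>_. 1) \<odot>\<^bsub>n\<^esub> adjm U"
      unfolding eye[symmetric] by (simp add: mmul_eye_right U(1,3))
    then have "qform n (eye n) v = qform n (diagm n (\<lambda>_. 1)) ?w" by (metis qform_congruence)
    then have "complex_of_real (\<Sum>i<n. (cmod (v i))\<^sup>2) = of_real (\<Sum>k<n. (cmod (?w k))\<^sup>2)"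
      unfolding eye qform_diagm by simp
    then have n: "(\<Sum>i<n. (cmod (v i))\<^sup>2) = (\<Sum>k<n. (cmod (?w k))\<^sup>2)" unfolding of_real_eq_iff .
    have "Re (qform n A v) = (\<Sum>k<n. l k * (cmod (?w k))\<^sup>2)"
      unfolding U(4) qform_congruence qform_diagm by simp
    moreover have "m * (\<Sum>k<n. (cmod (?w k))\<^sup>2) \<le> (\<Sum>k<n. l k * (cmod (?w k))\<^sup>2)"
      unfolding sum_distrib_left by (intro sum_mono mult_right_mono) (use m in auto)
    ultimately show ?thesis unfolding n by simp
  qed
  with m(1) show ?thesis by (rule that)
qed

lemma qform_bound:
  assumes "\<And>i j. i < n \<Longrightarrow> j < n \<Longrightarrow> cmod (E i j) \<le> e"
  shows "\<bar>Re (qform n E v)\<bar> \<le> e * real n * (\<Sum>i<n. (cmod (v i))\<^sup>2)"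
proof -
  have "\<bar>Re (qform n E v)\<bar> \<le> cmod (qform n E v)" by (rule abs_Re_le_cmod)
  also have "\<dots> \<le> (\<Sum>i<n. \<Sum>j<n. cmod (cnj (v i) * E i j * v j))"
    unfolding qform_def by (intro order_trans[OF norm_sum] sum_mono norm_sum)
  also have "\<dots> \<le> (\<Sum>i<n. \<Sum>j<n. e * (((cmod (v i))\<^sup>2 + (cmod (v j))\<^sup>2) / 2))"
  proof (intro sum_mono)
    fix i j assume ij: "i \<in> {..<n}" "j \<in> {..<n}"
    have "cmod (v i) * cmod (v j) \<le> ((cmod (v i))\<^sup>2 + (cmod (v j))\<^sup>2) / 2"
      using sum_squares_bound[of "cmod (v i)" "cmod (v j)"] by simp
    moreover have "0 \<le> e" using assms[of i j] ij order_trans[OF norm_ge_zero[of "E i j"]] by simp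
    ultimately have "cmod (E i j) * (cmod (v i) * cmod (v j)) \<le> e * (((cmod (v i))\<^sup>2 + (cmod (v j))\<^sup>2) / 2)"
      using assms[of i j] ij by (intro mult_mono) auto
    then show "cmod (cnj (v i) * E i j * v j) \<le> e * (((cmod (v i))\<^sup>2 + (cmod (v j))\<^sup>2) / 2)"
      by (simp add: norm_mult mult_ac)
  qed
  also have "\<dots> = e * real n * (\<Sum>i<n. (cmod (v i))\<^sup>2)"
    by (simp add: sum_distrib_left[symmetric] sum_divide_distrib[symmetric] sum.distrib)
  finally show ?thesis .
qed

text \<open>Entries of size \<open>e\<close> change the form by at most \<open>e n |v|^2\<close>;
  with \<open>m\<close> the lower bound of the form and \<open>e = m / (n + 1)\<close> this stays
  below \<open>m |v|^2\<close>.\<close>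

lemma pd_perturb:
  assumes p: "pd n A" and s: "msupp n A"
  obtains e where "e > 0" "\<And>B. adjm B = B \<Longrightarrow> (\<And>i j. i < n \<Longrightarrow> j < n \<Longrightarrow> cmod (B i j - A i j) \<le> e) \<Longrightarrow> pd n B"
proof -
  obtain m where m: "m > 0" "\<And>v. m * (\<Sum>i<n. (cmod (v i))\<^sup>2) \<le> Re (qform n A v)"
    by (rule pd_lower_bound[OF p s]) blast
  define e where "e = m / (real n + 1)"
  have e: "e > 0" "e * real n < m" using m(1) by (auto simp: e_def field_simps)
  have "pd n B" if B: "adjm B = B" "\<And>i j. i < n \<Longrightarrow> j < n \<Longrightarrow> cmod (B i j - A i j) \<le> e" for B
    unfolding pd_def
  proof (intro conjI allI impI)
    show "hermitian n B" by (rule hermitianI[OF B(1)])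
    fix v :: "nat \<Rightarrow> complex" assume "\<exists>i<n. v i \<noteq> 0"
    then have N: "0 < (\<Sum>i<n. (cmod (v i))\<^sup>2)" by (auto intro: sum_pos2)
    have "qform n B v = qform n A v + qform n (\<lambda>i j. B i j - A i j) v"
      unfolding qform_def by (simp add: sum.distrib[symmetric] algebra_simps)
    moreover have "\<bar>Re (qform n (\<lambda>i j. B i j - A i j) v)\<bar> \<le> e * real n * (\<Sum>i<n. (cmod (v i))\<^sup>2)"
      by (rule qform_bound) (rule B(2))
    moreover have "e * real n * (\<Sum>i<n. (cmod (v i))\<^sup>2) < m * (\<Sum>i<n. (cmod (v i))\<^sup>2)"
      using e(2) N by (rule mult_strict_right_mono)
    ultimately show "0 < Re (qform n B v)" using m(2)[of v] by simp
  qed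
  with e(1) show ?thesis by (rule that)
qed

context spa_model
begin

subsection \<open>Labelling of the estimated frequencies\<close>

definition near :: "(nat \<Rightarrow> real) \<Rightarrow> real \<Rightarrow> (nat \<Rightarrow> real) \<Rightarrow> bool"
  where "near \<eta>0 r \<eta> \<longleftrightarrow> (\<forall>i<d. \<bar>\<eta> i - \<eta>0 i\<bar> \<le> r)"

text \<open>A radius within which labels cannot be confused: boxes of this radius about the
  frequencies are disjoint modulo integers, and powers and noise variances stay positive.\<close>

definition separated :: "(nat \<Rightarrow> real) \<Rightarrow> real \<Rightarrow> bool"
  where "separated \<eta>0 r \<longleftrightarrow> 0 < r \<and> r < 1 / 2 \<and>
    (\<forall>k<K. \<forall>l<K. k \<noteq> l \<longrightarrow> (\<forall>z::int. 2 * r < \<bar>\<eta>0 k - \<eta>0 l + of_int z\<bar>)) \<and>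
    (\<forall>i. K \<le> i \<longrightarrow> i < d \<longrightarrow> r < \<eta>0 i)"

lemma exists_separated:
  assumes g: "good \<eta>0" and rng: "\<And>k. k < K \<Longrightarrow> \<eta>0 k \<in> {0..<1}"
  obtains r where "separated \<eta>0 r"
proof -
  have inj: "inj_on (zz \<eta>0) {..<K}" using g by (simp add: good_def)
  \<comment> \<open>Pairwise circular distances of the frequencies, all of which lie in
    \<open>[0, 1)\<close>.\<close>
  define D where "D = (\<lambda>(k, l). min \<bar>\<eta>0 k - \<eta>0 l\<bar> (1 - \<bar>\<eta>0 k - \<eta>0 l\<bar>)) ` ({(k, l). k < K \<and> l < K \<and> k \<noteq> l})"
  have finD: "finite D" unfolding D_def
    by (rule finite_imageI, rule finite_subset[of _ "{..<K} \<times> {..<K}"]) auto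
  have Dpos: "x > 0" if "x \<in> D" for x
  proof -
    from that obtain k l where kl: "k < K" "l < K" "k \<noteq> l" "x = min \<bar>\<eta>0 k - \<eta>0 l\<bar> (1 - \<bar>\<eta>0 k - \<eta>0 l\<bar>)"
      unfolding D_def by auto
    have "\<eta>0 k \<noteq> \<eta>0 l" using inj_onD[OF inj, of k l] kl by (auto simp: zz_def)
    then show ?thesis using kl rng[OF kl(1)] rng[OF kl(2)] by auto
  qed
  define E where "E = \<eta>0 ` {i. K \<le> i \<and> i < d}"
  have finE: "finite E" unfolding E_def by (rule finite_imageI, rule finite_subset[of _ "{..<d}"]) auto
  have Epos: "x > 0" if "x \<in> E" for x
  proof -
    from that obtain i where i: "K \<le> i" "i < d" "x = \<eta>0 i" unfolding E_def by auto
    show ?thesis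
    proof (cases "i < 2 * K")
      case True
      then show ?thesis using g i unfolding good_def by (metis le_add_diff_inverse less_diff_conv2 mult_2 add_less_cancel_left)
    next
      case False
      then have "i - 2 * K < nsig eqv Om" "2 * K + (i - 2 * K) = i" using i by auto
      then show ?thesis using g i unfolding good_def by metis
    qed
  qed
  define m where "m = Min (insert 1 (D \<union> E))"
  have m: "m > 0" "m \<le> 1" "\<And>x. x \<in> D \<Longrightarrow> m \<le> x" "\<And>x. x \<in> E \<Longrightarrow> m \<le> x"
    unfolding m_def using finD finE Dpos Epos by auto
  \<comment> \<open>A third of the least margin, so that twice the radius is still strictly below
    it.\<close>
  have "separated \<eta>0 (m / 3)"
    unfolding separated_def
  proof (intro conjI allI impI)
    show "0 < m / 3" "m / 3 < 1 / 2" using m by auto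
    fix k l and z :: int assume kl: "k < K" "l < K" "k \<noteq> l"
    then have mD: "m \<le> min \<bar>\<eta>0 k - \<eta>0 l\<bar> (1 - \<bar>\<eta>0 k - \<eta>0 l\<bar>)" by (intro m(3)) (auto simp: D_def)
    consider "z = 0" | "z \<ge> 1" | "z \<le> -1" by linarith
    then have "m \<le> \<bar>\<eta>0 k - \<eta>0 l + of_int z\<bar>"
    proof cases
      case 1 then show ?thesis using mD by simp
    next
      case 2
      then have "(of_int z :: real) \<ge> 1" by simp
      then show ?thesis using mD by (auto simp: abs_if split: if_splits)
    next
      case 3
      then have "(of_int z :: real) \<le> -1" by (metis of_int_le_iff of_int_minus of_int_1)
      then show ?thesis using mD by (auto simp: abs_if split: if_splits)
    qed
    then show "2 * (m / 3) < \<bar>\<eta>0 k - \<eta>0 l + of_int z\<bar>" using m(1) by linarith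
  next
    fix i assume "K \<le> i" "i < d"
    then have "m \<le> \<eta>0 i" by (intro m(4)) (auto simp: E_def)
    then show "m / 3 < \<eta>0 i" using m(1) by linarith
  qed
  then show ?thesis by (rule that)
qed

lemma near_good:
  assumes s: "separated \<eta>0 r" and n: "near \<eta>0 r \<eta>"
  shows "good \<eta>"
  unfolding good_def
proof (intro conjI allI impI)
  have pos: "0 < \<eta> i" if "K \<le> i" "i < d" for i
  proof -
    have "\<bar>\<eta> i - \<eta>0 i\<bar> \<le> r" "r < \<eta>0 i" using n s that unfolding near_def separated_def by auto
    then show ?thesis by linarith
  qed
  show "0 < \<eta> (K + k)" if "k < K" for k using that by (intro pos) auto
  show "0 < \<eta> (2 * K + j)" if "j < nsig eqv Om" for j using that by (intro pos) auto
  show "inj_on (zz \<eta>) {..<K}"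
  proof (rule inj_onI, rule ccontr)
    fix k l assume kl: "k \<in> {..<K}" "l \<in> {..<K}" "zz \<eta> k = zz \<eta> l" "k \<noteq> l"
    then obtain z :: int where z: "\<eta> k = \<eta> l + of_int z" unfolding zz_def cis_2pi_eq_iff by blast
    have "2 * r < \<bar>\<eta>0 k - \<eta>0 l + of_int (- z)\<bar>" using s kl unfolding separated_def by blast
    moreover have "\<bar>\<eta> k - \<eta>0 k\<bar> \<le> r" "\<bar>\<eta> l - \<eta>0 l\<bar> \<le> r" using n kl unfolding near_def by auto
    ultimately show False using z by (simp add: abs_if split: if_splits)
  qed
qed

lemma crep_near: "\<bar>x - c\<bar> < 1 / 2 \<Longrightarrow> crep c (frac x) = x"
proof -
  assume x: "\<bar>x - c\<bar> < 1 / 2"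
  have "\<lfloor>frac x - c + 1/2\<rfloor> = - \<lfloor>x\<rfloor>"
    using x by (intro floor_unique) (auto simp: frac_def abs_if split: if_splits)
  then show ?thesis unfolding crep_def by (simp add: frac_def)
qed

lemma crep_int: "\<exists>z::int. crep c (frac x) = x + of_int z"
  unfolding crep_def frac_def by (rule exI[of _ "- \<lfloor>x\<rfloor> - \<lfloor>x - of_int \<lfloor>x\<rfloor> - c + 1/2\<rfloor>"]) simp

text \<open>The estimate belonging to a true frequency is within \<open>r\<close> of it and every
  other one is further than \<open>r\<close> on the circle, so the choice in \<open>nearest\<close>
  is forced.\<close>

lemma labeled_est_eq:
  assumes s: "separated \<eta>0 r" and n: "near \<eta>0 r \<eta>" and th: "\<And>k. k < K \<Longrightarrow> th k = \<eta>0 k"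
    and Th: "Th = (\<lambda>k. frac (\<eta> k)) ` {..<K}" and P: "\<And>k. k < K \<Longrightarrow> P (frac (\<eta> k)) = \<eta> (K + k)"
    and sg: "\<And>j. j < nsig eqv Om \<Longrightarrow> sg j = \<eta> (2 * K + j)"
  shows "labeled_est eqv Om K th Th P sg = restrict \<eta> {..<d}"
proof -
  have r: "r < 1 / 2" "0 < r" using s by (auto simp: separated_def)
  have nk: "\<bar>\<eta> k - \<eta>0 k\<bar> \<le> r" if "k < K" for k using n that by (auto simp: near_def)
  have own: "crep (th k) (frac (\<eta> k)) = \<eta> k" if k: "k < K" for k
    by (rule crep_near) (use nk[OF k] r th[OF k] in auto)
  have other: "r < \<bar>crep (th i) (frac (\<eta> k)) - th i\<bar>" if ik: "i < K" "k < K" "k \<noteq> i" for i k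
  proof -
    obtain z :: int where z: "crep (th i) (frac (\<eta> k)) = \<eta> k + of_int z" using crep_int by blast
    have "2 * r < \<bar>\<eta>0 k - \<eta>0 i + of_int z\<bar>" using s ik unfolding separated_def by blast
    then show ?thesis using nk[OF ik(2)] th[OF ik(1)] unfolding z by (simp add: abs_if split: if_splits)
  qed
  have near: "nearest (th i) Th = frac (\<eta> i)" if i: "i < K" for i
    unfolding nearest_def
  proof (rule some_equality)
    show "frac (\<eta> i) \<in> Th \<and> (\<forall>\<theta>'\<in>Th. \<bar>crep (th i) (frac (\<eta> i)) - th i\<bar> \<le> \<bar>crep (th i) \<theta>' - th i\<bar>)"
    proof (intro conjI ballI)
      show "frac (\<eta> i) \<in> Th" using i by (auto simp: Th)
      fix t assume "t \<in> Th"
      then obtain k where k: "k < K" "t = frac (\<eta> k)" by (auto simp: Th)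
      show "\<bar>crep (th i) (frac (\<eta> i)) - th i\<bar> \<le> \<bar>crep (th i) t - th i\<bar>"
      proof (cases "k = i")
        case False
        then show ?thesis using other[OF i k(1)] nk[OF i] own[OF i] th[OF i] k(2) by simp
      qed (use k in simp)
    qed
    fix t assume t: "t \<in> Th \<and> (\<forall>\<theta>'\<in>Th. \<bar>crep (th i) t - th i\<bar> \<le> \<bar>crep (th i) \<theta>' - th i\<bar>)"
    then obtain k where k: "k < K" "t = frac (\<eta> k)" by (auto simp: Th)
    have "\<bar>crep (th i) t - th i\<bar> \<le> \<bar>crep (th i) (frac (\<eta> i)) - th i\<bar>"
      using t i by (auto simp: Th)
    then have "k = i" using other[OF i k(1)] nk[OF i] own[OF i] th[OF i] k(2) by fastforce
    then show "t = frac (\<eta> i)" using k by simp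
  qed
  show ?thesis unfolding labeled_est_def
  proof (rule restrict_ext)
    fix i assume "i \<in> {..<d}"
    then have id: "i < d" by simp
    consider "i < K" | "K \<le> i" "i < 2 * K" | "2 * K \<le> i" by linarith
    then show "(if i < K then crep (th i) (nearest (th i) Th)
      else if i < 2 * K then P (nearest (th (i - K)) Th) else sg (i - 2 * K)) = \<eta> i"
    proof cases
      case 1 then show ?thesis by (simp add: near own)
    next
      case 2
      then have "i - K < K" by linarith
      then show ?thesis using 2 by (simp add: near P)
    next
      case 3
      then show ?thesis using id sg[of "i - 2 * K"] by simp
    qed
  qed
qed

text \<open>One estimator output for the common covariance carries both parameter vectors as labels,
  so they coincide.\<close>

lemma Rpar_injective:
  assumes s: "separated \<eta>0 r" and n: "near \<eta>0 r \<eta>" and n': "near \<eta>0 r \<eta>'" and eq: "Rp \<eta> = Rp \<eta>'" and i: "i < d"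
  shows "\<eta> i = \<eta>' i"
proof -
  obtain u s' Th P sg where u: "spa_feasible eqv M Om u s'" "\<forall>j<L. \<forall>l<L. Rmod M Om u s' j l = Rp \<eta> j l"
    "spa_rest u s' Th P sg" using spa_rest_exists[OF near_good[OF s n]] by blast
  have "labeled_est eqv Om K \<eta>0 Th P sg = restrict \<eta> {..<d}"
    using u by (intro labeled_est_eq[OF s n] spa_rest_unique[OF near_good[OF s n] u(1) _ u(3)]) auto
  moreover have "labeled_est eqv Om K \<eta>0 Th P sg = restrict \<eta>' {..<d}"
    using u eq by (intro labeled_est_eq[OF s n'] spa_rest_unique[OF near_good[OF s n'] u(1) _ u(3)]) auto
  ultimately have "restrict \<eta> {..<d} i = restrict \<eta>' {..<d} i" by simp
  then show ?thesis using i by simp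
qed

subsection \<open>The Fisher information\<close>

text \<open>The Slepian-Bangs trace formula for the Fisher information of a centred circular
  Gaussian; it is matched with the integral \<open>fim1\<close> in
  \<open>fim1_eq_Fi\<close>.\<close>

definition Fi :: "(nat \<Rightarrow> real) \<Rightarrow> nat \<Rightarrow> nat \<Rightarrow> real"
  where "Fi \<eta> a b = Re (mtr L (minv L (Rp \<eta>) \<odot>\<^bsub>L\<^esub> Rder \<eta> a \<odot>\<^bsub>L\<^esub> minv L (Rp \<eta>) \<odot>\<^bsub>L\<^esub> Rder \<eta> b))"

lemma Fi_sym: "Fi \<eta> a b = Fi \<eta> b a"
  unfolding Fi_def
  by (subst mtr_mmul_comm[of L "minv L (Rp \<eta>) \<odot>\<^bsub>L\<^esub> Rder \<eta> a \<odot>\<^bsub>L\<^esub> minv L (Rp \<eta>)"])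
     (simp add: mmul_assoc, subst mtr_mmul_comm, simp add: mmul_assoc)

text \<open>The quadratic form is the squared Frobenius norm of \<open>W D W\<close>, where
  \<open>D\<close> combines the derivatives and \<open>W\<close> is the inverse root of the
  covariance; independence of the derivatives excludes zero.\<close>

lemma Fi_pos:
  assumes g: "good \<eta>" and x: "\<exists>i<d. x i \<noteq> 0"
  shows "0 < (\<Sum>a<d. \<Sum>b<d. x a * Fi \<eta> a b * x b)"
proof -
  let ?Q = "minv L (Rp \<eta>)"
  obtain S W where S: "msupp L S" "S \<odot>\<^bsub>L\<^esub> S = Rp \<eta>" "msupp L W" "adjm W = W" "W \<odot>\<^bsub>L\<^esub> S = eye L"
    "S \<odot>\<^bsub>L\<^esub> W = eye L" "W \<odot>\<^bsub>L\<^esub> W = ?Q" by (rule pd_sqrt[OF pd_Rpar[OF g] msupp_Rpar])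
  define D where "D j l = (\<Sum>a<d. of_real (x a) * Rder \<eta> a j l)" for j l
  have sD: "msupp L D" using msupp_Rder unfolding msupp_def D_def by simp
  have hD: "adjm D = D"
    using hermitian_iff_adjm[OF sD] tangent_Rder_sum[of x \<eta>] unfolding tangent_def D_def[abs_def] by blast
  define X where "X = W \<odot>\<^bsub>L\<^esub> D \<odot>\<^bsub>L\<^esub> W"
  have sX: "msupp L X" unfolding X_def by (intro msupp_mmul S sD)
  have "mtr L (adjm X \<odot>\<^bsub>L\<^esub> eye L \<odot>\<^bsub>L\<^esub> X) = mtr L (W \<odot>\<^bsub>L\<^esub> (D \<odot>\<^bsub>L\<^esub> ?Q \<odot>\<^bsub>L\<^esub> D \<odot>\<^bsub>L\<^esub> W))"
    by (simp add: mmul_eye_right msupp_adjm sX) (simp add: X_def adjm_mmul S(4) hD S(7)[symmetric] mmul_assoc)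
  also have "\<dots> = mtr L (D \<odot>\<^bsub>L\<^esub> ?Q \<odot>\<^bsub>L\<^esub> D \<odot>\<^bsub>L\<^esub> ?Q)"
    by (subst mtr_mmul_comm) (simp add: mmul_assoc S(7)[symmetric])
  also have "\<dots> = (\<Sum>a<d. \<Sum>b<d. of_real (x a * x b) * mtr L (Rder \<eta> a \<odot>\<^bsub>L\<^esub> ?Q \<odot>\<^bsub>L\<^esub> Rder \<eta> b \<odot>\<^bsub>L\<^esub> ?Q))"
  proof -
    have DX: "D \<odot>\<^bsub>L\<^esub> Y = (\<lambda>i j. \<Sum>a<d. of_real (x a) * (Rder \<eta> a \<odot>\<^bsub>L\<^esub> Y) i j)" for Y
      unfolding mmul_def D_def by (intro ext) (simp add: sum_distrib_left sum_distrib_right mult.assoc, rule sum.swap)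
    have tr: "mtr L (\<lambda>i j. \<Sum>a<d. complex_of_real (x a) * Y a i j) = (\<Sum>a<d. complex_of_real (x a) * mtr L (Y a))" for Y
      unfolding mtr_def by (simp add: sum_distrib_left) (rule sum.swap)
    have "mtr L (D \<odot>\<^bsub>L\<^esub> ?Q \<odot>\<^bsub>L\<^esub> D \<odot>\<^bsub>L\<^esub> ?Q) = (\<Sum>a<d. of_real (x a) * mtr L (Rder \<eta> a \<odot>\<^bsub>L\<^esub> (?Q \<odot>\<^bsub>L\<^esub> (D \<odot>\<^bsub>L\<^esub> ?Q))))"
      unfolding mmul_assoc DX[of "?Q \<odot>\<^bsub>L\<^esub> (D \<odot>\<^bsub>L\<^esub> ?Q)"] tr ..
    also have "\<dots> = (\<Sum>a<d. of_real (x a) * (\<Sum>b<d. of_real (x b) * mtr L ((Rder \<eta> a \<odot>\<^bsub>L\<^esub> ?Q) \<odot>\<^bsub>L\<^esub> (Rder \<eta> b \<odot>\<^bsub>L\<^esub> ?Q))))"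
      unfolding DX[of ?Q] mmul_assoc[symmetric, of _ _ _ _ "\<lambda>i j. \<Sum>a<d. _ a i j"] mtr_mmul_sum ..
    finally show ?thesis by (simp add: sum_distrib_left mmul_assoc mult.assoc)
  qed
  finally have "Re (mtr L (adjm X \<odot>\<^bsub>L\<^esub> eye L \<odot>\<^bsub>L\<^esub> X)) = (\<Sum>a<d. \<Sum>b<d. x a * x b * Re (mtr L (Rder \<eta> a \<odot>\<^bsub>L\<^esub> ?Q \<odot>\<^bsub>L\<^esub> Rder \<eta> b \<odot>\<^bsub>L\<^esub> ?Q)))" by simp
  also have "\<dots> = (\<Sum>a<d. \<Sum>b<d. x a * Fi \<eta> a b * x b)"
    unfolding Fi_def by (intro sum.cong refl, subst mtr_mmul_comm) (simp add: mmul_assoc mult_ac)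
  finally have e: "Re (mtr L (adjm X \<odot>\<^bsub>L\<^esub> eye L \<odot>\<^bsub>L\<^esub> X)) = (\<Sum>a<d. \<Sum>b<d. x a * Fi \<eta> a b * x b)" .
  show ?thesis
  proof (rule ccontr)
    assume "\<not> ?thesis"
    then have "X = 0" using e by (intro mtr_pd_zero[OF pd_eye _ sX]) simp
    then have "S \<odot>\<^bsub>L\<^esub> X \<odot>\<^bsub>L\<^esub> S = 0" by (simp add: mmul_def fun_eq_iff)
    moreover have "S \<odot>\<^bsub>L\<^esub> X \<odot>\<^bsub>L\<^esub> S = (S \<odot>\<^bsub>L\<^esub> W) \<odot>\<^bsub>L\<^esub> D \<odot>\<^bsub>L\<^esub> (W \<odot>\<^bsub>L\<^esub> S)"
      unfolding X_def by (simp add: mmul_assoc)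
    ultimately have "D = 0" unfolding S by (simp add: mmul_eye_left mmul_eye_right sD)
    then have "(\<Sum>a<d. of_real (x a) * Rder \<eta> a j l) = 0" for j l unfolding D_def by (simp add: fun_eq_iff)
    then show False using Rder_independent[OF g, of x] x by blast
  qed
qed

lemma pd_Fi:
  assumes g: "good \<eta>"
  shows "pd d (\<lambda>a b. complex_of_real (Fi \<eta> a b))"
  unfolding pd_def
proof (intro conjI allI impI)
  show "hermitian d (\<lambda>a b. complex_of_real (Fi \<eta> a b))" unfolding hermitian_def using Fi_sym by simp
  fix v :: "nat \<Rightarrow> complex" assume v: "\<exists>i<d. v i \<noteq> 0"
  have "Re (qform d (\<lambda>a b. complex_of_real (Fi \<eta> a b)) v) =
     (\<Sum>a<d. \<Sum>b<d. Re (v a) * Fi \<eta> a b * Re (v b)) + (\<Sum>a<d. \<Sum>b<d. Im (v a) * Fi \<eta> a b * Im (v b))"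
    unfolding qform_def by (simp add: sum.distrib[symmetric])
  moreover have nn: "0 \<le> (\<Sum>a<d. \<Sum>b<d. x a * Fi \<eta> a b * x b)" for x
  proof (cases "\<exists>i<d. x i \<noteq> 0")
    case True then show ?thesis using Fi_pos[OF g] by (simp add: less_imp_le)
  qed simp
  moreover consider "\<exists>i<d. Re (v i) \<noteq> 0" | "\<exists>i<d. Im (v i) \<noteq> 0" using v by (auto simp: complex_eq_iff)
  then have "0 < (\<Sum>a<d. \<Sum>b<d. Re (v a) * Fi \<eta> a b * Re (v b)) + (\<Sum>a<d. \<Sum>b<d. Im (v a) * Fi \<eta> a b * Im (v b))"
  proof cases
    case 1 show ?thesis by (rule add_pos_nonneg[OF Fi_pos[OF g 1] nn])
  next
    case 2 show ?thesis by (rule add_nonneg_pos[OF nn Fi_pos[OF g 2]])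
  qed
  ultimately show "0 < Re (qform d (\<lambda>a b. complex_of_real (Fi \<eta> a b)) v)" by simp
qed

lemma mdet_Fi: "good \<eta> \<Longrightarrow> mdet d (Fi \<eta>) \<noteq> 0"
  using pd_mdet[OF pd_Fi[of \<eta>]] by (simp add: mdet_of_real)

end

section \<open>Limits of matrix expressions and consistency of local minimisers\<close>

lemma tendsto_mmul:
  fixes A B :: "'x \<Rightarrow> nat \<Rightarrow> nat \<Rightarrow> complex"
  assumes "\<And>i j. i < n \<Longrightarrow> j < n \<Longrightarrow> ((\<lambda>x. A x i j) \<longlongrightarrow> A' i j) F"
    "\<And>i j. i < n \<Longrightarrow> j < n \<Longrightarrow> ((\<lambda>x. B x i j) \<longlongrightarrow> B' i j) F" "i < n" "j < n"
  shows "((\<lambda>x. mmul n (A x) (B x) i j) \<longlongrightarrow> mmul n A' B' i j) F"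
  unfolding mmul_def by (intro tendsto_intros assms) (use assms in auto)

lemma tendsto_mtr:
  fixes A :: "'x \<Rightarrow> nat \<Rightarrow> nat \<Rightarrow> complex"
  assumes "\<And>i j. i < n \<Longrightarrow> j < n \<Longrightarrow> ((\<lambda>x. A x i j) \<longlongrightarrow> A' i j) F"
  shows "((\<lambda>x. mtr n (A x)) \<longlongrightarrow> mtr n A') F"
  unfolding mtr_def by (intro tendsto_intros assms) auto

text \<open>The difference quotient of an exponential, completed at coincidence by the derivative so
  as to be continuous there.\<close>

definition cis_quot :: "real \<Rightarrow> real \<Rightarrow> real \<Rightarrow> complex"
  where "cis_quot f y x = (if x = y then \<i> * of_real f * cis (f * y) else (cis (f * x) - cis (f * y)) / of_real (x - y))"

lemma cis_quot_eq: "cis (f * x) - cis (f * y) = of_real (x - y) * cis_quot f y x"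
  by (simp add: cis_quot_def)

text \<open>Caratheodory's form of differentiability for the complex exponential provides a
  continuous quotient, of which this is the restriction to real arguments.\<close>

lemma tendsto_cis_quot: "(g \<longlongrightarrow> y) F \<Longrightarrow> ((\<lambda>n. cis_quot f y (g n)) \<longlongrightarrow> \<i> * of_real f * cis (f * y)) F"
proof -
  assume g: "(g \<longlongrightarrow> y) F"
  have "((\<lambda>t. exp (\<i> * of_real f * t)) has_field_derivative \<i> * of_real f * exp (\<i> * of_real f * of_real y)) (at (of_real y))"
    by (auto intro!: derivative_eq_intros)
  then obtain q where q: "\<And>z. exp (\<i> * of_real f * z) - exp (\<i> * of_real f * of_real y) = q z * (z - of_real y)"
    "isCont q (complex_of_real y)" "q (of_real y) = \<i> * of_real f * exp (\<i> * of_real f * of_real y)"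
    unfolding CARAT_DERIV by blast
  have e: "exp (\<i> * of_real f * of_real x) = cis (f * x)" for x
    by (simp add: cis_conv_exp mult.assoc)
  have "cis_quot f y x = q (of_real x)" for x
  proof (cases "x = y")
    case True then show ?thesis using q(3) by (simp add: cis_quot_def e)
  next
    case False
    have "cis (f * x) - cis (f * y) = q (of_real x) * of_real (x - y)" using q(1)[of "of_real x"] unfolding e by simp
    then show ?thesis using False by (simp add: cis_quot_def)
  qed
  moreover have "((\<lambda>n. q (of_real (g n))) \<longlongrightarrow> q (of_real y)) F"
    using isCont_tendsto_compose[OF q(2) tendsto_of_real[OF g]] .
  ultimately show ?thesis unfolding q(3) e by simp
qed

lemma avg_le: "x \<le> (x + y) / 2 + g \<Longrightarrow> x \<le> y + 2 * g" for x y g :: real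
  by (simp add: field_simps)

context spa_model
begin

lemma tendsto_Rpar:
  assumes E: "\<And>i. i < d \<Longrightarrow> ((\<lambda>x. E x i) \<longlongrightarrow> \<eta> i) F" and jl: "j < L" "l < L"
  shows "((\<lambda>x. Rp (E x) j l) \<longlongrightarrow> Rp \<eta> j l) F"
proof -
  have "((\<lambda>x. (\<Sum>k<K. of_real (E x (K + k)) * cis (freq j l * E x k)) + (if j = l then of_real (E x (sidx j)) else 0))
    \<longlongrightarrow> (\<Sum>k<K. of_real (\<eta> (K + k)) * cis (freq j l * \<eta> k)) + (if j = l then of_real (\<eta> (sidx j)) else 0)) F"
    using sidx_less[OF jl(1)] by (cases "j = l") (auto intro!: tendsto_intros E)
  then show ?thesis by (simp add: Rpar_entry jl)
qed

lemma tendsto_Rder: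
  assumes E: "\<And>i. i < d \<Longrightarrow> ((\<lambda>x. E x i) \<longlongrightarrow> \<eta> i) F" and a: "a < d"
  shows "((\<lambda>x. Rder (E x) a j l) \<longlongrightarrow> Rder \<eta> a j l) F"
proof (cases "j < L \<and> l < L")
  case jl: True
  consider "a < K" | "K \<le> a" "a < 2 * K" | "2 * K \<le> a" by linarith
  then show ?thesis
  proof cases
    case 1
    then have "((\<lambda>x. of_real (E x (K + a) * freq j l) * \<i> * cis (freq j l * E x a)) \<longlongrightarrow>
        of_real (\<eta> (K + a) * freq j l) * \<i> * cis (freq j l * \<eta> a)) F"
      by (intro tendsto_intros E) auto
    then show ?thesis using 1 jl by (simp add: Rder_def)
  next
    case 2
    then have "((\<lambda>x. cis (freq j l * E x (a - K))) \<longlongrightarrow> cis (freq j l * \<eta> (a - K))) F"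
      by (intro tendsto_intros E) auto
    then show ?thesis using 2 jl by (simp add: Rder_def)
  next
    case 3
    then show ?thesis using jl by (simp add: Rder_def)
  qed
next
  case False
  then have "Rder \<eta> a j l = 0" for \<eta> by (auto simp: Rder_def)
  then show ?thesis by simp
qed

text \<open>The criterion on parameters, without its constant \<open>- 2 L\<close>.\<close>

definition obj :: "(nat \<Rightarrow> nat \<Rightarrow> complex) \<Rightarrow> (nat \<Rightarrow> real) \<Rightarrow> real"
  where "obj Rt \<eta> = Re (mtr L (minv L (Rp \<eta>) \<odot>\<^bsub>L\<^esub> Rt)) + Re (mtr L (minv L Rt \<odot>\<^bsub>L\<^esub> Rp \<eta>))"

lemma tendsto_obj:
  assumes E: "\<And>i. i < d \<Longrightarrow> ((\<lambda>x. E x i) \<longlongrightarrow> \<eta> i) F" and g: "good \<eta>"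
    and R: "\<And>i j. i < L \<Longrightarrow> j < L \<Longrightarrow> ((\<lambda>x. Rt x i j) \<longlongrightarrow> R i j) F"
    and Q: "\<And>i j. i < L \<Longrightarrow> j < L \<Longrightarrow> ((\<lambda>x. minv L (Rt x) i j) \<longlongrightarrow> minv L R i j) F"
  shows "((\<lambda>x. obj (Rt x) (E x)) \<longlongrightarrow> obj R \<eta>) F"
  unfolding obj_def
  by (intro tendsto_intros tendsto_mtr tendsto_mmul R Q tendsto_minv tendsto_Rpar[OF E] pd_mdet[OF pd_Rpar[OF g]])

text \<open>The box is pinned to \<open>\<eta>0\<close> outside the \<open>d\<close> parameters,
  which makes it compact in the space of all functions.\<close>

definition Bx :: "(nat \<Rightarrow> real) \<Rightarrow> real \<Rightarrow> (nat \<Rightarrow> real) set"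
  where "Bx \<eta>0 r = {\<eta>. \<forall>i. \<eta> i \<in> (if i < d then {\<eta>0 i - r..\<eta>0 i + r} else {\<eta>0 i})}"

lemma Bx_near: "\<eta> \<in> Bx \<eta>0 r \<Longrightarrow> near \<eta>0 r \<eta>"
  unfolding Bx_def near_def
proof (intro allI impI)
  fix i assume "\<eta> \<in> {\<eta>. \<forall>i. \<eta> i \<in> (if i < d then {\<eta>0 i - r..\<eta>0 i + r} else {\<eta>0 i})}" "i < d"
  then have "\<eta> i \<in> {\<eta>0 i - r..\<eta>0 i + r}" by (metis (mono_tags, lifting) mem_Collect_eq)
  then show "\<bar>\<eta> i - \<eta>0 i\<bar> \<le> r" by (simp add: abs_le_iff)
qed

lemma compact_Bx: "compact (Bx \<eta>0 r)"
  unfolding Bx_def by (rule compact_fun_box) auto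

lemma exists_minimiser:
  assumes s: "separated \<eta>0 r"
  shows "\<exists>\<eta>\<in>Bx \<eta>0 r. \<forall>\<eta>'\<in>Bx \<eta>0 r. obj Rt \<eta> \<le> obj Rt \<eta>'"
proof (rule continuous_attains_inf[OF compact_Bx])
  have "r > 0" using s by (simp add: separated_def)
  then have "\<eta>0 \<in> Bx \<eta>0 r" by (auto simp: Bx_def)
  then show "Bx \<eta>0 r \<noteq> {}" by auto
  show "continuous_on (Bx \<eta>0 r) (obj Rt)"
    unfolding continuous_on_def
  proof
    fix \<eta> assume e: "\<eta> \<in> Bx \<eta>0 r"
    show "(obj Rt \<longlongrightarrow> obj Rt \<eta>) (at \<eta> within Bx \<eta>0 r)"
      by (rule tendsto_obj[where E = "\<lambda>x. x" and Rt = "\<lambda>_. Rt"])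
         (use continuous_on_coord[of "Bx \<eta>0 r"] e near_good[OF s Bx_near[OF e]] in \<open>auto simp: continuous_on_def\<close>)
  qed
qed

lemma near_self: "separated \<eta>0 r \<Longrightarrow> near \<eta>0 r \<eta>0"
  by (simp add: near_def separated_def)

lemma obj_self: "good \<eta> \<Longrightarrow> obj (Rp \<eta>) \<eta> = 2 * real L"
  unfolding obj_def by (simp add: minv_eye[OF pd_mdet[OF pd_Rpar] msupp_Rpar] mtr_eye)

text \<open>Compactness: a limit point \<open>l\<close> of minimisers minimises the limit criterion,
  hence does no worse than \<open>\<eta>0\<close>, where the criterion with its constant is zero.
  Then \<open>Rp l = Rp \<eta>0\<close>, and injectivity on the box identifies
  \<open>l\<close>.\<close>

lemma minimisers_converge:
  assumes s: "separated \<eta>0 r"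
    and Rt: "\<And>n. msupp L (Rt n)" "\<And>i j. i < L \<Longrightarrow> j < L \<Longrightarrow> (\<lambda>n. Rt n i j) \<longlonglongrightarrow> Rp \<eta>0 i j"
    and E: "\<And>n. E n \<in> Bx \<eta>0 r" "\<And>n \<eta>'. \<eta>' \<in> Bx \<eta>0 r \<Longrightarrow> obj (Rt n) (E n) \<le> obj (Rt n) \<eta>'"
  shows "(\<lambda>n. \<Sum>i<d. \<bar>E n i - \<eta>0 i\<bar>) \<longlonglongrightarrow> 0"
proof (rule ccontr)
  let ?\<psi> = "\<lambda>\<eta>. \<Sum>i<d. \<bar>\<eta> i - \<eta>0 i\<bar>"
  have g: "good \<eta>0" by (rule near_good[OF s near_self[OF s]])
  note p0 = pd_Rpar[OF g]
  assume "\<not> ?thesis"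
  then obtain e where e: "e > 0" "\<forall>N. \<exists>n\<ge>N. e \<le> ?\<psi> (E n)"
    unfolding lim_sequentially by (auto simp: dist_real_def not_less sum_nonneg)
  \<comment> \<open>The indices with a large error are extracted before a convergent subsequence is
    chosen, so its limit keeps the error.\<close>
  then have "infinite {n. e \<le> ?\<psi> (E n)}" unfolding infinite_nat_iff_unbounded_le by auto
  then obtain q where q: "strict_mono (q :: nat \<Rightarrow> nat)" "\<And>n. e \<le> ?\<psi> (E (q n))"
    using infinite_enumerate by blast
  obtain l t where l: "l \<in> Bx \<eta>0 r" "strict_mono (t :: nat \<Rightarrow> nat)" "((\<lambda>n. E (q n)) \<circ> t) \<longlonglongrightarrow> l"
    using seq_compactE[OF compact_imp_seq_compact[OF compact_Bx], of "\<lambda>n. E (q n)"] E(1) by blast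
  define w where "w n = q (t n)" for n
  have w: "strict_mono w" unfolding w_def using q(1) l(2) by (simp add: strict_mono_def)
  have lim: "(\<lambda>n. E (w n) i) \<longlonglongrightarrow> l i" for i
    using continuous_on_tendsto_compose[OF continuous_on_coord[of UNIV i] l(3)] by (simp add: w_def comp_def)
  have R: "(\<lambda>n. Rt (w n) i j) \<longlonglongrightarrow> Rp \<eta>0 i j" if "i < L" "j < L" for i j
    using LIMSEQ_subseq_LIMSEQ[OF Rt(2)[OF that] w] by (simp add: comp_def)
  have Q: "(\<lambda>n. minv L (Rt (w n)) i j) \<longlonglongrightarrow> minv L (Rp \<eta>0) i j" if "i < L" "j < L" for i j
    by (rule tendsto_minv[OF R pd_mdet[OF p0] that])
  have gl: "good l" by (rule near_good[OF s Bx_near[OF l(1)]])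
  have 1: "(\<lambda>n. obj (Rt (w n)) (E (w n))) \<longlonglongrightarrow> obj (Rp \<eta>0) l"
    by (rule tendsto_obj[OF lim gl R Q])
  have 2: "(\<lambda>n. obj (Rt (w n)) \<eta>0) \<longlonglongrightarrow> obj (Rp \<eta>0) \<eta>0"
    by (rule tendsto_obj[OF tendsto_const g R Q])
  have b0: "\<eta>0 \<in> Bx \<eta>0 r" using s by (auto simp: Bx_def separated_def)
  have "obj (Rp \<eta>0) l \<le> obj (Rp \<eta>0) \<eta>0"
    by (rule LIMSEQ_le[OF 1 2]) (use E(2)[OF b0] in blast)
  then have "spa_obj L L (Rp \<eta>0) (Rp l) \<le> 0"
    unfolding obj_self[OF g] spa_obj_trace[OF order_refl pd_Rpar[OF gl] p0 msupp_Rpar msupp_Rpar] by (simp add: obj_def)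
  then have "spa_obj L L (Rp \<eta>0) (Rp l) = 0"
    using spa_obj_nonneg[OF order_refl pd_Rpar[OF gl] p0 msupp_Rpar msupp_Rpar] by linarith
  then have "Rp l = Rp \<eta>0"
    by (rule spa_obj_zero[OF order_refl pd_Rpar[OF gl] p0 msupp_Rpar msupp_Rpar])
  then have "l i = \<eta>0 i" if "i < d" for i
    using Rpar_injective[OF s Bx_near[OF l(1)] near_self[OF s] _ that] by blast
  then have "?\<psi> l = 0" by simp
  moreover have "(\<lambda>n. ?\<psi> (E (w n))) \<longlonglongrightarrow> ?\<psi> l" by (intro tendsto_intros lim)
  then have "e \<le> ?\<psi> l" by (rule LIMSEQ_le_const) (use q(2) in \<open>auto simp: w_def\<close>)
  ultimately show False using e(1) by simp
qed

section \<open>From critical points of the smooth problem to outputs of the estimator\<close>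

definition critical :: "(nat \<Rightarrow> nat \<Rightarrow> complex) \<Rightarrow> (nat \<Rightarrow> real) \<Rightarrow> bool"
  where "critical Rt \<eta> \<longleftrightarrow> (\<forall>a<d. Re (mtr L (minv L Rt \<odot>\<^bsub>L\<^esub> Rder \<eta> a)) =
    Re (mtr L (minv L (Rp \<eta>) \<odot>\<^bsub>L\<^esub> Rder \<eta> a \<odot>\<^bsub>L\<^esub> minv L (Rp \<eta>) \<odot>\<^bsub>L\<^esub> Rt)))"

lemma interior_minimiser_critical:
  assumes s: "separated \<eta>0 r" and E: "\<eta> \<in> Bx \<eta>0 r" "\<And>\<eta>'. \<eta>' \<in> Bx \<eta>0 r \<Longrightarrow> obj Rt \<eta> \<le> obj Rt \<eta>'"
    and int: "\<And>i. i < d \<Longrightarrow> \<bar>\<eta> i - \<eta>0 i\<bar> < r"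
  shows "critical Rt \<eta>"
  unfolding critical_def
proof (intro allI impI)
  fix a assume a: "a < d"
  have g: "good \<eta>" by (rule near_good[OF s Bx_near[OF E(1)]])
  have "Re (mtr L (minv L Rt \<odot>\<^bsub>L\<^esub> Rder \<eta> a)) - Re (mtr L (minv L (Rp \<eta>) \<odot>\<^bsub>L\<^esub> Rder \<eta> a \<odot>\<^bsub>L\<^esub> minv L (Rp \<eta>) \<odot>\<^bsub>L\<^esub> Rt)) = 0"
  proof (rule DERIV_local_min[OF obj_deriv[OF g a, of Rt "minv L Rt"]])
    \<comment> \<open>The distance to the wall of the box in this coordinate; within it the
      competitor stays admissible.\<close>
    show "0 < r - \<bar>\<eta> a - \<eta>0 a\<bar>" using int[OF a] by simp
    show "\<forall>y. \<bar>\<eta> a - y\<bar> < r - \<bar>\<eta> a - \<eta>0 a\<bar> \<longrightarrow>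
        Re (mtr L (minv L (Rp (\<eta>(a := \<eta> a))) \<odot>\<^bsub>L\<^esub> Rt)) + Re (mtr L (minv L Rt \<odot>\<^bsub>L\<^esub> Rp (\<eta>(a := \<eta> a))))
        \<le> Re (mtr L (minv L (Rp (\<eta>(a := y))) \<odot>\<^bsub>L\<^esub> Rt)) + Re (mtr L (minv L Rt \<odot>\<^bsub>L\<^esub> Rp (\<eta>(a := y))))"
    proof (intro allI impI)
      fix y assume y: "\<bar>\<eta> a - y\<bar> < r - \<bar>\<eta> a - \<eta>0 a\<bar>"
      have "(\<eta>(a := y)) i \<in> (if i < d then {\<eta>0 i - r..\<eta>0 i + r} else {\<eta>0 i})" for i
      proof (cases "i = a")
        case True
        then show ?thesis using y a by (auto simp: abs_if split: if_splits)
      next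
        case False
        then show ?thesis using E(1) unfolding Bx_def by simp
      qed
      then have "\<eta>(a := y) \<in> Bx \<eta>0 r" unfolding Bx_def by blast
      from E(2)[OF this] show "Re (mtr L (minv L (Rp (\<eta>(a := \<eta> a))) \<odot>\<^bsub>L\<^esub> Rt)) + Re (mtr L (minv L Rt \<odot>\<^bsub>L\<^esub> Rp (\<eta>(a := \<eta> a))))
        \<le> Re (mtr L (minv L (Rp (\<eta>(a := y))) \<odot>\<^bsub>L\<^esub> Rt)) + Re (mtr L (minv L Rt \<odot>\<^bsub>L\<^esub> Rp (\<eta>(a := y))))"
        unfolding obj_def by simp
    qed
  qed
  then show "Re (mtr L (minv L Rt \<odot>\<^bsub>L\<^esub> Rder \<eta> a)) =
    Re (mtr L (minv L (Rp \<eta>) \<odot>\<^bsub>L\<^esub> Rder \<eta> a \<odot>\<^bsub>L\<^esub> minv L (Rp \<eta>) \<odot>\<^bsub>L\<^esub> Rt))" by simp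
qed

lemma mtr_rotate: "mtr L (Q \<odot>\<^bsub>L\<^esub> D \<odot>\<^bsub>L\<^esub> Q' \<odot>\<^bsub>L\<^esub> Rt) = mtr L (Q' \<odot>\<^bsub>L\<^esub> Rt \<odot>\<^bsub>L\<^esub> Q \<odot>\<^bsub>L\<^esub> D)"
  by (simp only: mmul_assoc) (subst mmul_assoc[symmetric], subst mtr_mmul_comm, simp only: mmul_assoc)

text \<open>Stationarity in the \<open>d\<close> coordinates extends to all tangent directions
  because the derivatives span them. This carries stationarity from the nonconvex parametrisation to
  the convex problem.\<close>

lemma critical_tangent:
  assumes g: "good \<eta>" and c: "critical Rt \<eta>" and D: "tangent D" "msupp L D"
  shows "Re (mtr L (minv L Rt \<odot>\<^bsub>L\<^esub> D)) = Re (mtr L (minv L (Rp \<eta>) \<odot>\<^bsub>L\<^esub> D \<odot>\<^bsub>L\<^esub> minv L (Rp \<eta>) \<odot>\<^bsub>L\<^esub> Rt))"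
proof -
  obtain x where x: "\<forall>j<L. \<forall>l<L. D j l = (\<Sum>a<d. of_real (x a) * Rder \<eta> a j l)"
    using tangent_span[OF g D(1)] by blast
  have "D = (\<lambda>j l. \<Sum>a<d. complex_of_real (x a) * Rder \<eta> a j l)"
    by (rule msupp_eqI[OF D(2)]) (use x msupp_Rder in \<open>auto simp: msupp_def\<close>)
  then have tr: "Re (mtr L (Z \<odot>\<^bsub>L\<^esub> D)) = (\<Sum>a<d. x a * Re (mtr L (Z \<odot>\<^bsub>L\<^esub> Rder \<eta> a)))" for Z
    by (simp add: mtr_mmul_sum)
  let ?Q = "minv L (Rp \<eta>)"
  have "Re (mtr L (minv L Rt \<odot>\<^bsub>L\<^esub> Rder \<eta> a)) = Re (mtr L (?Q \<odot>\<^bsub>L\<^esub> Rt \<odot>\<^bsub>L\<^esub> ?Q \<odot>\<^bsub>L\<^esub> Rder \<eta> a))" if "a < d" for a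
    by (rule trans[OF c[unfolded critical_def, rule_format, OF that]]) (simp only: mtr_rotate[of ?Q "Rder \<eta> a" ?Q Rt])
  then show ?thesis unfolding mtr_rotate[of ?Q D ?Q Rt] tr by simp
qed

text \<open>A feasible covariance differs from \<open>Rp \<eta>\<close> by a tangent matrix, so the
  convexity lemma makes \<open>Rp \<eta>\<close> the global minimum and the only minimising
  covariance. Both existence of an output and the value of every output follow.\<close>

theorem critical_imp_estimate:
  assumes s: "separated \<eta>0 r" and n: "near \<eta>0 r \<eta>" and c: "critical Rt \<eta>"
    and p: "pd L Rt" "msupp L Rt" and LN: "L \<le> N" and th: "\<And>k. k < K \<Longrightarrow> th k = \<eta>0 k"
  shows "\<exists>Th P sg. spa_output eqv M Om N Rt Th P sg"
    and "spa_output eqv M Om N Rt Th P sg \<Longrightarrow> labeled_est eqv Om K th Th P sg = restrict \<eta> {..<d}"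
proof -
  have g: "good \<eta>" by (rule near_good[OF s n])
  have sR: "msupp L (Rmod M Om u s')" for u s' by (auto simp: msupp_def Rmod_def compress_def diagm_def)
  have crit: "Re (mtr L (minv L Rt \<odot>\<^bsub>L\<^esub> (Rmod M Om u s' - Rp \<eta>))) =
      Re (mtr L (minv L (Rp \<eta>) \<odot>\<^bsub>L\<^esub> (Rmod M Om u s' - Rp \<eta>) \<odot>\<^bsub>L\<^esub> minv L (Rp \<eta>) \<odot>\<^bsub>L\<^esub> Rt))"
    if "spa_feasible eqv M Om u s'" for u s'
    by (rule critical_tangent[OF g c tangent_diff[OF tangent_Rmod[OF that] tangent_Rpar] msupp_minus[OF sR msupp_Rpar]])
  have pR: "pd L (Rmod M Om u s')" if "spa_feasible eqv M Om u s'" for u s'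
    using that unfolding spa_feasible_def by simp
  obtain u s' Th0 P0 sg0 where u: "spa_feasible eqv M Om u s'" "\<forall>j<L. \<forall>l<L. Rmod M Om u s' j l = Rp \<eta> j l"
    "spa_rest u s' Th0 P0 sg0" using spa_rest_exists[OF g] by blast
  have Ru: "Rmod M Om u s' = Rp \<eta>" by (rule msupp_eqI[OF sR msupp_Rpar]) (use u(2) in blast)
  have "spa_step1 eqv M Om N Rt u s'"
    unfolding spa_step1_def Ru
    using u(1) spa_obj_critical_le[OF pd_Rpar[OF g] pR p(1) msupp_Rpar sR p(2) crit LN] by blast
  then show "\<exists>Th P sg. spa_output eqv M Om N Rt Th P sg" using u(3) unfolding spa_output_iff by blast
  assume "spa_output eqv M Om N Rt Th P sg"
  then obtain u1 s1 where u1: "spa_step1 eqv M Om N Rt u1 s1" "spa_rest u1 s1 Th P sg" unfolding spa_output_iff by blast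
  have f1: "spa_feasible eqv M Om u1 s1" using u1(1) unfolding spa_step1_def by blast
  have "spa_obj L N Rt (Rmod M Om u1 s1) \<le> spa_obj L N Rt (Rp \<eta>)"
    using u1(1) u(1) unfolding spa_step1_def Ru[symmetric] by blast
  then have R1: "Rmod M Om u1 s1 = Rp \<eta>"
    by (rule spa_obj_critical_unique[OF pd_Rpar[OF g] pR[OF f1] p(1) msupp_Rpar sR p(2) crit[OF f1] LN])
  show "labeled_est eqv Om K th Th P sg = restrict \<eta> {..<d}"
    by (rule labeled_est_eq[OF s n th spa_rest_unique[OF g f1 _ u1(2)]]) (simp_all add: R1)
qed

subsection \<open>Linearisation\<close>

text \<open>Difference quotients in place of derivatives make the first-order expansion of \<open>R(\<eta>)\<close> exact.\<close>

definition Rquot :: "(nat \<Rightarrow> real) \<Rightarrow> (nat \<Rightarrow> real) \<Rightarrow> nat \<Rightarrow> nat \<Rightarrow> nat \<Rightarrow> complex"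
  where "Rquot \<eta>0 \<eta> a j l = (if j < L \<and> l < L then
      (if a < K then of_real (\<eta>0 (K + a)) * cis_quot (freq j l) (\<eta>0 a) (\<eta> a)
       else if a < 2 * K then cis (freq j l * \<eta> (a - K))
       else if j = l \<and> a = sidx j then 1 else 0) else 0)"

text \<open>The exact product rule \<open>p e - p0 e0 = p0 (e - e0) + (p - p0) e\<close>; hence old
  powers in the frequency quotients and new frequencies in the power quotients.\<close>

lemma Rpar_diff: "Rp \<eta> - Rp \<eta>0 = (\<lambda>j l. \<Sum>a<d. of_real (\<eta> a - \<eta>0 a) * Rquot \<eta>0 \<eta> a j l)"
proof (rule msupp_eqI[OF msupp_minus[OF msupp_Rpar msupp_Rpar]])
  show "msupp L (\<lambda>j l. \<Sum>a<d. of_real (\<eta> a - \<eta>0 a) * Rquot \<eta>0 \<eta> a j l)"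
    by (auto simp: msupp_def Rquot_def)
  fix j l assume jl: "j < L" "l < L"
  have 1: "(\<Sum>k<K. of_real (\<eta> k - \<eta>0 k) * Rquot \<eta>0 \<eta> k j l) = (\<Sum>k<K. of_real (\<eta>0 (K + k)) * (cis (freq j l * \<eta> k) - cis (freq j l * \<eta>0 k)))"
    using jl unfolding cis_quot_eq by (intro sum.cong refl) (simp add: Rquot_def mult_ac)
  have 2: "(\<Sum>k<K. of_real (\<eta> (K + k) - \<eta>0 (K + k)) * Rquot \<eta>0 \<eta> (K + k) j l) = (\<Sum>k<K. of_real (\<eta> (K + k) - \<eta>0 (K + k)) * cis (freq j l * \<eta> k))"
    using jl by (intro sum.cong refl) (simp add: Rquot_def)
  have 3: "(\<Sum>q<nsig eqv Om. of_real (\<eta> (2 * K + q) - \<eta>0 (2 * K + q)) * Rquot \<eta>0 \<eta> (2 * K + q) j l) = (if j = l then of_real (\<eta> (sidx j) - \<eta>0 (sidx j)) else 0)"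
  proof -
    let ?q = "if eqv then 0 else j"
    have q: "sidx j = 2 * K + ?q" "?q < nsig eqv Om" using jl by (auto simp: sidx_def nsig_def)
    have "(\<Sum>q<nsig eqv Om. of_real (\<eta> (2 * K + q) - \<eta>0 (2 * K + q)) * Rquot \<eta>0 \<eta> (2 * K + q) j l)
      = (\<Sum>q<nsig eqv Om. if q = ?q then (if j = l then of_real (\<eta> (sidx j) - \<eta>0 (sidx j)) else 0) else (0::complex))"
      using jl unfolding Rquot_def sidx_def by (intro sum.cong refl) auto
    then show ?thesis using q(2) by simp
  qed
  show "(Rp \<eta> - Rp \<eta>0) j l = (\<Sum>a<d. of_real (\<eta> a - \<eta>0 a) * Rquot \<eta>0 \<eta> a j l)"
    unfolding sum_d_split 1 2 3 using jl
    by (simp add: Rpar_entry algebra_simps sum.distrib sum_subtractf)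
qed

lemma tendsto_Rquot:
  assumes E: "\<And>i. i < d \<Longrightarrow> ((\<lambda>x. E x i) \<longlongrightarrow> \<eta> i) F" and a: "a < d"
  shows "((\<lambda>x. Rquot \<eta> (E x) a j l) \<longlongrightarrow> Rder \<eta> a j l) F"
proof (cases "j < L \<and> l < L")
  case jl: True
  consider "a < K" | "K \<le> a" "a < 2 * K" | "2 * K \<le> a" by linarith
  then show ?thesis
  proof cases
    case 1
    have "((\<lambda>x. of_real (\<eta> (K + a)) * cis_quot (freq j l) (\<eta> a) (E x a)) \<longlongrightarrow>
       of_real (\<eta> (K + a)) * (\<i> * of_real (freq j l) * cis (freq j l * \<eta> a))) F"
      by (intro tendsto_intros tendsto_cis_quot E a)
    then show ?thesis using 1 jl by (simp add: Rquot_def Rder_def mult_ac)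
  next
    case 2
    then have "((\<lambda>x. cis (freq j l * E x (a - K))) \<longlongrightarrow> cis (freq j l * \<eta> (a - K))) F"
      by (intro tendsto_intros E) auto
    then show ?thesis using 2 jl by (simp add: Rquot_def Rder_def)
  next
    case 3
    then show ?thesis using jl by (simp add: Rquot_def Rder_def)
  qed
next
  case False
  then have "Rder \<eta> a j l = 0" "Rquot \<eta> \<eta>' a j l = 0" for \<eta>' by (auto simp: Rder_def Rquot_def)
  then show ?thesis by simp
qed

definition Wm :: "(nat \<Rightarrow> real) \<Rightarrow> nat \<Rightarrow> nat \<Rightarrow> nat \<Rightarrow> complex"
  where "Wm \<eta> a = minv L (Rp \<eta>) \<odot>\<^bsub>L\<^esub> Rder \<eta> a \<odot>\<^bsub>L\<^esub> minv L (Rp \<eta>)"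

text \<open>Inverse Fisher information applied to the centred score statistic of the sample
  covariance: the leading term of the estimation error.\<close>

definition lin :: "(nat \<Rightarrow> real) \<Rightarrow> (nat \<Rightarrow> nat \<Rightarrow> complex) \<Rightarrow> nat \<Rightarrow> real"
  where "lin \<eta> D i = (\<Sum>a<d. minv d (Fi \<eta>) i a * Re (mtr L (Wm \<eta> a \<odot>\<^bsub>L\<^esub> D)))"

definition l1 :: "(nat \<Rightarrow> nat \<Rightarrow> complex) \<Rightarrow> real"
  where "l1 D = (\<Sum>i<L. \<Sum>j<L. cmod (D i j))"

lemma mtr_l1: "\<bar>Re (mtr L (A \<odot>\<^bsub>L\<^esub> D))\<bar> \<le> l1 A * l1 D"
proof -
  have "\<bar>Re (mtr L (A \<odot>\<^bsub>L\<^esub> D))\<bar> \<le> cmod (mtr L (A \<odot>\<^bsub>L\<^esub> D))" by (rule abs_Re_le_cmod)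
  also have "\<dots> \<le> (\<Sum>i<L. \<Sum>j<L. cmod (A i j * D j i))"
    unfolding mtr_mmul by (intro order_trans[OF norm_sum] sum_mono norm_sum)
  also have "\<dots> \<le> (\<Sum>i<L. \<Sum>j<L. cmod (A i j) * l1 D)"
  proof (intro sum_mono)
    fix i j assume ij: "i \<in> {..<L}" "j \<in> {..<L}"
    have "cmod (D j i) \<le> (\<Sum>l<L. cmod (D j l))" by (rule member_le_sum) (use ij in auto)
    also have "\<dots> \<le> l1 D" unfolding l1_def
      by (rule member_le_sum[where f="\<lambda>j. \<Sum>l<L. cmod (D j l)"]) (use ij in \<open>auto intro: sum_nonneg\<close>)
    finally show "cmod (A i j * D j i) \<le> cmod (A i j) * l1 D" by (simp add: norm_mult mult_left_mono)
  qed
  also have "\<dots> = l1 A * l1 D" unfolding l1_def[of A] by (simp add: sum_distrib_right)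
  finally show ?thesis .
qed

lemma l1_nonneg: "0 \<le> l1 D" unfolding l1_def by (intro sum_nonneg) auto

text \<open>With \<open>T\<close>, \<open>Q\<close> the inverses of \<open>Rt\<close>,
  \<open>Rp \<eta>\<close>, the factorisation \<open>T - Q Rt Q = (T + Q) (Rp \<eta> - Rt) Q\<close>
  turns stationarity into an identity linear in \<open>Rp \<eta> - Rt\<close>. The sum
  \<open>T + Q\<close> is the origin of the factor two on both sides.\<close>

lemma critical_equation:
  assumes g: "good \<eta>" and g0: "good \<eta>0" and p: "pd L Rt" "msupp L Rt" and c: "critical Rt \<eta>" and a: "a < d"
  defines "V \<equiv> minv L (Rp \<eta>) \<odot>\<^bsub>L\<^esub> Rder \<eta> a \<odot>\<^bsub>L\<^esub> (minv L Rt + minv L (Rp \<eta>))"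
  shows "(\<Sum>b<d. (\<eta> b - \<eta>0 b) * Re (mtr L (V \<odot>\<^bsub>L\<^esub> Rquot \<eta>0 \<eta> b))) = Re (mtr L (V \<odot>\<^bsub>L\<^esub> (Rt - Rp \<eta>0)))"
proof -
  let ?Q = "minv L (Rp \<eta>)" and ?T = "minv L Rt" and ?D = "Rder \<eta> a"
  note iR = minv_eye[OF pd_mdet[OF pd_Rpar[OF g]] msupp_Rpar] and iT = minv_eye[OF pd_mdet[OF p(1)] p(2)]
  have sQ: "msupp L ?Q" "msupp L ?T" by (intro msupp_minv_gen pd_mdet pd_Rpar g p)+
  have "(?T + ?Q) \<odot>\<^bsub>L\<^esub> (Rp \<eta> - Rt) \<odot>\<^bsub>L\<^esub> ?Q = ?T - ?Q \<odot>\<^bsub>L\<^esub> Rt \<odot>\<^bsub>L\<^esub> ?Q"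
  proof -
    have 1: "(?T + ?Q) \<odot>\<^bsub>L\<^esub> (Rp \<eta> - Rt) \<odot>\<^bsub>L\<^esub> ?Q = ?T \<odot>\<^bsub>L\<^esub> (Rp \<eta> \<odot>\<^bsub>L\<^esub> ?Q) - (?T \<odot>\<^bsub>L\<^esub> Rt) \<odot>\<^bsub>L\<^esub> ?Q + ((?Q \<odot>\<^bsub>L\<^esub> Rp \<eta>) \<odot>\<^bsub>L\<^esub> ?Q - ?Q \<odot>\<^bsub>L\<^esub> Rt \<odot>\<^bsub>L\<^esub> ?Q)"
      by (simp only: mmul_distribs mmul_assoc)
         (simp add: fun_eq_iff)
    show ?thesis unfolding 1 iR iT mmul_eye_left[OF sQ(1)] mmul_eye_right[OF sQ(2)] by (simp add: fun_eq_iff)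
  qed
  then have "mtr L (V \<odot>\<^bsub>L\<^esub> (Rp \<eta> - Rt)) = mtr L (?D \<odot>\<^bsub>L\<^esub> (?T - ?Q \<odot>\<^bsub>L\<^esub> Rt \<odot>\<^bsub>L\<^esub> ?Q))"
    unfolding V_def by (simp only: mmul_assoc) (subst mtr_mmul_comm, simp only: mmul_assoc)
  also have "\<dots> = mtr L (?T \<odot>\<^bsub>L\<^esub> ?D) - mtr L (?Q \<odot>\<^bsub>L\<^esub> ?D \<odot>\<^bsub>L\<^esub> ?Q \<odot>\<^bsub>L\<^esub> Rt)"
    unfolding mmul_distribs mtr_diff mtr_rotate
    by (simp only: mtr_mmul_comm[of L ?D])
  finally have "Re (mtr L (V \<odot>\<^bsub>L\<^esub> (Rp \<eta> - Rt))) = 0" using c a unfolding critical_def by simp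
  moreover have "Rp \<eta> - Rt = (Rp \<eta> - Rp \<eta>0) - (Rt - Rp \<eta>0)" by simp
  ultimately have "Re (mtr L (V \<odot>\<^bsub>L\<^esub> (Rp \<eta> - Rp \<eta>0))) = Re (mtr L (V \<odot>\<^bsub>L\<^esub> (Rt - Rp \<eta>0)))"
    by (metis mmul_diff_right mtr_diff minus_complex.sel(1) right_minus_eq)
  then show ?thesis unfolding Rpar_diff mtr_mmul_sum by simp
qed

text \<open>The critical equation reads \<open>F \<delta> = g + err\<close>, with \<open>err\<close>
  at most \<open>A n\<close> times the combined size of \<open>\<delta>\<close> and of the
  covariance error, and \<open>A n\<close> tending to zero. This is used twice: to bound
  \<open>\<delta>\<close> by the covariance error, and then to make the remainder small against
  it.\<close>

theorem linearisation:
  assumes s: "separated \<eta>0 r"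
    and Rt: "\<And>n. msupp L (Rt n)" "\<And>i j. i < L \<Longrightarrow> j < L \<Longrightarrow> (\<lambda>n. Rt n i j) \<longlonglongrightarrow> Rp \<eta>0 i j"
    and E: "\<And>i. i < d \<Longrightarrow> (\<lambda>n. E n i) \<longlonglongrightarrow> \<eta>0 i"
    and ev: "eventually (\<lambda>n. good (E n) \<and> pd L (Rt n) \<and> critical (Rt n) (E n)) sequentially" and \<kappa>: "\<kappa> > 0"
  shows "eventually (\<lambda>n. \<forall>i<d. \<bar>E n i - \<eta>0 i - lin \<eta>0 (Rt n - Rp \<eta>0) i\<bar> \<le> \<kappa> * l1 (Rt n - Rp \<eta>0)) sequentially"
proof -
  have g: "good \<eta>0" by (rule near_good[OF s near_self[OF s]])
  note p0 = pd_Rpar[OF g]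
  define V where "V n a = minv L (Rp (E n)) \<odot>\<^bsub>L\<^esub> Rder (E n) a \<odot>\<^bsub>L\<^esub> (minv L (Rt n) + minv L (Rp (E n)))" for n a
  define H where "H n a b = Re (mtr L (V n a \<odot>\<^bsub>L\<^esub> Rquot \<eta>0 (E n) b))" for n a b
  let ?W2 = "\<lambda>a. Wm \<eta>0 a + Wm \<eta>0 a"
  have limQ: "(\<lambda>n. minv L (Rp (E n)) i j) \<longlonglongrightarrow> minv L (Rp \<eta>0) i j" if "i < L" "j < L" for i j
    by (rule tendsto_minv[OF tendsto_Rpar[OF E] pd_mdet[OF p0] that])
  have limT: "(\<lambda>n. minv L (Rt n) i j) \<longlonglongrightarrow> minv L (Rp \<eta>0) i j" if "i < L" "j < L" for i j
    by (rule tendsto_minv[OF Rt(2) pd_mdet[OF p0] that])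
  have limV: "(\<lambda>n. V n a i j) \<longlonglongrightarrow> ?W2 a i j" if a: "a < d" and ij: "i < L" "j < L" for a i j
  proof -
    have "(\<lambda>n. V n a i j) \<longlonglongrightarrow> (minv L (Rp \<eta>0) \<odot>\<^bsub>L\<^esub> Rder \<eta>0 a \<odot>\<^bsub>L\<^esub> (minv L (Rp \<eta>0) + minv L (Rp \<eta>0))) i j"
      unfolding V_def
    proof (intro tendsto_mmul ij)
      show "(\<lambda>n. (minv L (Rt n) + minv L (Rp (E n))) i j) \<longlonglongrightarrow> (minv L (Rp \<eta>0) + minv L (Rp \<eta>0)) i j"
        if "i < L" "j < L" for i j
        using tendsto_add[OF limT[OF that] limQ[OF that]] by simp
    qed (auto intro: limQ tendsto_Rder[OF E a])
    then show ?thesis unfolding Wm_def mmul_add_right .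
  qed
  have limH: "(\<lambda>n. H n a b) \<longlonglongrightarrow> 2 * Fi \<eta>0 a b" if ab: "a < d" "b < d" for a b
  proof -
    have "(\<lambda>n. H n a b) \<longlonglongrightarrow> Re (mtr L (?W2 a \<odot>\<^bsub>L\<^esub> Rder \<eta>0 b))"
      unfolding H_def by (intro tendsto_Re tendsto_mtr tendsto_mmul limV ab tendsto_Rquot[OF E ab(2)])
    then show ?thesis unfolding mmul_add_left mtr_add Fi_def Wm_def by simp
  qed
  \<comment> \<open>Total deviation of the coefficients of the critical equation from their limits
    \<open>2 Fi\<close> and \<open>Wm + Wm\<close>.\<close>
  define A where "A n = (\<Sum>a<d. \<Sum>b<d. \<bar>H n a b - 2 * Fi \<eta>0 a b\<bar>) + (\<Sum>a<d. l1 (V n a - ?W2 a))" for n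
  have "A \<longlonglongrightarrow> (\<Sum>a<d. \<Sum>b<d. \<bar>2 * Fi \<eta>0 a b - 2 * Fi \<eta>0 a b\<bar>) + (\<Sum>a<d. l1 (\<lambda>i j. ?W2 a i j - ?W2 a i j))"
    unfolding A_def l1_def minus_apply
    by (intro tendsto_add tendsto_sum tendsto_rabs tendsto_norm tendsto_diff limH limV tendsto_const) auto
  then have A0: "A \<longlonglongrightarrow> 0" by (simp add: l1_def)
  have An: "0 \<le> A n" for n unfolding A_def by (intro add_nonneg_nonneg sum_nonneg l1_nonneg) auto
  define c where "c = (\<Sum>i<d. \<Sum>a<d. \<bar>minv d (Fi \<eta>0) i a\<bar>)"
  define C where "C = real d * c"
  define w where "w = (\<Sum>a<d. l1 (Wm \<eta>0 a))"
  have c0: "0 \<le> c" unfolding c_def by (intro sum_nonneg) auto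
  have w0: "0 \<le> w" unfolding w_def by (intro sum_nonneg l1_nonneg)
  have C0: "0 \<le> C" unfolding C_def using c0 by simp
  have cm: "\<bar>minv d (Fi \<eta>0) i a\<bar> \<le> c" if "i < d" "a < d" for i a
  proof -
    have "\<bar>minv d (Fi \<eta>0) i a\<bar> \<le> (\<Sum>a<d. \<bar>minv d (Fi \<eta>0) i a\<bar>)" by (rule member_le_sum) (use that in auto)
    also have "\<dots> \<le> c" unfolding c_def
      by (rule member_le_sum[where f="\<lambda>i. \<Sum>a<d. \<bar>minv d (Fi \<eta>0) i a\<bar>"]) (use that in \<open>auto intro: sum_nonneg\<close>)
    finally show ?thesis .
  qed
  \<comment> \<open>The first bound gives \<open>c * A n \<le> 1 / 2\<close>, so that
    \<open>D1\<close> can be absorbed; the second makes the final constant at most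
    \<open>\<kappa>\<close>. The added ones keep the denominators positive.\<close>
  define tol where "tol = min (1 / (2 * c + 1)) (\<kappa> / (c * (2 + 2 * (C * w)) + 1))"
  have tol: "tol > 0" unfolding tol_def using c0 C0 w0 \<kappa> by (auto intro!: divide_pos_pos add_nonneg_pos mult_nonneg_nonneg)
  have "eventually (\<lambda>n. A n < tol) sequentially" using order_tendstoD(2)[OF A0 tol] .
  then show ?thesis using ev
  proof eventually_elim
    case (elim n)
    then have gn: "good (E n)" and pn: "pd L (Rt n)" and cn: "critical (Rt n) (E n)" and At: "A n < tol" by auto
    let ?\<Delta> = "Rt n - Rp \<eta>0"
    define \<delta> where "\<delta> i = E n i - \<eta>0 i" for i
    define D1 where "D1 = (\<Sum>i<d. \<bar>\<delta> i\<bar>)"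
    define gr where "gr a = Re (mtr L (Wm \<eta>0 a \<odot>\<^bsub>L\<^esub> ?\<Delta>))" for a
    define er where "er a = (\<Sum>b<d. Fi \<eta>0 a b * \<delta> b) - gr a" for a
    have D1n: "0 \<le> D1" unfolding D1_def by (intro sum_nonneg) auto
    have er: "\<bar>er a\<bar> \<le> A n * (D1 + l1 ?\<Delta>)" if a: "a < d" for a
    proof -
      have eq: "(\<Sum>b<d. \<delta> b * H n a b) = Re (mtr L (V n a \<odot>\<^bsub>L\<^esub> ?\<Delta>))"
        unfolding \<delta>_def H_def V_def by (rule critical_equation[OF gn g pn Rt(1) cn a])
      have "2 * er a = (\<Sum>b<d. (2 * Fi \<eta>0 a b - H n a b) * \<delta> b) + Re (mtr L ((V n a - ?W2 a) \<odot>\<^bsub>L\<^esub> ?\<Delta>))"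
      proof -
        have "Re (mtr L ((V n a - ?W2 a) \<odot>\<^bsub>L\<^esub> ?\<Delta>)) = Re (mtr L (V n a \<odot>\<^bsub>L\<^esub> ?\<Delta>)) - 2 * gr a"
          unfolding mmul_diff_left mmul_add_left mtr_diff mtr_add gr_def by simp
        then show ?thesis unfolding er_def eq[symmetric]
          by (simp add: sum_distrib_left algebra_simps sum_subtractf)
      qed
      moreover have "\<bar>\<Sum>b<d. (2 * Fi \<eta>0 a b - H n a b) * \<delta> b\<bar> \<le> A n * D1"
      proof -
        have "\<bar>\<Sum>b<d. (2 * Fi \<eta>0 a b - H n a b) * \<delta> b\<bar> \<le> (\<Sum>b<d. \<bar>(2 * Fi \<eta>0 a b - H n a b) * \<delta> b\<bar>)" by (rule sum_abs)
        also have "\<dots> \<le> (\<Sum>b<d. A n * \<bar>\<delta> b\<bar>)"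
        proof (intro sum_mono)
          fix b assume b: "b \<in> {..<d}"
          have "\<bar>H n a b - 2 * Fi \<eta>0 a b\<bar> \<le> (\<Sum>b<d. \<bar>H n a b - 2 * Fi \<eta>0 a b\<bar>)" by (rule member_le_sum) (use b in auto)
          also have "\<dots> \<le> (\<Sum>a<d. \<Sum>b<d. \<bar>H n a b - 2 * Fi \<eta>0 a b\<bar>)"
            by (rule member_le_sum[where f="\<lambda>a. \<Sum>b<d. \<bar>H n a b - 2 * Fi \<eta>0 a b\<bar>"]) (use a in \<open>auto intro: sum_nonneg\<close>)
          also have "\<dots> \<le> A n" unfolding A_def by (simp add: sum_nonneg l1_nonneg)
          finally show "\<bar>(2 * Fi \<eta>0 a b - H n a b) * \<delta> b\<bar> \<le> A n * \<bar>\<delta> b\<bar>"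
            unfolding abs_mult by (intro mult_right_mono) (auto simp: abs_minus_commute)
        qed
        also have "\<dots> = A n * D1" by (simp add: D1_def sum_distrib_left)
        finally show ?thesis .
      qed
      moreover have "\<bar>Re (mtr L ((V n a - ?W2 a) \<odot>\<^bsub>L\<^esub> ?\<Delta>))\<bar> \<le> A n * l1 ?\<Delta>"
      proof -
        have "l1 (V n a - ?W2 a) \<le> (\<Sum>a<d. l1 (V n a - ?W2 a))" by (rule member_le_sum) (use a l1_nonneg in auto)
        also have "\<dots> \<le> A n" unfolding A_def by (simp add: sum_nonneg)
        finally show ?thesis using mtr_l1[of "V n a - ?W2 a" ?\<Delta>] mult_right_mono[OF _ l1_nonneg] order_trans by blast
      qed
      ultimately have "2 * \<bar>er a\<bar> \<le> A n * D1 + A n * l1 ?\<Delta>" by linarith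
      moreover have "0 \<le> A n * D1 + A n * l1 ?\<Delta>" using An D1n l1_nonneg by (intro add_nonneg_nonneg mult_nonneg_nonneg) auto
      ultimately show ?thesis by (simp add: distrib_left)
    qed
    have err: "\<bar>\<delta> i - lin \<eta>0 ?\<Delta> i\<bar> \<le> (\<Sum>a<d. \<bar>minv d (Fi \<eta>0) i a\<bar>) * (A n * (D1 + l1 ?\<Delta>))" if i: "i < d" for i
    proof -
      have "\<delta> i = (\<Sum>b<d. mmul d (minv d (Fi \<eta>0)) (Fi \<eta>0) i b * \<delta> b)"
        using i by (simp add: minv_left[OF mdet_Fi[OF g] i] idm_def if_distrib[of "\<lambda>x. x * _"] cong: if_cong)
      also have "\<dots> = (\<Sum>a<d. minv d (Fi \<eta>0) i a * (\<Sum>b<d. Fi \<eta>0 a b * \<delta> b))"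
        unfolding mmul_def sum_distrib_left sum_distrib_right by (subst sum.swap) (simp add: mult.assoc)
      finally have "\<delta> i - lin \<eta>0 ?\<Delta> i = (\<Sum>a<d. minv d (Fi \<eta>0) i a * er a)"
        unfolding lin_def er_def gr_def by (simp add: right_diff_distrib sum_subtractf)
      also have "\<bar>\<dots>\<bar> \<le> (\<Sum>a<d. \<bar>minv d (Fi \<eta>0) i a * er a\<bar>)" by (rule sum_abs)
      also have "\<dots> \<le> (\<Sum>a<d. \<bar>minv d (Fi \<eta>0) i a\<bar> * (A n * (D1 + l1 ?\<Delta>)))"
        unfolding abs_mult by (intro sum_mono mult_left_mono er) auto
      finally show ?thesis by (simp add: sum_distrib_right)
    qed
    have linb: "\<bar>lin \<eta>0 ?\<Delta> i\<bar> \<le> c * w * l1 ?\<Delta>" if i: "i < d" for i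
    proof -
      have "\<bar>lin \<eta>0 ?\<Delta> i\<bar> \<le> (\<Sum>a<d. \<bar>minv d (Fi \<eta>0) i a * gr a\<bar>)" unfolding lin_def gr_def by (rule sum_abs)
      also have "\<dots> \<le> (\<Sum>a<d. c * (l1 (Wm \<eta>0 a) * l1 ?\<Delta>))"
        unfolding abs_mult gr_def by (intro sum_mono mult_mono cm i c0 mtr_l1) auto
      also have "\<dots> = c * w * l1 ?\<Delta>" by (simp add: w_def sum_distrib_left sum_distrib_right mult.assoc)
      finally show ?thesis .
    qed
    have cA: "c * A n \<le> 1 / 2"
    proof -
      have "c * A n \<le> c * (1 / (2 * c + 1))" using At c0 unfolding tol_def by (intro mult_left_mono) auto
      also have "\<dots> \<le> 1 / 2" using c0 by (simp add: field_simps)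
      finally show ?thesis .
    qed
    have dC: "c * (A n * (D1 + l1 ?\<Delta>)) \<le> (D1 + l1 ?\<Delta>) / 2"
      using mult_right_mono[OF cA, of "D1 + l1 ?\<Delta>"] D1n l1_nonneg by (simp add: mult.assoc)
      \<comment> \<open>Absorption: half of \<open>D1\<close> on the right is moved to the
        left.\<close>
      have "D1 \<le> (1 + 2 * (real d * (c * w))) * l1 ?\<Delta>"
      proof -
        have "\<bar>\<delta> i\<bar> \<le> (\<Sum>a<d. \<bar>minv d (Fi \<eta>0) i a\<bar>) * (A n * (D1 + l1 ?\<Delta>)) + c * w * l1 ?\<Delta>" if "i < d" for i
          using err[OF that] linb[OF that] by linarith
        then have "(\<Sum>i<d. \<bar>\<delta> i\<bar>) \<le> (\<Sum>i<d. (\<Sum>a<d. \<bar>minv d (Fi \<eta>0) i a\<bar>) * (A n * (D1 + l1 ?\<Delta>)) + c * w * l1 ?\<Delta>)"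
          by (intro sum_mono) simp
        also have "\<dots> = c * (A n * (D1 + l1 ?\<Delta>)) + real d * (c * w * l1 ?\<Delta>)"
          by (simp add: sum.distrib c_def sum_distrib_right)
        also have "\<dots> \<le> (D1 + l1 ?\<Delta>) / 2 + real d * (c * w * l1 ?\<Delta>)" using dC by simp
        finally have h: "D1 \<le> (D1 + l1 ?\<Delta>) / 2 + real d * (c * w * l1 ?\<Delta>)" unfolding D1_def .
        define G where "G = real d * (c * w * l1 ?\<Delta>)"
        have "D1 \<le> l1 ?\<Delta> + 2 * G" by (rule avg_le) (use h in \<open>simp only: G_def\<close>)
        also have "\<dots> = (1 + 2 * (real d * (c * w))) * l1 ?\<Delta>" unfolding G_def by (simp add: algebra_simps)
        finally show ?thesis .
      qed
      then have D1b: "D1 \<le> (1 + 2 * (C * w)) * l1 ?\<Delta>" by (simp add: C_def mult.assoc)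
      show ?case
      proof (intro allI impI)
        fix i assume i: "i < d"
        have row: "(\<Sum>a<d. \<bar>minv d (Fi \<eta>0) i a\<bar>) \<le> c" unfolding c_def
          by (rule member_le_sum[where f="\<lambda>i. \<Sum>a<d. \<bar>minv d (Fi \<eta>0) i a\<bar>"]) (use i in \<open>auto intro: sum_nonneg\<close>)
        have "\<bar>E n i - \<eta>0 i - lin \<eta>0 ?\<Delta> i\<bar> \<le> (\<Sum>a<d. \<bar>minv d (Fi \<eta>0) i a\<bar>) * (A n * (D1 + l1 ?\<Delta>))"
          using err[OF i] by (simp add: \<delta>_def)
        also have "\<dots> \<le> c * (A n * (D1 + l1 ?\<Delta>))"
          using row An D1n l1_nonneg by (intro mult_right_mono) (auto intro!: mult_nonneg_nonneg add_nonneg_nonneg)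
        also have "\<dots> \<le> c * (A n * ((1 + 2 * (C * w)) * l1 ?\<Delta> + l1 ?\<Delta>))"
          using D1b c0 An by (intro mult_left_mono add_right_mono) auto
        also have "\<dots> = (c * (2 + 2 * (C * w))) * A n * l1 ?\<Delta>" by (simp add: algebra_simps)
        also have "\<dots> \<le> \<kappa> * l1 ?\<Delta>"
        proof (intro mult_right_mono l1_nonneg)
          let ?X = "c * (2 + 2 * (C * w))"
          have X: "0 \<le> ?X" using c0 C0 w0 by (intro mult_nonneg_nonneg add_nonneg_nonneg) auto
          have "?X * A n \<le> ?X * (\<kappa> / (?X + 1))" using At X unfolding tol_def by (intro mult_left_mono) auto
          also have "\<dots> \<le> \<kappa>" using X \<kappa> by (simp add: field_simps)
          finally show "?X * A n \<le> \<kappa>" .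
        qed
        finally show "\<bar>E n i - \<eta>0 i - lin \<eta>0 ?\<Delta> i\<bar> \<le> \<kappa> * l1 ?\<Delta>" .
      qed
  qed
qed

text \<open>A neighbourhood uniform in \<open>N\<close> and free of randomness. Were there none,
  counterexamples within \<open>1 / (n + 1)\<close> would form a convergent sequence, to which the
  sequential results apply and which they refute eventually.\<close>

theorem spa_local:
  assumes s: "separated \<eta>0 r" and th: "\<And>k. k < K \<Longrightarrow> th k = \<eta>0 k" and \<kappa>: "\<kappa> > 0"
  shows "\<exists>e>0. \<forall>Rt N. msupp L Rt \<longrightarrow> adjm Rt = Rt \<longrightarrow> (\<forall>i<L. \<forall>j<L. cmod (Rt i j - Rp \<eta>0 i j) < e) \<longrightarrow> L \<le> N \<longrightarrow>
    (\<exists>Th P sg. spa_output eqv M Om N Rt Th P sg) \<and>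
    (\<forall>Th P sg. spa_output eqv M Om N Rt Th P sg \<longrightarrow>
       (\<forall>i<d. \<bar>labeled_est eqv Om K th Th P sg i - \<eta>0 i - lin \<eta>0 (Rt - Rp \<eta>0) i\<bar> \<le> \<kappa> * l1 (Rt - Rp \<eta>0)))"
proof (rule ccontr)
  let ?Pr = "\<lambda>Rt N. msupp L Rt \<and> adjm Rt = Rt \<and> L \<le> N"
  let ?G = "\<lambda>Rt N. (\<exists>Th P sg. spa_output eqv M Om N Rt Th P sg) \<and>
    (\<forall>Th P sg. spa_output eqv M Om N Rt Th P sg \<longrightarrow>
       (\<forall>i<d. \<bar>labeled_est eqv Om K th Th P sg i - \<eta>0 i - lin \<eta>0 (Rt - Rp \<eta>0) i\<bar> \<le> \<kappa> * l1 (Rt - Rp \<eta>0)))"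
  have g: "good \<eta>0" by (rule near_good[OF s near_self[OF s]])
  assume neg: "\<not> ?thesis"
  \<comment> \<open>Failure at each radius \<open>1 / (n + 1)\<close> yields the sequence of
    counterexamples; \<open>N\<close> may vary along it.\<close>
  have "\<exists>Rt N. ?Pr Rt N \<and> (\<forall>i<L. \<forall>j<L. cmod (Rt i j - Rp \<eta>0 i j) < inverse (real (Suc n))) \<and> \<not> ?G Rt N" for n
  proof (rule ccontr)
    assume h: "\<not> ?thesis"
    have "0 < inverse (real (Suc n))" by simp
    with neg h show False by meson
  qed
  then obtain Rt Nn where Rt: "\<And>n. msupp L (Rt n)" "\<And>n. adjm (Rt n) = Rt n" "\<And>n. L \<le> Nn n"
    "\<And>n i j. i < L \<Longrightarrow> j < L \<Longrightarrow> cmod (Rt n i j - Rp \<eta>0 i j) < inverse (real (Suc n))" "\<And>n. \<not> ?G (Rt n) (Nn n)"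
    by metis
  have lim: "(\<lambda>n. Rt n i j) \<longlonglongrightarrow> Rp \<eta>0 i j" if "i < L" "j < L" for i j
  proof -
    have "(\<lambda>n. Rt n i j - Rp \<eta>0 i j) \<longlonglongrightarrow> 0"
      by (rule Lim_null_comparison[OF always_eventually LIMSEQ_inverse_real_of_nat]) (use Rt(4)[OF that] in \<open>auto simp: less_imp_le\<close>)
    then show ?thesis by (rule LIM_zero_cancel)
  qed
  have "\<forall>n. \<exists>\<eta>. \<eta> \<in> Bx \<eta>0 r \<and> (\<forall>\<eta>'\<in>Bx \<eta>0 r. obj (Rt n) \<eta> \<le> obj (Rt n) \<eta>')"
    using exists_minimiser[OF s] by blast
  then obtain E where E: "\<And>n. E n \<in> Bx \<eta>0 r" "\<And>n \<eta>'. \<eta>' \<in> Bx \<eta>0 r \<Longrightarrow> obj (Rt n) (E n) \<le> obj (Rt n) \<eta>'" by metis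
  have conv: "(\<lambda>n. \<Sum>i<d. \<bar>E n i - \<eta>0 i\<bar>) \<longlonglongrightarrow> 0"
    by (rule minimisers_converge[OF s Rt(1) lim E])
  have Elim: "(\<lambda>n. E n i) \<longlonglongrightarrow> \<eta>0 i" if i: "i < d" for i
  proof -
    have "norm (E n i - \<eta>0 i) \<le> (\<Sum>i<d. \<bar>E n i - \<eta>0 i\<bar>)" for n
      unfolding real_norm_def by (rule member_le_sum) (use i in auto)
    then have "(\<lambda>n. E n i - \<eta>0 i) \<longlonglongrightarrow> 0" by (intro Lim_null_comparison[OF always_eventually conv]) auto
    then show ?thesis by (rule LIM_zero_cancel)
  qed
  have r: "0 < r" using s by (simp add: separated_def)
  have evint: "eventually (\<lambda>n. \<forall>i<d. \<bar>E n i - \<eta>0 i\<bar> < r) sequentially"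
    using order_tendstoD(2)[OF conv r]
  proof eventually_elim
    case (elim n)
    show ?case
    proof (intro allI impI)
      fix i assume i: "i < d"
      have "\<bar>E n i - \<eta>0 i\<bar> \<le> (\<Sum>i<d. \<bar>E n i - \<eta>0 i\<bar>)" by (rule member_le_sum) (use i in auto)
      then show "\<bar>E n i - \<eta>0 i\<bar> < r" using elim by linarith
    qed
  qed
  obtain e where e: "e > 0" "\<And>B. adjm B = B \<Longrightarrow> (\<And>i j. i < L \<Longrightarrow> j < L \<Longrightarrow> cmod (B i j - Rp \<eta>0 i j) \<le> e) \<Longrightarrow> pd L B"
    by (rule pd_perturb[OF pd_Rpar[OF g] msupp_Rpar]) blast
  have "eventually (\<lambda>n. inverse (real (Suc n)) < e) sequentially"
    using order_tendstoD(2)[OF LIMSEQ_inverse_real_of_nat e(1)] .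
  then have evpd: "eventually (\<lambda>n. pd L (Rt n)) sequentially"
  proof eventually_elim
    case (elim n)
    show ?case
    proof (rule e(2)[OF Rt(2)])
      fix i j assume "i < L" "j < L"
      from Rt(4)[OF this, of n] elim show "cmod (Rt n i j - Rp \<eta>0 i j) \<le> e" by linarith
    qed
  qed
  have ev: "eventually (\<lambda>n. good (E n) \<and> pd L (Rt n) \<and> critical (Rt n) (E n)) sequentially"
    using evint evpd
  proof eventually_elim
    case (elim n)
    then show ?case
      using near_good[OF s Bx_near[OF E(1)]] interior_minimiser_critical[OF s E(1) E(2), of n] by blast
  qed
  have evlin: "eventually (\<lambda>n. \<forall>i<d. \<bar>E n i - \<eta>0 i - lin \<eta>0 (Rt n - Rp \<eta>0) i\<bar> \<le> \<kappa> * l1 (Rt n - Rp \<eta>0)) sequentially"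
    by (rule linearisation[OF s Rt(1) lim Elim ev \<kappa>])
  have "eventually (\<lambda>n. ?G (Rt n) (Nn n)) sequentially"
    using ev evlin
  proof eventually_elim
    case (elim n)
    have ex: "\<exists>Th P sg. spa_output eqv M Om (Nn n) (Rt n) Th P sg"
      by (rule critical_imp_estimate(1)[OF s Bx_near[OF E(1)[of n]] _ _ Rt(1) Rt(3) th]) (use elim in auto)
    have "labeled_est eqv Om K th Th P sg = restrict (E n) {..<d}" if "spa_output eqv M Om (Nn n) (Rt n) Th P sg" for Th P sg
      by (rule critical_imp_estimate(2)[OF s Bx_near[OF E(1)[of n]] _ _ Rt(1) Rt(3) th that]) (use elim in auto)
    then show ?case using ex elim by simp
  qed
  then show False using Rt(5) by (auto simp: eventually_sequentially)
qed

end

subsection \<open>Functions of independent identically distributed blocks\<close>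

lemma (in prob_space) indep_vars_reindex_inj:
  fixes X :: "'i \<Rightarrow> 'a \<Rightarrow> real"
  assumes ind: "indep_vars (\<lambda>_. borel) X (f ` I)" and inj: "inj_on f I"
  shows "indep_vars (\<lambda>_. borel) (\<lambda>i. X (f i)) I"
proof -
  have "indep_vars (\<lambda>j. PiM {f j} (\<lambda>_. borel)) (\<lambda>j w. restrict (\<lambda>i. X i w) {f j}) I"
    by (rule indep_vars_restrict[OF ind]) (use inj in \<open>auto simp: disjoint_family_on_def inj_on_def\<close>)
  then have "indep_vars (\<lambda>_. borel) (\<lambda>j w. (restrict (\<lambda>i. X i w) {f j}) (f j)) I"
    by (rule indep_vars_compose2) (auto intro: measurable_component_singleton)
  then show ?thesis by simp
qed

text \<open>Distinct \<open>t\<close> use disjoint blocks \<open>{t} \<times> J\<close>, which gives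
  independence; the joint law of a block is the product of the \<open>D j\<close>, whatever
  \<open>t\<close> is.\<close>

lemma (in prob_space) iid_blocks:
  fixes X :: "nat \<Rightarrow> 'j \<Rightarrow> 'a \<Rightarrow> real" and f :: "('j \<Rightarrow> real) \<Rightarrow> real"
  assumes J: "finite J" "J \<noteq> {}"
    and ind: "indep_vars (\<lambda>_. borel) (\<lambda>(t, j). X t j) (T \<times> J)"
    and D: "\<And>t j. t \<in> T \<Longrightarrow> j \<in> J \<Longrightarrow> distr M borel (X t j) = D j"
    and f: "f \<in> borel_measurable (PiM J (\<lambda>_. borel))"
  defines "H \<equiv> \<lambda>t w. f (restrict (\<lambda>j. X t j w) J)"
  shows indep_blocks: "indep_vars (\<lambda>_. borel) H T"
    and distr_block: "t \<in> T \<Longrightarrow> distr M borel (H t) = distr (PiM J D) borel f"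
proof -
  have Xm: "X t j \<in> borel_measurable M" if "t \<in> T" "j \<in> J" for t j
    using ind that unfolding indep_vars_def by auto
  have "indep_vars (\<lambda>t. PiM ({t} \<times> J) (\<lambda>_. borel)) (\<lambda>t w. restrict (\<lambda>i. (case i of (t, j) \<Rightarrow> X t j) w) ({t} \<times> J)) T"
    by (rule indep_vars_restrict[OF ind]) (auto simp: disjoint_family_on_def)
  then have "indep_vars (\<lambda>_. borel) (\<lambda>t w. f (restrict (\<lambda>j. (restrict (\<lambda>i. (case i of (t, j) \<Rightarrow> X t j) w) ({t} \<times> J)) (t, j)) J)) T"
  proof (rule indep_vars_compose2)
    fix t assume "t \<in> T"
    have "(\<lambda>x. restrict (\<lambda>j. x (t, j)) J) \<in> measurable (PiM ({t} \<times> J) (\<lambda>_. borel :: real measure)) (PiM J (\<lambda>_. borel))"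
      by (intro measurable_restrict measurable_component_singleton) auto
    from measurable_compose[OF this f]
    show "(\<lambda>x. f (restrict (\<lambda>j. x (t, j)) J)) \<in> measurable (PiM ({t} \<times> J) (\<lambda>_. borel)) borel" .
  qed
  moreover have "f (restrict (\<lambda>j. (restrict (\<lambda>i. (case i of (t, j) \<Rightarrow> X t j) w) ({t} \<times> J)) (t, j)) J) = H t w" for t w
    unfolding H_def by (rule arg_cong[of _ _ f]) (auto simp: fun_eq_iff restrict_def)
  ultimately show "indep_vars (\<lambda>_. borel) H T" by simp
  assume t: "t \<in> T"
  have "indep_vars (\<lambda>_. borel) (\<lambda>(t, j). X t j) ({t} \<times> J)"
    by (rule indep_vars_subset[OF ind]) (use t in auto)
  then have "distr M (PiM ({t} \<times> J) (\<lambda>_. borel)) (\<lambda>w. \<lambda>i\<in>{t} \<times> J. (case i of (t, j) \<Rightarrow> X t j) w)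
      = PiM ({t} \<times> J) (\<lambda>i. distr M borel (case i of (t, j) \<Rightarrow> X t j))"
    by (subst (asm) indep_vars_iff_distr_eq_PiM') (use J Xm t in auto)
  also have "\<dots> = PiM ({t} \<times> J) (\<lambda>i. D (snd i))"
    by (intro PiM_cong) (use D t in auto)
  finally have e: "distr M (PiM ({t} \<times> J) (\<lambda>_. borel)) (\<lambda>w. \<lambda>i\<in>{t} \<times> J. (case i of (t, j) \<Rightarrow> X t j) w) = PiM ({t} \<times> J) (\<lambda>i. D (snd i))" .
  have pD: "prob_space (D j)" if "j \<in> J" for j
    using D[OF t that] Xm[OF t that] prob_space_distr by metis
  have setsD: "sets (D j) = sets borel" if "j \<in> J" for j
    using D[OF t that] by (metis sets_distr)
  have "distr M (PiM J (\<lambda>_. borel)) (\<lambda>w. \<lambda>j\<in>J. X t j w) = PiM J D"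
  proof -
    let ?r = "\<lambda>x. restrict (\<lambda>j. x (t, j)) J"
    have r: "?r \<in> measurable (PiM ({t} \<times> J) (\<lambda>_. borel :: real measure)) (PiM J (\<lambda>_. borel))"
      by (intro measurable_restrict measurable_component_singleton) auto
    have xm: "(\<lambda>w. \<lambda>i\<in>{t} \<times> J. (case i of (t, j) \<Rightarrow> X t j) w) \<in> measurable M (PiM ({t} \<times> J) (\<lambda>_. borel))"
      by (rule measurable_restrict) (use Xm t in auto)
    have "distr M (PiM J (\<lambda>_. borel)) (\<lambda>w. \<lambda>j\<in>J. X t j w)
      = distr (distr M (PiM ({t} \<times> J) (\<lambda>_. borel)) (\<lambda>w. \<lambda>i\<in>{t} \<times> J. (case i of (t, j) \<Rightarrow> X t j) w)) (PiM J (\<lambda>_. borel)) ?r"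
      unfolding distr_distr[OF r xm] by (rule distr_cong) (auto simp: comp_def fun_eq_iff)
    also have "\<dots> = distr (PiM ({t} \<times> J) (\<lambda>i. D (snd i))) (PiM J D) (\<lambda>x. restrict (\<lambda>j. x (t, j)) J)"
      unfolding e by (rule distr_cong) (auto intro!: sets_PiM_cong setsD[symmetric])
    also have "\<dots> = PiM J (\<lambda>j. D (snd (t, j)))"
    proof -
      have "prob_space (D (snd i))" if "i \<in> {t} \<times> J" for i using that pD by auto
      from distr_PiM_reindex[where M="\<lambda>i. D (snd i)" and K="{t} \<times> J" and I=J and f="\<lambda>j. (t, j)", OF this]
      show ?thesis by (simp add: inj_on_def)
    qed
    finally show ?thesis by simp
  qed
  moreover have "distr M borel (H t) = distr (distr M (PiM J (\<lambda>_. borel)) (\<lambda>w. \<lambda>j\<in>J. X t j w)) borel f"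
    unfolding H_def by (subst distr_distr[OF f]) (use Xm t in \<open>auto intro!: measurable_restrict simp: comp_def\<close>)
  ultimately show "distr M borel (H t) = distr (PiM J D) borel f" by simp
qed

text \<open>The limit is the mean of the cosine of a normal variable of variance \<open>v\<close>,
  shifted by \<open>b\<close>, so weak convergence applies to one bounded continuous
  function.\<close>

lemma (in prob_space) iid_sum_cos:
  fixes H :: "nat \<Rightarrow> 'a \<Rightarrow> real"
  assumes ind: "indep_vars (\<lambda>_. borel) H {1..}" and ident: "\<And>t. 1 \<le> t \<Longrightarrow> distr M borel (H t) = \<mu>"
    and mean: "\<And>t. 1 \<le> t \<Longrightarrow> has_bochner_integral M (H t) 0"
    and var: "\<And>t. 1 \<le> t \<Longrightarrow> has_bochner_integral M (\<lambda>w. (H t w)\<^sup>2) v"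
  shows "(\<lambda>N. expectation (\<lambda>w. cos ((\<Sum>t\<in>{1..N}. H t w) / sqrt (real N) + b))) \<longlonglongrightarrow> cos b * exp (- v / 2)"
proof -
  have Hm: "H t \<in> borel_measurable M" if "1 \<le> t" for t
    using ind that unfolding indep_vars_def by auto
  have v0: "v \<ge> 0" using var[of 1] by (auto simp: has_bochner_integral_iff intro: Bochner_Integration.integral_nonneg)
  show ?thesis
  proof (cases "v = 0")
    case True
    \<comment> \<open>The central limit theorem asks for positive variance; in the degenerate case
      the summands vanish almost surely.\<close>
    have "AE w in M. H t w = 0" if "1 \<le> t" for t
    proof -
      have "AE w in M. (H t w)\<^sup>2 = 0"
        using var[OF that] True by (subst integral_nonneg_eq_0_iff_AE[symmetric]) (auto simp: has_bochner_integral_iff)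
      then show ?thesis by simp
    qed
    then have z: "AE w in M. \<forall>t\<in>{1..N}. H t w = 0" for N by (intro AE_finite_allI) auto
    have AE: "AE w in M. cos ((\<Sum>t\<in>{1..N}. H t w) / sqrt (real N) + b) = cos b" for N
      using z[of N] by eventually_elim simp
    have "expectation (\<lambda>w. cos ((\<Sum>t\<in>{1..N}. H t w) / sqrt (real N) + b)) = expectation (\<lambda>w. cos b)" for N
    proof (rule integral_cong_AE[OF _ _ AE])
      have "(\<lambda>w. \<Sum>t\<in>{1..N}. H t w) \<in> borel_measurable M" by (intro borel_measurable_sum Hm) auto
      then show "(\<lambda>w. cos ((\<Sum>t\<in>{1..N}. H t w) / sqrt (real N) + b)) \<in> borel_measurable M" by measurable
    qed simp
    then show ?thesis using True by (simp add: prob_space)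
  next
    case False
    then have v: "v > 0" using v0 by simp
    \<comment> \<open>Snapshots are numbered from \<open>1\<close>, the sequence of the limit
      theorem from \<open>0\<close>.\<close>
    define X where "X n = H (Suc n)" for n
    define \<sigma> where "\<sigma> = sqrt v"
    have \<sigma>: "\<sigma> > 0" "\<sigma>\<^sup>2 = v" using v by (auto simp: \<sigma>_def)
    have Xm: "X n \<in> borel_measurable M" for n unfolding X_def by (rule Hm) simp
    have indX: "indep_vars (\<lambda>i. borel) X UNIV"
    proof -
      have *: "indep_vars (\<lambda>_. borel) H (Suc ` UNIV)" using ind by (rule indep_vars_subset) auto
      show ?thesis using indep_vars_reindex_inj[OF *] by (simp add: X_def[abs_def])
    qed
    have "weak_conv_m (\<lambda>n. distr M borel (\<lambda>x. (\<Sum>i<n. X i x) / sqrt (real n * \<sigma>\<^sup>2))) std_normal_distribution"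
    proof (rule central_limit_theorem_zero_mean[OF indX _ \<sigma>(1)])
      show "expectation (X n) = 0" for n using mean[of "Suc n"] by (simp add: X_def has_bochner_integral_iff)
      then show "variance (X n) = \<sigma>\<^sup>2" for n using var[of "Suc n"] \<sigma> by (simp add: X_def has_bochner_integral_iff)
      show "integrable M (\<lambda>x. (X n x)\<^sup>2)" for n using var[of "Suc n"] by (simp add: X_def has_bochner_integral_iff)
      show "distr M borel (X n) = \<mu>" for n using ident[of "Suc n"] by (simp add: X_def)
    qed
    then have "(\<lambda>n. \<integral>x. cos (\<sigma> * x + b) \<partial>distr M borel (\<lambda>x. (\<Sum>i<n. X i x) / sqrt (real n * \<sigma>\<^sup>2)))
      \<longlonglongrightarrow> (\<integral>x. cos (\<sigma> * x + b) \<partial>std_normal_distribution)"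
    proof (rule weak_conv_imp_integral_bdd_continuous_conv[where B = 1, rotated 2])
      show "real_distribution (distr M borel (\<lambda>x. (\<Sum>i<n. X i x) / sqrt (real n * \<sigma>\<^sup>2)))" for n
        using Xm by (intro real_distribution_distr) auto
      show "real_distribution std_normal_distribution" by (rule real_dist_normal_dist)
    qed (auto intro!: continuous_intros)
    also have "(\<integral>x. cos (\<sigma> * x + b) \<partial>std_normal_distribution) = cos b * exp (- v / 2)"
    proof -
      have "has_bochner_integral lborel (\<lambda>x. cis b * (cis (\<sigma> * x) * complex_of_real (std_normal_density x)))
        (cis b * of_real (exp (- (\<sigma>\<^sup>2 * 1\<^sup>2) / 2)))"
        by (intro has_bochner_integral_mult_right has_bochner_integral_cis_normal) simp
      note h = has_bochner_integral_bounded_linear[OF bounded_linear_Re this]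
      have "(\<integral>x. std_normal_density x * cos (\<sigma> * x + b) \<partial>lborel) = cos b * exp (- v / 2)"
      proof -
        have e: "Re (cis b * (cis (\<sigma> * x) * complex_of_real (std_normal_density x))) = std_normal_density x * cos (\<sigma> * x + b)" for x
          by (simp add: cos_add algebra_simps)
        have e': "Re (cis b * complex_of_real r) = cos b * r" for r by simp
        show ?thesis using h unfolding e e' has_bochner_integral_iff by (simp add: \<sigma>)
      qed
      then show ?thesis by (subst integral_density) auto
    qed
    finally have lim: "(\<lambda>n. \<integral>x. cos (\<sigma> * x + b) \<partial>distr M borel (\<lambda>x. (\<Sum>i<n. X i x) / sqrt (real n * \<sigma>\<^sup>2)))
      \<longlonglongrightarrow> cos b * exp (- v / 2)" .
    have "(\<integral>x. cos (\<sigma> * x + b) \<partial>distr M borel (\<lambda>x. (\<Sum>i<n. X i x) / sqrt (real n * \<sigma>\<^sup>2)))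
      = expectation (\<lambda>w. cos ((\<Sum>t\<in>{1..n}. H t w) / sqrt (real n) + b))" for n
    proof -
      have s: "(\<Sum>t\<in>{1..n}. H t w) = (\<Sum>i<n. X i w)" for w
        unfolding X_def by (rule sum.reindex_bij_witness[of _ Suc "\<lambda>t. t - 1"]) auto
      have "\<sigma> * ((\<Sum>i<n. X i w) / sqrt (real n * \<sigma>\<^sup>2)) = (\<Sum>i<n. X i w) / sqrt (real n)" for w
        using \<sigma>(1) by (simp add: real_sqrt_mult)
      moreover have "(\<lambda>x. (\<Sum>i<n. X i x) / sqrt (real n * \<sigma>\<^sup>2)) \<in> borel_measurable M" using Xm by auto
      ultimately show ?thesis unfolding s
        by (subst integral_distr) (auto intro!: borel_measurable_continuous_onI continuous_intros)
    qed
    then show ?thesis using lim by simp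
  qed
qed

lemma (in prob_space) iid_sum_second_moment:
  fixes H :: "nat \<Rightarrow> 'a \<Rightarrow> real"
  assumes ind: "indep_vars (\<lambda>_. borel) H {1..}"
    and mean: "\<And>t. 1 \<le> t \<Longrightarrow> has_bochner_integral M (H t) 0"
    and var: "\<And>t. 1 \<le> t \<Longrightarrow> has_bochner_integral M (\<lambda>w. (H t w)\<^sup>2) v"
  shows "has_bochner_integral M (\<lambda>w. (\<Sum>t\<in>{1..N}. H t w)\<^sup>2) (real N * v)"
proof -
  have pair: "has_bochner_integral M (\<lambda>w. H t w * H u w) (if t = u then v else 0)" if "1 \<le> t" "1 \<le> u" for t u
  proof (cases "t = u")
    case True then show ?thesis using var[OF that(1)] by (simp add: power2_eq_square)
  next
    case False
    have i: "indep_vars (\<lambda>_. borel) H {t, u}" by (rule indep_vars_subset[OF ind]) (use that in auto)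
    have I: "integrable M (H i)" if "i \<in> {t, u}" for i
      using that mean[OF \<open>1 \<le> t\<close>] mean[OF \<open>1 \<le> u\<close>] by (auto simp: has_bochner_integral_iff)
    show ?thesis
      using indep_vars_integrable[OF _ i I] indep_vars_lebesgue_integral[OF _ i I] mean[OF that(1)] False
      by (simp add: has_bochner_integral_iff)
  qed
  have "has_bochner_integral M (\<lambda>w. \<Sum>t\<in>{1..N}. \<Sum>u\<in>{1..N}. H t w * H u w) (\<Sum>t\<in>{1..N}. \<Sum>u\<in>{1..N}. if t = u then v else 0)"
    by (intro has_bochner_integral_sum pair) auto
  then show ?thesis by (simp add: power2_eq_square sum_product)
qed

subsection \<open>Centred quadratic forms and the Fisher information\<close>

lemma Im_mtr_hermitian: "adjm A = A \<Longrightarrow> adjm B = B \<Longrightarrow> Im (mtr n (A \<odot>\<^bsub>n\<^esub> B)) = 0"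
proof -
  assume h: "adjm A = A" "adjm B = B"
  have "cnj (mtr n (A \<odot>\<^bsub>n\<^esub> B)) = mtr n (adjm (A \<odot>\<^bsub>n\<^esub> B))" by (simp add: mtr_def adjm_def)
  also have "\<dots> = mtr n (A \<odot>\<^bsub>n\<^esub> B)" by (simp add: adjm_mmul h mtr_mmul_comm[of n A])
  finally show ?thesis by (simp add: complex_eq_iff)
qed

text \<open>Centring cancels the product of the means in Wick's formula and leaves the trace of the
  cross pairing. The real weight \<open>h\<close> admits a density or the constant
  \<open>1\<close>.\<close>

lemma centred_qform_moments:
  fixes w :: "nat \<Rightarrow> 'v \<Rightarrow> complex" and h :: "'v \<Rightarrow> real"
  assumes H: "\<And>a b. (\<And>k. k < m \<Longrightarrow> a k \<le> 2) \<Longrightarrow> (\<And>k. k < m \<Longrightarrow> b k \<le> 2) \<Longrightarrow>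
      has_bochner_integral N (\<lambda>x. (\<Prod>k<m. cnj (w k x) ^ a k * w k x ^ b k) * of_real (h x))
        (\<Prod>k<m. if a k = b k then of_real (fact (a k) * v k ^ a k) else 0)"
    and y: "\<And>x p. p < n \<Longrightarrow> y x p = (\<Sum>k<m. A p k * w k x)"
    and R: "R = A \<odot>\<^bsub>m\<^esub> diagm m v \<odot>\<^bsub>m\<^esub> adjm A"
    and hB: "adjm B = B" "adjm B' = B'"
  defines "f \<equiv> \<lambda>B x. Re (qform n B (y x)) - Re (mtr n (B \<odot>\<^bsub>n\<^esub> R))"
  shows centred_qform_moment1: "has_bochner_integral N (\<lambda>x. f B x * h x) 0"
    and centred_qform_moment2: "has_bochner_integral N (\<lambda>x. f B x * f B' x * h x) (Re (mtr n (B \<odot>\<^bsub>n\<^esub> R \<odot>\<^bsub>n\<^esub> B' \<odot>\<^bsub>n\<^esub> R)))"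
proof -
  have hR: "adjm R = R" unfolding R by (rule hermitian_congruence[OF adjm_diagm])
  let ?t = "\<lambda>B. mtr n (B \<odot>\<^bsub>n\<^esub> R)" and ?q = "\<lambda>B x. qform n B (y x)" and ?h = "\<lambda>x. complex_of_real (h x)"
  have f: "complex_of_real (f B x) = ?q B x - ?t B" if "adjm B = B" for B x
    using qform_real[OF hermitianI[OF that], of n "y x"] Im_mtr_hermitian[OF that hR, of n]
    unfolding f_def by (simp add: complex_eq_iff)
  have m0: "has_bochner_integral N ?h 1" by (rule fourth_moment_product(3)[OF H])
  have m1: "has_bochner_integral N (\<lambda>x. ?q B x * ?h x) (?t B)" for B
    unfolding R by (rule qform_moment1[OF H y])
  have m2: "has_bochner_integral N (\<lambda>x. ?q B x * ?q B' x * ?h x) (?t B * ?t B' + mtr n (B \<odot>\<^bsub>n\<^esub> R \<odot>\<^bsub>n\<^esub> B' \<odot>\<^bsub>n\<^esub> R))"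
    unfolding R by (rule qform_moment2[OF H y])
  have "has_bochner_integral N (\<lambda>x. ?q B x * ?h x - ?t B * ?h x) (?t B - ?t B * 1)"
    by (intro has_bochner_integral_diff m1 has_bochner_integral_mult_right m0)
  also have "(\<lambda>x. ?q B x * ?h x - ?t B * ?h x) = (\<lambda>x. complex_of_real (f B x * h x))"
    by (simp add: f[OF hB(1)] algebra_simps)
  finally show "has_bochner_integral N (\<lambda>x. f B x * h x) 0"
    using has_bochner_integral_bounded_linear[OF bounded_linear_Re] by fastforce
  have "has_bochner_integral N (\<lambda>x. (?q B x * ?q B' x * ?h x - ?t B' * (?q B x * ?h x)) - (?t B * (?q B' x * ?h x) - (?t B * ?t B') * ?h x))
    ((?t B * ?t B' + mtr n (B \<odot>\<^bsub>n\<^esub> R \<odot>\<^bsub>n\<^esub> B' \<odot>\<^bsub>n\<^esub> R) - ?t B' * ?t B) - (?t B * ?t B' - (?t B * ?t B') * 1))"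
    by (intro has_bochner_integral_diff m1 m2 has_bochner_integral_mult_right m0)
  also have "(\<lambda>x. (?q B x * ?q B' x * ?h x - ?t B' * (?q B x * ?h x)) - (?t B * (?q B' x * ?h x) - (?t B * ?t B') * ?h x))
    = (\<lambda>x. complex_of_real (f B x * f B' x * h x))"
    unfolding of_real_mult by (simp add: f hB algebra_simps)
  also have "(?t B * ?t B' + mtr n (B \<odot>\<^bsub>n\<^esub> R \<odot>\<^bsub>n\<^esub> B' \<odot>\<^bsub>n\<^esub> R) - ?t B' * ?t B) - (?t B * ?t B' - (?t B * ?t B') * 1)
    = mtr n (B \<odot>\<^bsub>n\<^esub> R \<odot>\<^bsub>n\<^esub> B' \<odot>\<^bsub>n\<^esub> R)" by simp
  finally show "has_bochner_integral N (\<lambda>x. f B x * f B' x * h x) (Re (mtr n (B \<odot>\<^bsub>n\<^esub> R \<odot>\<^bsub>n\<^esub> B' \<odot>\<^bsub>n\<^esub> R)))"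
    using has_bochner_integral_bounded_linear[OF bounded_linear_Re] by fastforce
qed

lemma borel_measurable_qform:
  "qform n B \<in> borel_measurable (PiM {..<n} (\<lambda>_. lborel))"
proof -
  have [measurable]: "(\<lambda>x. x i) \<in> borel_measurable (PiM {..<n} (\<lambda>_. lborel :: complex measure))" if "i \<in> {..<n}" for i
    using measurable_component_singleton[OF that, of "\<lambda>_. lborel :: complex measure"] by simp
  have "(\<lambda>x. \<Sum>i<n. \<Sum>j<n. cnj (x i) * B i j * x j) \<in> borel_measurable (PiM {..<n} (\<lambda>_. lborel))"
    by (intro borel_measurable_sum borel_measurable_times borel_measurable_const
        measurable_compose[OF _ borel_measurable_continuous_onI[of cnj]] continuous_on_cnj continuous_on_id) auto
  then show ?thesis unfolding qform_def[abs_def] .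
qed

context spa_model
begin

lemma adjm_Wm: "good \<eta> \<Longrightarrow> a < d \<Longrightarrow> adjm (Wm \<eta> a) = Wm \<eta> a"
  unfolding Wm_def
  by (simp add: adjm_mmul adjm_minv[OF pd_mdet[OF pd_Rpar] msupp_Rpar adjm_Rpar] hermitian_Rder mmul_assoc)

lemma Wm_Rpar: "good \<eta> \<Longrightarrow> Wm \<eta> a \<odot>\<^bsub>L\<^esub> Rp \<eta> = minv L (Rp \<eta>) \<odot>\<^bsub>L\<^esub> Rder \<eta> a"
  unfolding Wm_def mmul_assoc
  by (simp add: minv_eye[OF pd_mdet[OF pd_Rpar] msupp_Rpar] mmul_eye_right msupp_Rder)

lemma Fi_Wm: "good \<eta> \<Longrightarrow> Re (mtr L (Wm \<eta> a \<odot>\<^bsub>L\<^esub> Rp \<eta> \<odot>\<^bsub>L\<^esub> Wm \<eta> b \<odot>\<^bsub>L\<^esub> Rp \<eta>)) = Fi \<eta> a b"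
  unfolding mmul_assoc[of _ _ "Wm \<eta> b"] Wm_Rpar Fi_def by (simp add: Wm_Rpar mmul_assoc)

text \<open>The triangular substitution turns the snapshot density into a product of circular
  Gaussians, under which the scores are centred quadratic forms with matrices \<open>Wm\<close>;
  their covariance is the trace in \<open>Fi\<close>.\<close>

theorem fim1_eq_Fi:
  assumes g: "good \<eta>" and ab: "a < d" "b < d"
  shows "fim1 eqv Om K \<eta> a b = Fi \<eta> a b"
proof -
  obtain A V where A: "\<forall>i<L. A i i = 1" "\<forall>i j. i < j \<longrightarrow> A i j = 0" "msupp L A"
    "\<forall>i<L. 0 < V i" "\<forall>i<L. \<forall>j<L. Rp \<eta> i j = (\<Sum>k<L. A i k * complex_of_real (V k) * cnj (A j k))"
    using pd_LDL[OF pd_Rpar[OF g]] by (elim exE conjE) (rule that)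
  have R: "Rp \<eta> = A \<odot>\<^bsub>L\<^esub> diagm L V \<odot>\<^bsub>L\<^esub> adjm A"
  proof (rule msupp_eqI[OF msupp_Rpar])
    show "msupp L (A \<odot>\<^bsub>L\<^esub> diagm L V \<odot>\<^bsub>L\<^esub> adjm A)" by (intro msupp_mmul msupp_diagm msupp_adjm A(3))
    fix i j assume "i < L" "j < L"
    then show "Rp \<eta> i j = (A \<odot>\<^bsub>L\<^esub> diagm L V \<odot>\<^bsub>L\<^esub> adjm A) i j"
      using A(5) unfolding mmul_diagm by (simp add: mmul_def adjm_def)
  qed
  have pV: "0 < (\<Prod>k<L. V k)" using A(4) by (intro prod_pos) auto
  have dens: "exp (loglik eqv Om K \<eta> (shear L A z)) = (\<Prod>k<L. cgd (V k) (z k))" for z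
  proof -
    have "loglik eqv Om K \<eta> (shear L A z) = - (real L * ln pi) - ln (\<Prod>k<L. V k) + - (\<Sum>k<L. (cmod (z k))\<^sup>2 / V k)"
      unfolding loglik_def LDL_mdet[OF A] by (subst LDL_qform[OF A, where z=z]) (simp_all add: shear_def del: of_real_prod)
    moreover have "exp (- (real L * ln pi) - ln P + - S) = exp (- S) / (pi ^ L * P)" if "0 < P" for P S :: real
      unfolding exp_add exp_diff exp_ln[OF that] by (simp add: exp_minus exp_of_nat_mult exp_of_nat2_mult field_simps)
    ultimately have "exp (loglik eqv Om K \<eta> (shear L A z)) = exp (- (\<Sum>k<L. (cmod (z k))\<^sup>2 / V k)) / (pi ^ L * (\<Prod>k<L. V k))"
      using pV by metis
    also have "\<dots> = (\<Prod>k<L. cgd (V k) (z k))"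
      unfolding cgd_def by (simp add: prod_dividef prod.distrib exp_sum[symmetric] sum_negf)
    finally show ?thesis .
  qed
  have H: "has_bochner_integral (PiM {..<L} (\<lambda>_. lborel)) (\<lambda>z. (\<Prod>k<L. cnj (z k) ^ a k * z k ^ b k) * of_real (\<Prod>k<L. cgd (V k) (z k)))
    (\<Prod>k<L. if a k = b k then of_real (fact (a k) * V k ^ a k) else 0)"
    if "\<And>k. k < L \<Longrightarrow> a k \<le> 2" "\<And>k. k < L \<Longrightarrow> b k \<le> 2" for a b
    by (rule cgd_product_moments) (use A(4) that in auto)
  have sc: "score eqv Om K \<eta> a y = Re (qform L (Wm \<eta> a) y) - Re (mtr L (Wm \<eta> a \<odot>\<^bsub>L\<^esub> Rp \<eta>))" if "a < d" for a y
    unfolding score_eq[OF g that] Wm_Rpar[OF g] by (simp add: Wm_def)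
  have i: "has_bochner_integral (PiM {..<L} (\<lambda>_. lborel))
     (\<lambda>z. score eqv Om K \<eta> a (shear L A z) * score eqv Om K \<eta> b (shear L A z) * exp (loglik eqv Om K \<eta> (shear L A z))) (Fi \<eta> a b)"
    unfolding dens sc[OF ab(1)] sc[OF ab(2)] Fi_Wm[OF g, symmetric]
    by (rule centred_qform_moment2[where w="\<lambda>k z. z k", OF H _ R adjm_Wm[OF g ab(1)] adjm_Wm[OF g ab(2)]])
       (auto simp: shear_def)
  have m: "(\<lambda>y. score eqv Om K \<eta> a y * score eqv Om K \<eta> b y * exp (loglik eqv Om K \<eta> y))
     \<in> borel_measurable (PiM {..<L} (\<lambda>_. lborel))"
  proof -
    note [measurable] = borel_measurable_qform
    show ?thesis unfolding sc[OF ab(1)] sc[OF ab(2)] loglik_def by measurable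
  qed
  have "has_bochner_integral (PiM {..<L} (\<lambda>_. lborel))
     (\<lambda>y. score eqv Om K \<eta> a y * score eqv Om K \<eta> b y * exp (loglik eqv Om K \<eta> y)) (Fi \<eta> a b)"
    by (rule has_bochner_integral_shear[OF _ _ m i]) (use A(1,2) in auto)
  then show ?thesis unfolding fim1_def by (simp add: has_bochner_integral_iff)
qed

end

subsection \<open>Snapshots and the sample covariance\<close>

lemma distributed_normal_moment:
  assumes v: "v > 0" and m: "m \<le> 4" and D: "distributed Mp lborel X (\<lambda>x. ennreal (normal_density 0 (sqrt (v / 2)) x))"
  shows "has_bochner_integral Mp (\<lambda>w. X w ^ m) (nmom v m)"
proof -
  have g: "(\<lambda>x. x ^ m) \<in> borel_measurable (lborel :: real measure)" by simp
  have nn: "\<And>x. x \<in> space lborel \<Longrightarrow> 0 \<le> normal_density 0 (sqrt (v / 2)) x" by simp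
  show ?thesis
    using distributed_integrable[OF D g nn] distributed_integral[OF D g nn] normal_moments[OF v m]
    by (simp add: has_bochner_integral_iff mult.commute)
qed

text \<open>Sources and noise are merged into one family of \<open>K + L\<close> independent
  circular variables per time; \<open>W t (k, True)\<close> is the real part and
  \<open>W t (k, False)\<close> the imaginary part. Times start at \<open>1\<close>.\<close>

locale gaussian_snapshots = spa_model eqv M K Om + prob_space Mp
  for eqv :: bool and M K :: nat and Om :: "nat list" and Mp :: "'w measure" +
  fixes \<eta>0 :: "nat \<Rightarrow> real" and W :: "nat \<Rightarrow> nat \<times> bool \<Rightarrow> 'w \<Rightarrow> real"
  assumes good0: "good \<eta>0" and rng0: "\<And>k. k < K \<Longrightarrow> \<eta>0 k \<in> {0..<1}"
    and indW: "indep_vars (\<lambda>_. borel) (\<lambda>(t, j). W t j) ({1..} \<times> ({..<K + length Om} \<times> UNIV))"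
    and distrW: "\<And>t k r. 1 \<le> t \<Longrightarrow> k < K + length Om \<Longrightarrow>
      distributed Mp lborel (W t (k, r)) (\<lambda>x. ennreal (normal_density 0 (sqrt (mixv \<eta>0 k / 2)) x))"
begin

abbreviation "J \<equiv> {..<K + L} \<times> (UNIV :: bool set)"
abbreviation "R0 \<equiv> Rp \<eta>0"

definition mixing :: "(nat \<times> bool \<Rightarrow> real) \<Rightarrow> nat \<Rightarrow> complex"
  where "mixing x p = (\<Sum>k<K + L. mixm \<eta>0 p k * Complex (x (k, True)) (x (k, False)))"

definition snap :: "nat \<Rightarrow> 'w \<Rightarrow> nat \<Rightarrow> complex"
  where "snap t w = mixing (\<lambda>j. W t j w)"

definition Rs :: "nat \<Rightarrow> 'w \<Rightarrow> nat \<Rightarrow> nat \<Rightarrow> complex"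
  where "Rs N w = (\<lambda>i j. if i < L \<and> j < L then (1 / of_nat N) * (\<Sum>t\<in>{1..N}. snap t w i * cnj (snap t w j)) else 0)"

text \<open>A centred quadratic form written as a function of the real coordinates of one snapshot,
  the shape required by \<open>iid_blocks\<close>.\<close>

definition cq :: "(nat \<Rightarrow> nat \<Rightarrow> complex) \<Rightarrow> (nat \<times> bool \<Rightarrow> real) \<Rightarrow> real"
  where "cq B x = Re (qform L B (mixing x)) - Re (mtr L (B \<odot>\<^bsub>L\<^esub> R0))"

definition vq :: "(nat \<Rightarrow> nat \<Rightarrow> complex) \<Rightarrow> real"
  where "vq B = Re (mtr L (B \<odot>\<^bsub>L\<^esub> R0 \<odot>\<^bsub>L\<^esub> B \<odot>\<^bsub>L\<^esub> R0))"

lemma mixing_cong: "(\<And>j. j \<in> J \<Longrightarrow> x j = x' j) \<Longrightarrow> mixing x = mixing x'"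
  unfolding mixing_def by (intro ext sum.cong) auto

lemma cq_restrict: "cq B (restrict x J) = cq B x"
  unfolding cq_def by (subst mixing_cong[of "restrict x J" x]) auto

lemma borel_measurable_cq: "cq B \<in> borel_measurable (PiM J (\<lambda>_. borel))"
proof -
  have x: "(\<lambda>x. x j) \<in> borel_measurable (PiM J (\<lambda>_. borel :: real measure))" if "j \<in> J" for j
    using that by (rule measurable_component_singleton)
  have C: "(\<lambda>x. Complex (x (k, True)) (x (k, False))) \<in> borel_measurable (PiM J (\<lambda>_. borel))" if "k < K + L" for k
    unfolding Complex_eq
    by (intro borel_measurable_add borel_measurable_times borel_measurable_const borel_measurable_of_real x) (use that in auto)
  have m: "(\<lambda>x. mixing x p) \<in> borel_measurable (PiM J (\<lambda>_. borel))" for p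
    unfolding mixing_def by (intro borel_measurable_sum borel_measurable_times borel_measurable_const C) auto
  have cm: "(\<lambda>x. cnj (mixing x p)) \<in> borel_measurable (PiM J (\<lambda>_. borel))" for p
    by (rule measurable_compose[OF m borel_measurable_continuous_onI[of cnj]]) (intro continuous_on_cnj continuous_on_id)
  have "(\<lambda>x. Re (\<Sum>i<L. \<Sum>j<L. cnj (mixing x i) * B i j * mixing x j)) \<in> borel_measurable (PiM J (\<lambda>_. borel))"
    by (intro measurable_compose[OF _ borel_measurable_continuous_onI[of Re]] continuous_on_Re continuous_on_id
        borel_measurable_sum borel_measurable_times borel_measurable_const m cm)
  then show ?thesis unfolding cq_def[abs_def] qform_def by simp
qed

text \<open>The trailing factor \<open>1\<close> is the trivial weight expected by
  \<open>circular_moments\<close>.\<close>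

lemma W_moments:
  assumes t: "1 \<le> t" and k: "k < K + L" and ml: "m \<le> 4" "l \<le> 4"
  shows "has_bochner_integral Mp (\<lambda>w. W t (k, True) w ^ m * W t (k, False) w ^ l * 1) (nmom (mixv \<eta>0 k) m * nmom (mixv \<eta>0 k) l)"
proof -
  have v: "mixv \<eta>0 k > 0" by (rule mixv_pos[OF good0 k])
  have "indep_vars (\<lambda>_. borel) (\<lambda>(t, j). W t j) ((\<lambda>r. (t, k, r)) ` UNIV)"
    by (rule indep_vars_subset[OF indW]) (use t k in auto)
  from indep_vars_reindex_inj[OF this] have "indep_vars (\<lambda>_. borel) (\<lambda>r. W t (k, r)) UNIV" by (simp add: inj_on_def)
  then have i: "indep_vars (\<lambda>_. borel) (\<lambda>r w. W t (k, r) w ^ (if r then m else l)) UNIV"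
    by (rule indep_vars_compose2) simp
  have I: "has_bochner_integral Mp (\<lambda>w. W t (k, r) w ^ (if r then m else l)) (nmom (mixv \<eta>0 k) (if r then m else l))" for r
    by (rule distributed_normal_moment[OF v _ distrW[OF t k]]) (use ml in auto)
  then have I': "\<And>r. r \<in> UNIV \<Longrightarrow> integrable Mp (\<lambda>w. W t (k, r) w ^ (if r then m else l))"
    by (auto simp: has_bochner_integral_iff)
  show ?thesis
    using indep_vars_integrable[OF _ i I'] indep_vars_lebesgue_integral[OF _ i I'] I[of True] I[of False]
    by (simp add: has_bochner_integral_iff UNIV_bool mult.commute)
qed

text \<open>Real and imaginary parts are grouped by \<open>k\<close> into independent complex
  variables, so the mixed moment is a product. The result is the moment hypothesis of the Wick
  lemmas.\<close>

lemma snapshot_moments: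
  assumes t: "1 \<le> t" and ab: "\<And>k. k < K + L \<Longrightarrow> a k \<le> 2" "\<And>k. k < K + L \<Longrightarrow> b k \<le> 2"
  defines "w \<equiv> \<lambda>k \<omega>. Complex (W t (k, True) \<omega>) (W t (k, False) \<omega>)"
  shows "has_bochner_integral Mp (\<lambda>x. (\<Prod>k<K + L. cnj (w k x) ^ a k * w k x ^ b k) * of_real 1)
    (\<Prod>k<K + L. if a k = b k then of_real (fact (a k) * mixv \<eta>0 k ^ a k) else 0)"
proof -
  let ?g = "\<lambda>k (x :: nat \<times> nat \<times> bool \<Rightarrow> real). cnj (Complex (x (t, k, True)) (x (t, k, False))) ^ a k * Complex (x (t, k, True)) (x (t, k, False)) ^ b k"
  let ?S = "\<lambda>k. {t} \<times> {k} \<times> (UNIV :: bool set)"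
  have g: "?g k \<in> borel_measurable (PiM (?S k) (\<lambda>_. borel))" for k
  proof -
    have x: "(\<lambda>x. x (t, k, r)) \<in> borel_measurable (PiM (?S k) (\<lambda>_. borel :: real measure))" for r
      by (rule measurable_component_singleton) auto
    have C: "(\<lambda>x. Complex (x (t, k, True)) (x (t, k, False))) \<in> borel_measurable (PiM (?S k) (\<lambda>_. borel))"
      unfolding Complex_eq by (intro borel_measurable_add borel_measurable_times borel_measurable_const
          measurable_compose[OF x borel_measurable_continuous_onI[of of_real]] continuous_on_of_real continuous_on_id)
    have "(\<lambda>x. cnj (Complex (x (t, k, True)) (x (t, k, False)))) \<in> borel_measurable (PiM (?S k) (\<lambda>_. borel))"
      by (rule measurable_compose[OF C borel_measurable_continuous_onI[of cnj]]) (intro continuous_on_cnj continuous_on_id)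
    with C show ?thesis by (intro borel_measurable_times borel_measurable_power)
  qed
  have "indep_vars (\<lambda>k. PiM (?S k) (\<lambda>_. borel)) (\<lambda>k \<omega>. restrict (\<lambda>i. (case i of (t, j) \<Rightarrow> W t j) \<omega>) (?S k)) {..<K + L}"
    by (rule indep_vars_restrict[OF indW]) (use t in \<open>auto simp: disjoint_family_on_def\<close>)
  from indep_vars_compose2[OF this g]
  have i: "indep_vars (\<lambda>_. borel) (\<lambda>k x. cnj (w k x) ^ a k * w k x ^ b k) {..<K + L}" by (simp add: w_def)
  have I: "has_bochner_integral Mp (\<lambda>x. cnj (w k x) ^ a k * w k x ^ b k)
     (if a k = b k then of_real (fact (a k) * mixv \<eta>0 k ^ a k) else 0)" if "k < K + L" for k
    using circular_moments[OF W_moments[OF t that] ab(1)[OF that] ab(2)[OF that]] by (simp add: w_def)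
  then have I': "\<And>k. k \<in> {..<K + L} \<Longrightarrow> integrable Mp (\<lambda>x. cnj (w k x) ^ a k * w k x ^ b k)"
    by (auto simp only: has_bochner_integral_iff lessThan_iff)
  have "(\<Prod>k<K + L. \<integral>x. cnj (w k x) ^ a k * w k x ^ b k \<partial>Mp) = (\<Prod>k<K + L. if a k = b k then of_real (fact (a k) * mixv \<eta>0 k ^ a k) else 0)"
    by (intro prod.cong refl has_bochner_integral_integral_eq I) simp
  then show ?thesis
    using indep_vars_integrable[OF _ i I'] indep_vars_lebesgue_integral[OF _ i I'] by (simp add: has_bochner_integral_iff)
qed

context
  fixes B assumes hB: "adjm B = B"
begin

abbreviation "Hq t w \<equiv> cq B (\<lambda>j. W t j w)"

lemma Hq_iid:
  shows Hq_indep: "indep_vars (\<lambda>_. borel) Hq {1..}"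
    and Hq_distr: "1 \<le> t \<Longrightarrow> distr Mp borel (Hq t) = distr Mp borel (Hq 1)"
proof -
  define D where "D j = density lborel (\<lambda>x. ennreal (normal_density 0 (sqrt (mixv \<eta>0 (fst j) / 2)) x))" for j :: "nat \<times> bool"
  have D: "distr Mp borel (W t j) = D j" if "t \<in> {1..}" "j \<in> J" for t j
    using that distributed_distr_eq_density[OF distrW[of t "fst j" "snd j"]]
    unfolding D_def by (auto intro: trans[OF distr_cong[of Mp Mp borel lborel]])
  have J: "finite J" "J \<noteq> {}" using L_pos by auto
  note h = iid_blocks[OF J indW D borel_measurable_cq[of B], unfolded cq_restrict]
  show "indep_vars (\<lambda>_. borel) Hq {1..}" by (rule h(1))
  show "1 \<le> t \<Longrightarrow> distr Mp borel (Hq t) = distr Mp borel (Hq 1)" using h(2)[of t] h(2)[of 1] by simp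
qed

lemma Hq_moments:
  assumes t: "1 \<le> t"
  shows Hq_mean: "has_bochner_integral Mp (Hq t) 0"
    and Hq_var: "has_bochner_integral Mp (\<lambda>w. (Hq t w)\<^sup>2) (vq B)"
  using centred_qform_moments[where w="\<lambda>k \<omega>. Complex (W t (k, True) \<omega>) (W t (k, False) \<omega>)" and y="snap t"
      and h="\<lambda>_. 1" and m="K + L" and n=L and A="mixm \<eta>0" and v="mixv \<eta>0" and N=Mp, OF snapshot_moments[OF t] _ Rpar_factor hB hB]
  by (simp_all add: snap_def mixing_def cq_def vq_def power2_eq_square)

text \<open>A linear statistic of the sample covariance is an average of independent centred
  quadratic forms; this opens it to the limit theorem and the second moment bound.\<close>

lemma sum_Hq:
  assumes N: "1 \<le> N"
  shows "Re (mtr L (B \<odot>\<^bsub>L\<^esub> (Rs N w - R0))) = (\<Sum>t\<in>{1..N}. Hq t w) / real N"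
proof -
  have "mtr L (B \<odot>\<^bsub>L\<^esub> Rs N w) = (\<Sum>i<L. \<Sum>j<L. \<Sum>t\<in>{1..N}. (1 / of_nat N) * (cnj (snap t w i) * B i j * snap t w j))"
    unfolding mtr_mmul Rs_def by (intro sum.cong refl) (simp add: sum_distrib_left mult_ac)
  also have "\<dots> = (\<Sum>i<L. \<Sum>t\<in>{1..N}. \<Sum>j<L. (1 / of_nat N) * (cnj (snap t w i) * B i j * snap t w j))"
    by (rule sum.cong[OF refl], rule sum.swap)
  also have "\<dots> = (\<Sum>t\<in>{1..N}. (1 / of_nat N) * qform L B (snap t w))"
    unfolding qform_def sum_distrib_left by (rule sum.swap)
  finally have "Re (mtr L (B \<odot>\<^bsub>L\<^esub> Rs N w)) = (\<Sum>t\<in>{1..N}. Re (qform L B (snap t w))) / real N"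
    by (simp add: sum_divide_distrib)
  moreover have "(\<Sum>t\<in>{1..N}. Hq t w) / real N = (\<Sum>t\<in>{1..N}. Re (qform L B (snap t w))) / real N - Re (mtr L (B \<odot>\<^bsub>L\<^esub> R0))"
    using N by (simp add: cq_def snap_def sum_subtractf field_simps)
  ultimately show ?thesis unfolding mmul_diff_right mtr_diff by simp
qed

lemma sample_clt:
  "(\<lambda>N. expectation (\<lambda>w. cos (sqrt (real N) * Re (mtr L (B \<odot>\<^bsub>L\<^esub> (Rs N w - R0))) + b))) \<longlonglongrightarrow> cos b * exp (- vq B / 2)"
proof (rule Lim_transform_eventually[OF iid_sum_cos[OF Hq_indep Hq_distr Hq_mean Hq_var]])
  have "sqrt (real N) * ((\<Sum>t\<in>{1..N}. Hq t w) / real N) = (\<Sum>t\<in>{1..N}. Hq t w) / sqrt (real N)" if "1 \<le> N" for N w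
    using that by (simp add: field_simps)
  then show "\<forall>\<^sub>F N in sequentially. expectation (\<lambda>w. cos ((\<Sum>t\<in>{1..N}. Hq t w) / sqrt (real N) + b))
     = expectation (\<lambda>w. cos (sqrt (real N) * Re (mtr L (B \<odot>\<^bsub>L\<^esub> (Rs N w - R0))) + b))"
    by (intro eventually_sequentiallyI[of 1]) (simp add: sum_Hq)
qed

lemma sample_second_moment:
  assumes N: "1 \<le> N"
  shows "has_bochner_integral Mp (\<lambda>w. (Re (mtr L (B \<odot>\<^bsub>L\<^esub> (Rs N w - R0))))\<^sup>2) (vq B / real N)"
proof -
  have "has_bochner_integral Mp (\<lambda>w. (1 / (real N)\<^sup>2) * (\<Sum>t\<in>{1..N}. Hq t w)\<^sup>2) ((1 / (real N)\<^sup>2) * (real N * vq B))"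
    by (intro has_bochner_integral_mult_right iid_sum_second_moment[OF Hq_indep Hq_mean Hq_var]) auto
  then show ?thesis using N by (simp add: sum_Hq power_divide power2_eq_square)
qed

end

end

subsection \<open>Asymptotic normality\<close>

context gaussian_snapshots
begin

definition s2 :: "nat \<Rightarrow> 'w \<Rightarrow> real"
  where "s2 N w = (\<Sum>i<L. \<Sum>j<L. (cmod ((Rs N w - R0) i j))\<^sup>2)"

text \<open>\<open>ReB\<close> and \<open>ImB\<close> are Hermitian matrices whose trace pairing
  reads off the real and imaginary part of one entry, so the moment bound for Hermitian weights
  reaches every entry.\<close>

definition ReB :: "nat \<Rightarrow> nat \<Rightarrow> nat \<Rightarrow> nat \<Rightarrow> complex"
  where "ReB i j = (\<lambda>p q. (of_bool (p = j \<and> q = i) + of_bool (p = i \<and> q = j)) / 2)"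

definition ImB :: "nat \<Rightarrow> nat \<Rightarrow> nat \<Rightarrow> nat \<Rightarrow> complex"
  where "ImB i j = (\<lambda>p q. \<i> * (of_bool (p = i \<and> q = j) - of_bool (p = j \<and> q = i)) / 2)"

lemma msupp_Rs: "msupp L (Rs N w)" by (auto simp: msupp_def Rs_def)

lemma adjm_Rs: "adjm (Rs N w) = Rs N w"
  by (auto simp: adjm_def Rs_def mult.commute intro!: ext)

lemma Rs_diff_hermitian: "cnj ((Rs N w - R0) i j) = (Rs N w - R0) j i"
  using fun_cong[OF fun_cong[OF adjm_Rs[of N w]], of j i] fun_cong[OF fun_cong[OF adjm_Rpar[of \<eta>0]], of j i]
  by (simp add: adjm_def)

lemma cnj_of_bool: "cnj (of_bool b) = of_bool b" by (cases b) auto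

lemma adjm_ReB: "adjm (ReB i j) = ReB i j"
  unfolding adjm_def ReB_def by (intro ext) (simp add: cnj_of_bool add.commute conj_commute)

lemma adjm_ImB: "adjm (ImB i j) = ImB i j"
  unfolding adjm_def ImB_def by (intro ext) (simp add: cnj_of_bool conj_commute algebra_simps)

lemma sum_delta2:
  fixes f :: "nat \<Rightarrow> nat \<Rightarrow> complex"
  assumes "i < L" "j < L"
  shows "(\<Sum>p<L. \<Sum>q<L. of_bool (p = i \<and> q = j) * f p q) = f i j"
proof -
  have "of_bool (p = i \<and> q = j) * f p q = (if p = i then if q = j then f i j else 0 else 0)" for p q
    by (cases "p = i"; cases "q = j") simp_all
  then have "(\<Sum>p<L. \<Sum>q<L. of_bool (p = i \<and> q = j) * f p q) = (\<Sum>p<L. \<Sum>q<L. if p = i then if q = j then f i j else 0 else 0)"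
    by (simp only:)
  also have "\<dots> = (\<Sum>p<L. if p = i then (\<Sum>q<L. if q = j then f i j else 0) else 0)"
    by (rule sum.cong[OF refl]) (simp only: if_True if_False sum.neutral_const split: if_split, simp)
  finally show ?thesis using assms by (simp only: sum.delta finite_lessThan lessThan_iff if_True)
qed

lemma add_halves_mult: "(a + b) / 2 * x = a * (x / 2) + b * (x / 2)"
  and diff_halves_mult: "\<i> * (a - b) / 2 * x = a * (\<i> * x / 2) - b * (\<i> * x / 2)" for a b x :: complex
  by (simp_all add: field_simps)

lemma mtr_ReB:
  assumes ij: "i < L" "j < L"
  shows "Re (mtr L (ReB i j \<odot>\<^bsub>L\<^esub> (Rs N w - R0))) = Re ((Rs N w - R0) i j)"
proof -
  let ?D = "Rs N w - R0"
  have "mtr L (ReB i j \<odot>\<^bsub>L\<^esub> ?D) = (\<Sum>p<L. \<Sum>q<L. of_bool (p = j \<and> q = i) * (?D q p / 2)) + (\<Sum>p<L. \<Sum>q<L. of_bool (p = i \<and> q = j) * (?D q p / 2))"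
    unfolding mtr_mmul ReB_def sum.distrib[symmetric] add_halves_mult ..
  also have "\<dots> = (?D i j + cnj (?D i j)) / 2"
    unfolding sum_delta2[OF ij] sum_delta2[OF ij(2,1)] Rs_diff_hermitian by (simp add: add_divide_distrib)
  finally have e: "mtr L (ReB i j \<odot>\<^bsub>L\<^esub> ?D) = (?D i j + cnj (?D i j)) / 2" .
  have "Re ((z + cnj z) / 2) = Re z" for z by simp
  then show ?thesis unfolding e .
qed

lemma mtr_ImB:
  assumes ij: "i < L" "j < L"
  shows "Re (mtr L (ImB i j \<odot>\<^bsub>L\<^esub> (Rs N w - R0))) = Im ((Rs N w - R0) i j)"
proof -
  let ?D = "Rs N w - R0"
  have "mtr L (ImB i j \<odot>\<^bsub>L\<^esub> ?D) = (\<Sum>p<L. \<Sum>q<L. of_bool (p = i \<and> q = j) * (\<i> * ?D q p / 2)) - (\<Sum>p<L. \<Sum>q<L. of_bool (p = j \<and> q = i) * (\<i> * ?D q p / 2))"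
    unfolding mtr_mmul ImB_def sum_subtractf[symmetric] diff_halves_mult ..
  also have "\<dots> = \<i> * (cnj (?D i j) - ?D i j) / 2"
    unfolding sum_delta2[OF ij] sum_delta2[OF ij(2,1)] Rs_diff_hermitian by (simp add: algebra_simps diff_divide_distrib)
  finally have e: "mtr L (ImB i j \<odot>\<^bsub>L\<^esub> ?D) = \<i> * (cnj (?D i j) - ?D i j) / 2" .
  have "Re (\<i> * (cnj z - z) / 2) = Im z" for z by simp
  then show ?thesis unfolding e .
qed

text \<open>The mean of \<open>s2 N\<close> multiplied by \<open>N\<close>, a constant in
  \<open>N\<close>.\<close>

definition vtot :: real
  where "vtot = (\<Sum>i<L. \<Sum>j<L. vq (ReB i j) + vq (ImB i j))"

lemma s2_nonneg: "0 \<le> s2 N w" unfolding s2_def by (intro sum_nonneg) auto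

lemma s2_moment:
  assumes N: "1 \<le> N"
  shows "has_bochner_integral Mp (s2 N) (vtot / real N)"
proof -
  have "has_bochner_integral Mp (\<lambda>w. \<Sum>i<L. \<Sum>j<L. (Re (mtr L (ReB i j \<odot>\<^bsub>L\<^esub> (Rs N w - R0))))\<^sup>2 + (Re (mtr L (ImB i j \<odot>\<^bsub>L\<^esub> (Rs N w - R0))))\<^sup>2)
     (\<Sum>i<L. \<Sum>j<L. vq (ReB i j) / real N + vq (ImB i j) / real N)"
    by (intro has_bochner_integral_sum has_bochner_integral_add sample_second_moment adjm_ReB adjm_ImB N)
  also have "(\<lambda>w. \<Sum>i<L. \<Sum>j<L. (Re (mtr L (ReB i j \<odot>\<^bsub>L\<^esub> (Rs N w - R0))))\<^sup>2 + (Re (mtr L (ImB i j \<odot>\<^bsub>L\<^esub> (Rs N w - R0))))\<^sup>2) = s2 N"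
    unfolding s2_def cmod_power2 by (intro ext sum.cong refl arg_cong2[where f="(+)"]) (simp_all only: mtr_ReB mtr_ImB lessThan_iff)
  also have "(\<Sum>i<L. \<Sum>j<L. vq (ReB i j) / real N + vq (ImB i j) / real N) = vtot / real N"
    unfolding vtot_def by (simp add: sum_divide_distrib add_divide_distrib)
  finally show ?thesis .
qed

text \<open>The squared Frobenius error is compared with \<open>u^2 / N\<close>, so that Markov's
  inequality bounds the probability by \<open>vtot / u^2\<close> for all \<open>N\<close> at
  once.\<close>

definition bad :: "real \<Rightarrow> nat \<Rightarrow> 'w set"
  where "bad u N = {w \<in> space Mp. u\<^sup>2 / real N \<le> s2 N w}"

lemma bad_event: "1 \<le> N \<Longrightarrow> bad u N \<in> events"
  using borel_measurable_has_bochner_integral[OF s2_moment] unfolding bad_def by measurable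

lemma prob_bad:
  assumes N: "1 \<le> N" and u: "u > 0"
  shows "prob (bad u N) \<le> vtot / u\<^sup>2"
proof -
  have "prob (bad u N) \<le> (\<integral>w. s2 N w \<partial>Mp) / (u\<^sup>2 / real N)" unfolding bad_def
    by (rule integral_Markov_inequality_measure[OF _ sets.empty_sets])
       (use s2_moment[OF N] s2_nonneg N u in \<open>auto simp: has_bochner_integral_iff\<close>)
  also have "\<dots> = vtot / u\<^sup>2" using s2_moment[OF N] N by (simp add: has_bochner_integral_iff)
  finally show ?thesis .
qed

lemma entry_bound:
  assumes w: "w \<in> space Mp" "w \<notin> bad u N" and N: "1 \<le> N" and u: "u > 0" and ij: "i < L" "j < L"
  shows "cmod ((Rs N w - R0) i j) < u / sqrt (real N)"
proof -
  have "(cmod ((Rs N w - R0) i j))\<^sup>2 \<le> (\<Sum>j<L. (cmod ((Rs N w - R0) i j))\<^sup>2)"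
    by (rule member_le_sum) (use ij in auto)
  also have "\<dots> \<le> s2 N w" unfolding s2_def
    by (rule member_le_sum[where f="\<lambda>i. \<Sum>j<L. (cmod ((Rs N w - R0) i j))\<^sup>2"]) (use ij in \<open>auto intro: sum_nonneg\<close>)
  also have "\<dots> < (u / sqrt (real N))\<^sup>2" using w by (simp add: bad_def power_divide)
  finally show ?thesis by (rule power_less_imp_less_base) (use u in simp)
qed

lemma l1_bound:
  assumes w: "w \<in> space Mp" "w \<notin> bad u N" and N: "1 \<le> N" and u: "u > 0"
  shows "sqrt (real N) * l1 (Rs N w - R0) \<le> (real L)\<^sup>2 * u"
proof -
  have "l1 (Rs N w - R0) \<le> (\<Sum>i<L. \<Sum>j<L. u / sqrt (real N))"
    unfolding l1_def by (intro sum_mono less_imp_le entry_bound[OF w N u]) auto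
  then have "sqrt (real N) * l1 (Rs N w - R0) \<le> sqrt (real N) * (\<Sum>i<L. \<Sum>j<L. u / sqrt (real N))"
    by (intro mult_left_mono) auto
  also have "\<dots> = (real L)\<^sup>2 * u" using N by (simp add: power2_eq_square)
  finally show ?thesis .
qed

definition Fv :: "nat \<Rightarrow> nat \<Rightarrow> real"
  where "Fv = minv d (Fi \<eta>0)"

text \<open>Cramer-Wold: the weight whose trace pairing is the combination of the coordinates of
  \<open>lin\<close> with coefficients \<open>c\<close>.\<close>

definition Bc :: "(nat \<Rightarrow> real) \<Rightarrow> nat \<Rightarrow> nat \<Rightarrow> complex"
  where "Bc c = (\<lambda>p q. \<Sum>a<d. of_real (\<Sum>i<d. c i * Fv i a) * Wm \<eta>0 a p q)"

lemma adjm_Bc: "adjm (Bc c) = Bc c"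
proof (intro ext)
  fix p q
  have "cnj (Wm \<eta>0 a q p) = Wm \<eta>0 a p q" if "a < d" for a
    using fun_cong[OF fun_cong[OF adjm_Wm[OF good0 that]], of p q] by (simp add: adjm_def)
  then show "adjm (Bc c) p q = Bc c p q" unfolding adjm_def Bc_def by simp
qed

lemma lin_Bc: "(\<Sum>i<d. c i * lin \<eta>0 D i) = Re (mtr L (Bc c \<odot>\<^bsub>L\<^esub> D))"
proof -
  have "mtr L (Bc c \<odot>\<^bsub>L\<^esub> D) = (\<Sum>a<d. of_real (\<Sum>i<d. c i * Fv i a) * mtr L (Wm \<eta>0 a \<odot>\<^bsub>L\<^esub> D))"
    unfolding mtr_mmul_comm[of L "Bc c"] unfolding Bc_def mtr_mmul_sum mtr_mmul_comm[of L D] ..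
  then have "Re (mtr L (Bc c \<odot>\<^bsub>L\<^esub> D)) = (\<Sum>a<d. (\<Sum>i<d. c i * Fv i a) * Re (mtr L (Wm \<eta>0 a \<odot>\<^bsub>L\<^esub> D)))" by simp
  also have "\<dots> = (\<Sum>i<d. c i * lin \<eta>0 D i)"
    unfolding lin_def Fv_def sum_distrib_right sum_distrib_left by (subst sum.swap) (simp add: mult.assoc)
  finally show ?thesis ..
qed

lemma Fv_Fi: "i < d \<Longrightarrow> b < d \<Longrightarrow> (\<Sum>a<d. Fv i a * Fi \<eta>0 a b) = of_bool (i = b)"
  using minv_left[OF mdet_Fi[OF good0], of i b] unfolding Fv_def mmul_def idm_def by simp

text \<open>The score statistic has covariance \<open>F\<close>, so the linear statistic has
  \<open>F^-1 F F^-1 = F^-1\<close>: here the limit covariance attains the information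
  bound.\<close>

lemma vq_Bc: "vq (Bc c) = (\<Sum>i<d. \<Sum>j<d. c i * Fv i j * c j)"
proof -
  define x where "x a = (\<Sum>i<d. c i * Fv i a)" for a
  have B: "Bc c = (\<lambda>p q. \<Sum>a<d. of_real (x a) * Wm \<eta>0 a p q)" by (simp add: Bc_def x_def)
  have "mtr L (Bc c \<odot>\<^bsub>L\<^esub> R0 \<odot>\<^bsub>L\<^esub> Bc c \<odot>\<^bsub>L\<^esub> R0) = mtr L ((R0 \<odot>\<^bsub>L\<^esub> Bc c \<odot>\<^bsub>L\<^esub> R0) \<odot>\<^bsub>L\<^esub> Bc c)"
    unfolding mmul_assoc by (subst mtr_mmul_comm) (simp only: mmul_assoc)
  also have "\<dots> = (\<Sum>b<d. of_real (x b) * mtr L ((R0 \<odot>\<^bsub>L\<^esub> Bc c \<odot>\<^bsub>L\<^esub> R0) \<odot>\<^bsub>L\<^esub> Wm \<eta>0 b))"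
    unfolding B[of] mtr_mmul_sum ..
  also have "\<dots> = (\<Sum>b<d. of_real (x b) * (\<Sum>a<d. of_real (x a) * mtr L ((R0 \<odot>\<^bsub>L\<^esub> Wm \<eta>0 b \<odot>\<^bsub>L\<^esub> R0) \<odot>\<^bsub>L\<^esub> Wm \<eta>0 a)))"
  proof (intro sum.cong refl arg_cong2[where f=times])
    fix b
    have "mtr L ((R0 \<odot>\<^bsub>L\<^esub> Bc c \<odot>\<^bsub>L\<^esub> R0) \<odot>\<^bsub>L\<^esub> Wm \<eta>0 b) = mtr L ((R0 \<odot>\<^bsub>L\<^esub> Wm \<eta>0 b \<odot>\<^bsub>L\<^esub> R0) \<odot>\<^bsub>L\<^esub> Bc c)"
      using mtr_mmul_comm[of L "R0 \<odot>\<^bsub>L\<^esub> Bc c" "R0 \<odot>\<^bsub>L\<^esub> Wm \<eta>0 b"] by (simp only: mmul_assoc)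
    also have "\<dots> = (\<Sum>a<d. of_real (x a) * mtr L ((R0 \<odot>\<^bsub>L\<^esub> Wm \<eta>0 b \<odot>\<^bsub>L\<^esub> R0) \<odot>\<^bsub>L\<^esub> Wm \<eta>0 a))"
      unfolding B mtr_mmul_sum ..
    finally show "mtr L ((R0 \<odot>\<^bsub>L\<^esub> Bc c \<odot>\<^bsub>L\<^esub> R0) \<odot>\<^bsub>L\<^esub> Wm \<eta>0 b)
      = (\<Sum>a<d. of_real (x a) * mtr L ((R0 \<odot>\<^bsub>L\<^esub> Wm \<eta>0 b \<odot>\<^bsub>L\<^esub> R0) \<odot>\<^bsub>L\<^esub> Wm \<eta>0 a))" .
  qed
  finally have "vq (Bc c) = (\<Sum>b<d. x b * (\<Sum>a<d. x a * Re (mtr L ((R0 \<odot>\<^bsub>L\<^esub> Wm \<eta>0 b \<odot>\<^bsub>L\<^esub> R0) \<odot>\<^bsub>L\<^esub> Wm \<eta>0 a))))"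
    unfolding vq_def by simp
  also have "\<dots> = (\<Sum>b<d. x b * (\<Sum>a<d. Fi \<eta>0 b a * x a))"
  proof -
    have "Re (mtr L ((R0 \<odot>\<^bsub>L\<^esub> Wm \<eta>0 b \<odot>\<^bsub>L\<^esub> R0) \<odot>\<^bsub>L\<^esub> Wm \<eta>0 a)) = Fi \<eta>0 b a" for a b
      using mtr_mmul_comm[of L R0 "Wm \<eta>0 b \<odot>\<^bsub>L\<^esub> R0 \<odot>\<^bsub>L\<^esub> Wm \<eta>0 a"] Fi_Wm[OF good0, of b a]
      by (simp only: mmul_assoc)
    then show ?thesis by (simp add: mult.commute)
  qed
  also have "\<dots> = (\<Sum>b<d. x b * c b)"
  proof (intro sum.cong refl arg_cong2[where f=times])
    fix b assume "b \<in> {..<d}"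
    then have b: "b < d" by simp
    have "(\<Sum>a<d. Fi \<eta>0 b a * x a) = (\<Sum>a<d. \<Sum>i<d. c i * (Fv i a * Fi \<eta>0 a b))"
      unfolding x_def sum_distrib_left by (simp add: Fi_sym[of _ b] mult_ac)
    also have "\<dots> = (\<Sum>i<d. c i * (\<Sum>a<d. Fv i a * Fi \<eta>0 a b))"
      unfolding sum_distrib_left by (rule sum.swap)
    also have "\<dots> = (\<Sum>i<d. if i = b then c b else 0)"
      by (intro sum.cong refl) (simp add: Fv_Fi b)
    finally show "(\<Sum>a<d. Fi \<eta>0 b a * x a) = c b" using b by simp
  qed
  also have "\<dots> = (\<Sum>i<d. \<Sum>j<d. c i * Fv i j * c j)"
    unfolding x_def sum_distrib_right by (rule sum.swap)
  finally show ?thesis .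
qed

lemma pd_Fv: "pd d (\<lambda>a b. complex_of_real (Fv a b))"
proof -
  have nz: "mdet d (Fi \<eta>0) \<noteq> 0" by (rule mdet_Fi[OF good0])
  \<comment> \<open>Cut off outside the block, because \<open>pd_minv\<close> asks for support
    there.\<close>
  define C where "C = (\<lambda>a b. if a < d \<and> b < d then complex_of_real (Fi \<eta>0 a b) else 0)"
  have s: "msupp d C" by (auto simp: C_def msupp_def)
  have p: "pd d C"
    using pd_Fi[OF good0] unfolding pd_def hermitian_def qform_def C_def by simp
  have "minv d C = minv d (\<lambda>a b. complex_of_real (Fi \<eta>0 a b))"
    by (rule minv_cong[OF _ pd_mdet[OF p]]) (simp add: C_def)
  then have "minv d C = (\<lambda>a b. complex_of_real (Fv a b))"
    by (simp add: fun_eq_iff minv_of_real[OF nz] Fv_def)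
  then show ?thesis using pd_minv[OF p s] by simp
qed

end

lemma abs_cos_diff_le: "\<bar>cos x - cos y\<bar> \<le> \<bar>x - y\<bar>" for x y :: real
proof -
  have "\<bar>cos x - cos y\<bar> = 2 * \<bar>sin ((x + y) / 2)\<bar> * \<bar>sin ((y - x) / 2)\<bar>"
    by (simp add: cos_diff_cos abs_mult)
  also have "\<dots> \<le> 2 * 1 * \<bar>(y - x) / 2\<bar>"
    by (intro mult_mono abs_sin_x_le_abs_x) auto
  finally show ?thesis by simp
qed

context gaussian_snapshots
begin

lemma sample_measurable:
  assumes hB: "adjm B = B" and N: "1 \<le> N"
  shows "(\<lambda>w. Re (mtr L (B \<odot>\<^bsub>L\<^esub> (Rs N w - R0)))) \<in> borel_measurable Mp"
proof -
  have "(\<lambda>w. (\<Sum>t\<in>{1..N}. cq B (\<lambda>j. W t j w)) / real N) \<in> borel_measurable Mp"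
    by (intro borel_measurable_divide borel_measurable_sum borel_measurable_const
        borel_measurable_has_bochner_integral[OF Hq_mean[OF hB]]) auto
  then show ?thesis by (simp add: sum_Hq[OF hB N])
qed

text \<open>A measurable selection, tied to the estimator only where an output exists; elsewhere it
  is arbitrary, and those outcomes must be shown to have small probability.\<close>

context
  fixes est :: "nat \<Rightarrow> 'w \<Rightarrow> nat \<Rightarrow> real" and th :: "nat \<Rightarrow> real"
  assumes est_meas: "\<And>N. est N \<in> borel_measurable Mp"
    and th: "\<And>k. k < K \<Longrightarrow> th k = \<eta>0 k"
    and est_spa: "\<And>N w. 1 \<le> N \<Longrightarrow> w \<in> space Mp \<Longrightarrow> \<exists>Th Pw sg. spa_output eqv M Om N (Rs N w) Th Pw sg \<Longrightarrow>
      \<exists>Th Pw sg. spa_output eqv M Om N (Rs N w) Th Pw sg \<and> est N w = labeled_est eqv Om K th Th Pw sg"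
begin

definition X :: "nat \<Rightarrow> 'w \<Rightarrow> nat \<Rightarrow> real"
  where "X N w = restrict (\<lambda>i. sqrt (real N) * (est N w i - \<eta>0 i)) {..<d}"

lemma X_measurable: "X N \<in> borel_measurable Mp"
proof (rule measurable_coordinatewise_then_product)
  fix i
  have "(\<lambda>w. est N w i) \<in> borel_measurable Mp" by (rule measurable_product_then_coordinatewise[OF est_meas])
  then have "(\<lambda>w. sqrt (real N) * (est N w i - \<eta>0 i)) \<in> borel_measurable Mp" by simp
  then show "(\<lambda>w. X N w i) \<in> borel_measurable Mp" unfolding X_def by (cases "i < d") simp_all
qed

text \<open>Off the bad event the sample covariance is within \<open>u / sqrt N\<close> of the
  truth, hence eventually in the neighbourhood of \<open>spa_local\<close>. The \<open>L^2\<close>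
  entries contribute the factor \<open>L^2\<close>, compensated by using
  \<open>\<kappa> / L^2\<close> there.\<close>

lemma X_close:
  assumes \<kappa>: "\<kappa> > 0" and u: "u > 0"
  shows "\<exists>N0. \<forall>N\<ge>N0. 1 \<le> N \<and> (\<forall>w\<in>space Mp. w \<notin> bad u N \<longrightarrow>
    (\<forall>i<d. \<bar>X N w i - sqrt (real N) * lin \<eta>0 (Rs N w - R0) i\<bar> \<le> \<kappa> * u))"
proof -
  obtain r where r: "separated \<eta>0 r" using exists_separated[OF good0 rng0] by metis
  have L2: "(real L)\<^sup>2 > 0" using L_pos by simp
  obtain e where e: "e > 0" and loc: "\<And>Rt N. msupp L Rt \<Longrightarrow> adjm Rt = Rt \<Longrightarrow> (\<forall>i<L. \<forall>j<L. cmod (Rt i j - R0 i j) < e) \<Longrightarrow> L \<le> N \<Longrightarrow>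
    (\<exists>Th P sg. spa_output eqv M Om N Rt Th P sg) \<and>
    (\<forall>Th P sg. spa_output eqv M Om N Rt Th P sg \<longrightarrow>
       (\<forall>i<d. \<bar>labeled_est eqv Om K th Th P sg i - \<eta>0 i - lin \<eta>0 (Rt - R0) i\<bar> \<le> \<kappa> / (real L)\<^sup>2 * l1 (Rt - R0)))"
    using spa_local[OF r th, of "\<kappa> / (real L)\<^sup>2"] \<kappa> L2 by auto
  obtain N1 where N1: "(u / e)\<^sup>2 < real N1" using reals_Archimedean2 by blast
  show ?thesis
  proof (intro exI[of _ "max N1 (max 1 L)"] allI impI conjI ballI)
    fix N assume N: "max N1 (max 1 L) \<le> N"
    then show "1 \<le> N" by simp
    then have N1': "1 \<le> N" .
    have sN: "0 < sqrt (real N)" using N1' by simp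
    have "(u / e)\<^sup>2 < real N" using N N1 by linarith
    then have "u / e < sqrt (real N)" by (rule real_less_rsqrt)
    then have small: "u / sqrt (real N) < e" using e sN by (simp add: field_simps)
    fix w i assume w: "w \<in> space Mp" "w \<notin> bad u N" and i: "i < d"
    have "\<forall>i<L. \<forall>j<L. cmod (Rs N w i j - R0 i j) < e"
      using entry_bound[OF w N1' u] small by (auto intro: less_trans)
    from loc[OF msupp_Rs adjm_Rs this] N
    have l: "\<exists>Th P sg. spa_output eqv M Om N (Rs N w) Th P sg"
      "\<And>Th P sg. spa_output eqv M Om N (Rs N w) Th P sg \<Longrightarrow>
        \<bar>labeled_est eqv Om K th Th P sg i - \<eta>0 i - lin \<eta>0 (Rs N w - R0) i\<bar> \<le> \<kappa> / (real L)\<^sup>2 * l1 (Rs N w - R0)"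
      using i by auto
    obtain Th P sg where o: "spa_output eqv M Om N (Rs N w) Th P sg" "est N w = labeled_est eqv Om K th Th P sg"
      using est_spa[OF N1' w(1) l(1)] by auto
    have "\<bar>est N w i - \<eta>0 i - lin \<eta>0 (Rs N w - R0) i\<bar> \<le> \<kappa> / (real L)\<^sup>2 * l1 (Rs N w - R0)"
      unfolding o(2) by (rule l(2)[OF o(1)])
    then have "sqrt (real N) * \<bar>est N w i - \<eta>0 i - lin \<eta>0 (Rs N w - R0) i\<bar> \<le> sqrt (real N) * (\<kappa> / (real L)\<^sup>2 * l1 (Rs N w - R0))"
      using sN by (intro mult_left_mono) auto
    also have "\<dots> = \<kappa> / (real L)\<^sup>2 * (sqrt (real N) * l1 (Rs N w - R0))" by simp
    also have "\<dots> \<le> \<kappa> / (real L)\<^sup>2 * ((real L)\<^sup>2 * u)"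
      using l1_bound[OF w N1' u] \<kappa> by (intro mult_left_mono) auto
    also have "\<dots> = \<kappa> * u" using L2 by simp
    also have "sqrt (real N) * \<bar>est N w i - \<eta>0 i - lin \<eta>0 (Rs N w - R0) i\<bar>
      = \<bar>sqrt (real N) * (est N w i - \<eta>0 i - lin \<eta>0 (Rs N w - R0) i)\<bar>" using sN by (simp add: abs_mult)
    finally show "\<bar>X N w i - sqrt (real N) * lin \<eta>0 (Rs N w - R0) i\<bar> \<le> \<kappa> * u"
      using i by (simp add: X_def right_diff_distrib)
  qed
qed

lemma vtot_nonneg: "0 \<le> vtot"
  using order_trans[OF measure_nonneg prob_bad[of 1 1]] by simp

lemma exists_tail:
  assumes "e > 0"
  obtains u where "u > 0" "2 * (vtot / u\<^sup>2) < e"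
proof
  \<comment> \<open>Solves \<open>2 vtot < e u^2\<close>; the added one keeps \<open>u\<close>
    positive when \<open>vtot = 0\<close>.\<close>
  let ?u = "sqrt (2 * vtot / e + 1)"
  have p: "0 < 2 * vtot / e + 1" using vtot_nonneg assms by (intro add_nonneg_pos) auto
  then show "?u > 0" by simp
  have "?u\<^sup>2 = 2 * vtot / e + 1" using p by simp
  moreover have "2 * vtot < e * (2 * vtot / e + 1)" using assms by (simp add: field_simps)
  ultimately show "2 * (vtot / ?u\<^sup>2) < e" using p by (simp add: divide_less_eq)
qed

text \<open>Slutsky's argument on cosines: off the bad event the arguments are close and the cosine
  is 1-Lipschitz, on it the difference is at most two.\<close>

lemma X_trig:
  "(\<lambda>N. expectation (\<lambda>w. cos ((\<Sum>i<d. c i * X N w i) + b))) \<longlonglongrightarrow> cos b * exp (- (\<Sum>i<d. \<Sum>j<d. c i * Fv i j * c j) / 2)"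
proof -
  let ?T = "\<lambda>N w. sqrt (real N) * Re (mtr L (Bc c \<odot>\<^bsub>L\<^esub> (Rs N w - R0)))"
  let ?f = "\<lambda>N w. cos ((\<Sum>i<d. c i * X N w i) + b)" and ?g = "\<lambda>N w. cos (?T N w + b)"
  have "(\<lambda>N. expectation (?f N) - expectation (?g N)) \<longlonglongrightarrow> 0"
  proof (rule LIMSEQ_I)
    fix e :: real assume e: "e > 0"
    define c1 where "c1 = (\<Sum>i<d. \<bar>c i\<bar>)"
    have c1: "c1 \<ge> 0" unfolding c1_def by (intro sum_nonneg) auto
    obtain u where u: "u > 0" "2 * (vtot / u\<^sup>2) < e / 2" using exists_tail[of "e / 2"] e by auto
    \<comment> \<open>Makes \<open>c1 * (\<kappa> * u)\<close> at most \<open>e / 2\<close>; the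
      \<open>+ 1\<close> covers \<open>c = 0\<close>.\<close>
    define \<kappa> where "\<kappa> = e / (2 * (c1 + 1) * u)"
    have \<kappa>: "\<kappa> > 0" using e u c1 by (simp add: \<kappa>_def)
    have small: "c1 * (\<kappa> * u) \<le> e / 2"
    proof -
      have "\<kappa> * u = e / (2 * (c1 + 1))" using u by (simp add: \<kappa>_def)
      then have "c1 * (\<kappa> * u) = (c1 / (c1 + 1)) * (e / 2)" by simp
      also have "\<dots> \<le> 1 * (e / 2)" using c1 e by (intro mult_right_mono) auto
      finally show ?thesis by simp
    qed
    obtain N0 where N0: "\<And>N. N0 \<le> N \<Longrightarrow> 1 \<le> N" "\<And>N w i. N0 \<le> N \<Longrightarrow> w \<in> space Mp \<Longrightarrow> w \<notin> bad u N \<Longrightarrow> i < d \<Longrightarrow>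
      \<bar>X N w i - sqrt (real N) * lin \<eta>0 (Rs N w - R0) i\<bar> \<le> \<kappa> * u" using X_close[OF \<kappa> u(1)] by metis
    show "\<exists>N0. \<forall>N\<ge>N0. norm (expectation (?f N) - expectation (?g N) - 0) < e"
    proof (intro exI[of _ N0] allI impI)
      fix N assume N: "N0 \<le> N"
      note N1 = N0(1)[OF N]
      have "(\<lambda>w. X N w i) \<in> borel_measurable Mp" for i by (rule measurable_product_then_coordinatewise[OF X_measurable])
      then have fm: "?f N \<in> borel_measurable Mp" by measurable
      have gm: "?g N \<in> borel_measurable Mp" using sample_measurable[OF adjm_Bc N1] by measurable
      have "\<bar>expectation (?f N) - expectation (?g N)\<bar> \<le> c1 * (\<kappa> * u) + (1 + 1) * prob (bad u N)"
      proof (rule expectation_diff_le[OF fm gm bad_event[OF N1]])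
        fix w assume w: "w \<in> space Mp" "w \<notin> bad u N"
        have "\<bar>?f N w - ?g N w\<bar> \<le> \<bar>((\<Sum>i<d. c i * X N w i) + b) - (?T N w + b)\<bar>" by (rule abs_cos_diff_le)
        also have "\<dots> = \<bar>\<Sum>i<d. c i * (X N w i - sqrt (real N) * lin \<eta>0 (Rs N w - R0) i)\<bar>"
          unfolding lin_Bc[symmetric] by (simp add: sum_subtractf right_diff_distrib sum_distrib_left mult_ac)
        also have "\<dots> \<le> (\<Sum>i<d. \<bar>c i\<bar> * (\<kappa> * u))"
          by (rule order_trans[OF sum_abs], rule sum_mono) (use N0(2)[OF N w] in \<open>auto simp: abs_mult intro!: mult_left_mono\<close>)
        also have "\<dots> = c1 * (\<kappa> * u)" by (simp add: c1_def sum_distrib_right)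
        finally show "\<bar>?f N w - ?g N w\<bar> \<le> c1 * (\<kappa> * u)" .
      qed (use c1 \<kappa> u in auto)
      also have "\<dots> < e"
      proof -
        have "(1 + 1) * prob (bad u N) \<le> 2 * (vtot / u\<^sup>2)" using prob_bad[OF N1 u(1)] by simp
        from add_le_less_mono[OF small le_less_trans[OF this u(2)]] show ?thesis by simp
      qed
      finally show "norm (expectation (?f N) - expectation (?g N) - 0) < e" by simp
    qed
  qed
  from tendsto_add[OF this sample_clt[OF adjm_Bc, of c b]] show ?thesis by (simp add: vq_Bc)
qed

text \<open>Off the bad event both the linear term and the remainder are bounded by constants
  depending on \<open>u\<close> alone, and the bad event is rare uniformly in
  \<open>N\<close>.\<close>

lemma X_tight:
  assumes e: "e > 0"
  shows "\<exists>B. eventually (\<lambda>N. prob {w \<in> space Mp. \<exists>i<d. B < \<bar>X N w i\<bar>} < e) sequentially"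
proof -
  obtain u where u: "u > 0" "2 * (vtot / u\<^sup>2) < e" using exists_tail[OF e] .
  define l where "l = (\<Sum>i<d. \<Sum>a<d. \<bar>Fv i a\<bar> * l1 (Wm \<eta>0 a))"
  have l: "(\<Sum>a<d. \<bar>Fv i a\<bar> * l1 (Wm \<eta>0 a)) \<le> l" if "i < d" for i
    unfolding l_def by (rule member_le_sum[where f="\<lambda>i. \<Sum>a<d. \<bar>Fv i a\<bar> * l1 (Wm \<eta>0 a)"])
      (use that in \<open>auto intro!: sum_nonneg mult_nonneg_nonneg l1_nonneg\<close>)
  obtain N0 where N0: "\<And>N. N0 \<le> N \<Longrightarrow> 1 \<le> N" "\<And>N w i. N0 \<le> N \<Longrightarrow> w \<in> space Mp \<Longrightarrow> w \<notin> bad u N \<Longrightarrow> i < d \<Longrightarrow>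
    \<bar>X N w i - sqrt (real N) * lin \<eta>0 (Rs N w - R0) i\<bar> \<le> 1 * u" using X_close[of 1 u] u(1) by auto
  let ?B = "u + l * ((real L)\<^sup>2 * u)"
  have "prob {w \<in> space Mp. \<exists>i<d. ?B < \<bar>X N w i\<bar>} < e" if N: "N0 \<le> N" for N
  proof -
    note N1 = N0(1)[OF N]
    have "{w \<in> space Mp. \<exists>i<d. ?B < \<bar>X N w i\<bar>} \<subseteq> bad u N"
    proof (rule subsetI, rule ccontr)
      fix w assume "w \<in> {w \<in> space Mp. \<exists>i<d. ?B < \<bar>X N w i\<bar>}" and nb: "w \<notin> bad u N"
      then obtain i where w: "w \<in> space Mp" and i: "i < d" "?B < \<bar>X N w i\<bar>" by auto
      let ?D = "Rs N w - R0"
      have "\<bar>lin \<eta>0 ?D i\<bar> \<le> (\<Sum>a<d. \<bar>Fv i a\<bar> * (l1 (Wm \<eta>0 a) * l1 ?D))"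
        unfolding lin_def Fv_def[symmetric]
        by (rule order_trans[OF sum_abs], rule sum_mono) (auto simp: abs_mult intro!: mult_left_mono mtr_l1)
      also have "\<dots> = (\<Sum>a<d. \<bar>Fv i a\<bar> * l1 (Wm \<eta>0 a)) * l1 ?D" by (simp add: sum_distrib_right mult.assoc)
      also have "\<dots> \<le> l * l1 ?D" by (intro mult_right_mono l i l1_nonneg)
      finally have "sqrt (real N) * \<bar>lin \<eta>0 ?D i\<bar> \<le> sqrt (real N) * (l * l1 ?D)" by (intro mult_left_mono) auto
      also have "\<dots> = l * (sqrt (real N) * l1 ?D)" by simp
      also have "\<dots> \<le> l * ((real L)\<^sup>2 * u)"
        using l1_bound[OF w nb N1 u(1)] by (intro mult_left_mono) (auto simp: l_def intro!: sum_nonneg mult_nonneg_nonneg l1_nonneg)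
      finally have "\<bar>sqrt (real N) * lin \<eta>0 ?D i\<bar> \<le> l * ((real L)\<^sup>2 * u)" by (simp add: abs_mult)
      then show False using N0(2)[OF N w nb i(1)] i(2) by linarith
    qed
    then have "prob {w \<in> space Mp. \<exists>i<d. ?B < \<bar>X N w i\<bar>} \<le> prob (bad u N)"
      by (rule finite_measure_mono[OF _ bad_event[OF N1]])
    also have "\<dots> < e" using prob_bad[OF N1 u(1)] u(2) vtot_nonneg
      by (smt (verit) divide_nonneg_nonneg zero_le_power2)
    finally show ?thesis .
  qed
  then show ?thesis unfolding eventually_sequentially by blast
qed

theorem asymptotic_normality:
  "conv_distr_normal Mp (\<lambda>N w. restrict (\<lambda>i. sqrt (real N) * (est N w i - \<eta>0 i)) {..<d}) d Fv"
  unfolding conv_distr_normal_def X_def[symmetric]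
proof (intro allI impI)
  fix g :: "(nat \<Rightarrow> real) \<Rightarrow> real" assume g: "continuous_on UNIV g \<and> bounded (range g)"
  then obtain C where C: "\<And>x. \<bar>g x\<bar> \<le> C" unfolding bounded_iff by auto
  let ?P = "PiM {..<d} (\<lambda>_. lborel :: real measure)"
  let ?D = "gauss_dens d Fv"
  define G where "G = density ?P (\<lambda>x. ennreal (?D x))"
  \<comment> \<open>The limit law lives on the product sigma-algebra over \<open>d\<close>
    coordinates, weak convergence on the Borel sets of all functions. \<open>Y\<close> mediates
    between them and is the identity on the product space.\<close>
  define Y where "Y x = restrict x {..<d}" for x :: "nat \<Rightarrow> real"
  have nn: "0 \<le> ?D x" for x by (rule gauss_dens_nonneg[OF pd_Fv])
  have one: "has_bochner_integral ?P ?D 1"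
    using gauss_dens_cos[OF pd_Fv, of "\<lambda>_. 0" 0] by simp
  have Gp: "prob_space G"
  proof
    have "emeasure G (space G) = (\<integral>\<^sup>+x. ennreal (?D x) \<partial>?P)"
      unfolding G_def by (simp add: emeasure_density cong: nn_integral_cong)
    also have "\<dots> = ennreal 1"
      using one nn by (subst nn_integral_eq_integral) (auto simp: has_bochner_integral_iff)
    finally show "emeasure G (space G) = 1" by simp
  qed
  have Ym: "Y \<in> borel_measurable ?P"
  proof (rule measurable_coordinatewise_then_product)
    fix i
    have "(\<lambda>x. x i) \<in> borel_measurable ?P" if "i \<in> {..<d}"
      using measurable_component_singleton[OF that, of "\<lambda>_. lborel :: real measure"] by simp
    then show "(\<lambda>x. Y x i) \<in> borel_measurable ?P" unfolding Y_def by (cases "i < d") simp_all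
  qed
  have YG: "(\<integral>x. h (Y x) \<partial>G) = (\<integral>x. h x * ?D x \<partial>?P)" if h: "h \<in> borel_measurable borel" for h :: "(nat \<Rightarrow> real) \<Rightarrow> real"
  proof -
    have "(\<integral>x. h (Y x) \<partial>G) = (\<integral>x. ?D x *\<^sub>R h (Y x) \<partial>?P)" unfolding G_def
      by (rule integral_density) (use nn measurable_compose[OF Ym h] in auto)
    also have "\<dots> = (\<integral>x. h x * ?D x \<partial>?P)"
    proof (rule Bochner_Integration.integral_cong[OF refl])
      fix x assume "x \<in> space ?P"
      then have "Y x = x" unfolding Y_def by (intro extensional_restrict) (auto simp: space_PiM PiE_def)
      then show "?D x *\<^sub>R h (Y x) = h x * ?D x" by simp
    qed
    finally show ?thesis .
  qed
  have "(\<lambda>N. \<integral>w. g (X N w) \<partial>Mp) \<longlonglongrightarrow> (\<integral>w. g (Y w) \<partial>G)"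
  proof (rule weak_convergence_of_trig[where d=d, OF prob_space_axioms Gp X_measurable _ _ _ _ X_tight conjunct1[OF g] C])
    show "Y \<in> borel_measurable G" using Ym by (simp add: G_def)
    fix c b
    have "(\<lambda>x :: nat \<Rightarrow> real. cos ((\<Sum>i<d. c i * x i) + b)) \<in> borel_measurable borel"
      by (intro borel_measurable_continuous_onI continuous_intros continuous_on_coord)
    from YG[OF this] have "(\<integral>w. cos ((\<Sum>i<d. c i * Y w i) + b) \<partial>G) = cos b * exp (- (\<Sum>i<d. \<Sum>j<d. c i * Fv i j * c j) / 2)"
      using gauss_dens_cos[OF pd_Fv, of c b] by (simp add: has_bochner_integral_iff)
    then show "(\<lambda>N. \<integral>w. cos ((\<Sum>i<d. c i * X N w i) + b) \<partial>Mp) \<longlonglongrightarrow> (\<integral>w. cos ((\<Sum>i<d. c i * Y w i) + b) \<partial>G)"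
      using X_trig by simp
  qed (simp_all add: X_def Y_def)
  then show "(\<lambda>N. \<integral>w. g (X N w) \<partial>Mp) \<longlonglongrightarrow> (\<integral>x. g x * ?D x \<partial>?P)"
    unfolding YG[OF borel_measurable_continuous_onI[OF conjunct1[OF g]]] .
qed

end

end

section \<open>Sources and noise as independent variables: transfer to the array model\<close>

theorem theorem4:
  fixes eqv :: bool  \<comment> \<open>True: equal-noise-variance variant; False: different noise variances\<close>
    and M K :: nat and Om :: "nat list"
    and th0 p0 sg0 :: "nat \<Rightarrow> real"
    and Mp :: "'w measure"
    and s e :: "nat \<Rightarrow> nat \<Rightarrow> 'w \<Rightarrow> complex"
    and est :: "nat \<Rightarrow> 'w \<Rightarrow> nat \<Rightarrow> real"
    and y :: "nat \<Rightarrow> 'w \<Rightarrow> nat \<Rightarrow> complex"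
    and Rt :: "nat \<Rightarrow> 'w \<Rightarrow> nat \<Rightarrow> nat \<Rightarrow> complex"
    and Z :: "bool \<times> nat \<times> nat \<times> bool \<Rightarrow> 'w \<Rightarrow> real"
  assumes M2: "M \<ge> 2"
    and arr: "is_array M Om"
    and red: "redundancy_array M Om"
    and KM: "K = M - 1"
    and th0_rng: "\<forall>k<K. th0 k \<in> {0..<1}"
    and th0_dist: "inj_on th0 {..<K}"
    and p0_pos: "\<forall>k<K. 0 < p0 k"
    and sg0_pos: "\<forall>j<nsig eqv Om. 0 < sg0 j"
    and P: "prob_space Mp"
    and Z_def: "Z \<equiv> (\<lambda>(b, k, t, r) \<omega>. let z = (if b then e k t \<omega> else s k t \<omega>)
                                       in if r then Re z else Im z)"
    and indep: "prob_space.indep_vars Mp (\<lambda>_. borel) Z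
                  {(b, k, t, r). 1 \<le> t \<and> (if b then k < length Om else k < K)}"
    and s_distr: "\<forall>k<K. \<forall>t\<ge>1. \<forall>r. distributed Mp lborel (Z (False, k, t, r))
                     (\<lambda>x. ennreal (normal_density 0 (sqrt (p0 k / 2)) x))"
    and e_distr: "\<forall>j<length Om. \<forall>t\<ge>1. \<forall>r. distributed Mp lborel (Z (True, j, t, r))
                     (\<lambda>x. ennreal (normal_density 0 (sqrt (sg0 (if eqv then 0 else j) / 2)) x))"
    and y_def: "y \<equiv> (\<lambda>t \<omega> j. (\<Sum>k<K. steerO Om (th0 k) j * s k t \<omega>) + e j t \<omega>)"
    and Rt_def: "Rt \<equiv> (\<lambda>N \<omega> i j. if i < length Om \<and> j < length Om
                       then (1 / of_nat N) * (\<Sum>t\<in>{1..N}. y t \<omega> i * cnj (y t \<omega> j)) else 0)"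
    and est_meas: "\<forall>N. est N \<in> borel_measurable Mp"
    and est_spa: "\<forall>N\<ge>1. \<forall>\<omega>\<in>space Mp.
                   (\<exists>Th Pw sg. spa_output eqv M Om N (Rt N \<omega>) Th Pw sg) \<longrightarrow>
                   (\<exists>Th Pw sg. spa_output eqv M Om N (Rt N \<omega>) Th Pw sg \<and>
                               est N \<omega> = labeled_est eqv Om K th0 Th Pw sg)"
  shows "let d = 2 * K + nsig eqv Om;
             \<eta>0 = param_vec eqv Om K th0 p0 sg0;
             F = fim1 eqv Om K \<eta>0
         in mdet d F \<noteq> 0 \<and>
            conv_distr_normal Mp
              (\<lambda>N \<omega>. restrict (\<lambda>i. sqrt (real N) * (est N \<omega> i - \<eta>0 i)) {..<d}) d (minv d F)"
proof -
  interpret spa_model eqv M K Om by unfold_locales (fact M2 arr red KM)+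
  interpret prob_space Mp by (rule P)
  define \<eta>0 where "\<eta>0 = param_vec eqv Om K th0 p0 sg0"
  have \<eta>: "\<eta>0 k = th0 k" "\<eta>0 (K + k) = p0 k" if "k < K" for k
    using that by (simp_all add: \<eta>0_def param_vec_def)
  have \<eta>s: "\<eta>0 (2 * K + j) = sg0 j" if "j < nsig eqv Om" for j
    using that by (simp add: \<eta>0_def param_vec_def)
  have sx: "\<eta>0 (sidx j) = sg0 (if eqv then 0 else j)" if "j < L" for j
    using that unfolding sidx_def by (subst \<eta>s) (auto simp: nsig_def)
  have good: "good \<eta>0"
    unfolding good_def
  proof (intro conjI allI impI inj_onI)
    fix k assume "k < K" then show "0 < \<eta>0 (K + k)" using p0_pos by (simp add: \<eta>)
  next
    fix j assume "j < nsig eqv Om" then show "0 < \<eta>0 (2 * K + j)" using sg0_pos by (simp add: \<eta>s)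
  next
    fix k l assume kl: "k \<in> {..<K}" "l \<in> {..<K}" and "zz \<eta>0 k = zz \<eta>0 l"
    then obtain n :: int where n: "th0 k = th0 l + of_int n" unfolding zz_def cis_2pi_eq_iff by (auto simp: \<eta>)
    have "0 \<le> th0 k" "th0 k < 1" "0 \<le> th0 l" "th0 l < 1" using th0_rng kl by auto
    then have "-1 < real_of_int n" "real_of_int n < 1" using n by linarith+
    then have "n = 0" by linarith
    then show "k = l" using n th0_dist kl by (simp add: inj_on_def)
  qed
  \<comment> \<open>Flattens the two families: indices below \<open>K\<close> are sources, index
    \<open>K + j\<close> is the noise of sensor \<open>j\<close>.\<close>
  define W where "W t = (\<lambda>(k, r). Z (\<not> k < K, if k < K then k else k - K, t, r))" for t
  have distrW: "distributed Mp lborel (W t (k, r)) (\<lambda>x. ennreal (normal_density 0 (sqrt (mixv \<eta>0 k / 2)) x))"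
    if "1 \<le> t" "k < K + L" for t k r
    using that s_distr e_distr by (cases "k < K") (simp_all add: W_def mixv_def \<eta> sx)
  have indW: "indep_vars (\<lambda>_. borel) (\<lambda>(t, j). W t j) ({1..} \<times> ({..<K + L} \<times> UNIV))"
  proof -
    let ?f = "\<lambda>(t, k, r). (\<not> k < K, if k < K then k else k - K, t, r)" and ?I = "{1..} \<times> ({..<K + L} \<times> (UNIV :: bool set))"
    have sub: "?f ` ?I \<subseteq> {(b, k, t, r). 1 \<le> t \<and> (if b then k < L else k < K)}" by auto
    have "inj_on ?f ?I" by (auto simp: inj_on_def split: if_splits)
    from indep_vars_reindex_inj[OF indep_vars_subset[OF indep sub] this]
    show ?thesis by (simp add: W_def case_prod_beta')
  qed
  interpret gaussian_snapshots eqv M K Om Mp \<eta>0 W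
    by unfold_locales (use good th0_rng \<eta> indW distrW in auto)
  \<comment> \<open>The mixing of the merged family reproduces the observation, so the two sample
    covariances agree for every outcome.\<close>
  have "snap t \<omega> p = y t \<omega> p" if "p < L" for t \<omega> p
  proof -
    have W: "Complex (W t (k, True) \<omega>) (W t (k, False) \<omega>) = (if k < K then s k t \<omega> else e (k - K) t \<omega>)" for k
      by (simp add: W_def Z_def Let_def)
    have "snap t \<omega> p = (\<Sum>k<K. steerO Om (th0 k) p * s k t \<omega>) + (\<Sum>k<L. if k = p then e k t \<omega> else 0)"
      unfolding snap_def mixing_def W sum_lessThan_add
      by (intro arg_cong2[where f="(+)"] sum.cong refl) (use that in \<open>auto simp: mixm_def \<eta>\<close>)
    then show ?thesis using that by (simp add: y_def)
  qed
  then have Rs: "Rs N \<omega> = Rt N \<omega>" for N \<omega>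
    unfolding Rs_def Rt_def by (intro ext) simp
  have F: "fim1 eqv Om K \<eta>0 a b = Fi \<eta>0 a b" if "a < d" "b < d" for a b
    by (rule fim1_eq_Fi[OF good that])
  have "mdet d (fim1 eqv Om K \<eta>0) = mdet d (Fi \<eta>0)" by (rule mdet_cong) (rule F)
  then have nz: "mdet d (fim1 eqv Om K \<eta>0) \<noteq> 0" using mdet_Fi[OF good] by simp
  have "minv d (fim1 eqv Om K \<eta>0) = Fv" unfolding Fv_def by (rule minv_cong[OF F nz])
  moreover have "conv_distr_normal Mp (\<lambda>N w. restrict (\<lambda>i. sqrt (real N) * (est N w i - \<eta>0 i)) {..<d}) d Fv"
    by (rule asymptotic_normality[of est th0]) (use est_meas est_spa \<eta> in \<open>simp_all add: Rs\<close>)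
  ultimately show ?thesis using nz unfolding \<eta>0_def Let_def by simp
qed

end
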